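(* Let $\sigma: M\times G\to M$ be a smooth right action of a Lie group $G$ on a finite-dimensional manifold $M$ (possibly with boundary), and let $E$ be a locally convex space. Then the induced left action $$\alpha: G\times C^{\infty}(M,E)\to C^{\infty}(M,E),\qquad \alpha(g,f)(m):=(g.f)(m):=f(\sigma(m,g))$$ of $G$ on the locally convex space $C^{\infty}(M,E)$ is smooth.
   Context: Manifolds such as $M$ are finite-dimensional, paracompact, second countable and smooth. A Lie group is a smooth manifold modeled on a (possibly infinite-dimensional) locally convex space with smooth multiplication and inversion. Smoothness of maps between locally convex spaces (and manifolds modeled on them) is understood in the Michal–Bastiani sense: for $U\subseteq E$ open, $f:U\to F$ is $C^1$ if it is continuous, the directional derivatives $df(x)(h)=\lim_{t\to 0}\frac1t(f(x+th)-f(x))$ exist for all $x\in U$, $h\in E$, and $df:U\times E\to F$ is continuous; $f$ is $C^n$ if it is $C^1$ and $df$ is $C^{n-1}$; smooth means $C^n$ for all $n$. The space $C^{\infty}(M,E)$ carries the smooth compact open topology, i.e. the initial topology with respect to the embedding $C^{\infty}(M,E)\hookrightarrow\prod_{n\in\mathbb{N}_0}C(T^nM,T^nE)$, $f\mapsto (T^nf)_{n}$, where the spaces $C(T^nM,T^nE)$ carry the compact open topology and $T^n$ is the $n$-fold iterated tangent functor. *)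

theory Defs
  imports
    "HOL-Analysis.Analysis"
    "HOL-Algebra.Group"
    "HOL-Library.Function_Algebras"
begin

section \<open>Locally convex spaces\<close>

instantiation "fun" :: (type, real_vector) real_vector
begin

definition scaleR_fun :: "real \<Rightarrow> ('a \<Rightarrow> 'b) \<Rightarrow> 'a \<Rightarrow> 'b"
  where "scaleR_fun c f = (\<lambda>x. c *\<^sub>R f x)"

instance
  by standard (auto simp: scaleR_fun_def fun_eq_iff scaleR_add_right scaleR_add_left)

end

text \<open>
  A locally convex space is given by its topology, whose underlying set is a linear subspace of an
  ambient real vector space; the ambient space itself carries no topology. As usual in
  Michal--Bastiani calculus, locally convex spaces are Hausdorff.
\<close>

definition lcs :: "'a::real_vector topology \<Rightarrow> bool" where
  "lcs X \<longleftrightarrow>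
     subspace (topspace X) \<and>
     continuous_map (prod_topology X X) X (\<lambda>(x, y). x + y) \<and>
     continuous_map (prod_topology euclideanreal X) X (\<lambda>(c, x). c *\<^sub>R x) \<and>
     Hausdorff_space X \<and>
     (\<forall>U. openin X U \<and> 0 \<in> U \<longrightarrow> (\<exists>V. openin X V \<and> 0 \<in> V \<and> V \<subseteq> U \<and> convex V))"

text \<open>
  The recursion ``\<open>f\<close> is \<open>C\<^sup>n\<^sup>+\<^sup>1\<close> iff \<open>f\<close> is \<open>C\<^sup>1\<close> and \<open>df\<close> is \<open>C\<^sup>n\<close>'' passes from functions on \<open>E\<close> to
  functions on \<open>E \<times> E\<close>, as does iteration of the tangent functor. To keep the type fixed, pairs of
  sequences are encoded as sequences by interleaving, and a space \<open>E\<close> is first embedded as the space of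
  sequences supported in \<open>{0}\<close>. The \<open>n\<close>-fold iterated product of \<open>E\<close> then becomes the space of sequences
  supported in \<open>{..<2^n}\<close>.
\<close>

definition seq_pair :: "(nat \<Rightarrow> 'a) \<Rightarrow> (nat \<Rightarrow> 'a) \<Rightarrow> nat \<Rightarrow> 'a" where
  "seq_pair x h = (\<lambda>i. if even i then x (i div 2) else h (i div 2))"

definition seq_fst :: "(nat \<Rightarrow> 'a) \<Rightarrow> nat \<Rightarrow> 'a" where
  "seq_fst z = (\<lambda>i. z (2 * i))"

definition seq_snd :: "(nat \<Rightarrow> 'a) \<Rightarrow> nat \<Rightarrow> 'a" where
  "seq_snd z = (\<lambda>i. z (2 * i + 1))"

lemma seq_pair_simps [simp]:
  "seq_fst (seq_pair x h) = x" "seq_snd (seq_pair x h) = h"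
  "seq_pair (seq_fst z) (seq_snd z) = z"
  by (auto simp: seq_pair_def seq_fst_def seq_snd_def fun_eq_iff elim!: evenE oddE)

definition seq_times :: "(nat \<Rightarrow> 'a) set \<Rightarrow> (nat \<Rightarrow> 'a) set \<Rightarrow> (nat \<Rightarrow> 'a) set" where
  "seq_times A B = {z. seq_fst z \<in> A \<and> seq_snd z \<in> B}"

definition seq_square :: "(nat \<Rightarrow> 'a) topology \<Rightarrow> (nat \<Rightarrow> 'a) topology" where
  "seq_square X =
     pullback_topology UNIV (\<lambda>z. (seq_fst z, seq_snd z)) (prod_topology X X)"

lemma topspace_seq_square [simp]:
  "topspace (seq_square X) = seq_times (topspace X) (topspace X)"
  by (auto simp: seq_square_def seq_times_def topspace_pullback_topology)

definition seq_embed :: "'a::zero \<Rightarrow> nat \<Rightarrow> 'a" where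
  "seq_embed x = (\<lambda>i. if i = 0 then x else 0)"

definition seq_lcs :: "'a::zero topology \<Rightarrow> (nat \<Rightarrow> 'a) topology" where
  "seq_lcs X = pullback_topology (range seq_embed) (\<lambda>z. z 0) X"


section \<open>Michal--Bastiani calculus\<close>

text \<open>
  The limit is taken over those \<open>t\<close> for which \<open>x + t h\<close> lies in the domain \<open>U\<close>. If \<open>U\<close> is open this is
  the ordinary limit \<open>t \<rightarrow> 0\<close>; if \<open>U\<close> is relatively open in a closed half-space and \<open>x\<close> is a boundary
  point, it is a one-sided limit for directions \<open>h\<close> not tangent to the boundary.
\<close>

definition has_dir_deriv ::
    "'b::real_vector topology \<Rightarrow> 'a::real_vector set \<Rightarrow> ('a \<Rightarrow> 'b) \<Rightarrow> 'a \<Rightarrow> 'a \<Rightarrow> 'b \<Rightarrow> bool" where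
  "has_dir_deriv Y U f x h l \<longleftrightarrow>
     limitin Y (\<lambda>t. (1 / t) *\<^sub>R (f (x + t *\<^sub>R h) - f x)) l (at 0 within {t. x + t *\<^sub>R h \<in> U})"

definition dir_deriv ::
    "'b::real_vector topology \<Rightarrow> 'a::real_vector set \<Rightarrow> ('a \<Rightarrow> 'b) \<Rightarrow> 'a \<Rightarrow> 'a \<Rightarrow> 'b" where
  "dir_deriv Y U f x h = (THE l. has_dir_deriv Y U f x h l)"

definition seq_deriv ::
    "'b::real_vector topology \<Rightarrow> (nat \<Rightarrow> 'a::real_vector) set \<Rightarrow> ((nat \<Rightarrow> 'a) \<Rightarrow> 'b)
      \<Rightarrow> (nat \<Rightarrow> 'a) \<Rightarrow> 'b" where
  "seq_deriv Y U f z = dir_deriv Y U f (seq_fst z) (seq_snd z)"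

definition C1_on ::
    "(nat \<Rightarrow> 'a::real_vector) topology \<Rightarrow> (nat \<Rightarrow> 'a) set \<Rightarrow> 'b::real_vector topology
      \<Rightarrow> ((nat \<Rightarrow> 'a) \<Rightarrow> 'b) \<Rightarrow> bool" where
  "C1_on X U Y f \<longleftrightarrow>
     continuous_map (subtopology X U) Y f \<and>
     (\<forall>x\<in>U. \<forall>h\<in>topspace X. \<exists>l. has_dir_deriv Y U f x h l) \<and>
     continuous_map (subtopology (seq_square X) (seq_times U (topspace X))) Y (seq_deriv Y U f)"

primrec Cn_on ::
    "nat \<Rightarrow> (nat \<Rightarrow> 'a::real_vector) topology \<Rightarrow> (nat \<Rightarrow> 'a) set \<Rightarrow> 'b::real_vector topology
      \<Rightarrow> ((nat \<Rightarrow> 'a) \<Rightarrow> 'b) \<Rightarrow> bool" where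
  "Cn_on 0 X U Y f \<longleftrightarrow> continuous_map (subtopology X U) Y f"
| "Cn_on (Suc n) X U Y f \<longleftrightarrow>
     C1_on X U Y f \<and>
     Cn_on n (seq_square X) (seq_times U (topspace X)) Y (seq_deriv Y U f)"

definition smooth_on_lcs ::
    "'a::real_vector topology \<Rightarrow> 'a set \<Rightarrow> 'b::real_vector topology \<Rightarrow> ('a \<Rightarrow> 'b) \<Rightarrow> bool" where
  "smooth_on_lcs X U Y f \<longleftrightarrow>
     (\<forall>n. Cn_on n (seq_lcs X) (seq_embed ` U) Y (\<lambda>z. f (z 0)))"


section \<open>Manifolds\<close>

text \<open>
  A topological space with an atlas, indexed by \<open>mindex\<close>, of charts with values in a locally convex
  space.
\<close>

record ('p, 'x, 'i) manifold =
  mtop :: "'p topology"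
  mmodel :: "'x topology"
  mindex :: "'i set"
  mdom :: "'i \<Rightarrow> 'p set"
  mchart :: "'i \<Rightarrow> 'p \<Rightarrow> 'x"

definition chart_inv :: "('p, 'x, 'i) manifold \<Rightarrow> 'i \<Rightarrow> 'x \<Rightarrow> 'p" where
  "chart_inv M i = inv_into (mdom M i) (mchart M i)"

text \<open>
  The chart images are required to be relatively open in one of the model domains \<open>Q \<in> \<Q>\<close>.
\<close>

definition smooth_manifold :: "'x::real_vector set set \<Rightarrow> ('p, 'x, 'i) manifold \<Rightarrow> bool" where
  "smooth_manifold \<Q> M \<longleftrightarrow>
     lcs (mmodel M) \<and>
     Hausdorff_space (mtop M) \<and>
     topspace (mtop M) = (\<Union>i\<in>mindex M. mdom M i) \<and>
     (\<forall>i\<in>mindex M.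
        openin (mtop M) (mdom M i) \<and>
        (\<exists>Q\<in>\<Q>. openin (subtopology (mmodel M) Q) (mchart M i ` mdom M i)) \<and>
        homeomorphic_map (subtopology (mtop M) (mdom M i))
          (subtopology (mmodel M) (mchart M i ` mdom M i)) (mchart M i)) \<and>
     (\<forall>i\<in>mindex M. \<forall>j\<in>mindex M.
        smooth_on_lcs (mmodel M) (mchart M i ` (mdom M i \<inter> mdom M j)) (mmodel M)
          (mchart M j \<circ> chart_inv M i))"

definition paracompact_top :: "'a topology \<Rightarrow> bool" where
  "paracompact_top X \<longleftrightarrow>
     (\<forall>\<U>. (\<forall>U\<in>\<U>. openin X U) \<and> \<Union>\<U> = topspace X \<longrightarrow>
       (\<exists>\<V>. (\<forall>V\<in>\<V>. openin X V) \<and> \<Union>\<V> = topspace X \<and>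
            (\<forall>V\<in>\<V>. \<exists>U\<in>\<U>. V \<subseteq> U) \<and> locally_finite_in X \<V>))"

text \<open>
  Manifolds of dimension \<open>d\<close>, possibly with boundary: charts take values in open subsets of \<open>\<real>\<^sup>d\<close> or of
  the half-space \<open>x\<^sub>0 \<ge> 0\<close>. The boundary may be empty.
\<close>

definition finite_dim_manifold :: "nat \<Rightarrow> ('p, nat \<Rightarrow> real, 'i) manifold \<Rightarrow> bool" where
  "finite_dim_manifold d M \<longleftrightarrow>
     mmodel M = Euclidean_space d \<and>
     smooth_manifold {topspace (Euclidean_space d), {x \<in> topspace (Euclidean_space d). 0 \<le> x 0}} M \<and>
     paracompact_top (mtop M) \<and> second_countable (mtop M)"

definition lcs_manifold :: "'a topology \<Rightarrow> ('a, 'a, unit) manifold" where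
  "lcs_manifold X =
     \<lparr>mtop = X, mmodel = X, mindex = UNIV, mdom = (\<lambda>_. topspace X), mchart = (\<lambda>_ x. x)\<rparr>"

definition prod_manifold ::
    "('p, 'x, 'i) manifold \<Rightarrow> ('q, 'y, 'j) manifold \<Rightarrow> ('p \<times> 'q, 'x \<times> 'y, 'i \<times> 'j) manifold" where
  "prod_manifold M N =
     \<lparr>mtop = prod_topology (mtop M) (mtop N),
      mmodel = prod_topology (mmodel M) (mmodel N),
      mindex = mindex M \<times> mindex N,
      mdom = (\<lambda>(i, j). mdom M i \<times> mdom N j),
      mchart = (\<lambda>(i, j). map_prod (mchart M i) (mchart N j))\<rparr>"

definition smooth_map ::
    "('p, 'x::real_vector, 'i) manifold \<Rightarrow> ('q, 'y::real_vector, 'j) manifold \<Rightarrow> ('p \<Rightarrow> 'q) \<Rightarrow> bool" where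
  "smooth_map M N f \<longleftrightarrow>
     continuous_map (mtop M) (mtop N) f \<and>
     (\<forall>i\<in>mindex M. \<forall>j\<in>mindex N.
        smooth_on_lcs (mmodel M) (mchart M i ` (mdom M i \<inter> f -` mdom N j)) (mmodel N)
          (mchart N j \<circ> f \<circ> chart_inv M i))"


section \<open>Lie groups and smooth right actions\<close>

definition lie_group :: "('g, 'z) monoid_scheme \<Rightarrow> ('g, 'x::real_vector, 'i) manifold \<Rightarrow> bool" where
  "lie_group G A \<longleftrightarrow>
     group G \<and>
     carrier G = topspace (mtop A) \<and>
     smooth_manifold {topspace (mmodel A)} A \<and>
     smooth_map (prod_manifold A A) A (\<lambda>(g, h). g \<otimes>\<^bsub>G\<^esub> h) \<and>
     smooth_map A A (\<lambda>g. inv\<^bsub>G\<^esub> g)"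

definition smooth_right_action ::
    "('p, 'y::real_vector, 'j) manifold \<Rightarrow> ('g, 'z) monoid_scheme \<Rightarrow> ('g, 'x::real_vector, 'i) manifold
      \<Rightarrow> ('p \<times> 'g \<Rightarrow> 'p) \<Rightarrow> bool" where
  "smooth_right_action M G A \<sigma> \<longleftrightarrow>
     smooth_map (prod_manifold M A) M \<sigma> \<and>
     (\<forall>m\<in>topspace (mtop M). \<sigma> (m, \<one>\<^bsub>G\<^esub>) = m) \<and>
     (\<forall>m\<in>topspace (mtop M). \<forall>g\<in>carrier G. \<forall>h\<in>carrier G.
        \<sigma> (\<sigma> (m, g), h) = \<sigma> (m, g \<otimes>\<^bsub>G\<^esub> h))"


section \<open>The iterated tangent functor\<close>

text \<open>
  In order to iterate the tangent functor within one type, a point of \<open>T\<^sup>nM\<close> is represented as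
  \<open>(m, [v\<^sub>n, \<dots>, v\<^sub>1])\<close>, where \<open>m\<close> is a point of \<open>M\<close> and \<open>v\<^sub>k\<close> is a tangent vector to \<open>T\<^sup>k\<^sup>-\<^sup>1M\<close> at
  \<open>(m, [v\<^sub>k\<^sub>-\<^sub>1, \<dots>, v\<^sub>1])\<close>.
\<close>

type_synonym ('m, 'i) tpoint = "'m \<times> ('i \<Rightarrow> nat \<Rightarrow> real) list"

definition base_manifold ::
    "('m, nat \<Rightarrow> real, 'i) manifold \<Rightarrow> (('m, 'i) tpoint, nat \<Rightarrow> real, 'i) manifold" where
  "base_manifold M =
     \<lparr>mtop = pullback_topology {p. snd p = []} fst (mtop M),
      mmodel = mmodel M,
      mindex = mindex M,
      mdom = (\<lambda>i. mdom M i \<times> {[]}),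
      mchart = (\<lambda>i. mchart M i \<circ> fst)\<rparr>"

text \<open>
  A tangent vector at \<open>p\<close> is the family \<open>v\<close> of its coordinate representatives: \<open>v i\<close> represents it in the
  chart \<open>i\<close> around \<open>p\<close>, and representatives transform by the derivatives of the chart changes. The family
  is normalised to \<open>0\<close> at indices not belonging to a chart around \<open>p\<close>.
\<close>

definition tangent_space :: "('p, nat \<Rightarrow> real, 'i) manifold \<Rightarrow> 'p \<Rightarrow> ('i \<Rightarrow> nat \<Rightarrow> real) set" where
  "tangent_space M p =
     {v. (\<forall>i. i \<in> mindex M \<and> p \<in> mdom M i \<longrightarrow> v i \<in> topspace (mmodel M)) \<and>
         (\<forall>i. \<not> (i \<in> mindex M \<and> p \<in> mdom M i) \<longrightarrow> v i = 0) \<and>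
         (\<forall>i\<in>mindex M. \<forall>j\<in>mindex M. p \<in> mdom M i \<and> p \<in> mdom M j \<longrightarrow>
            v j = dir_deriv (mmodel M) (mchart M i ` (mdom M i \<inter> mdom M j))
                    (mchart M j \<circ> chart_inv M i) (mchart M i p) (v i))}"

definition tangent_dom ::
    "(('m, 'i) tpoint, nat \<Rightarrow> real, 'i) manifold \<Rightarrow> 'i \<Rightarrow> ('m, 'i) tpoint set" where
  "tangent_dom M i = {(m, v # vs) | m v vs. (m, vs) \<in> mdom M i \<and> v \<in> tangent_space M (m, vs)}"

definition tangent_chart ::
    "(('m, 'i) tpoint, nat \<Rightarrow> real, 'i) manifold \<Rightarrow> 'i \<Rightarrow> ('m, 'i) tpoint \<Rightarrow> nat \<Rightarrow> real" where
  "tangent_chart M i =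
     (\<lambda>(m, vs). seq_pair (mchart M i (m, tl vs)) (hd vs i))"

definition tangent_bundle ::
    "(('m, 'i) tpoint, nat \<Rightarrow> real, 'i) manifold \<Rightarrow> (('m, 'i) tpoint, nat \<Rightarrow> real, 'i) manifold" where
  "tangent_bundle M =
     \<lparr>mtop = topology_generated_by
        {tangent_dom M i \<inter> tangent_chart M i -` V | i V.
           i \<in> mindex M \<and> openin (seq_square (mmodel M)) V},
      mmodel = seq_square (mmodel M),
      mindex = mindex M,
      mdom = tangent_dom M,
      mchart = tangent_chart M\<rparr>"

definition Tn_manifold ::
    "nat \<Rightarrow> ('m, nat \<Rightarrow> real, 'i) manifold \<Rightarrow> (('m, 'i) tpoint, nat \<Rightarrow> real, 'i) manifold" where
  "Tn_manifold n M = (tangent_bundle ^^ n) (base_manifold M)"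

definition Tn_lcs :: "nat \<Rightarrow> 'e::real_vector topology \<Rightarrow> (nat \<Rightarrow> 'e) topology" where
  "Tn_lcs n E = (seq_square ^^ n) (seq_lcs E)"

text \<open>
  For \<open>f : M \<rightarrow> F\<close> with \<open>F\<close> locally convex, \<open>Tf : TM \<rightarrow> TF = F \<times> F\<close> maps a tangent vector \<open>v\<close> at \<open>p\<close> to
  \<open>(f p, df v)\<close>, where \<open>df v\<close> is computed in any chart around \<open>p\<close>.
\<close>

definition tangent_map ::
    "(('m, 'i) tpoint, nat \<Rightarrow> real, 'i) manifold \<Rightarrow> (nat \<Rightarrow> 'e::real_vector) topology
      \<Rightarrow> (('m, 'i) tpoint \<Rightarrow> nat \<Rightarrow> 'e) \<Rightarrow> ('m, 'i) tpoint \<Rightarrow> nat \<Rightarrow> 'e" where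
  "tangent_map M F f = (\<lambda>(m, vs).
     let p = (m, tl vs);
         i = (SOME i. i \<in> mindex M \<and> p \<in> mdom M i)
     in seq_pair (f p)
          (dir_deriv F (mchart M i ` mdom M i) (f \<circ> chart_inv M i) (mchart M i p) (hd vs i)))"

primrec Tn_map ::
    "nat \<Rightarrow> ('m, nat \<Rightarrow> real, 'i) manifold \<Rightarrow> 'e::real_vector topology \<Rightarrow> ('m \<Rightarrow> 'e)
      \<Rightarrow> ('m, 'i) tpoint \<Rightarrow> nat \<Rightarrow> 'e" where
  "Tn_map 0 M E f = seq_embed \<circ> f \<circ> fst"
| "Tn_map (Suc n) M E f = tangent_map (Tn_manifold n M) (Tn_lcs n E) (Tn_map n M E f)"


section \<open>The space of smooth functions\<close>

definition compact_open_topology :: "'a topology \<Rightarrow> 'b topology \<Rightarrow> ('a \<Rightarrow> 'b) topology" where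
  "compact_open_topology X Y =
     topology_generated_by
       {{f \<in> extensional (topspace X). continuous_map X Y f \<and> f ` K \<subseteq> V} | K V.
          compactin X K \<and> openin Y V}"

text \<open>
  Functions on \<open>M\<close> are normalised to \<open>0\<close> outside \<open>M\<close>, so that they form a linear subspace of the
  function type.
\<close>

definition smooth_functions ::
    "('m, nat \<Rightarrow> real, 'i) manifold \<Rightarrow> 'e::real_vector topology \<Rightarrow> ('m \<Rightarrow> 'e) set" where
  "smooth_functions M E =
     {f. smooth_map M (lcs_manifold E) f \<and> (\<forall>m. m \<notin> topspace (mtop M) \<longrightarrow> f m = 0)}"

definition smooth_function_space ::
    "('m, nat \<Rightarrow> real, 'i) manifold \<Rightarrow> 'e::real_vector topology \<Rightarrow> ('m \<Rightarrow> 'e) topology" where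
  "smooth_function_space M E =
     pullback_topology (smooth_functions M E)
       (\<lambda>f n. restrict (Tn_map n M E f) (topspace (mtop (Tn_manifold n M))))
       (product_topology
          (\<lambda>n. compact_open_topology (mtop (Tn_manifold n M)) (Tn_lcs n E)) UNIV)"

definition induced_action ::
    "('m, nat \<Rightarrow> real, 'i) manifold \<Rightarrow> ('m \<times> 'g \<Rightarrow> 'm) \<Rightarrow> 'g \<times> ('m \<Rightarrow> 'e::real_vector) \<Rightarrow> 'm \<Rightarrow> 'e" where
  "induced_action M \<sigma> = (\<lambda>(g, f) m. if m \<in> topspace (mtop M) then f (\<sigma> (m, g)) else 0)"

end

theory Submission
  imports Defs
begin

text \<open>
  The assertion is local in the group, so let \<open>W\<close> be the image of a chart of \<open>G\<close>, an open subset of a locally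
  convex space, and let \<open>C\<close> be the space of smooth functions. The map \<open>W \<times> C \<rightarrow> C\<close> in question sends \<open>(a, f)\<close> to the
  function \<open>p \<mapsto> f (\<sigma> (p, a))\<close>. Two facts about \<open>C\<close> reduce its smoothness to that of \<open>\<sigma>\<close>.

  Evaluation \<open>C \<times> M \<rightarrow> E\<close> is smooth (\<open>evaluation_smooth\<close>). Since \<open>T\<^sup>nM\<close> is locally compact, the compact-open
  topology makes \<open>(f, q) \<mapsto> T\<^sup>nf(q)\<close> jointly continuous for every \<open>n\<close> (\<open>Tn_eval_continuous\<close>). Evaluation is linear
  in \<open>f\<close>, and its derivative at \<open>(f, x)\<close> in the direction \<open>(k, v)\<close> is \<open>k(x) + df(x; v)\<close>: a value of \<open>k\<close> plus a component
  of a value of \<open>Tf\<close>. The derivative of the evaluation map for \<open>T\<^sup>nf\<close> is in the same way expressed by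
  those for \<open>T\<^sup>nf\<close> and \<open>T\<^sup>n\<^sup>+\<^sup>1f\<close>, and induction on the order of differentiability gives smoothness (\<open>ev_Cn\<close>).

  The exponential law: if \<open>f : W \<times> M \<rightarrow> E\<close> is smooth, then so is the curried map \<open>W \<rightarrow> C\<close> (\<open>exponential_law\<close>).
  Applying the tangent functor to the second variable yields smooth maps \<open>W \<times> T\<^sup>nM \<rightarrow> T\<^sup>nE\<close>, in particular jointly
  continuous ones, and a jointly continuous map curries to a continuous map into functions with the compact-open
  topology (\<open>curry_compact_open\<close>). Hence the curried map is continuous. Its derivative should be the curried
  derivative of \<open>f\<close> in the parameter, which is again smooth in both variables; so only the first derivative needs an
  argument, and higher orders follow by induction. The difference quotients in the parameter, extended to \<open>t = 0\<close> by the
  derivative, are jointly continuous in \<open>t\<close> and the point by the mean value inequality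
  (\<open>smooth_family_quotient_continuous\<close>). This applies to \<open>T\<^sup>nf\<close> for every \<open>n\<close>, and \<open>T\<^sup>n\<close> commutes with the derivative in
  the parameter by the symmetry of second derivatives (\<open>schwarz\<close>, \<open>param_deriv_tangent_map\<close>). Currying again, now with
  \<open>t\<close> as the parameter, shows that the difference quotients converge in \<open>C\<close> (\<open>family_has_dir_deriv\<close>).

  Now \<open>((a, f), p) \<mapsto> f (\<sigma> (p, a))\<close> is smooth on \<open>(W \<times> C) \<times> M\<close>, being evaluation composed with \<open>(f, \<sigma> (p, a))\<close>
  (\<open>joint_action_smooth\<close>), and the exponential law with parameter space \<open>W \<times> C\<close> gives the claim.

  Everything rests on calculus in locally convex spaces that need not be complete, over domains with boundary. Estimates
  are made with continuous seminorms, and the mean value inequality is proved for a seminorm by subdividing the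
  interval. Of the geometry of half-spaces only the properties collected in \<open>half_dom\<close> enter; they persist under products
  with locally convex spaces, and so hold for tangent bundles and for \<open>W \<times> M\<close> in charts.
\<close>

section \<open>Locally convex spaces\<close>

lemma lcs_subspace: "lcs X \<Longrightarrow> subspace (topspace X)"
  by (simp add: lcs_def)

lemma lcs_zero: "lcs X \<Longrightarrow> 0 \<in> topspace X"
  by (simp add: lcs_def subspace_0)

lemma lcs_add_mem: "lcs X \<Longrightarrow> x \<in> topspace X \<Longrightarrow> y \<in> topspace X \<Longrightarrow> x + y \<in> topspace X"
  by (simp add: lcs_def subspace_add)

lemma lcs_scale_mem: "lcs X \<Longrightarrow> x \<in> topspace X \<Longrightarrow> c *\<^sub>R x \<in> topspace X"
  by (simp add: lcs_def subspace_scale)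

lemma lcs_diff_mem: "lcs X \<Longrightarrow> x \<in> topspace X \<Longrightarrow> y \<in> topspace X \<Longrightarrow> x - y \<in> topspace X"
  by (simp add: lcs_def subspace_diff)

lemmas lcs_mem = lcs_zero lcs_add_mem lcs_scale_mem lcs_diff_mem

lemma lcs_convex: "lcs X \<Longrightarrow> convex (topspace X)"
  by (simp add: lcs_def subspace_imp_convex)

lemma lcs_Hausdorff: "lcs X \<Longrightarrow> Hausdorff_space X"
  by (simp add: lcs_def)

lemma continuous_map_lcs_add:
  assumes "lcs X" "continuous_map T X f" "continuous_map T X g"
  shows "continuous_map T X (\<lambda>z. f z + g z)"
proof -
  have "continuous_map T (prod_topology X X) (\<lambda>z. (f z, g z))"
    using assms by (simp add: continuous_map_pairedI)
  then have "continuous_map T X ((\<lambda>(x, y). x + y) \<circ> (\<lambda>z. (f z, g z)))"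
    using assms(1) by (intro continuous_map_compose) (auto simp: lcs_def)
  then show ?thesis by (simp add: o_def)
qed

lemma continuous_map_lcs_scale:
  assumes "lcs X" "continuous_map T euclideanreal c" "continuous_map T X f"
  shows "continuous_map T X (\<lambda>z. c z *\<^sub>R f z)"
proof -
  have "continuous_map T (prod_topology euclideanreal X) (\<lambda>z. (c z, f z))"
    using assms by (simp add: continuous_map_pairedI)
  then have "continuous_map T X ((\<lambda>(x, y). x *\<^sub>R y) \<circ> (\<lambda>z. (c z, f z)))"
    using assms(1) by (intro continuous_map_compose) (auto simp: lcs_def)
  then show ?thesis by (simp add: o_def)
qed

lemma continuous_map_lcs_diff:
  assumes "lcs X" "continuous_map T X f" "continuous_map T X g"
  shows "continuous_map T X (\<lambda>z. f z - g z)"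
proof -
  have "continuous_map T X (\<lambda>z. f z + (-1) *\<^sub>R g z)"
    using assms by (intro continuous_map_lcs_add continuous_map_lcs_scale) auto
  then show ?thesis by simp
qed

lemma openin_preimage:
  assumes "continuous_map T X f" "openin X U"
  shows "openin T {z \<in> topspace T. f z \<in> U}"
  using assms by (simp add: openin_continuous_map_preimage)

section \<open>Seminorms\<close>

definition cont_seminorm :: "'a::real_vector topology \<Rightarrow> ('a \<Rightarrow> real) \<Rightarrow> bool" where
  "cont_seminorm X p \<longleftrightarrow>
     (\<forall>x\<in>topspace X. \<forall>y\<in>topspace X. p (x + y) \<le> p x + p y) \<and>
     (\<forall>c. \<forall>x\<in>topspace X. p (c *\<^sub>R x) = \<bar>c\<bar> * p x) \<and>
     (\<forall>e>0. \<exists>N. openin X N \<and> 0 \<in> N \<and> (\<forall>x\<in>N. p x < e))"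

lemma seminorm_triangle: "cont_seminorm X p \<Longrightarrow> x \<in> topspace X \<Longrightarrow> y \<in> topspace X \<Longrightarrow> p (x + y) \<le> p x + p y"
  by (simp add: cont_seminorm_def)

lemma seminorm_scale: "cont_seminorm X p \<Longrightarrow> x \<in> topspace X \<Longrightarrow> p (c *\<^sub>R x) = \<bar>c\<bar> * p x"
  by (simp add: cont_seminorm_def)

lemma seminorm_zero: "lcs X \<Longrightarrow> cont_seminorm X p \<Longrightarrow> p 0 = 0"
  using seminorm_scale[of X p 0 0] lcs_zero[of X] by simp

lemma seminorm_minus: "cont_seminorm X p \<Longrightarrow> x \<in> topspace X \<Longrightarrow> p (- x) = p x"
  using seminorm_scale[of X p x "-1"] by simp

lemma seminorm_commute:
  "lcs X \<Longrightarrow> cont_seminorm X p \<Longrightarrow> x \<in> topspace X \<Longrightarrow> y \<in> topspace X \<Longrightarrow> p (x - y) = p (y - x)"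
  using seminorm_minus[of X p "x - y"] by (simp add: lcs_mem)

lemma seminorm_nonneg: "lcs X \<Longrightarrow> cont_seminorm X p \<Longrightarrow> x \<in> topspace X \<Longrightarrow> 0 \<le> p x"
  using seminorm_triangle[of X p x "-1 *\<^sub>R x"] seminorm_zero[of X p] seminorm_minus[of X p x]
    lcs_scale_mem[of X x "-1"] by simp

lemma seminorm_diff_triangle:
  "lcs X \<Longrightarrow> cont_seminorm X p \<Longrightarrow> x \<in> topspace X \<Longrightarrow> y \<in> topspace X \<Longrightarrow> z \<in> topspace X \<Longrightarrow>
    p (x - z) \<le> p (x - y) + p (y - z)"
  using seminorm_triangle[of X p "x - y" "y - z"] by (simp add: lcs_mem)

text \<open>
  The seminorm is the Minkowski functional \<open>p x = inf {r > 0. x / r \<in> W}\<close>; it turns statements about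
  neighbourhoods into estimates.
\<close>

lemma minkowski_seminorm:
  assumes X: "lcs X" and W: "openin X W" "convex W" "0 \<in> W" and sym: "\<And>x. x \<in> W \<Longrightarrow> - x \<in> W"
  obtains p where "cont_seminorm X p" "\<And>x. x \<in> topspace X \<Longrightarrow> p x < 1 \<Longrightarrow> x \<in> W"
proof -
  define A where "A = (\<lambda>x. {r. 0 < r \<and> inverse r *\<^sub>R x \<in> W})"
  define p where "p = (\<lambda>x. Inf (A x))"
  have bdd: "bdd_below (A x)" for x by (auto simp: A_def intro: bdd_belowI[of _ 0])
  have scale0: "c *\<^sub>R x \<in> W" if "x \<in> W" "0 \<le> c" "c \<le> 1" for c x
    using W(2,3) that convexD_alt[of W 0 x c] by (simp add: algebra_simps)
  have up: "r' \<in> A x" if "r \<in> A x" "r \<le> r'" for r r' x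
  proof -
    have r: "0 < r" "inverse r *\<^sub>R x \<in> W" using that by (auto simp: A_def)
    have "(r / r') *\<^sub>R (inverse r *\<^sub>R x) \<in> W" using r that(2) by (intro scale0[OF r(2)]) auto
    moreover have "r / r' * inverse r = inverse r'" using r that(2) by (simp add: field_simps)
    ultimately show ?thesis using r that(2) by (simp add: A_def)
  qed
  have ne: "A x \<noteq> {}" if x: "x \<in> topspace X" for x
  proof -
    have "continuous_map euclideanreal X (\<lambda>c. c *\<^sub>R x)"
      using x by (intro continuous_map_lcs_scale[OF X]) auto
    then have "open {c. c *\<^sub>R x \<in> W}" using openin_preimage[OF _ W(1)] by fastforce
    moreover have "0 \<in> {c. c *\<^sub>R x \<in> W}" using W by simp
    ultimately obtain e where e: "e > 0" "ball 0 e \<subseteq> {c. c *\<^sub>R x \<in> W}"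
      using openE by blast
    then have "e / 2 \<in> ball 0 e" by auto
    then have "(e / 2) *\<^sub>R x \<in> W" using e by blast
    then have "2 / e \<in> A x" using e by (simp add: A_def)
    then show ?thesis by auto
  qed
  have nn: "0 \<le> p x" if "x \<in> topspace X" for x
    unfolding p_def using ne[OF that] by (intro cInf_greatest) (auto simp: A_def)
  have le: "p x \<le> r" if "r \<in> A x" for r x unfolding p_def using bdd that by (simp add: cInf_lower)
  have less: "r \<in> A x" if "p x < r" "x \<in> topspace X" for r x
    using cInf_lessD[OF ne[OF that(2)]] that up unfolding p_def by (meson less_imp_le)
  have tri: "p (x + y) \<le> p x + p y" if x: "x \<in> topspace X" and y: "y \<in> topspace X" for x y
  proof (rule field_le_epsilon)
    fix e :: real assume e: "e > 0"
    define r s where "r = p x + e / 2" and "s = p y + e / 2"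
    have r: "r > 0" and s: "s > 0" using nn[OF x] nn[OF y] e by (auto simp: r_def s_def)
    have "inverse r *\<^sub>R x \<in> W" "inverse s *\<^sub>R y \<in> W"
      using less[of x r] less[of y s] e x y by (auto simp: A_def r_def s_def)
    then have "(r / (r + s)) *\<^sub>R (inverse r *\<^sub>R x) + (s / (r + s)) *\<^sub>R (inverse s *\<^sub>R y) \<in> W"
      using W(2) r s by (intro convexD) (auto simp: add_divide_distrib[symmetric])
    moreover have "r / (r + s) * inverse r = inverse (r + s)" "s / (r + s) * inverse s = inverse (r + s)"
      using r s by (auto simp: field_simps)
    ultimately have "inverse (r + s) *\<^sub>R (x + y) \<in> W"
      by (simp add: scaleR_add_right)
    then have "r + s \<in> A (x + y)" using r s by (simp add: A_def)
    then show "p (x + y) \<le> p x + p y + e" using le by (fastforce simp: r_def s_def)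
  qed
  have pos: "p (c *\<^sub>R x) \<le> c * p x" if c: "c > 0" and x: "x \<in> topspace X" for c x
  proof -
    have "p (c *\<^sub>R x) / c \<le> r" if "r \<in> A x" for r
    proof -
      have "inverse (c * r) * c = inverse r" using that c by (simp add: A_def field_simps)
      then have "c * r \<in> A (c *\<^sub>R x)" using that c by (simp add: A_def del: inverse_mult_distrib)
      then show ?thesis using le c by (fastforce simp: field_simps)
    qed
    then have "p (c *\<^sub>R x) / c \<le> p x"
      unfolding p_def[of] by (intro cInf_greatest ne x) (auto simp: p_def)
    then show ?thesis using c by (simp add: field_simps)
  qed
  have pos': "p (c *\<^sub>R x) = c * p x" if c: "c > 0" and x: "x \<in> topspace X" for c x
    using pos[OF c x] pos[of "inverse c" "c *\<^sub>R x"] c x X by (simp add: lcs_mem field_simps)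
  have "A (- x) = A x" for x using sym by (force simp: A_def)
  then have pm: "p (- x) = p x" for x by (simp add: p_def)
  have "p 0 \<le> e" if "e > 0" for e using that W(3) by (intro le) (auto simp: A_def)
  then have p0: "p 0 = 0" using nn[of 0] lcs_zero[OF X] by (meson dense_le eq_iff less_eq_real_def not_le)
  have sc: "p (c *\<^sub>R x) = \<bar>c\<bar> * p x" if x: "x \<in> topspace X" for c x
  proof (cases "c > 0")
    case False
    then consider "c = 0" | "- c > 0" by linarith
    then show ?thesis
      using pos'[of "-c" x] pm[of "c *\<^sub>R x"] p0 x by cases (auto simp: abs_if)
  qed (use pos'[OF _ x] in simp)
  have ct: "\<exists>N. openin X N \<and> 0 \<in> N \<and> (\<forall>x\<in>N. p x < e)" if e: "e > 0" for e
  proof (intro exI conjI ballI)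
    show "openin X {x \<in> topspace X. inverse (e / 2) *\<^sub>R x \<in> W}"
      by (intro openin_preimage[OF _ W(1)] continuous_map_lcs_scale[OF X]) auto
    show "0 \<in> {x \<in> topspace X. inverse (e / 2) *\<^sub>R x \<in> W}" using lcs_zero[OF X] W(3) by simp
    show "p x < e" if "x \<in> {x \<in> topspace X. inverse (e / 2) *\<^sub>R x \<in> W}" for x
      using le[of "e/2" x] that e by (auto simp: A_def)
  qed
  show thesis
  proof (rule that[of p])
    show "cont_seminorm X p" using tri sc ct by (simp add: cont_seminorm_def)
    show "x \<in> W" if "x \<in> topspace X" "p x < 1" for x
      using less[OF that(2,1)] by (simp add: A_def)
  qed
qed

lemma lcs_translate_open:
  assumes X: "lcs X" and U: "openin X U" and y: "y \<in> topspace X"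
  shows "openin X {z \<in> topspace X. z - y \<in> U}" "openin X {z \<in> topspace X. z + y \<in> U}"
  using y by (auto intro!: openin_preimage[OF _ U] continuous_map_lcs_diff[OF X] continuous_map_lcs_add[OF X])

lemma lcs_convex_nbhd:
  assumes X: "lcs X" and U: "openin X U" and y: "y \<in> U"
  obtains V where "openin X V" "y \<in> V" "V \<subseteq> U" "convex V"
proof -
  have yS: "y \<in> topspace X" using openin_subset[OF U] y by auto
  have o: "openin X {z \<in> topspace X. z + y \<in> U}" by (rule lcs_translate_open[OF X U yS])
  obtain V where V: "openin X V" "0 \<in> V" "V \<subseteq> {z \<in> topspace X. z + y \<in> U}" "convex V"
    using X o y lcs_zero[OF X] unfolding lcs_def by (smt (verit) add_0 mem_Collect_eq)
  have VS: "V \<subseteq> topspace X" using V(1) openin_subset by auto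
  show thesis
  proof (rule that)
    show "openin X {z \<in> topspace X. z - y \<in> V}" by (rule lcs_translate_open[OF X V(1) yS])
    show "y \<in> {z \<in> topspace X. z - y \<in> V}" using yS V by simp
    show "{z \<in> topspace X. z - y \<in> V} \<subseteq> U" using V(3) by (force simp: subset_iff)
    have "{z \<in> topspace X. z - y \<in> V} = (+) y ` V"
      using VS yS lcs_add_mem[OF X] by (force simp: image_iff)
    then show "convex {z \<in> topspace X. z - y \<in> V}" using V(4) by (simp add: convex_translation)
  qed
qed

text \<open>
  Every neighbourhood contains a seminorm ball: a convex neighbourhood is made symmetric by intersecting
  it with its negative, and its Minkowski functional is taken.
\<close>

lemma lcs_seminorm_nbhd:
  assumes X: "lcs X" and U: "openin X U" and y: "y \<in> U"
  obtains p where "cont_seminorm X p" "\<And>z. z \<in> topspace X \<Longrightarrow> p (z - y) < 1 \<Longrightarrow> z \<in> U"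
proof -
  have yS: "y \<in> topspace X" using openin_subset[OF U] y by auto
  have o: "openin X {z \<in> topspace X. z + y \<in> U}" by (rule lcs_translate_open[OF X U yS])
  obtain V where V: "openin X V" "0 \<in> V" "V \<subseteq> {z \<in> topspace X. z + y \<in> U}" "convex V"
    using X o y lcs_zero[OF X] unfolding lcs_def by (smt (verit) add_0 mem_Collect_eq)
  \<comment> \<open>A seminorm needs a symmetric unit ball.\<close>
  define W where "W = V \<inter> {x \<in> topspace X. -1 *\<^sub>R x \<in> V}"
  have VS: "V \<subseteq> topspace X" using V(1) openin_subset by auto
  have "openin X {x \<in> topspace X. -1 *\<^sub>R x \<in> V}"
    by (intro openin_preimage[OF _ V(1)] continuous_map_lcs_scale[OF X]) auto
  then have 1: "openin X W" using V by (auto simp: W_def)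
  have W_alt: "W = V \<inter> uminus ` V"
  proof -
    have "x \<in> topspace X" if "- x \<in> V" for x
      using lcs_scale_mem[OF X, of "-x" "-1"] that VS by auto
    then show ?thesis by (force simp: W_def image_iff)
  qed
  then have 2: "convex W" using V(4) by (simp add: convex_Int convex_negations)
  have 3: "0 \<in> W" using V lcs_zero[OF X] by (simp add: W_def)
  have 4: "- x \<in> W" if "x \<in> W" for x using that by (auto simp: W_alt)
  obtain p where p: "cont_seminorm X p" "\<And>x. x \<in> topspace X \<Longrightarrow> p x < 1 \<Longrightarrow> x \<in> W"
    using minkowski_seminorm[OF X 1 2 3 4] by blast
  show thesis
  proof (rule that[OF p(1)])
    fix z assume "z \<in> topspace X" "p (z - y) < 1"
    then have "z - y \<in> V" using p(2)[of "z - y"] yS X by (simp add: lcs_mem W_def)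
    then show "z \<in> U" using V(3) by auto
  qed
qed

lemma seminorm_ball_open:
  assumes X: "lcs X" and p: "cont_seminorm X p" and y: "y \<in> topspace X"
  shows "openin X {z \<in> topspace X. p (z - y) < e}"
proof (subst openin_subopen, safe)
  fix z assume z: "z \<in> topspace X" "p (z - y) < e"
  obtain N where N: "openin X N" "0 \<in> N" "\<forall>x\<in>N. p x < e - p (z - y)"
    using p z unfolding cont_seminorm_def by (metis diff_gt_0_iff_gt)
  show "\<exists>T. openin X T \<and> z \<in> T \<and> T \<subseteq> {z \<in> topspace X. p (z - y) < e}"
  proof (intro exI conjI)
    show "openin X {x \<in> topspace X. x - z \<in> N}" using lcs_translate_open[OF X N(1) z(1)] by simp
    show "{x \<in> topspace X. x - z \<in> N} \<subseteq> {z \<in> topspace X. p (z - y) < e}"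
    proof safe
      fix x assume x: "x \<in> topspace X" "x - z \<in> N"
      then have "p (x - z) < e - p (z - y)" using N(3) by blast
      then show "p (x - y) < e"
        using seminorm_diff_triangle[OF X p x(1) z(1) y] by linarith
    qed
  qed (use z N in auto)
qed

lemma limitin_seminorm:
  assumes X: "lcs X"
  shows "limitin X f l F \<longleftrightarrow> l \<in> topspace X \<and> (\<forall>\<^sub>F x in F. f x \<in> topspace X) \<and>
    (\<forall>p e. cont_seminorm X p \<longrightarrow> 0 < e \<longrightarrow> (\<forall>\<^sub>F x in F. p (f x - l) < e))" (is "?L \<longleftrightarrow> ?R")
proof
  assume L: ?L
  then have l: "l \<in> topspace X" by (simp add: limitin_def)
  have "\<forall>\<^sub>F x in F. p (f x - l) < e" if "cont_seminorm X p" "0 < e" for p e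
  proof -
    have "\<forall>\<^sub>F x in F. f x \<in> {z \<in> topspace X. p (z - l) < e}"
      using L by (rule limitinD) (use seminorm_ball_open[OF X] that l seminorm_zero[OF X that(1)] in auto)
    then show ?thesis by eventually_elim auto
  qed
  moreover have "\<forall>\<^sub>F x in F. f x \<in> topspace X"
    using L l by (intro limitinD[OF L]) auto
  ultimately show ?R using l by auto
next
  assume R: ?R
  show ?L unfolding limitin_def
  proof safe
    fix U assume U: "openin X U" "l \<in> U"
    obtain p where p: "cont_seminorm X p" "\<And>z. z \<in> topspace X \<Longrightarrow> p (z - l) < 1 \<Longrightarrow> z \<in> U"
      using lcs_seminorm_nbhd[OF X U] by blast
    have "\<forall>\<^sub>F x in F. p (f x - l) < 1" using R p(1) by auto
    with conjunct1[OF conjunct2[OF R]] show "\<forall>\<^sub>F x in F. f x \<in> U"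
      by eventually_elim (use p in auto)
  qed (use R in auto)
qed

lemma continuous_map_seminorm:
  assumes X: "lcs X"
  shows "continuous_map T X f \<longleftrightarrow> (\<forall>x\<in>topspace T. f x \<in> topspace X) \<and>
    (\<forall>x\<in>topspace T. \<forall>p e. cont_seminorm X p \<longrightarrow> 0 < e \<longrightarrow>
       (\<exists>N. openin T N \<and> x \<in> N \<and> (\<forall>z\<in>N. p (f z - f x) < e)))" (is "?L \<longleftrightarrow> ?R")
proof
  assume L: ?L
  then have m: "\<forall>x\<in>topspace T. f x \<in> topspace X" by (auto simp: continuous_map_def)
  have "\<exists>N. openin T N \<and> x \<in> N \<and> (\<forall>z\<in>N. p (f z - f x) < e)"
    if "cont_seminorm X p" "0 < e" "x \<in> topspace T" for x p e
    using openin_preimage[OF L seminorm_ball_open[OF X that(1) m[rule_format, OF that(3)], of e]] that m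
    by (intro exI[of _ "{z \<in> topspace T. f z \<in> {z \<in> topspace X. p (z - f x) < e}}"])
      (auto simp: seminorm_zero[OF X that(1)])
  then show ?R using m by auto
next
  assume R: ?R
  show ?L unfolding continuous_map_def
  proof safe
    show "f x \<in> topspace X" if "x \<in> topspace T" for x using R that by auto
    fix U assume U: "openin X U"
    show "openin T {x \<in> topspace T. f x \<in> U}"
    proof (subst openin_subopen, safe)
      fix x assume x: "x \<in> topspace T" "f x \<in> U"
      obtain p where p: "cont_seminorm X p" "\<And>z. z \<in> topspace X \<Longrightarrow> p (z - f x) < 1 \<Longrightarrow> z \<in> U"
        using lcs_seminorm_nbhd[OF X U x(2)] by blast
      obtain N where N: "openin T N" "x \<in> N" "\<forall>z\<in>N. p (f z - f x) < 1"
        using R p(1) x(1) by (metis zero_less_one)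
      then show "\<exists>S. openin T S \<and> x \<in> S \<and> S \<subseteq> {x \<in> topspace T. f x \<in> U}"
        using p(2) R openin_subset[OF N(1)] by (intro exI[of _ N]) auto
    qed
  qed
qed

lemma seminorm_separates:
  assumes X: "lcs X" and x: "x \<in> topspace X" "y \<in> topspace X" and p: "\<And>p. cont_seminorm X p \<Longrightarrow> p (x - y) = 0"
  shows "x = y"
proof (rule ccontr)
  assume "x \<noteq> y"
  then obtain U where U: "openin X U" "y \<in> U" "x \<notin> U"
    using lcs_Hausdorff[OF X] x unfolding Hausdorff_space_def disjnt_iff by metis
  obtain p where "cont_seminorm X p" "\<And>z. z \<in> topspace X \<Longrightarrow> p (z - y) < 1 \<Longrightarrow> z \<in> U"
    using lcs_seminorm_nbhd[OF X U(1,2)] by blast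
  then show False using p U x by force
qed

section \<open>Products, pullbacks and spaces of sequences\<close>

lemma lcs_prod:
  assumes X: "lcs X" and Y: "lcs Y"
  shows "lcs (prod_topology X Y)"
  unfolding lcs_def
proof (intro conjI allI impI)
  show "subspace (topspace (prod_topology X Y))"
    using X Y by (auto intro!: subspace_Times lcs_subspace)
  show "continuous_map (prod_topology (prod_topology X Y) (prod_topology X Y)) (prod_topology X Y) (\<lambda>(x, y). x + y)"
    unfolding case_prod_unfold plus_prod_def
    by (intro continuous_map_pairedI continuous_map_lcs_add X Y
        continuous_map_compose[OF continuous_map_fst continuous_map_fst, unfolded o_def]
        continuous_map_compose[OF continuous_map_fst continuous_map_snd, unfolded o_def]
        continuous_map_compose[OF continuous_map_snd continuous_map_fst, unfolded o_def]
        continuous_map_compose[OF continuous_map_snd continuous_map_snd, unfolded o_def])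
  show "continuous_map (prod_topology euclideanreal (prod_topology X Y)) (prod_topology X Y) (\<lambda>(x, y). x *\<^sub>R y)"
    unfolding case_prod_unfold scaleR_prod_def
    by (intro continuous_map_pairedI continuous_map_lcs_scale X Y continuous_map_fst
        continuous_map_compose[OF continuous_map_snd continuous_map_fst, unfolded o_def]
        continuous_map_compose[OF continuous_map_snd continuous_map_snd, unfolded o_def])
  show "Hausdorff_space (prod_topology X Y)"
    using lcs_Hausdorff[OF X] lcs_Hausdorff[OF Y] unfolding Hausdorff_space_prod_topology by blast
  fix U assume *: "openin (prod_topology X Y) U \<and> 0 \<in> U"
  have 0: "(0 :: 'a \<times> 'b) = (0, 0)" by (rule zero_prod_def)
  have U: "openin (prod_topology X Y) U" "(0, 0) \<in> U" using * unfolding 0 by blast+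
  have "\<exists>A B. openin X A \<and> openin Y B \<and> 0 \<in> A \<and> 0 \<in> B \<and> A \<times> B \<subseteq> U"
    using U(1)[unfolded openin_prod_topology_alt, rule_format, OF U(2)] .
  then obtain A B where AB: "openin X A" "openin Y B" "0 \<in> A" "0 \<in> B" "A \<times> B \<subseteq> U"
    by metis
  obtain A' where "openin X A'" "0 \<in> A'" "A' \<subseteq> A" "convex A'"
    using lcs_convex_nbhd[OF X AB(1,3)] .
  moreover obtain B' where "openin Y B'" "0 \<in> B'" "B' \<subseteq> B" "convex B'"
    using lcs_convex_nbhd[OF Y AB(2,4)] .
  ultimately have "openin (prod_topology X Y) (A' \<times> B')" "(0, 0) \<in> A' \<times> B'" "A' \<times> B' \<subseteq> U"
      "convex (A' \<times> B')"
    using AB by (auto simp: openin_prod_Times_iff convex_Times)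
  then show "\<exists>V. openin (prod_topology X Y) V \<and> 0 \<in> V \<and> V \<subseteq> U \<and> convex V"
    unfolding 0 by blast
qed

lemma continuous_map_from_pullback: "continuous_map (pullback_topology A f X) X f"
proof -
  have "continuous_map (pullback_topology A f X) X (id \<circ> f)"
    by (rule continuous_map_pullback) (rule continuous_map_id)
  then show ?thesis by (simp only: id_comp)
qed

lemma continuous_map_pullback_iff:
  "continuous_map T (pullback_topology A f X) g \<longleftrightarrow>
     g ` topspace T \<subseteq> A \<and> continuous_map T X (f \<circ> g)" (is "?L \<longleftrightarrow> ?R")
proof
  assume L: ?L
  have "g ` topspace T \<subseteq> A"
    using continuous_map_image_subset_topspace[OF L] unfolding topspace_pullback_topology by blast
  then show ?R using continuous_map_compose[OF L continuous_map_from_pullback] by blast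
next
  assume R: ?R
  show ?L
    by (rule continuous_map_pullback') (use R in blast)+
qed

text \<open>
  Both encodings by sequences, \<open>seq_square X\<close> and \<open>seq_lcs X\<close>, are pullbacks along linear maps.
  Injectivity on \<open>A\<close> is what makes the pullback Hausdorff.
\<close>

lemma lcs_pullback:
  fixes f :: "'a::real_vector \<Rightarrow> 'b::real_vector"
  assumes X: "lcs X" and f: "linear f" "inj_on f A" and A: "subspace A"
  shows "lcs (pullback_topology A f X)"
  unfolding lcs_def
proof (intro conjI allI impI)
  let ?P = "pullback_topology A f X"
  show sub: "subspace (topspace ?P)"
    unfolding topspace_pullback_topology
    by (intro subspace_inter linear_subspace_vimage lcs_subspace X A f)
  have top: "topspace ?P \<subseteq> A" by (auto simp: topspace_pullback_topology)
  have fc: "continuous_map ?P X f" by (rule continuous_map_from_pullback)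
  show "continuous_map (prod_topology ?P ?P) ?P (\<lambda>(x, y). x + y)"
    unfolding continuous_map_pullback_iff
  proof
    show "(\<lambda>(x, y). x + y) ` topspace (prod_topology ?P ?P) \<subseteq> A"
      using top by (auto intro!: subspace_add[OF A])
    have "continuous_map (prod_topology ?P ?P) X (\<lambda>z. f (fst z) + f (snd z))"
      by (intro continuous_map_lcs_add X continuous_map_compose[OF continuous_map_fst fc, unfolded o_def]
          continuous_map_compose[OF continuous_map_snd fc, unfolded o_def])
    then show "continuous_map (prod_topology ?P ?P) X (f \<circ> (\<lambda>(x, y). x + y))"
      by (simp add: o_def case_prod_unfold linear_add[OF f(1)])
  qed
  show "continuous_map (prod_topology euclideanreal ?P) ?P (\<lambda>(c, y). c *\<^sub>R y)"
    unfolding continuous_map_pullback_iff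
  proof
    show "(\<lambda>(c, y). c *\<^sub>R y) ` topspace (prod_topology euclideanreal ?P) \<subseteq> A"
      using top by (auto intro!: subspace_scale[OF A])
    have "continuous_map (prod_topology euclideanreal ?P) X (\<lambda>z. fst z *\<^sub>R f (snd z))"
      by (intro continuous_map_lcs_scale X continuous_map_fst
          continuous_map_compose[OF continuous_map_snd fc, unfolded o_def])
    then show "continuous_map (prod_topology euclideanreal ?P) X (f \<circ> (\<lambda>(c, y). c *\<^sub>R y))"
      by (simp add: o_def case_prod_unfold linear_scale[OF f(1)])
  qed
  show "Hausdorff_space ?P"
    unfolding Hausdorff_space_def
  proof clarify
    fix x y assume xy: "x \<in> topspace ?P" "y \<in> topspace ?P" "x \<noteq> y"
    then have "f x \<in> topspace X" "f y \<in> topspace X" "f x \<noteq> f y"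
      using f(2) by (auto simp: topspace_pullback_topology inj_on_def)
    then obtain U V where UV: "openin X U" "openin X V" "f x \<in> U" "f y \<in> V" "disjnt U V"
      using lcs_Hausdorff[OF X] unfolding Hausdorff_space_def by meson
    have "disjnt {z \<in> topspace ?P. f z \<in> U} {z \<in> topspace ?P. f z \<in> V}"
      using UV(5) unfolding disjnt_iff by blast
    moreover have "x \<in> {z \<in> topspace ?P. f z \<in> U}" "y \<in> {z \<in> topspace ?P. f z \<in> V}"
      using xy UV by blast+
    ultimately show "\<exists>U V. openin ?P U \<and> openin ?P V \<and> x \<in> U \<and> y \<in> V \<and> disjnt U V"
      using openin_preimage[OF fc UV(1)] openin_preimage[OF fc UV(2)] by blast
  qed
  fix U assume "openin ?P U \<and> 0 \<in> U"
  then obtain V where V: "openin X V" "U = f -` V \<inter> A" "0 \<in> V"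
    using linear_0[OF f(1)] unfolding openin_pullback_topology by (metis IntD1 vimageD)
  obtain V' where V': "openin X V'" "0 \<in> V'" "V' \<subseteq> V" "convex V'"
    using lcs_convex_nbhd[OF X V(1,3)] by blast
  have "convex (f -` V' \<inter> A)"
    by (intro convex_Int convex_linear_vimage f V' subspace_imp_convex A)
  moreover have "openin ?P (f -` V' \<inter> A)" using V'(1) unfolding openin_pullback_topology by blast
  moreover have "0 \<in> f -` V' \<inter> A" using V'(2) subspace_0[OF A] linear_0[OF f(1)] by simp
  moreover have "f -` V' \<inter> A \<subseteq> U" using V(2) V'(3) by blast
  ultimately show "\<exists>V. openin ?P V \<and> 0 \<in> V \<and> V \<subseteq> U \<and> convex V" by blast
qed

lemma seq_fst_add: "seq_fst (x + y) = seq_fst x + seq_fst y"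
  and seq_snd_add: "seq_snd (x + y) = seq_snd x + seq_snd y"
  and seq_pair_add: "seq_pair (a + b) (c + d) = seq_pair a c + seq_pair b d"
  by (auto simp: seq_fst_def seq_snd_def seq_pair_def fun_eq_iff)

lemma seq_fst_scale: "seq_fst (r *\<^sub>R x) = r *\<^sub>R seq_fst x"
  and seq_snd_scale: "seq_snd (r *\<^sub>R x) = r *\<^sub>R seq_snd x"
  and seq_pair_scale: "seq_pair (r *\<^sub>R a) (r *\<^sub>R b) = r *\<^sub>R seq_pair a b"
  by (auto simp: seq_fst_def seq_snd_def seq_pair_def fun_eq_iff scaleR_fun_def)

lemma linear_seq_fst: "linear seq_fst" and linear_seq_snd: "linear seq_snd"
  by (auto intro!: linearI simp: seq_fst_add seq_snd_add seq_fst_scale seq_snd_scale)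

lemma linear_seq_pair: "linear (\<lambda>(x, y). seq_pair x y)"
  by (auto intro!: linearI simp: seq_pair_add seq_pair_scale)

lemma linear_seq_embed: "linear seq_embed"
  by (auto intro!: linearI simp: seq_embed_def fun_eq_iff scaleR_fun_def)

lemma linear_eval: "linear (\<lambda>f. f x)"
  by (auto intro!: linearI simp: scaleR_fun_def)

lemma seq_embed_0 [simp]: "seq_embed x 0 = x"
  by (simp add: seq_embed_def)

lemma lcs_seq_square: "lcs X \<Longrightarrow> lcs (seq_square X)"
  unfolding seq_square_def
proof (rule lcs_pullback[OF lcs_prod])
  show "linear (\<lambda>z::nat \<Rightarrow> 'a. (seq_fst z, seq_snd z))"
    by (auto intro!: linearI simp: seq_fst_add seq_snd_add seq_fst_scale seq_snd_scale)
  show "inj_on (\<lambda>z. (seq_fst z, seq_snd z)) UNIV"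
    by (rule inj_onI) (metis Pair_inject seq_pair_simps(3))
qed simp_all

lemma lcs_seq_lcs: "lcs X \<Longrightarrow> lcs (seq_lcs X)"
  unfolding seq_lcs_def
proof (rule lcs_pullback)
  show "subspace (range (seq_embed :: 'a \<Rightarrow> _))"
    by (intro linear_subspace_image linear_seq_embed subspace_UNIV)
  show "inj_on (\<lambda>z. z 0) (range (seq_embed :: 'a \<Rightarrow> _))"
    by (rule inj_onI) (metis imageE seq_embed_0)
qed (simp_all add: linear_eval)

lemma topspace_seq_lcs: "topspace (seq_lcs X) = seq_embed ` topspace X"
  unfolding seq_lcs_def topspace_pullback_topology by force

lemma continuous_map_into_seq_square:
  "continuous_map T (seq_square X) g \<longleftrightarrow>
    continuous_map T X (\<lambda>z. seq_fst (g z)) \<and> continuous_map T X (\<lambda>z. seq_snd (g z))"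
  by (simp add: seq_square_def continuous_map_pullback_iff o_def continuous_map_pairwise)

lemma continuous_map_seq_fst: "continuous_map (seq_square X) X seq_fst"
  and continuous_map_seq_snd: "continuous_map (seq_square X) X seq_snd"
proof -
  have "continuous_map (seq_square X) (seq_square X) (\<lambda>z. z)" by simp
  then show "continuous_map (seq_square X) X seq_fst" "continuous_map (seq_square X) X seq_snd"
    unfolding continuous_map_into_seq_square by blast+
qed

lemma continuous_map_into_seq_lcs:
  "continuous_map T (seq_lcs X) g \<longleftrightarrow>
    g ` topspace T \<subseteq> range seq_embed \<and> continuous_map T X (\<lambda>z. g z 0)"
  by (simp add: seq_lcs_def continuous_map_pullback_iff o_def)

lemma continuous_map_eval_seq_lcs: "continuous_map (seq_lcs X) X (\<lambda>z. z 0)"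
  unfolding seq_lcs_def by (rule continuous_map_from_pullback)

lemma continuous_map_seq_embed: "continuous_map X (seq_lcs X) seq_embed"
  by (simp add: continuous_map_into_seq_lcs image_mono)

lemma continuous_map_seq_pair:
  "continuous_map T X f \<Longrightarrow> continuous_map T X g \<Longrightarrow> continuous_map T (seq_square X) (\<lambda>z. seq_pair (f z) (g z))"
  by (simp add: continuous_map_into_seq_square)

lemma lcs_Tn_lcs: "lcs E \<Longrightarrow> lcs (Tn_lcs n E)"
  by (induction n) (simp_all add: Tn_lcs_def lcs_seq_lcs lcs_seq_square)

section \<open>Domains, directional derivatives and the mean value inequality\<close>

text \<open>
  The properties of a half-space on which the calculus rests, shared by the whole space and by products of
  a half-space with a locally convex space. By the last condition one of the directions \<open>h\<close> and \<open>- h\<close>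
  stays inside at every point, so that directional derivatives are limits along a nontrivial filter even
  at a boundary point.
\<close>

definition half_dom :: "'a::real_vector topology \<Rightarrow> 'a set \<Rightarrow> bool" where
  "half_dom X Q \<longleftrightarrow> Q \<subseteq> topspace X \<and> convex Q \<and>
     (\<forall>x\<in>Q. \<forall>h\<in>topspace X. x + h \<in> Q \<or> x - h \<in> Q)"

text \<open>
  The domains of the calculus: open subsets of a space with boundary.
\<close>

definition mb_dom :: "'a::real_vector topology \<Rightarrow> 'a set \<Rightarrow> bool" where
  "mb_dom X U \<longleftrightarrow> (\<exists>Q. half_dom X Q \<and> openin (subtopology X Q) U)"

lemma mb_dom_subset: "mb_dom X U \<Longrightarrow> U \<subseteq> topspace X"
  unfolding mb_dom_def half_dom_def using openin_subset by fastforce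

lemma mb_dom_mem: "mb_dom X U \<Longrightarrow> x \<in> U \<Longrightarrow> x \<in> topspace X"
  using mb_dom_subset by blast

lemma half_dom_topspace: "lcs X \<Longrightarrow> half_dom X (topspace X)"
  by (simp add: half_dom_def lcs_convex lcs_mem)

lemma mb_dom_open: "lcs X \<Longrightarrow> openin X U \<Longrightarrow> mb_dom X U"
  unfolding mb_dom_def using half_dom_topspace by (metis subtopology_topspace)

lemma openin_subtopology_chain:
  assumes "openin (subtopology X U) V" "openin (subtopology X Q) U"
  shows "openin (subtopology X Q) V"
proof -
  obtain T where T: "openin X T" "V = T \<inter> U" using assms(1) unfolding openin_subtopology by blast
  obtain T' where T': "openin X T'" "U = T' \<inter> Q" using assms(2) unfolding openin_subtopology by blast
  have "V = (T \<inter> T') \<inter> Q" using T(2) T'(2) by blast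
  then show ?thesis using openin_Int[OF T(1) T'(1)] unfolding openin_subtopology by blast
qed

lemma mb_dom_open_subset: "mb_dom X U \<Longrightarrow> openin (subtopology X U) V \<Longrightarrow> mb_dom X V"
  unfolding mb_dom_def using openin_subtopology_chain by blast

lemma mb_dom_local_convex:
  assumes X: "lcs X" and U: "mb_dom X U" and V: "openin (subtopology X U) V" and x: "x \<in> V"
  obtains C where "openin (subtopology X U) C" "convex C" "x \<in> C" "C \<subseteq> V"
proof -
  obtain Q W where Q: "half_dom X Q" "openin X W" "U = W \<inter> Q"
    using U unfolding mb_dom_def openin_subtopology by blast
  obtain W' where W': "openin X W'" "V = W' \<inter> U" using V unfolding openin_subtopology by blast
  have "openin X (W \<inter> W')" "x \<in> W \<inter> W'" using Q W' x by auto
  then obtain N where N: "openin X N" "x \<in> N" "N \<subseteq> W \<inter> W'" "convex N"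
    using lcs_convex_nbhd[OF X] by blast
  show thesis
  proof (rule that[of "N \<inter> Q"])
    have "N \<inter> Q = N \<inter> U" using N Q by blast
    then show "openin (subtopology X U) (N \<inter> Q)" using N(1) by (metis openin_subtopology)
    show "convex (N \<inter> Q)" using N(4) Q(1) by (simp add: half_dom_def convex_Int)
  qed (use N Q W' x in blast)+
qed

lemma continuous_map_line:
  assumes X: "lcs X" and "x \<in> topspace X" "h \<in> topspace X"
  shows "continuous_map euclideanreal X (\<lambda>t. x + t *\<^sub>R h)"
  using assms by (intro continuous_map_lcs_add continuous_map_lcs_scale) auto

lemma open_line_preimage:
  assumes "lcs X" "x \<in> topspace X" "h \<in> topspace X" "openin X W"
  shows "open {t. x + t *\<^sub>R h \<in> W}"
  using openin_preimage[OF continuous_map_line[OF assms(1,2,3)] assms(4)] by simp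

text \<open>
  One of the two directions stays in the model domain; convexity keeps the segment inside, and
  openness of \<open>U\<close> in it limits the length.
\<close>

lemma mb_dom_direction:
  assumes X: "lcs X" and U: "mb_dom X U" and x: "x \<in> U" and h: "h \<in> topspace X"
  obtains \<sigma> \<delta> :: real where "\<sigma> = 1 \<or> \<sigma> = -1" "\<delta> > 0" "\<And>t. 0 \<le> t \<Longrightarrow> t \<le> \<delta> \<Longrightarrow> x + (\<sigma> * t) *\<^sub>R h \<in> U"
proof -
  obtain Q W where Q: "half_dom X Q" "openin X W" "U = W \<inter> Q"
    using U unfolding mb_dom_def openin_subtopology by blast
  have xS: "x \<in> topspace X" using mb_dom_mem[OF U x] .
  have "x + h \<in> Q \<or> x - h \<in> Q" using Q x h by (auto simp: half_dom_def)
  then obtain \<sigma> :: real where \<sigma>: "\<sigma> = 1 \<or> \<sigma> = -1" "x + \<sigma> *\<^sub>R h \<in> Q" by (metis diff_conv_add_uminus scaleR_minus1_left scaleR_one)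
  have line: "x + (\<sigma> * t) *\<^sub>R h \<in> Q" if "0 \<le> t" "t \<le> 1" for t
  proof -
    have "(1 - t) *\<^sub>R x + t *\<^sub>R (x + \<sigma> *\<^sub>R h) \<in> Q"
      using Q x \<sigma>(2) that by (intro convexD) (auto simp: half_dom_def)
    then show ?thesis by (simp add: algebra_simps)
  qed
  have "open {t. x + t *\<^sub>R (\<sigma> *\<^sub>R h) \<in> W}"
    using open_line_preimage[OF X xS lcs_scale_mem[OF X h] Q(2)] by simp
  moreover have "0 \<in> {t. x + t *\<^sub>R (\<sigma> *\<^sub>R h) \<in> W}" using x Q by simp
  ultimately obtain e where e: "e > 0" "ball 0 e \<subseteq> {t. x + t *\<^sub>R (\<sigma> *\<^sub>R h) \<in> W}"
    using openE by blast
  show thesis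
  proof (rule that[OF \<sigma>(1)])
    show "min 1 (e / 2) > 0" using e by simp
    fix t assume t: "0 \<le> t" "t \<le> min 1 (e / 2)"
    then have "t \<in> ball 0 e" using e(1) by auto
    then have "x + t *\<^sub>R (\<sigma> *\<^sub>R h) \<in> W" using e(2) by blast
    then have "x + (\<sigma> * t) *\<^sub>R h \<in> W" by (simp add: mult.commute)
    then show "x + (\<sigma> * t) *\<^sub>R h \<in> U" using line[of t] t Q(3) by auto
  qed
qed

lemma dir_filter_nontrivial:
  assumes "lcs X" "mb_dom X U" "x \<in> U" "h \<in> topspace X"
  shows "at 0 within {t. x + t *\<^sub>R h \<in> U} \<noteq> bot"
proof -
  obtain \<sigma> \<delta> :: real where s: "\<sigma> = 1 \<or> \<sigma> = -1" "\<delta> > 0" "\<And>t. 0 \<le> t \<Longrightarrow> t \<le> \<delta> \<Longrightarrow> x + (\<sigma> * t) *\<^sub>R h \<in> U"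
    using mb_dom_direction[OF assms] by blast
  have "0 islimpt {t. x + t *\<^sub>R h \<in> U}"
    unfolding islimpt_approachable
  proof (intro allI impI)
    fix e :: real assume e: "e > 0"
    show "\<exists>t\<in>{t. x + t *\<^sub>R h \<in> U}. t \<noteq> 0 \<and> dist t 0 < e"
    proof (rule bexI)
      define r where "r = min \<delta> (e / 2)"
      have r: "0 < r" "r \<le> \<delta>" "r < e" using s(2) e by (auto simp: r_def)
      show "\<sigma> * r \<in> {t. x + t *\<^sub>R h \<in> U}" using s(3)[of r] r by simp
      show "\<sigma> * r \<noteq> 0 \<and> dist (\<sigma> * r) 0 < e" using s(1) r by auto
    qed
  qed
  then show ?thesis by (simp add: trivial_limit_within)
qed

lemma eventually_in_within: "eventually (\<lambda>t. t \<in> A) (at x within A)"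
  by (simp add: eventually_at_filter)

lemma eventually_not_at: "eventually (\<lambda>t. t \<noteq> x) (at x within A)"
  by (simp add: eventually_at_filter)

lemma has_dir_deriv_unique:
  assumes "lcs X" "Hausdorff_space Y" "mb_dom X U" "x \<in> U" "h \<in> topspace X"
    "has_dir_deriv Y U f x h l" "has_dir_deriv Y U f x h l'"
  shows "l = l'"
  using assms(6,7)[unfolded has_dir_deriv_def] dir_filter_nontrivial[OF assms(1,3,4,5)] assms(2)
  by (rule limitin_Hausdorff_unique)

lemma dir_deriv_eq:
  assumes "lcs X" "Hausdorff_space Y" "mb_dom X U" "x \<in> U" "h \<in> topspace X"
    "has_dir_deriv Y U f x h l"
  shows "dir_deriv Y U f x h = l"
  unfolding dir_deriv_def using has_dir_deriv_unique[OF assms(1-5)] assms(6) by blast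

lemma has_dir_deriv_cong_imp:
  assumes "x \<in> U" "\<And>y. y \<in> U \<Longrightarrow> f y = g y" "has_dir_deriv Y U f x h l"
  shows "has_dir_deriv Y U g x h l"
proof -
  have "\<forall>\<^sub>F t in at 0 within {t. x + t *\<^sub>R h \<in> U}.
      (1 / t) *\<^sub>R (f (x + t *\<^sub>R h) - f x) = (1 / t) *\<^sub>R (g (x + t *\<^sub>R h) - g x)"
    using eventually_in_within by eventually_elim (use assms(1,2) in auto)
  then show ?thesis using assms(3) unfolding has_dir_deriv_def by (rule limitin_transform_eventually)
qed

lemma has_dir_deriv_cong:
  assumes "x \<in> U" "\<And>y. y \<in> U \<Longrightarrow> f y = g y"
  shows "has_dir_deriv Y U f x h l = has_dir_deriv Y U g x h l"
proof
  show "has_dir_deriv Y U f x h l \<Longrightarrow> has_dir_deriv Y U g x h l"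
    by (rule has_dir_deriv_cong_imp[OF assms])
  show "has_dir_deriv Y U g x h l \<Longrightarrow> has_dir_deriv Y U f x h l"
    by (rule has_dir_deriv_cong_imp[of x U g f]) (simp_all add: assms)
qed

lemma dir_deriv_cong:
  assumes "x \<in> U" "\<And>y. y \<in> U \<Longrightarrow> f y = g y"
  shows "dir_deriv Y U f x h = dir_deriv Y U g x h"
proof -
  have "has_dir_deriv Y U f x h l = has_dir_deriv Y U g x h l" for l
    by (rule has_dir_deriv_cong[OF assms])
  then show ?thesis by (simp add: dir_deriv_def)
qed

lemma dir_filter_subset:
  assumes X: "lcs X" and U: "U \<subseteq> topspace X" and V: "openin (subtopology X U) V" and x: "x \<in> V" and h: "h \<in> topspace X"
  shows "at 0 within {t. x + t *\<^sub>R h \<in> V} = at (0::real) within {t. x + t *\<^sub>R h \<in> U}"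
proof -
  obtain W where W: "openin X W" "V = W \<inter> U" using V unfolding openin_subtopology by blast
  have "x \<in> topspace X" using U x W by auto
  then have "open {t. x + t *\<^sub>R h \<in> W}" using open_line_preimage[OF X _ h W(1)] by blast
  then show ?thesis
    by (intro at_within_nhd[of _ "{t. x + t *\<^sub>R h \<in> W}"]) (use W x in auto)
qed

lemma has_dir_deriv_subset:
  assumes "lcs X" "U \<subseteq> topspace X" "openin (subtopology X U) V" "x \<in> V" "h \<in> topspace X"
  shows "has_dir_deriv Y V f x h l = has_dir_deriv Y U f x h l"
    "dir_deriv Y V f x h = dir_deriv Y U f x h"
  unfolding dir_deriv_def has_dir_deriv_def by (simp_all only: dir_filter_subset[OF assms])

lemma limitin_compose_filterlim:
  "limitin Y f l F \<Longrightarrow> filterlim g F G \<Longrightarrow> limitin Y (\<lambda>t. f (g t)) l G"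
  unfolding limitin_def filterlim_iff by blast

lemma has_dir_deriv_mem: "has_dir_deriv Y U f x h l \<Longrightarrow> l \<in> topspace Y"
  by (simp add: has_dir_deriv_def limitin_def)

lemma has_dir_deriv_postlinear:
  assumes L: "linear L" "continuous_map Y Z L" and f: "has_dir_deriv Y U f x h l"
  shows "has_dir_deriv Z U (\<lambda>x. L (f x)) x h (L l)"
proof -
  have "limitin Z (L \<circ> (\<lambda>t. (1 / t) *\<^sub>R (f (x + t *\<^sub>R h) - f x))) (L l) (at 0 within {t. x + t *\<^sub>R h \<in> U})"
    using f unfolding has_dir_deriv_def by (rule continuous_map_limit[OF L(2)])
  then show ?thesis
    unfolding has_dir_deriv_def o_def by (simp add: linear_scale[OF L(1)] linear_diff[OF L(1)])
qed

lemma has_dir_deriv_pair: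
  assumes "has_dir_deriv Y U f x h l" "has_dir_deriv Z U g x h m"
  shows "has_dir_deriv (prod_topology Y Z) U (\<lambda>x. (f x, g x)) x h (l, m)"
  using assms unfolding has_dir_deriv_def limitin_pairwise by (simp add: o_def)

lemma has_dir_deriv_homogeneous:
  assumes Y: "lcs Y" and x: "x \<in> U" and f: "has_dir_deriv Y U f x h l"
  shows "has_dir_deriv Y U f x (c *\<^sub>R h) (c *\<^sub>R l)"
proof (cases "c = 0")
  case True
  then show ?thesis using lcs_zero[OF Y] by (simp add: has_dir_deriv_def)
next
  case False
  let ?A = "{t. x + t *\<^sub>R h \<in> U}" and ?B = "{t. x + t *\<^sub>R c *\<^sub>R h \<in> U}"
  have "filterlim (\<lambda>t. t * c) (at 0 within ?A) (at 0 within ?B)"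
    unfolding filterlim_at
  proof
    show "\<forall>\<^sub>F t in at 0 within ?B. t * c \<in> ?A \<and> t * c \<noteq> 0"
      using eventually_in_within eventually_not_at by eventually_elim (use False in auto)
    show "((\<lambda>t. t * c) \<longlongrightarrow> 0) (at 0 within ?B)" by (auto intro!: tendsto_eq_intros)
  qed
  with f have "limitin Y (\<lambda>t. (1 / (t * c)) *\<^sub>R (f (x + (t * c) *\<^sub>R h) - f x)) l (at 0 within ?B)"
    unfolding has_dir_deriv_def by (rule limitin_compose_filterlim)
  moreover have "continuous_map Y Y (\<lambda>y. c *\<^sub>R y)"
    by (intro continuous_map_lcs_scale[OF Y]) auto
  ultimately have "limitin Y ((\<lambda>y. c *\<^sub>R y) \<circ> (\<lambda>t. (1 / (t * c)) *\<^sub>R (f (x + (t * c) *\<^sub>R h) - f x))) (c *\<^sub>R l) (at 0 within ?B)"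
    by (rule continuous_map_limit[rotated])
  then show ?thesis using False unfolding has_dir_deriv_def by (simp add: o_def)
qed

text \<open>
  The mean value inequality. Near each point of the interval the definition of the derivative gives the
  bound with constant \<open>B + e\<close> on small subintervals containing that point; these are put together by
  subdivision. No integral is formed, so \<open>Y\<close> may be incomplete.
\<close>

lemma mean_value_real:
  fixes \<gamma> :: "real \<Rightarrow> 'b::real_vector"
  assumes Y: "lcs Y" and p: "cont_seminorm Y p"
    and m: "\<And>s. 0 \<le> s \<Longrightarrow> s \<le> 1 \<Longrightarrow> \<gamma> s \<in> topspace Y"
    and d: "\<And>s. 0 \<le> s \<Longrightarrow> s \<le> 1 \<Longrightarrow> \<exists>l. has_dir_deriv Y {0..1} \<gamma> s 1 l \<and> p l \<le> B"
  shows "p (\<gamma> 1 - \<gamma> 0) \<le> B"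
proof (rule field_le_epsilon)
  fix e :: real assume e: "e > 0"
  \<comment> \<open>The relation proved by subdivision; the slack \<open>e\<close> absorbs the error of the difference quotients.\<close>
  define P where "P = (\<lambda>a b. 0 \<le> a \<and> b \<le> 1 \<and> a \<le> b \<longrightarrow> p (\<gamma> b - \<gamma> a) \<le> (B + e) * (b - a))"
  have "P 0 1"
  proof (rule Bolzano)
    fix a b c assume "P a b" "P b c" "a \<le> b" "b \<le> c"
    moreover have "p (\<gamma> c - \<gamma> a) \<le> p (\<gamma> c - \<gamma> b) + p (\<gamma> b - \<gamma> a)" if "0 \<le> a" "c \<le> 1"
      using \<open>a \<le> b\<close> \<open>b \<le> c\<close> that by (intro seminorm_diff_triangle[OF Y p] m) auto
    ultimately show "P a c" unfolding P_def by (fastforce simp: algebra_simps)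
  next
    fix x :: real assume x: "0 \<le> x" "x \<le> 1"
    then obtain l where l: "has_dir_deriv Y {0..1} \<gamma> x 1 l" "p l \<le> B" using d by blast
    have "\<forall>\<^sub>F t in at 0 within {t. x + t *\<^sub>R 1 \<in> {0..1}}. p ((1 / t) *\<^sub>R (\<gamma> (x + t *\<^sub>R 1) - \<gamma> x) - l) < e"
      using l(1) p e unfolding has_dir_deriv_def limitin_seminorm[OF Y] by blast
    then obtain \<delta> where \<delta>: "\<delta> > 0"
      "\<And>t. x + t \<in> {0..1} \<Longrightarrow> t \<noteq> 0 \<Longrightarrow> \<bar>t\<bar> < \<delta> \<Longrightarrow> p ((1 / t) *\<^sub>R (\<gamma> (x + t) - \<gamma> x) - l) < e"
      unfolding eventually_at by auto
    have lm: "l \<in> topspace Y" using has_dir_deriv_mem[OF l(1)] .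
    have xm: "\<gamma> x \<in> topspace Y" using m x by auto
    have est: "p (\<gamma> (x + t) - \<gamma> x) \<le> (B + e) * \<bar>t\<bar>" if t: "0 \<le> x + t" "x + t \<le> 1" "\<bar>t\<bar> < \<delta>" for t
    proof (cases "t = 0")
      case True
      then show ?thesis using seminorm_zero[OF Y p] by simp
    next
      case False
      define q where "q = (1 / t) *\<^sub>R (\<gamma> (x + t) - \<gamma> x)"
      have dm: "\<gamma> (x + t) - \<gamma> x \<in> topspace Y" using m[OF t(1,2)] xm Y by (simp add: lcs_mem)
      have qm: "q \<in> topspace Y" unfolding q_def using dm Y by (simp add: lcs_mem)
      have "p q \<le> p (q - l) + p l"
        using seminorm_triangle[OF p, of "q - l" l] qm lm Y by (simp add: lcs_mem)
      also have "\<dots> \<le> B + e" using \<delta>(2)[of t] False t l(2) by (simp add: q_def)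
      finally have "\<bar>t\<bar> * p q \<le> (B + e) * \<bar>t\<bar>" by (simp add: mult.commute mult_left_mono)
      moreover have "p (t *\<^sub>R q) = \<bar>t\<bar> * p q" using seminorm_scale[OF p qm] .
      moreover have "t *\<^sub>R q = \<gamma> (x + t) - \<gamma> x" using False by (simp add: q_def)
      ultimately show ?thesis by simp
    qed
    show "\<exists>d>0. \<forall>a b. a \<le> x \<and> x \<le> b \<and> b - a < d \<longrightarrow> P a b"
    proof (intro exI conjI allI impI)
      show "\<delta> > 0" by fact
      fix a b assume ab: "a \<le> x \<and> x \<le> b \<and> b - a < \<delta>"
      show "P a b" unfolding P_def
      proof
        assume ab': "0 \<le> a \<and> b \<le> 1 \<and> a \<le> b"
        have "p (\<gamma> b - \<gamma> a) \<le> p (\<gamma> b - \<gamma> x) + p (\<gamma> x - \<gamma> a)"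
          using ab ab' x by (intro seminorm_diff_triangle[OF Y p] m) auto
        also have "p (\<gamma> x - \<gamma> a) = p (\<gamma> a - \<gamma> x)"
          using ab ab' x by (intro seminorm_commute[OF Y p] m) auto
        also have "p (\<gamma> b - \<gamma> x) \<le> (B + e) * (b - x)" using est[of "b - x"] ab ab' x by simp
        also have "p (\<gamma> a - \<gamma> x) \<le> (B + e) * (x - a)" using est[of "a - x"] ab ab' x by simp
        finally show "p (\<gamma> b - \<gamma> a) \<le> (B + e) * (b - a)" by (simp add: algebra_simps)
      qed
    qed
  qed simp
  then show "p (\<gamma> 1 - \<gamma> 0) \<le> B + e" by (simp add: P_def)
qed

text \<open>
  Subtracting \<open>s *\<^sub>R l\<close> from the curve \<open>s \<mapsto> g (y + s *\<^sub>R k)\<close> makes the inequality compare an increment of \<open>g\<close>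
  with a prescribed linear approximation.
\<close>

lemma mean_value_segment:
  assumes Y: "lcs Y" and p: "cont_seminorm Y p"
    and gm: "\<And>s. 0 \<le> s \<Longrightarrow> s \<le> 1 \<Longrightarrow> g (y + s *\<^sub>R k) \<in> topspace Y"
    and g: "\<And>s. 0 \<le> s \<Longrightarrow> s \<le> 1 \<Longrightarrow> has_dir_deriv Y U g (y + s *\<^sub>R k) k (d s)"
    and seg: "\<And>s. 0 \<le> s \<Longrightarrow> s \<le> 1 \<Longrightarrow> y + s *\<^sub>R k \<in> U"
    and l: "l \<in> topspace Y"
    and B: "\<And>s. 0 \<le> s \<Longrightarrow> s \<le> 1 \<Longrightarrow> p (d s - l) \<le> B"
  shows "p (g (y + k) - g y - l) \<le> B"
proof -
  define \<gamma> where "\<gamma> = (\<lambda>s. g (y + s *\<^sub>R k) - s *\<^sub>R l)"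
  have "p (\<gamma> 1 - \<gamma> 0) \<le> B"
  proof (rule mean_value_real[OF Y p])
    fix s :: real assume s: "0 \<le> s" "s \<le> 1"
    then show "\<gamma> s \<in> topspace Y" using gm l Y by (simp add: \<gamma>_def lcs_mem)
    let ?A = "{t. s + t *\<^sub>R 1 \<in> {0..1}}" and ?B = "{t. y + s *\<^sub>R k + t *\<^sub>R k \<in> U}"
    have "?A \<subseteq> ?B"
    proof safe
      fix t assume "s + t *\<^sub>R 1 \<in> {0..1::real}"
      then show "y + s *\<^sub>R k + t *\<^sub>R k \<in> U" using seg[of "s + t"] by (simp add: scaleR_add_left add.assoc)
    qed
    then have le: "at 0 within ?A \<le> at 0 within ?B" by (rule at_le)
    have "limitin Y (\<lambda>t. (1 / t) *\<^sub>R (g (y + s *\<^sub>R k + t *\<^sub>R k) - g (y + s *\<^sub>R k))) (d s) (at 0 within ?A)"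
      using g[OF s] unfolding has_dir_deriv_def limitin_def using filter_leD[OF le] by blast
    moreover have "continuous_map Y Y (\<lambda>z. z - l)"
      using l by (intro continuous_map_lcs_diff[OF Y]) auto
    ultimately have lim: "limitin Y ((\<lambda>z. z - l) \<circ> (\<lambda>t. (1 / t) *\<^sub>R (g (y + s *\<^sub>R k + t *\<^sub>R k) - g (y + s *\<^sub>R k)))) (d s - l) (at 0 within ?A)"
      by (rule continuous_map_limit[rotated])
    have ev: "\<forall>\<^sub>F t in at 0 within ?A. ((\<lambda>z. z - l) \<circ> (\<lambda>t. (1 / t) *\<^sub>R (g (y + s *\<^sub>R k + t *\<^sub>R k) - g (y + s *\<^sub>R k)))) t
        = (1 / t) *\<^sub>R (\<gamma> (s + t *\<^sub>R 1) - \<gamma> s)"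
      using eventually_not_at
    proof eventually_elim
      case (elim t)
      have "\<gamma> (s + t *\<^sub>R 1) - \<gamma> s = (g (y + s *\<^sub>R k + t *\<^sub>R k) - g (y + s *\<^sub>R k)) - t *\<^sub>R l"
        by (simp add: \<gamma>_def scaleR_add_left add.assoc)
      then show ?case using elim by (simp add: scaleR_diff_right)
    qed
    have "has_dir_deriv Y {0..1} \<gamma> s 1 (d s - l)"
      unfolding has_dir_deriv_def using ev lim by (rule limitin_transform_eventually)
    then show "\<exists>l. has_dir_deriv Y {0..1} \<gamma> s 1 l \<and> p l \<le> B" using B[OF s] by blast
  qed
  moreover have "\<gamma> 1 - \<gamma> 0 = g (y + k) - g y - l" by (simp add: \<gamma>_def)
  ultimately show ?thesis by simp
qed

text \<open>
  Class \<open>C\<^sup>1\<close> with a named derivative, for arbitrary vector spaces: the derivative is a function of two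
  variables, whereas \<open>C1_on\<close> encodes point and direction in one sequence.
\<close>

definition C1map :: "'a::real_vector topology \<Rightarrow> 'a set \<Rightarrow> 'b::real_vector topology \<Rightarrow> ('a \<Rightarrow> 'b) \<Rightarrow> ('a \<Rightarrow> 'a \<Rightarrow> 'b) \<Rightarrow> bool" where
  "C1map X U Y f df \<longleftrightarrow> continuous_map (subtopology X U) Y f \<and>
     (\<forall>x\<in>U. \<forall>h\<in>topspace X. has_dir_deriv Y U f x h (df x h)) \<and>
     continuous_map (subtopology (prod_topology X X) (U \<times> topspace X)) Y (\<lambda>(x, h). df x h)"

text \<open>
  The chain rule. With \<open>q t\<close> the difference quotient of \<open>f\<close> and \<open>y = f x\<close>, the increment of \<open>g\<close> along the
  segment from \<open>y\<close> to \<open>y + t *\<^sub>R q t\<close> is compared with \<open>t *\<^sub>R dg y l\<close> by the mean value inequality; the two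
  are close because \<open>dg\<close> is jointly continuous and \<open>q t\<close> tends to \<open>l\<close>.
\<close>

lemma has_dir_deriv_compose:
  assumes Y: "lcs Y" and Z: "lcs Z" and V: "mb_dom Y V" and g: "C1map Y V Z g dg"
    and fU: "f ` U \<subseteq> V" and x: "x \<in> U" and f: "has_dir_deriv Y U f x h l"
  shows "has_dir_deriv Z U (\<lambda>x. g (f x)) x h (dg (f x) l)"
  unfolding has_dir_deriv_def limitin_seminorm[OF Z]
proof (intro conjI allI impI)
  define y where "y = f x"
  let ?F = "at 0 within {t. x + t *\<^sub>R h \<in> U}"
  define q where "q = (\<lambda>t. (1 / t) *\<^sub>R (f (x + t *\<^sub>R h) - f x))"
  have y: "y \<in> V" "y \<in> topspace Y" using fU x mb_dom_mem[OF V] by (auto simp: y_def)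
  have l: "l \<in> topspace Y" by (rule has_dir_deriv_mem[OF f])
  have ql: "limitin Y q l ?F" using f by (simp add: has_dir_deriv_def q_def)
  have gder: "has_dir_deriv Z V g y' k (dg y' k)" if "y' \<in> V" "k \<in> topspace Y" for y' k
    using g that by (simp add: C1map_def)
  have gm: "g y' \<in> topspace Z" if "y' \<in> V" for y'
    using g that mb_dom_mem[OF V that] unfolding C1map_def continuous_map_def by auto
  have dgm: "dg y' k \<in> topspace Z" if "y' \<in> V" "k \<in> topspace Y" for y' k
    using has_dir_deriv_mem[OF gder[OF that]] .
  have hom: "dg y' (t *\<^sub>R k) = t *\<^sub>R dg y' k" if "y' \<in> V" "k \<in> topspace Y" for y' k t
    using has_dir_deriv_unique[OF Y lcs_Hausdorff[OF Z] V that(1) lcs_scale_mem[OF Y that(2)] gder[OF that(1) lcs_scale_mem[OF Y that(2)]]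
      has_dir_deriv_homogeneous[OF Z that(1) gder[OF that]]] .
  show "dg (f x) l \<in> topspace Z" using dgm y l by (simp add: y_def)
  show "\<forall>\<^sub>F t in ?F. (1 / t) *\<^sub>R (g (f (x + t *\<^sub>R h)) - g (f x)) \<in> topspace Z"
    using eventually_in_within
  proof eventually_elim
    case (elim t)
    then have "f (x + t *\<^sub>R h) \<in> V" using fU by blast
    then show ?case using gm y(1) Z by (simp add: y_def lcs_mem)
  qed
  fix p and e :: real assume p: "cont_seminorm Z p" and e: "0 < e"
  have "continuous_map (subtopology (prod_topology Y Y) (V \<times> topspace Y)) Z (\<lambda>(x, h). dg x h)"
    using g by (simp add: C1map_def)
  moreover have "(y, l) \<in> topspace (subtopology (prod_topology Y Y) (V \<times> topspace Y))" using y l by simp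
  moreover have "0 < e / 2" using e by simp
  ultimately obtain N where N: "openin (subtopology (prod_topology Y Y) (V \<times> topspace Y)) N" "(y, l) \<in> N"
      "\<forall>z\<in>N. p ((\<lambda>(x, h). dg x h) z - dg y l) < e / 2"
    unfolding continuous_map_seminorm[OF Z] using p by (metis (mono_tags, lifting) case_prod_conv)
  obtain N' where N': "openin (prod_topology Y Y) N'" "N = N' \<inter> V \<times> topspace Y"
    using N(1) unfolding openin_subtopology by blast
  have "(y, l) \<in> N'" using N N' by blast
  with N'(1) have "\<exists>A B. openin Y A \<and> openin Y B \<and> y \<in> A \<and> l \<in> B \<and> A \<times> B \<subseteq> N'"
    unfolding openin_prod_topology_alt by blast
  then obtain A B where AB: "openin Y A" "openin Y B" "y \<in> A" "l \<in> B" "A \<times> B \<subseteq> N'" by metis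
  have dgAB: "p (dg y' k - dg y l) < e / 2" if "y' \<in> A" "y' \<in> V" "k \<in> B" for y' k
  proof -
    have "k \<in> topspace Y" using openin_subset[OF AB(2)] that by blast
    then have "(y', k) \<in> N" using AB(5) N'(2) that by blast
    then show ?thesis using N(3) by fastforce
  qed
  have "openin (subtopology Y V) (A \<inter> V)" using AB(1) unfolding openin_subtopology by blast
  then obtain C where C: "openin (subtopology Y V) C" "convex C" "y \<in> C" "C \<subseteq> A \<inter> V"
    using mb_dom_local_convex[OF Y V, of "A \<inter> V" y] AB(3) y(1) by blast
  obtain W where W: "openin Y W" "C = W \<inter> V" using C(1) unfolding openin_subtopology by blast
  \<comment> \<open>For small \<open>t\<close> the end point \<open>y + t *\<^sub>R q t = f (x + t *\<^sub>R h)\<close> lies in \<open>C\<close>, hence by convexity so does the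
    whole segment from \<open>y\<close>, on which \<open>dg\<close> in direction \<open>q t\<close> is close to \<open>dg y l\<close>.\<close>
  have evB: "\<forall>\<^sub>F t in ?F. q t \<in> B" using limitinD[OF ql AB(2) AB(4)] .
  have lq: "limitin (prod_topology euclideanreal Y) (\<lambda>t. (t, q t)) (0, l) ?F"
    using ql unfolding limitin_pairwise by (simp add: o_def)
  have cq: "continuous_map (prod_topology euclideanreal Y) Y (\<lambda>z. y + fst z *\<^sub>R snd z)"
    using y(2) by (intro continuous_map_lcs_add[OF Y] continuous_map_lcs_scale[OF Y] continuous_map_fst continuous_map_snd) auto
  have "limitin Y (\<lambda>t. y + t *\<^sub>R q t) y ?F"
    using continuous_map_limit[OF cq lq] by (simp add: o_def)
  then have evW: "\<forall>\<^sub>F t in ?F. y + t *\<^sub>R q t \<in> W" by (rule limitinD) (use W C in auto)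
  show "\<forall>\<^sub>F t in ?F. p ((1 / t) *\<^sub>R (g (f (x + t *\<^sub>R h)) - g (f x)) - dg (f x) l) < e"
    using evB evW eventually_in_within eventually_not_at
  proof eventually_elim
    case (elim t)
    define k where "k = t *\<^sub>R q t"
    have qm: "q t \<in> topspace Y" using openin_subset[OF AB(2)] elim by blast
    have yk: "y + k = f (x + t *\<^sub>R h)" using elim by (simp add: k_def q_def y_def)
    have "f (x + t *\<^sub>R h) \<in> V" using elim(3) fU by blast
    then have ykV: "y + k \<in> V" by (simp only: yk)
    moreover have "y + k \<in> W" using elim(2) by (simp only: k_def)
    ultimately have "y + k \<in> C" unfolding W(2) by blast
    then have seg: "y + s *\<^sub>R k \<in> C" if "0 \<le> s" "s \<le> 1" for s
    proof -
      have "(1 - s) *\<^sub>R y + s *\<^sub>R (y + k) \<in> C" using C \<open>y + k \<in> C\<close> that by (intro convexD) auto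
      then show ?thesis by (simp add: algebra_simps)
    qed
    have km: "k \<in> topspace Y" using qm Y by (simp add: k_def lcs_mem)
    have le: "p (g (y + k) - g y - t *\<^sub>R dg y l) \<le> \<bar>t\<bar> * (e / 2)"
    proof (rule mean_value_segment[OF Z p, where U = V and d = "\<lambda>s. dg (y + s *\<^sub>R k) k"])
      fix s :: real assume s: "0 \<le> s" "s \<le> 1"
      have sV: "y + s *\<^sub>R k \<in> V" "y + s *\<^sub>R k \<in> A" using seg[OF s] C by auto
      show "g (y + s *\<^sub>R k) \<in> topspace Z" using gm sV by blast
      show "y + s *\<^sub>R k \<in> V" by (fact sV)
      show "has_dir_deriv Z V g (y + s *\<^sub>R k) k (dg (y + s *\<^sub>R k) k)" using gder sV km by blast
      have "dg (y + s *\<^sub>R k) k - t *\<^sub>R dg y l = t *\<^sub>R (dg (y + s *\<^sub>R k) (q t) - dg y l)"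
        using hom[OF sV(1) qm] by (simp add: k_def scaleR_diff_right)
      moreover have "p (t *\<^sub>R (dg (y + s *\<^sub>R k) (q t) - dg y l)) = \<bar>t\<bar> * p (dg (y + s *\<^sub>R k) (q t) - dg y l)"
        using dgm[OF sV(1) qm] dgm[OF y(1) l] Z by (intro seminorm_scale[OF p]) (simp add: lcs_mem)
      ultimately show "p (dg (y + s *\<^sub>R k) k - t *\<^sub>R dg y l) \<le> \<bar>t\<bar> * (e / 2)"
        using dgAB[OF sV(2,1), of "q t"] elim by (simp add: mult_left_mono)
    qed (use dgm[OF y(1) l] Z in \<open>simp add: lcs_mem\<close>)
    have rm: "g (y + k) - g y - t *\<^sub>R dg y l \<in> topspace Z"
      by (intro lcs_diff_mem[OF Z] lcs_scale_mem[OF Z] gm[OF ykV] gm[OF y(1)] dgm[OF y(1) l])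
    have "(1 / t) *\<^sub>R (g (f (x + t *\<^sub>R h)) - g (f x)) - dg (f x) l = (1 / t) *\<^sub>R (g (y + k) - g y - t *\<^sub>R dg y l)"
      using elim yk by (simp add: y_def scaleR_diff_right)
    then have "p ((1 / t) *\<^sub>R (g (f (x + t *\<^sub>R h)) - g (f x)) - dg (f x) l) = \<bar>1 / t\<bar> * p (g (y + k) - g y - t *\<^sub>R dg y l)"
      using seminorm_scale[OF p rm] by (simp only:)
    also have "\<dots> \<le> \<bar>1 / t\<bar> * (\<bar>t\<bar> * (e / 2))" using le by (intro mult_left_mono) simp_all
    also have "\<bar>1 / t\<bar> * (\<bar>t\<bar> * (e / 2)) = e / 2" using elim(4) by simp
    also have "e / 2 < e" using e by simp
    finally show ?case .
  qed
qed

lemma continuous_map_compose': "continuous_map T X f \<Longrightarrow> continuous_map X Y g \<Longrightarrow> continuous_map T Y (\<lambda>z. g (f z))"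
  using continuous_map_compose[of T X f Y g] by (simp add: o_def)

lemma continuous_map_fst_sub: "continuous_map (subtopology (prod_topology X Z) (U \<times> W)) (subtopology X U) fst"
  by (auto simp: continuous_map_in_subtopology intro!: continuous_map_from_subtopology continuous_map_fst)

lemma continuous_map_snd_sub: "continuous_map (subtopology (prod_topology X Z) (U \<times> W)) (subtopology Z W) snd"
  by (auto simp: continuous_map_in_subtopology intro!: continuous_map_from_subtopology continuous_map_snd)

lemma continuous_map_seq_fst_sub: "continuous_map (subtopology (seq_square X) (seq_times U W)) (subtopology X U) seq_fst"
  by (auto simp: continuous_map_in_subtopology seq_times_def intro!: continuous_map_from_subtopology continuous_map_seq_fst)

lemma continuous_map_local:
  assumes "\<And>x. x \<in> topspace T \<Longrightarrow> \<exists>N. openin T N \<and> x \<in> N \<and> continuous_map (subtopology T N) Y f"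
  shows "continuous_map T Y f"
  unfolding continuous_map_def
proof safe
  fix x assume x: "x \<in> topspace T"
  then obtain N where N: "openin T N" "x \<in> N" "continuous_map (subtopology T N) Y f" using assms by blast
  then show "f x \<in> topspace Y" using x by (auto simp: continuous_map_def)
next
  fix W assume W: "openin Y W"
  show "openin T {x \<in> topspace T. f x \<in> W}"
  proof (subst openin_subopen, safe)
    fix x assume x: "x \<in> topspace T" "f x \<in> W"
    then obtain N where N: "openin T N" "x \<in> N" "continuous_map (subtopology T N) Y f" using assms by blast
    have "openin (subtopology T N) {z \<in> topspace (subtopology T N). f z \<in> W}"
      by (rule openin_preimage[OF N(3) W])
    then have "openin T {z \<in> topspace (subtopology T N). f z \<in> W}"
      using N(1) openin_trans_full by blast
    then show "\<exists>S. openin T S \<and> x \<in> S \<and> S \<subseteq> {x \<in> topspace T. f x \<in> W}"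
      using N x by (intro exI[of _ "{z \<in> topspace (subtopology T N). f z \<in> W}"]) auto
  qed
qed

section \<open>Maps of class \<open>C\<^sup>1\<close>\<close>

lemma C1map_mem: "C1map X U Y f df \<Longrightarrow> mb_dom X U \<Longrightarrow> x \<in> U \<Longrightarrow> f x \<in> topspace Y"
  using mb_dom_mem unfolding C1map_def continuous_map_def by fastforce

lemma C1map_has: "C1map X U Y f df \<Longrightarrow> x \<in> U \<Longrightarrow> h \<in> topspace X \<Longrightarrow> has_dir_deriv Y U f x h (df x h)"
  by (simp add: C1map_def)

lemma C1map_deriv_eq:
  assumes "lcs X" "lcs Y" "mb_dom X U" "C1map X U Y f df" "x \<in> U" "h \<in> topspace X"
  shows "dir_deriv Y U f x h = df x h"
  using dir_deriv_eq[OF assms(1) lcs_Hausdorff[OF assms(2)] assms(3,5,6) C1map_has[OF assms(4-6)]] .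

lemma C1map_deriv_mem: "C1map X U Y f df \<Longrightarrow> x \<in> U \<Longrightarrow> h \<in> topspace X \<Longrightarrow> df x h \<in> topspace Y"
  using C1map_has has_dir_deriv_mem by metis

text \<open>
  Pairs and interleaved sequences carry the same topology.
\<close>

lemma continuous_deriv_seq_iff:
  "continuous_map (subtopology (prod_topology X X) (U \<times> topspace X)) Y (\<lambda>(x, h). df x h) \<longleftrightarrow>
   continuous_map (subtopology (seq_square X) (seq_times U (topspace X))) Y (\<lambda>z. df (seq_fst z) (seq_snd z))"
  (is "?L \<longleftrightarrow> ?R")
proof
  assume L: ?L
  have "continuous_map (subtopology (seq_square X) (seq_times U (topspace X)))
     (subtopology (prod_topology X X) (U \<times> topspace X)) (\<lambda>z. (seq_fst z, seq_snd z))"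
    by (auto simp: continuous_map_in_subtopology seq_times_def continuous_map_paired
        intro!: continuous_map_from_subtopology continuous_map_seq_fst continuous_map_seq_snd)
  from continuous_map_compose'[OF this L] show ?R by simp
next
  assume R: ?R
  have "continuous_map (subtopology (prod_topology X X) (U \<times> topspace X))
     (subtopology (seq_square X) (seq_times U (topspace X))) (\<lambda>z. seq_pair (fst z) (snd z))"
    by (auto simp: continuous_map_in_subtopology seq_times_def
        intro!: continuous_map_from_subtopology continuous_map_seq_pair continuous_map_fst continuous_map_snd)
  from continuous_map_compose'[OF this R] show ?L by (simp add: case_prod_unfold)
qed

lemma C1_on_iff:
  assumes "lcs X" "lcs Y" "mb_dom X U"
  shows "C1_on X U Y f \<longleftrightarrow> C1map X U Y f (dir_deriv Y U f)"
proof -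
  have "(\<exists>l. has_dir_deriv Y U f x h l) \<longleftrightarrow> has_dir_deriv Y U f x h (dir_deriv Y U f x h)"
    if "x \<in> U" "h \<in> topspace X" for x h
    using dir_deriv_eq[OF assms(1) lcs_Hausdorff[OF assms(2)] assms(3) that] by metis
  then show ?thesis
    unfolding C1_on_def C1map_def continuous_deriv_seq_iff seq_deriv_def[abs_def] by blast
qed

lemma C1map_cong:
  assumes f: "C1map X U Y f df" and eq: "\<And>x. x \<in> U \<Longrightarrow> f x = g x" and deq: "\<And>x h. x \<in> U \<Longrightarrow> h \<in> topspace X \<Longrightarrow> df x h = dg x h"
  shows "C1map X U Y g dg"
  unfolding C1map_def
proof (intro conjI ballI)
  show "continuous_map (subtopology X U) Y g"
    using f unfolding C1map_def by (auto intro: continuous_map_eq simp: eq)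
  show "has_dir_deriv Y U g x h (dg x h)" if "x \<in> U" "h \<in> topspace X" for x h
    using C1map_has[OF f that] has_dir_deriv_cong[of x U f g] eq that deq by simp
  show "continuous_map (subtopology (prod_topology X X) (U \<times> topspace X)) Y (\<lambda>(x, h). dg x h)"
    using f unfolding C1map_def by (auto intro: continuous_map_eq simp: deq)
qed

lemma C1map_linear:
  assumes U: "U \<subseteq> topspace X" and L: "linear L" "continuous_map X Y L"
  shows "C1map X U Y L (\<lambda>x h. L h)"
  unfolding C1map_def
proof (intro conjI ballI)
  show "continuous_map (subtopology X U) Y L" using L(2) by (rule continuous_map_from_subtopology)
  fix x h assume xh: "x \<in> U" "h \<in> topspace X"
  have "L h \<in> topspace Y" using L(2) xh(2) by (auto simp: continuous_map_def)
  moreover have "\<forall>\<^sub>F t in at 0 within {t. x + t *\<^sub>R h \<in> U}. (1 / t) *\<^sub>R (L (x + t *\<^sub>R h) - L x) = L h"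
    using eventually_not_at
    by eventually_elim (simp add: linear_add[OF L(1)] linear_scale[OF L(1)])
  ultimately show "has_dir_deriv Y U L x h (L h)"
    unfolding has_dir_deriv_def by (rule limitin_eventually)
next
  show "continuous_map (subtopology (prod_topology X X) (U \<times> topspace X)) Y (\<lambda>(x, h). L h)"
    unfolding case_prod_unfold
    by (intro continuous_map_from_subtopology continuous_map_compose'[OF continuous_map_snd L(2)])
qed

lemma C1map_const:
  assumes "lcs Y" "c \<in> topspace Y"
  shows "C1map X U Y (\<lambda>x. c) (\<lambda>x h. 0)"
  unfolding C1map_def has_dir_deriv_def case_prod_unfold using assms lcs_zero by auto

lemma C1map_pair:
  assumes "C1map X U Y f df" "C1map X U Z g dg"
  shows "C1map X U (prod_topology Y Z) (\<lambda>x. (f x, g x)) (\<lambda>x h. (df x h, dg x h))"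
  using assms unfolding C1map_def case_prod_unfold
  by (intro conjI ballI continuous_map_pairedI has_dir_deriv_pair) blast+

lemma C1map_compose:
  assumes X: "lcs X" and Y: "lcs Y" and Z: "lcs Z" and U: "mb_dom X U" and V: "mb_dom Y V"
    and f: "C1map X U Y f df" and g: "C1map Y V Z g dg" and fU: "f ` U \<subseteq> V"
  shows "C1map X U Z (\<lambda>x. g (f x)) (\<lambda>x h. dg (f x) (df x h))"
  unfolding C1map_def
proof (intro conjI ballI)
  have fc: "continuous_map (subtopology X U) (subtopology Y V) f"
    using f fU by (auto simp: C1map_def continuous_map_in_subtopology)
  then show "continuous_map (subtopology X U) Z (\<lambda>x. g (f x))"
    using g by (auto simp: C1map_def intro: continuous_map_compose')
  show "has_dir_deriv Z U (\<lambda>x. g (f x)) x h (dg (f x) (df x h))" if "x \<in> U" "h \<in> topspace X" for x h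
    by (rule has_dir_deriv_compose[OF Y Z V g fU that(1) C1map_has[OF f that]])
  let ?P = "subtopology (prod_topology X X) (U \<times> topspace X)"
  have 1: "continuous_map ?P (subtopology Y V) (\<lambda>z. f (fst z))"
    by (rule continuous_map_compose'[OF continuous_map_fst_sub fc])
  have 2: "continuous_map ?P Y (\<lambda>z. df (fst z) (snd z))"
    using f by (simp add: C1map_def case_prod_unfold)
  have "continuous_map ?P (subtopology (prod_topology Y Y) (V \<times> topspace Y)) (\<lambda>z. (f (fst z), df (fst z) (snd z)))"
    unfolding continuous_map_in_subtopology
  proof
    show "continuous_map ?P (prod_topology Y Y) (\<lambda>z. (f (fst z), df (fst z) (snd z)))"
      using 1 2 by (intro continuous_map_pairedI) (auto simp: continuous_map_in_subtopology)
    show "(\<lambda>z. (f (fst z), df (fst z) (snd z))) \<in> topspace ?P \<rightarrow> V \<times> topspace Y"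
      using fU C1map_deriv_mem[OF f] by auto
  qed
  moreover have "continuous_map (subtopology (prod_topology Y Y) (V \<times> topspace Y)) Z (\<lambda>z. dg (fst z) (snd z))"
    using g by (simp add: C1map_def case_prod_unfold)
  ultimately have "continuous_map ?P Z (\<lambda>z. dg (fst (f (fst z), df (fst z) (snd z))) (snd (f (fst z), df (fst z) (snd z))))"
    by (rule continuous_map_compose')
  then show "continuous_map ?P Z (\<lambda>(x, h). dg (f x) (df x h))"
    by (simp add: case_prod_unfold)
qed

lemma C1map_postlinear:
  assumes f: "C1map X U Y f df" and L: "linear L" "continuous_map Y Z L"
  shows "C1map X U Z (\<lambda>x. L (f x)) (\<lambda>x h. L (df x h))"
  using f unfolding C1map_def case_prod_unfold
  by (intro conjI ballI continuous_map_compose'[OF _ L(2)] has_dir_deriv_postlinear[OF L]) blast+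

section \<open>Calculus of the classes \<open>C\<^sup>n\<close>\<close>

lemma half_dom_seq_times: "half_dom X Q \<Longrightarrow> lcs X \<Longrightarrow> half_dom (seq_square X) (seq_times Q (topspace X))"
  unfolding half_dom_def
proof (intro conjI ballI)
  assume Q: "Q \<subseteq> topspace X \<and> convex Q \<and> (\<forall>x\<in>Q. \<forall>h\<in>topspace X. x + h \<in> Q \<or> x - h \<in> Q)" and X: "lcs X"
  show "seq_times Q (topspace X) \<subseteq> topspace (seq_square X)" using Q by (auto simp: seq_times_def)
  have "convex (seq_fst -` Q \<inter> seq_snd -` topspace X)"
    using Q by (intro convex_Int convex_linear_vimage linear_seq_fst linear_seq_snd lcs_convex[OF X]) auto
  then show "convex (seq_times Q (topspace X))" by (simp add: seq_times_def vimage_def Int_def)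
  fix x h assume xh: "x \<in> seq_times Q (topspace X)" "h \<in> topspace (seq_square X)"
  then have "seq_fst x + seq_fst h \<in> Q \<or> seq_fst x - seq_fst h \<in> Q" using Q by (auto simp: seq_times_def)
  then show "x + h \<in> seq_times Q (topspace X) \<or> x - h \<in> seq_times Q (topspace X)"
    using xh X by (auto simp: seq_times_def seq_fst_add seq_snd_add linear_diff[OF linear_seq_fst] linear_diff[OF linear_seq_snd] lcs_mem)
qed

lemma openin_seq_times:
  assumes "openin (subtopology X U) V"
  shows "openin (subtopology (seq_square X) (seq_times U (topspace X))) (seq_times V (topspace X))"
proof -
  have V: "V \<subseteq> topspace X \<inter> U" using openin_subset[OF assms] by simp
  have "openin (subtopology (seq_square X) (seq_times U (topspace X)))
     {z \<in> topspace (subtopology (seq_square X) (seq_times U (topspace X))). seq_fst z \<in> V}"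
    by (rule openin_preimage[OF continuous_map_seq_fst_sub assms])
  moreover have "{z \<in> topspace (subtopology (seq_square X) (seq_times U (topspace X))). seq_fst z \<in> V} = seq_times V (topspace X)"
    using V by (auto simp: seq_times_def)
  ultimately show ?thesis by simp
qed

lemma mb_dom_seq_square: "lcs X \<Longrightarrow> mb_dom X U \<Longrightarrow> mb_dom (seq_square X) (seq_times U (topspace X))"
  unfolding mb_dom_def using half_dom_seq_times openin_seq_times by blast

lemma Cn_on_cong:
  assumes "Cn_on n X U Y f" "\<And>x. x \<in> U \<Longrightarrow> f x = g x"
  shows "Cn_on n X U Y g"
  using assms
proof (induction n arbitrary: X U f g)
  case 0
  then show ?case by (auto intro: continuous_map_eq)
next
  case (Suc n)
  have eq: "seq_deriv Y U f z = seq_deriv Y U g z" if "z \<in> seq_times U (topspace X)" for z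
    using dir_deriv_cong[of "seq_fst z" U f g] Suc.prems(2) that by (simp add: seq_deriv_def seq_times_def)
  have "C1_on X U Y g"
    unfolding C1_on_def
  proof (intro conjI ballI)
    show "continuous_map (subtopology X U) Y g"
      using Suc.prems by (auto simp: C1_on_def intro: continuous_map_eq)
    show "\<exists>l. has_dir_deriv Y U g x h l" if "x \<in> U" "h \<in> topspace X" for x h
    proof -
      have "\<forall>x\<in>U. \<forall>h\<in>topspace X. \<exists>l. has_dir_deriv Y U f x h l"
        using Suc.prems(1) by (simp add: C1_on_def)
      with that obtain l where "has_dir_deriv Y U f x h l" by metis
      then have "has_dir_deriv Y U g x h l"
        by (rule has_dir_deriv_cong_imp[rotated 2]) (use that Suc.prems(2) in blast)+
      then show ?thesis by blast
    qed
    show "continuous_map (subtopology (seq_square X) (seq_times U (topspace X))) Y (seq_deriv Y U g)"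
      using Suc.prems(1) eq by (auto simp: C1_on_def intro: continuous_map_eq)
  qed
  moreover have "Cn_on n (seq_square X) (seq_times U (topspace X)) Y (seq_deriv Y U g)"
    using Suc.IH[of "seq_square X" "seq_times U (topspace X)" "seq_deriv Y U f" "seq_deriv Y U g"] Suc.prems(1) eq by simp
  ultimately show ?case by simp
qed

lemma Cn_on_SucI:
  assumes "lcs X" "lcs Y" "mb_dom X U" "C1map X U Y f df"
    "Cn_on n (seq_square X) (seq_times U (topspace X)) Y (\<lambda>z. df (seq_fst z) (seq_snd z))"
  shows "Cn_on (Suc n) X U Y f"
proof -
  have "C1map X U Y f (dir_deriv Y U f)"
    using C1map_cong[OF assms(4), of f] C1map_deriv_eq[OF assms(1-4)] by simp
  moreover have "Cn_on n (seq_square X) (seq_times U (topspace X)) Y (seq_deriv Y U f)"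
    by (rule Cn_on_cong[OF assms(5)]) (use C1map_deriv_eq[OF assms(1-4)] in \<open>auto simp: seq_deriv_def seq_times_def\<close>)
  ultimately show ?thesis using C1_on_iff[OF assms(1-3)] by simp
qed

lemma Cn_on_SucD:
  assumes "lcs X" "lcs Y" "mb_dom X U" "Cn_on (Suc n) X U Y f"
  shows "C1map X U Y f (dir_deriv Y U f)"
    "Cn_on n (seq_square X) (seq_times U (topspace X)) Y (\<lambda>z. dir_deriv Y U f (seq_fst z) (seq_snd z))"
  using C1_on_iff[OF assms(1-3)] assms(4) by (simp_all add: seq_deriv_def[abs_def])

lemma Cn_on_mono: "Cn_on (Suc n) X U Y f \<Longrightarrow> Cn_on n X U Y f"
proof (induction n arbitrary: X U f)
  case 0
  then show ?case by (simp add: C1_on_def)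
next
  case (Suc n)
  then show ?case using Suc.IH by (metis Cn_on.simps(2))
qed

lemma Cn_on_continuous: "Cn_on n X U Y f \<Longrightarrow> continuous_map (subtopology X U) Y f"
  by (cases n) (auto simp: C1_on_def)

lemma Cn_on_linear:
  assumes "lcs X" "lcs Y" "mb_dom X U" "linear L" "continuous_map X Y L"
  shows "Cn_on n X U Y L"
  using assms
proof (induction n arbitrary: X U L)
  case 0
  then show ?case by (simp add: continuous_map_from_subtopology)
next
  case (Suc n)
  have "Cn_on n (seq_square X) (seq_times U (topspace X)) Y (\<lambda>z. L (seq_snd z))"
    using Suc.prems by (intro Suc.IH lcs_seq_square mb_dom_seq_square linear_compose[OF linear_seq_snd, unfolded o_def]
      continuous_map_compose'[OF continuous_map_seq_snd])
  then show ?case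
    using Suc.prems C1map_linear[OF mb_dom_subset] by (intro Cn_on_SucI[where df = "\<lambda>x h. L h"]) auto
qed

lemma Cn_on_const:
  assumes "lcs X" "lcs Y" "mb_dom X U" "c \<in> topspace Y"
  shows "Cn_on n X U Y (\<lambda>x. c)"
  using assms
proof (induction n arbitrary: X U c)
  case 0
  then show ?case by simp
next
  case (Suc n)
  show ?case
    using Suc.prems by (intro Cn_on_SucI[where df = "\<lambda>x h. 0"] Suc.IH C1map_const lcs_seq_square mb_dom_seq_square lcs_zero)
qed

lemma Cn_on_postlinear:
  assumes "lcs X" "lcs Y" "lcs Z" "mb_dom X U" "linear L" "continuous_map Y Z L" "Cn_on n X U Y f"
  shows "Cn_on n X U Z (\<lambda>x. L (f x))"
  using assms
proof (induction n arbitrary: X U f)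
  case 0
  then show ?case by (auto intro: continuous_map_compose')
next
  case (Suc n)
  note D = Cn_on_SucD[OF Suc.prems(1,2,4,7)]
  show ?case
    using Suc.prems D by (intro Cn_on_SucI[OF _ _ _ C1map_postlinear[OF D(1)]] Suc.IH lcs_seq_square mb_dom_seq_square)
qed

lemma Cn_on_pair:
  assumes "lcs X" "lcs Y" "lcs Z" "mb_dom X U" "Cn_on n X U Y f" "Cn_on n X U Z g"
  shows "Cn_on n X U (prod_topology Y Z) (\<lambda>x. (f x, g x))"
  using assms
proof (induction n arbitrary: X U f g)
  case 0
  then show ?case by (simp add: continuous_map_pairedI)
next
  case (Suc n)
  note D = Cn_on_SucD[OF Suc.prems(1,2,4,5)] and D' = Cn_on_SucD[OF Suc.prems(1,3,4,6)]
  show ?case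
    using Suc.prems D D' by (intro Cn_on_SucI[OF _ _ _ C1map_pair[OF D(1) D'(1)]] Suc.IH lcs_seq_square mb_dom_seq_square lcs_prod)
qed

lemma continuous_map_case_seq_pair: "continuous_map (prod_topology X X) (seq_square X) (\<lambda>(x, y). seq_pair x y)"
  unfolding case_prod_unfold by (intro continuous_map_seq_pair continuous_map_fst continuous_map_snd)

lemma Cn_on_seq_pair:
  assumes "lcs X" "lcs Y" "mb_dom X U" "Cn_on n X U Y f" "Cn_on n X U Y g"
  shows "Cn_on n X U (seq_square Y) (\<lambda>x. seq_pair (f x) (g x))"
  using Cn_on_postlinear[OF assms(1) lcs_prod[OF assms(2,2)] lcs_seq_square[OF assms(2)] assms(3) linear_seq_pair continuous_map_case_seq_pair
      Cn_on_pair[OF assms(1,2,2,3,4,5)]] by simp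

lemma linear_seq_pair_compose:
  assumes "linear f" "linear g" shows "linear (\<lambda>z. seq_pair (f z) (g z))"
  using assms by (intro linearI) (simp_all add: linear_add linear_scale seq_pair_add seq_pair_scale)

text \<open>
  Composition with a linear map comes first: the induction step for general composition contains the
  projections \<open>seq_fst\<close> and \<open>seq_snd\<close> as inner functions. A linear \<open>L\<close> has the tangent map \<open>L \<times> L\<close>, which
  is again linear.
\<close>

lemma Cn_on_prelinear:
  assumes "lcs X" "lcs Y" "lcs Z" "mb_dom X U" "mb_dom Y V" "linear L" "continuous_map X Y L" "L ` U \<subseteq> V" "Cn_on n Y V Z g"
  shows "Cn_on n X U Z (\<lambda>x. g (L x))"
  using assms
proof (induction n arbitrary: X U Y V L g)
  case 0
  then have "continuous_map (subtopology X U) (subtopology Y V) L"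
    by (auto simp: continuous_map_in_subtopology continuous_map_from_subtopology)
  from continuous_map_compose'[OF this, of Z g] show ?case using 0 by simp
next
  case (Suc n)
  note D = Cn_on_SucD[OF Suc.prems(2,3,5,9)]
  let ?L = "\<lambda>z. seq_pair (L (seq_fst z)) (L (seq_snd z))"
  have L: "linear ?L"
    using linear_compose[OF linear_seq_fst Suc.prems(6)] linear_compose[OF linear_seq_snd Suc.prems(6)]
    by (intro linear_seq_pair_compose) (simp_all add: o_def)
  have Lc: "continuous_map (seq_square X) (seq_square Y) ?L"
    by (intro continuous_map_seq_pair continuous_map_compose'[OF continuous_map_seq_fst Suc.prems(7)]
      continuous_map_compose'[OF continuous_map_seq_snd Suc.prems(7)])
  have LU: "?L ` seq_times U (topspace X) \<subseteq> seq_times V (topspace Y)"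
    using Suc.prems(7,8) by (auto simp: seq_times_def continuous_map_def)
  have "Cn_on n (seq_square X) (seq_times U (topspace X)) Z
     (\<lambda>z. dir_deriv Z V g (seq_fst (?L z)) (seq_snd (?L z)))"
    by (rule Suc.IH[OF _ _ _ _ _ L Lc LU D(2)]) (use Suc.prems in \<open>auto intro: lcs_seq_square mb_dom_seq_square\<close>)
  then have "Cn_on n (seq_square X) (seq_times U (topspace X)) Z (\<lambda>z. dir_deriv Z V g (L (seq_fst z)) (L (seq_snd z)))"
    by simp
  with Suc.prems(1,3,4) C1map_compose[OF Suc.prems(1-5) C1map_linear[OF mb_dom_subset[OF Suc.prems(4)] Suc.prems(6,7)] D(1) Suc.prems(8)]
  show ?case by (intro Cn_on_SucI)
qed

text \<open>
  By the chain rule the derivative of \<open>g \<circ> f\<close> is the derivative of \<open>g\<close> composed with the tangent map \<open>?F\<close> of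
  \<open>f\<close>, to which the induction hypothesis applies.
\<close>

lemma Cn_on_compose:
  fixes Y :: "(nat \<Rightarrow> 'b::real_vector) topology"
  assumes "lcs X" "lcs Y" "lcs Z" "mb_dom X U" "mb_dom Y V" "Cn_on n X U Y f" "Cn_on n Y V Z g" "f ` U \<subseteq> V"
  shows "Cn_on n X U Z (\<lambda>x. g (f x))"
  using assms
proof (induction n arbitrary: X U Y V f g)
  case 0
  then have "continuous_map (subtopology X U) (subtopology Y V) f"
    by (auto simp: continuous_map_in_subtopology)
  from continuous_map_compose'[OF this, of Z g] show ?case using 0 by simp
next
  case (Suc n)
  note D = Cn_on_SucD[OF Suc.prems(1,2,4,6)] and D' = Cn_on_SucD[OF Suc.prems(2,3,5,7)]
  note sq = lcs_seq_square[OF Suc.prems(1)] lcs_seq_square[OF Suc.prems(2)] mb_dom_seq_square[OF Suc.prems(1,4)] mb_dom_seq_square[OF Suc.prems(2,5)]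
  let ?F = "\<lambda>z. seq_pair (f (seq_fst z)) (dir_deriv Y U f (seq_fst z) (seq_snd z))"
  have "Cn_on n (seq_square X) (seq_times U (topspace X)) Y (\<lambda>z. f (seq_fst z))"
    by (rule Cn_on_prelinear[OF sq(1) Suc.prems(1,2) sq(3) Suc.prems(4) linear_seq_fst continuous_map_seq_fst _ Cn_on_mono[OF Suc.prems(6)]])
      (auto simp: seq_times_def)
  then have F: "Cn_on n (seq_square X) (seq_times U (topspace X)) (seq_square Y) ?F"
    by (rule Cn_on_seq_pair[OF sq(1) Suc.prems(2) sq(3) _ D(2)])
  have FU: "?F ` seq_times U (topspace X) \<subseteq> seq_times V (topspace Y)"
    using Suc.prems(8) C1map_deriv_mem[OF D(1)] by (auto simp: seq_times_def)
  have "Cn_on n (seq_square X) (seq_times U (topspace X)) Z (\<lambda>z. dir_deriv Z V g (seq_fst (?F z)) (seq_snd (?F z)))"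
    by (rule Suc.IH[OF sq(1,2) Suc.prems(3) sq(3,4) F D'(2) FU])
  then have "Cn_on n (seq_square X) (seq_times U (topspace X)) Z
      (\<lambda>z. dir_deriv Z V g (f (seq_fst z)) (dir_deriv Y U f (seq_fst z) (seq_snd z)))" by simp
  with Suc.prems(1,3,4) C1map_compose[OF Suc.prems(1-5) D(1) D'(1) Suc.prems(8)]
  show ?case by (intro Cn_on_SucI)
qed

text \<open>
  Directional derivatives do not change when the domain shrinks to a relatively open subset, so the local
  derivatives are restrictions of a single one.
\<close>

lemma Cn_on_local:
  assumes "lcs X" "mb_dom X U" "\<And>x. x \<in> U \<Longrightarrow> \<exists>V. openin (subtopology X U) V \<and> x \<in> V \<and> Cn_on n X V Y f"
  shows "Cn_on n X U Y f"
  using assms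
proof (induction n arbitrary: X U f)
  case 0
  have US: "topspace (subtopology X U) = U" using mb_dom_subset[OF 0(2)] by auto
  have "continuous_map (subtopology X U) Y f"
  proof (rule continuous_map_local, unfold US)
    fix x assume "x \<in> U"
    then obtain V where V: "openin (subtopology X U) V" "x \<in> V" "Cn_on 0 X V Y f" using 0(3) by blast
    moreover have "U \<inter> V = V" using openin_imp_subset[OF V(1)] by blast
    ultimately show "\<exists>N. openin (subtopology X U) N \<and> x \<in> N \<and> continuous_map (subtopology (subtopology X U) N) Y f"
      by (intro exI[of _ V]) (simp add: subtopology_subtopology)
  qed
  then show ?case by simp
next
  case (Suc n)
  have US: "U \<subseteq> topspace X" using mb_dom_subset[OF Suc.prems(2)] .
  have loc: "\<exists>V. openin (subtopology X U) V \<and> x \<in> V \<and> C1_on X V Y f \<and>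
      Cn_on n (seq_square X) (seq_times V (topspace X)) Y (seq_deriv Y U f)" if xU: "x \<in> U" for x
  proof -
    obtain V where V: "openin (subtopology X U) V" "x \<in> V" "C1_on X V Y f"
      "Cn_on n (seq_square X) (seq_times V (topspace X)) Y (seq_deriv Y V f)" using Suc.prems(3)[OF xU] by auto
    have eq: "seq_deriv Y V f z = seq_deriv Y U f z" if "z \<in> seq_times V (topspace X)" for z
      using that by (simp add: seq_deriv_def seq_times_def has_dir_deriv_subset(2)[OF Suc.prems(1) US V(1)])
    have "Cn_on n (seq_square X) (seq_times V (topspace X)) Y (seq_deriv Y U f)"
      by (rule Cn_on_cong[OF V(4)]) (rule eq)
    then show ?thesis using V(1-3) by blast
  qed
  have Cn: "Cn_on n (seq_square X) (seq_times U (topspace X)) Y (seq_deriv Y U f)"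
  proof (rule Suc.IH[OF lcs_seq_square[OF Suc.prems(1)] mb_dom_seq_square[OF Suc.prems(1,2)]])
    fix z assume z: "z \<in> seq_times U (topspace X)"
    then obtain V where V: "openin (subtopology X U) V" "seq_fst z \<in> V"
      "Cn_on n (seq_square X) (seq_times V (topspace X)) Y (seq_deriv Y U f)"
      using loc by (auto simp: seq_times_def)
    have "z \<in> seq_times V (topspace X)" using z V(2) by (simp add: seq_times_def)
    then show "\<exists>V. openin (subtopology (seq_square X) (seq_times U (topspace X))) V \<and> z \<in> V \<and> Cn_on n (seq_square X) V Y (seq_deriv Y U f)"
      using V(3) openin_seq_times[OF V(1)] by blast
  qed
  have "C1_on X U Y f"
    unfolding C1_on_def
  proof (intro conjI ballI)
    show "continuous_map (subtopology X U) Y f"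
    proof (rule continuous_map_local)
      fix x assume "x \<in> topspace (subtopology X U)"
      then obtain V where V: "openin (subtopology X U) V" "x \<in> V" "C1_on X V Y f" using loc by auto
      moreover have "U \<inter> V = V" using openin_imp_subset[OF V(1)] by blast
      ultimately show "\<exists>N. openin (subtopology X U) N \<and> x \<in> N \<and> continuous_map (subtopology (subtopology X U) N) Y f"
        by (intro exI[of _ V]) (simp add: subtopology_subtopology C1_on_def)
    qed
    show "\<exists>l. has_dir_deriv Y U f x h l" if xh: "x \<in> U" "h \<in> topspace X" for x h
    proof -
      obtain V where V: "openin (subtopology X U) V" "x \<in> V" "C1_on X V Y f" using loc[OF xh(1)] by blast
      have "\<forall>x\<in>V. \<forall>h\<in>topspace X. \<exists>l. has_dir_deriv Y V f x h l" using V(3) by (simp add: C1_on_def)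
      with V(2) xh(2) obtain l where "has_dir_deriv Y V f x h l" by metis
      then show ?thesis unfolding has_dir_deriv_subset(1)[OF Suc.prems(1) US V(1,2) xh(2)] by blast
    qed
    show "continuous_map (subtopology (seq_square X) (seq_times U (topspace X))) Y (seq_deriv Y U f)"
      using Cn by (rule Cn_on_continuous)
  qed
  then show ?case using Cn by simp
qed

section \<open>Smooth maps between locally convex spaces\<close>

lemma seq_embed_inj: "seq_embed x = seq_embed y \<longleftrightarrow> x = y"
  by (metis seq_embed_0)

lemma seq_embed_mem: "seq_embed x \<in> seq_embed ` U \<longleftrightarrow> x \<in> U"
  by (auto simp: seq_embed_inj)

lemma openin_seq_embed:
  assumes "openin (subtopology X U) V"
  shows "openin (subtopology (seq_lcs X) (seq_embed ` U)) (seq_embed ` V)"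
proof -
  have V: "V \<subseteq> topspace X \<inter> U" using openin_subset[OF assms] by simp
  have "continuous_map (subtopology (seq_lcs X) (seq_embed ` U)) (subtopology X U) (\<lambda>z. z 0)"
    by (auto simp: continuous_map_in_subtopology intro!: continuous_map_from_subtopology continuous_map_eval_seq_lcs)
  from openin_preimage[OF this assms]
  have "openin (subtopology (seq_lcs X) (seq_embed ` U))
     {z \<in> topspace (subtopology (seq_lcs X) (seq_embed ` U)). z 0 \<in> V}" .
  moreover have "{z \<in> topspace (subtopology (seq_lcs X) (seq_embed ` U)). z 0 \<in> V} = seq_embed ` V"
    using V by (auto simp: topspace_seq_lcs)
  ultimately show ?thesis by simp
qed

lemma half_dom_seq_embed:
  assumes "half_dom X Q" shows "half_dom (seq_lcs X) (seq_embed ` Q)"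
  unfolding half_dom_def
proof (intro conjI ballI)
  show "seq_embed ` Q \<subseteq> topspace (seq_lcs X)" using assms by (auto simp: half_dom_def topspace_seq_lcs)
  show "convex (seq_embed ` Q)" using assms by (simp add: half_dom_def convex_linear_image linear_seq_embed)
  fix x h assume "x \<in> seq_embed ` Q" "h \<in> topspace (seq_lcs X)"
  then obtain a b where ab: "x = seq_embed a" "a \<in> Q" "h = seq_embed b" "b \<in> topspace X" by (auto simp: topspace_seq_lcs)
  then have "a + b \<in> Q \<or> a - b \<in> Q" using assms by (auto simp: half_dom_def)
  then show "x + h \<in> seq_embed ` Q \<or> x - h \<in> seq_embed ` Q"
    unfolding ab linear_add[OF linear_seq_embed, symmetric] linear_diff[OF linear_seq_embed, symmetric] by blast
qed

lemma mb_dom_seq_embed: "mb_dom X U \<Longrightarrow> mb_dom (seq_lcs X) (seq_embed ` U)"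
  unfolding mb_dom_def using half_dom_seq_embed openin_seq_embed by blast

text \<open>
  Directional derivatives do not see the embedding of \<open>X\<close> as the space of sequences supported in \<open>{0}\<close>.
  This carries the rules for \<open>Cn_on\<close> over to smooth maps between arbitrary spaces.
\<close>

lemma has_dir_deriv_seq_embed:
  "has_dir_deriv Y (seq_embed ` U) (\<lambda>z. f (z 0)) (seq_embed x) (seq_embed h) l = has_dir_deriv Y U f x h l"
proof -
  have eq: "seq_embed x + t *\<^sub>R seq_embed h = seq_embed (x + t *\<^sub>R h)" for t
    by (simp add: linear_add[OF linear_seq_embed] linear_scale[OF linear_seq_embed])
  show ?thesis unfolding has_dir_deriv_def eq seq_embed_mem seq_embed_0 ..
qed

lemma dir_deriv_seq_embed:
  "dir_deriv Y (seq_embed ` U) (\<lambda>z. f (z 0)) (seq_embed x) (seq_embed h) = dir_deriv Y U f x h"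
  unfolding dir_deriv_def has_dir_deriv_seq_embed ..

lemma smooth_onI: "(\<And>n. Cn_on n (seq_lcs X) (seq_embed ` U) Y (\<lambda>z. f (z 0))) \<Longrightarrow> smooth_on_lcs X U Y f"
  by (simp add: smooth_on_lcs_def)

lemma smooth_onD: "smooth_on_lcs X U Y f \<Longrightarrow> Cn_on n (seq_lcs X) (seq_embed ` U) Y (\<lambda>z. f (z 0))"
  by (simp add: smooth_on_lcs_def)

lemma continuous_map_seq_embed_sub:
  "continuous_map (subtopology X U) (subtopology (seq_lcs X) (seq_embed ` U)) seq_embed"
  by (auto simp: continuous_map_in_subtopology intro!: continuous_map_from_subtopology continuous_map_seq_embed)

lemma smooth_on_continuous:
  assumes "smooth_on_lcs X U Y f" shows "continuous_map (subtopology X U) Y f"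
  using continuous_map_compose'[OF continuous_map_seq_embed_sub Cn_on_continuous[OF smooth_onD[OF assms, of 0]]] by simp

lemma smooth_on_cong:
  assumes "smooth_on_lcs X U Y f" "\<And>x. x \<in> U \<Longrightarrow> f x = g x"
  shows "smooth_on_lcs X U Y g"
proof (rule smooth_onI)
  fix n
  show "Cn_on n (seq_lcs X) (seq_embed ` U) Y (\<lambda>z. g (z 0))"
    by (rule Cn_on_cong[OF smooth_onD[OF assms(1)]]) (use assms(2) in auto)
qed

lemma smooth_on_C1map:
  assumes X: "lcs X" and Y: "lcs Y" and U: "mb_dom X U" and f: "smooth_on_lcs X U Y f"
  shows "C1map X U Y f (dir_deriv Y U f)"
proof -
  let ?f = "\<lambda>z. f (z 0)" and ?U = "seq_embed ` U"
  have D: "C1map (seq_lcs X) ?U Y ?f (dir_deriv Y ?U ?f)"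
    using Cn_on_SucD(1)[OF lcs_seq_lcs[OF X] Y mb_dom_seq_embed[OF U] smooth_onD[OF f, of "Suc 0"]] .
  show ?thesis
    unfolding C1map_def
  proof (intro conjI ballI)
    show "continuous_map (subtopology X U) Y f" using f by (rule smooth_on_continuous)
    show "has_dir_deriv Y U f x h (dir_deriv Y U f x h)" if "x \<in> U" "h \<in> topspace X" for x h
      using C1map_has[OF D, of "seq_embed x" "seq_embed h"] that
      by (simp add: has_dir_deriv_seq_embed dir_deriv_seq_embed topspace_seq_lcs)
    have "continuous_map (subtopology (prod_topology X X) (U \<times> topspace X))
      (subtopology (prod_topology (seq_lcs X) (seq_lcs X)) (?U \<times> topspace (seq_lcs X))) (\<lambda>z. (seq_embed (fst z), seq_embed (snd z)))"
      by (auto simp: continuous_map_in_subtopology topspace_seq_lcs intro!: continuous_map_from_subtopology continuous_map_pairedI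
         continuous_map_compose'[OF continuous_map_fst continuous_map_seq_embed] continuous_map_compose'[OF continuous_map_snd continuous_map_seq_embed])
    from continuous_map_compose'[OF this] D
    have "continuous_map (subtopology (prod_topology X X) (U \<times> topspace X)) Y
      (\<lambda>z. (\<lambda>(x, h). dir_deriv Y ?U ?f x h) (seq_embed (fst z), seq_embed (snd z)))"
      unfolding C1map_def by blast
    then show "continuous_map (subtopology (prod_topology X X) (U \<times> topspace X)) Y (\<lambda>(x, h). dir_deriv Y U f x h)"
      by (simp add: dir_deriv_seq_embed case_prod_unfold)
  qed
qed

lemma half_dom_Times: "half_dom X Q \<Longrightarrow> lcs Z \<Longrightarrow> half_dom (prod_topology X Z) (Q \<times> topspace Z)"
  unfolding half_dom_def
  by (auto intro!: convex_Times lcs_convex simp: lcs_mem)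

lemma half_dom_Times': "half_dom X Q \<Longrightarrow> lcs Z \<Longrightarrow> half_dom (prod_topology Z X) (topspace Z \<times> Q)"
  unfolding half_dom_def
  by (auto intro!: convex_Times lcs_convex simp: lcs_mem)

lemma openin_sub_Times:
  assumes "openin (subtopology X U) V" "openin (subtopology Z W) W'"
  shows "openin (subtopology (prod_topology X Z) (U \<times> W)) (V \<times> W')"
proof -
  obtain T T' where T: "openin X T" "V = T \<inter> U" "openin Z T'" "W' = T' \<inter> W"
    using assms unfolding openin_subtopology by blast
  have "openin (prod_topology X Z) (T \<times> T')" using T by (simp add: openin_prod_Times_iff)
  moreover have "V \<times> W' = (T \<times> T') \<inter> (U \<times> W)" unfolding T(2,4) by blast
  ultimately show ?thesis unfolding openin_subtopology by blast
qed

lemma mb_dom_Times: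
  assumes "lcs Z" "mb_dom X U" "openin Z W" shows "mb_dom (prod_topology X Z) (U \<times> W)"
proof -
  obtain Q where Q: "half_dom X Q" "openin (subtopology X Q) U" using assms(2) by (auto simp: mb_dom_def)
  have "openin (subtopology (prod_topology X Z) (Q \<times> topspace Z)) (U \<times> W)"
    by (rule openin_sub_Times[OF Q(2)]) (simp add: assms(3))
  then show ?thesis using half_dom_Times[OF Q(1) assms(1)] unfolding mb_dom_def by blast
qed

lemma mb_dom_Times':
  assumes "lcs Z" "mb_dom X U" "openin Z W" shows "mb_dom (prod_topology Z X) (W \<times> U)"
proof -
  obtain Q where Q: "half_dom X Q" "openin (subtopology X Q) U" using assms(2) by (auto simp: mb_dom_def)
  have "openin (subtopology (prod_topology Z X) (topspace Z \<times> Q)) (W \<times> U)"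
    by (rule openin_sub_Times[OF _ Q(2)]) (simp add: assms(3))
  then show ?thesis using half_dom_Times'[OF Q(1) assms(1)] unfolding mb_dom_def by blast
qed

lemma smooth_on_compose:
  assumes X: "lcs X" and Y: "lcs Y" and Z: "lcs Z" and U: "mb_dom X U" and V: "mb_dom Y V"
    and f: "smooth_on_lcs X U Y f" and g: "smooth_on_lcs Y V Z g" and fU: "f ` U \<subseteq> V"
  shows "smooth_on_lcs X U Z (\<lambda>x. g (f x))"
proof (rule smooth_onI)
  fix n
  have 1: "Cn_on n (seq_lcs X) (seq_embed ` U) (seq_lcs Y) (\<lambda>z. seq_embed (f (z 0)))"
    by (rule Cn_on_postlinear[OF lcs_seq_lcs[OF X] Y lcs_seq_lcs[OF Y] mb_dom_seq_embed[OF U] linear_seq_embed continuous_map_seq_embed smooth_onD[OF f]])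
  have "(\<lambda>z. seq_embed (f (z 0))) ` seq_embed ` U \<subseteq> seq_embed ` V" using fU by auto
  from Cn_on_compose[OF lcs_seq_lcs[OF X] lcs_seq_lcs[OF Y] Z mb_dom_seq_embed[OF U] mb_dom_seq_embed[OF V] 1 smooth_onD[OF g] this]
  show "Cn_on n (seq_lcs X) (seq_embed ` U) Z (\<lambda>z. g (f (z 0)))" by simp
qed

lemma smooth_on_linear:
  assumes "lcs X" "lcs Y" "mb_dom X U" "linear L" "continuous_map X Y L"
  shows "smooth_on_lcs X U Y L"
proof (rule smooth_onI)
  fix n
  show "Cn_on n (seq_lcs X) (seq_embed ` U) Y (\<lambda>z. L (z 0))"
    by (rule Cn_on_linear[OF lcs_seq_lcs[OF assms(1)] assms(2) mb_dom_seq_embed[OF assms(3)]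
        linear_compose[OF linear_eval assms(4), unfolded o_def]
        continuous_map_compose'[OF continuous_map_eval_seq_lcs assms(5)]])
qed

lemma smooth_on_const: "lcs X \<Longrightarrow> lcs Y \<Longrightarrow> mb_dom X U \<Longrightarrow> c \<in> topspace Y \<Longrightarrow> smooth_on_lcs X U Y (\<lambda>x. c)"
  by (rule smooth_onI, rule Cn_on_const[OF lcs_seq_lcs _ mb_dom_seq_embed])

lemma smooth_on_pair:
  "lcs X \<Longrightarrow> lcs Y \<Longrightarrow> lcs Z \<Longrightarrow> mb_dom X U \<Longrightarrow> smooth_on_lcs X U Y f \<Longrightarrow> smooth_on_lcs X U Z g \<Longrightarrow>
   smooth_on_lcs X U (prod_topology Y Z) (\<lambda>x. (f x, g x))"
  by (rule smooth_onI, rule Cn_on_pair[OF lcs_seq_lcs _ _ mb_dom_seq_embed smooth_onD smooth_onD])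

lemma smooth_on_postlinear:
  "lcs X \<Longrightarrow> lcs Y \<Longrightarrow> lcs Z \<Longrightarrow> mb_dom X U \<Longrightarrow> linear L \<Longrightarrow> continuous_map Y Z L \<Longrightarrow> smooth_on_lcs X U Y f \<Longrightarrow>
   smooth_on_lcs X U Z (\<lambda>x. L (f x))"
  by (rule smooth_onI, rule Cn_on_postlinear[OF lcs_seq_lcs _ _ mb_dom_seq_embed _ _ smooth_onD])

lemma smooth_on_prelinear:
  assumes "lcs X" "lcs Y" "lcs Z" "mb_dom X U" "mb_dom Y V" "linear L" "continuous_map X Y L" "L ` U \<subseteq> V" "smooth_on_lcs Y V Z g"
  shows "smooth_on_lcs X U Z (\<lambda>x. g (L x))"
  using smooth_on_compose[OF assms(1-5) smooth_on_linear[OF assms(1,2,4,6,7)] assms(9,8)] .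

lemma smooth_on_seq_pair:
  assumes "lcs X" "lcs Y" "mb_dom X U" "smooth_on_lcs X U Y f" "smooth_on_lcs X U Y g"
  shows "smooth_on_lcs X U (seq_square Y) (\<lambda>x. seq_pair (f x) (g x))"
  by (rule smooth_onI, rule Cn_on_seq_pair[OF lcs_seq_lcs[OF assms(1)] assms(2) mb_dom_seq_embed[OF assms(3)]
     smooth_onD[OF assms(4)] smooth_onD[OF assms(5)]])

lemma smooth_on_local:
  assumes X: "lcs X" and U: "mb_dom X U"
    and loc: "\<And>x. x \<in> U \<Longrightarrow> \<exists>V. openin (subtopology X U) V \<and> x \<in> V \<and> smooth_on_lcs X V Y f"
  shows "smooth_on_lcs X U Y f"
proof (rule smooth_onI, rule Cn_on_local[OF lcs_seq_lcs[OF X] mb_dom_seq_embed[OF U]])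
  fix n and z :: "nat \<Rightarrow> 'a" assume "z \<in> seq_embed ` U"
  then obtain x where x: "x \<in> U" "z = seq_embed x" by blast
  obtain V where V: "openin (subtopology X U) V" "x \<in> V" "smooth_on_lcs X V Y f" using loc[OF x(1)] by blast
  show "\<exists>V. openin (subtopology (seq_lcs X) (seq_embed ` U)) V \<and> z \<in> V \<and> Cn_on n (seq_lcs X) V Y (\<lambda>z. f (z 0))"
    using openin_seq_embed[OF V(1)] V(2) x(2) smooth_onD[OF V(3)] by blast
qed

lemma smooth_on_deriv:
  assumes X: "lcs X" and Y: "lcs Y" and U: "mb_dom X U" and f: "smooth_on_lcs X U Y f"
  shows "smooth_on_lcs (prod_topology X X) (U \<times> topspace X) Y (\<lambda>(x, h). dir_deriv Y U f x h)"
proof (rule smooth_onI)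
  fix n
  let ?S = "seq_lcs X" and ?V = "seq_embed ` U" and ?f = "\<lambda>z. f (z 0)"
  have D: "Cn_on n (seq_square ?S) (seq_times ?V (topspace ?S)) Y (\<lambda>z. dir_deriv Y ?V ?f (seq_fst z) (seq_snd z))"
    by (rule Cn_on_SucD(2)[OF lcs_seq_lcs[OF X] Y mb_dom_seq_embed[OF U] smooth_onD[OF f]])
  \<comment> \<open>An embedded pair has to be turned into a pair of embedded vectors.\<close>
  let ?L = "\<lambda>z::nat \<Rightarrow> 'a \<times> 'a. seq_pair (seq_embed (fst (z 0))) (seq_embed (snd (z 0)))"
  have e0: "linear (\<lambda>z. z (0::nat) :: 'a \<times> 'a)" by (rule linear_eval)
  have L: "linear ?L"
    using linear_compose[OF linear_compose[OF e0 linear_fst] linear_seq_embed] linear_compose[OF linear_compose[OF e0 linear_snd] linear_seq_embed]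
    by (intro linear_seq_pair_compose) (simp_all add: o_def)
  have Lc: "continuous_map (seq_lcs (prod_topology X X)) (seq_square ?S) ?L"
    by (intro continuous_map_seq_pair
      continuous_map_compose'[OF continuous_map_compose'[OF continuous_map_eval_seq_lcs continuous_map_fst] continuous_map_seq_embed]
      continuous_map_compose'[OF continuous_map_compose'[OF continuous_map_eval_seq_lcs continuous_map_snd] continuous_map_seq_embed])
  have LU: "?L ` seq_embed ` (U \<times> topspace X) \<subseteq> seq_times ?V (topspace ?S)"
    by (auto simp: seq_times_def topspace_seq_lcs)
  have "mb_dom (prod_topology X X) (U \<times> topspace X)" by (rule mb_dom_Times[OF X U openin_topspace])
  from Cn_on_prelinear[OF lcs_seq_lcs[OF lcs_prod[OF X X]] lcs_seq_square[OF lcs_seq_lcs[OF X]] Y mb_dom_seq_embed[OF this]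
      mb_dom_seq_square[OF lcs_seq_lcs[OF X] mb_dom_seq_embed[OF U]] L Lc LU D]
  show "Cn_on n (seq_lcs (prod_topology X X)) (seq_embed ` (U \<times> topspace X)) Y (\<lambda>z. (\<lambda>(x, h). dir_deriv Y U f x h) (z 0))"
    by (simp add: dir_deriv_seq_embed case_prod_unfold)
qed

lemma smooth_on_dir:
  assumes X: "lcs X" and Y: "lcs Y" and U: "mb_dom X U" and f: "smooth_on_lcs X U Y f" and h: "h \<in> topspace X"
  shows "smooth_on_lcs X U Y (\<lambda>x. dir_deriv Y U f x h)"
proof -
  have 1: "smooth_on_lcs X U (prod_topology X X) (\<lambda>x. (x, h))"
    using X U h smooth_on_linear[OF X X U linear_ident] smooth_on_const[OF X X U h] by (intro smooth_on_pair) simp_all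
  have "(\<lambda>x. (x, h)) ` U \<subseteq> U \<times> topspace X" using h by auto
  from smooth_on_compose[OF X lcs_prod[OF X X] Y U mb_dom_Times[OF X U openin_topspace] 1 smooth_on_deriv[OF X Y U f] this]
  show ?thesis by simp
qed

section \<open>Symmetry of second derivatives\<close>

lemma has_dir_deriv_mono:
  assumes "has_dir_deriv Y U f x h l" "V \<subseteq> U"
  shows "has_dir_deriv Y V f x h l"
proof -
  have "at 0 within {t. x + t *\<^sub>R h \<in> V} \<le> at 0 within {t. x + t *\<^sub>R h \<in> U}"
    using assms(2) by (intro at_le) auto
  then show ?thesis using assms(1) unfolding has_dir_deriv_def limitin_def using filter_leD by blast
qed

lemma has_dir_deriv_shift:
  assumes "has_dir_deriv Y U f (x + c) h l"
  shows "has_dir_deriv Y {y. y + c \<in> U} (\<lambda>y. f (y + c)) x h l"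
proof -
  have eq: "x + t *\<^sub>R h + c = x + c + t *\<^sub>R h" for t by simp
  show ?thesis using assms unfolding has_dir_deriv_def mem_Collect_eq eq .
qed

lemma linear_fst_minus_snd: "linear (\<lambda>z::'a::real_vector \<times> 'a. fst z - snd z)"
  by (intro linearI) (auto simp: algebra_simps)

lemma has_dir_deriv_diff:
  assumes "lcs Y" "has_dir_deriv Y U f x h l" "has_dir_deriv Y U g x h m"
  shows "has_dir_deriv Y U (\<lambda>x. f x - g x) x h (l - m)"
  using has_dir_deriv_postlinear[OF linear_fst_minus_snd continuous_map_lcs_diff[OF assms(1) continuous_map_fst continuous_map_snd]
    has_dir_deriv_pair[OF assms(2,3)]] by simp

lemma linear_scaleR_const: "linear (\<lambda>y::'a::real_vector. c *\<^sub>R y)"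
  by (intro linearI) (auto simp: algebra_simps)

lemma continuous_map_scaleR_const: "lcs Y \<Longrightarrow> continuous_map Y Y (\<lambda>y. c *\<^sub>R y)"
  by (intro continuous_map_lcs_scale) auto

lemma has_dir_deriv_scale:
  assumes "lcs Y" "has_dir_deriv Y U f x h l"
  shows "has_dir_deriv Y U (\<lambda>x. c *\<^sub>R f x) x h (c *\<^sub>R l)"
  by (rule has_dir_deriv_postlinear[OF linear_scaleR_const continuous_map_scaleR_const[OF assms(1)] assms(2)])

text \<open>
  The second difference over the parallelogram spanned by \<open>s *\<^sub>R h\<close> and \<open>s *\<^sub>R k\<close> is estimated by two nested
  applications of the mean value inequality: along \<open>h\<close> to the increment \<open>G y = f (y + s *\<^sub>R k) - f y\<close>, then
  along \<open>k\<close> to the derivative \<open>D\<close> of \<open>f\<close> in direction \<open>h\<close>. The parallelogram stays in a convex neighbourhood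
  \<open>C\<close> of \<open>x\<close> on which the second derivative \<open>DD\<close> varies by less than \<open>e\<close>.
\<close>

lemma second_difference_estimate:
  assumes X: "lcs X" and Y: "lcs Y" and U: "mb_dom X U" and f: "smooth_on_lcs X U Y f"
    and x: "x \<in> U" and h: "h \<in> topspace X" and k: "k \<in> topspace X"
    and hp: "\<And>t. 0 \<le> t \<Longrightarrow> t \<le> d \<Longrightarrow> x + t *\<^sub>R h \<in> U" and kp: "\<And>t. 0 \<le> t \<Longrightarrow> t \<le> d \<Longrightarrow> x + t *\<^sub>R k \<in> U" and d: "d > 0"
    and p: "cont_seminorm Y p" and e: "e > 0"
  shows "\<exists>\<delta>>0. \<forall>s. 0 < s \<and> s \<le> \<delta> \<longrightarrow>
     x + s *\<^sub>R h \<in> U \<and> x + s *\<^sub>R k \<in> U \<and> x + s *\<^sub>R h + s *\<^sub>R k \<in> U \<and>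
     p (f (x + s *\<^sub>R h + s *\<^sub>R k) - f (x + s *\<^sub>R h) - (f (x + s *\<^sub>R k) - f x)
        - (s * s) *\<^sub>R dir_deriv Y U (\<lambda>y. dir_deriv Y U f y h) x k) \<le> s * s * e"
proof -
  define D where "D = (\<lambda>y. dir_deriv Y U f y h)"
  define DD where "DD = (\<lambda>y. dir_deriv Y U D y k)"
  have C1: "C1map X U Y f (dir_deriv Y U f)" by (rule smooth_on_C1map[OF X Y U f])
  have Ds: "smooth_on_lcs X U Y D" unfolding D_def by (rule smooth_on_dir[OF X Y U f h])
  have D1: "C1map X U Y D (dir_deriv Y U D)" by (rule smooth_on_C1map[OF X Y U Ds])
  have DDs: "smooth_on_lcs X U Y DD" unfolding DD_def by (rule smooth_on_dir[OF X Y U Ds k])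
  have fm: "f y \<in> topspace Y" if "y \<in> U" for y using C1map_mem[OF C1 U that] .
  have Dm: "D y \<in> topspace Y" if "y \<in> U" for y using C1map_mem[OF D1 U that] .
  have DDm: "DD y \<in> topspace Y" if "y \<in> U" for y
    using C1map_deriv_mem[OF D1 that k] by (simp add: DD_def)
  have "x \<in> topspace (subtopology X U)" using x mb_dom_mem[OF U x] by simp
  then obtain N where N: "openin (subtopology X U) N" "x \<in> N" "\<forall>z\<in>N. p (DD z - DD x) < e"
    using smooth_on_continuous[OF DDs] p e unfolding continuous_map_seminorm[OF Y] by blast
  obtain C where C: "openin (subtopology X U) C" "convex C" "x \<in> C" "C \<subseteq> N"
    using mb_dom_local_convex[OF X U N(1,2)] by blast
  have CU: "C \<subseteq> U" using openin_imp_subset[OF C(1)] .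
  obtain W where W: "openin X W" "C = W \<inter> U" using C(1) unfolding openin_subtopology by blast
  have xS: "x \<in> topspace X" using mb_dom_mem[OF U x] .
  have ray: "\<exists>r>0. \<forall>t. 0 \<le> t \<and> t \<le> r \<longrightarrow> x + t *\<^sub>R v \<in> C"
    if v: "v \<in> topspace X" and vp: "\<And>t. 0 \<le> t \<Longrightarrow> t \<le> d \<Longrightarrow> x + t *\<^sub>R v \<in> U" for v
  proof -
    have "open {t. x + t *\<^sub>R v \<in> W}" by (rule open_line_preimage[OF X xS v W(1)])
    moreover have "0 \<in> {t. x + t *\<^sub>R v \<in> W}" using C(3) W(2) by simp
    ultimately obtain r where r: "r > 0" "ball 0 r \<subseteq> {t. x + t *\<^sub>R v \<in> W}" using openE by blast
    have "x + t *\<^sub>R v \<in> C" if t: "0 \<le> t" "t \<le> min d (r / 2)" for t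
    proof -
      have "t \<in> ball 0 r" using t r(1) by auto
      then have "x + t *\<^sub>R v \<in> W" using r(2) by blast
      then show ?thesis using vp[of t] t W(2) by auto
    qed
    moreover have "min d (r / 2) > 0" using d r(1) by simp
    ultimately show ?thesis by blast
  qed
  obtain r1 where r1: "r1 > 0" "\<And>t. 0 \<le> t \<Longrightarrow> t \<le> r1 \<Longrightarrow> x + t *\<^sub>R h \<in> C" using ray[OF h hp] by blast
  obtain r2 where r2: "r2 > 0" "\<And>t. 0 \<le> t \<Longrightarrow> t \<le> r2 \<Longrightarrow> x + t *\<^sub>R k \<in> C" using ray[OF k kp] by blast
  define r where "r = min r1 r2"
  have r: "r > 0" using r1(1) r2(1) by (simp add: r_def)
  \<comment> \<open>The bound is \<open>r / 2\<close> because the point is the midpoint of \<open>x + (2 * a) *\<^sub>R h\<close> and \<open>x + (2 * b) *\<^sub>R k\<close>.\<close>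
  have square: "x + a *\<^sub>R h + b *\<^sub>R k \<in> C" if ab: "0 \<le> a" "a \<le> r / 2" "0 \<le> b" "b \<le> r / 2" for a b
  proof -
    have "x + (2 * a) *\<^sub>R h \<in> C" "x + (2 * b) *\<^sub>R k \<in> C" using r1(2) r2(2) ab by (auto simp: r_def)
    then have "(1/2) *\<^sub>R (x + (2 * a) *\<^sub>R h) + (1/2) *\<^sub>R (x + (2 * b) *\<^sub>R k) \<in> C"
      using C(2) by (intro convexD) auto
    moreover have "(1/2) *\<^sub>R (x + (2 * a) *\<^sub>R h) + (1/2) *\<^sub>R (x + (2 * b) *\<^sub>R k) = ((1/2) *\<^sub>R x + (1/2) *\<^sub>R x) + a *\<^sub>R h + b *\<^sub>R k"
      by (simp add: scaleR_add_right algebra_simps)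
    moreover have "(1/2) *\<^sub>R x + (1/2) *\<^sub>R x = x" by (simp flip: scaleR_add_left)
    ultimately show ?thesis by simp
  qed
  have est: "p (f (x + s *\<^sub>R h + s *\<^sub>R k) - f (x + s *\<^sub>R h) - (f (x + s *\<^sub>R k) - f x) - (s * s) *\<^sub>R DD x) \<le> s * s * e"
    if s: "0 < s" "s \<le> r / 2" for s
  proof -
    define G where "G = (\<lambda>y. f (y + s *\<^sub>R k) - f y)"
    define U' where "U' = {y. y + s *\<^sub>R k \<in> U} \<inter> U"
    have pts: "x + (\<tau> * s) *\<^sub>R h \<in> C" "x + (\<tau> * s) *\<^sub>R h + (\<rho> * s) *\<^sub>R k \<in> C" if "0 \<le> \<tau>" "\<tau> \<le> 1" "0 \<le> \<rho>" "\<rho> \<le> 1" for \<tau> \<rho>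
    proof -
      have "\<tau> * s \<le> r / 2" "\<rho> * s \<le> r / 2" using that s mult_left_le_one_le[of s \<tau>] mult_left_le_one_le[of s \<rho>] by linarith+
      then show "x + (\<tau> * s) *\<^sub>R h \<in> C" "x + (\<tau> * s) *\<^sub>R h + (\<rho> * s) *\<^sub>R k \<in> C"
        using square[of "\<tau> * s" 0] square[of "\<tau> * s" "\<rho> * s"] that s r by auto
    qed
    have "p (G (x + s *\<^sub>R h) - G x - (s * s) *\<^sub>R DD x) \<le> s * s * e"
    proof (rule mean_value_segment[OF Y p, where U = U' and d = "\<lambda>\<tau>. s *\<^sub>R (D (x + \<tau> *\<^sub>R (s *\<^sub>R h) + s *\<^sub>R k) - D (x + \<tau> *\<^sub>R (s *\<^sub>R h)))"])
      fix \<tau> :: real assume \<tau>: "0 \<le> \<tau>" "\<tau> \<le> 1"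
      define y where "y = x + \<tau> *\<^sub>R (s *\<^sub>R h)"
      have y: "y \<in> C" "y \<in> U" "y + s *\<^sub>R k \<in> U" and yr: "\<And>\<rho>. 0 \<le> \<rho> \<Longrightarrow> \<rho> \<le> 1 \<Longrightarrow> y + \<rho> *\<^sub>R (s *\<^sub>R k) \<in> C"
        using pts[OF \<tau>, of 1] pts[OF \<tau>] CU by (auto simp: y_def)
      have "y \<in> U'" using y by (simp add: U'_def)
      then show "x + \<tau> *\<^sub>R (s *\<^sub>R h) \<in> U'" by (simp only: y_def)
      show "G (x + \<tau> *\<^sub>R (s *\<^sub>R h)) \<in> topspace Y"
        unfolding y_def[symmetric] G_def by (intro lcs_diff_mem[OF Y] fm y)
      have hd: "has_dir_deriv Y U f z (s *\<^sub>R h) (s *\<^sub>R D z)" if "z \<in> U" for z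
        unfolding D_def by (rule has_dir_deriv_homogeneous[OF Y that C1map_has[OF C1 that h]])
      have "has_dir_deriv Y U' G y (s *\<^sub>R h) (s *\<^sub>R D (y + s *\<^sub>R k) - s *\<^sub>R D y)"
        unfolding G_def U'_def
        by (rule has_dir_deriv_diff[OF Y has_dir_deriv_mono[OF has_dir_deriv_shift[OF hd[OF y(3)]]] has_dir_deriv_mono[OF hd[OF y(2)]]]) auto
      then show "has_dir_deriv Y U' G (x + \<tau> *\<^sub>R (s *\<^sub>R h)) (s *\<^sub>R h) (s *\<^sub>R (D (x + \<tau> *\<^sub>R (s *\<^sub>R h) + s *\<^sub>R k) - D (x + \<tau> *\<^sub>R (s *\<^sub>R h))))"
        unfolding y_def scaleR_diff_right .
      have inner: "p (D (y + s *\<^sub>R k) - D y - s *\<^sub>R DD x) \<le> s * e"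
      proof (rule mean_value_segment[OF Y p, where U = U and d = "\<lambda>\<rho>. s *\<^sub>R DD (y + \<rho> *\<^sub>R (s *\<^sub>R k))"])
        fix \<rho> :: real assume \<rho>: "0 \<le> \<rho>" "\<rho> \<le> 1"
        have zC: "y + \<rho> *\<^sub>R (s *\<^sub>R k) \<in> C" by (rule yr[OF \<rho>])
        then show zU: "y + \<rho> *\<^sub>R (s *\<^sub>R k) \<in> U" using CU by blast
        then show "D (y + \<rho> *\<^sub>R (s *\<^sub>R k)) \<in> topspace Y" by (rule Dm)
        show "has_dir_deriv Y U D (y + \<rho> *\<^sub>R (s *\<^sub>R k)) (s *\<^sub>R k) (s *\<^sub>R DD (y + \<rho> *\<^sub>R (s *\<^sub>R k)))"
          unfolding DD_def by (rule has_dir_deriv_homogeneous[OF Y zU C1map_has[OF D1 zU k]])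
        have "p (s *\<^sub>R (DD (y + \<rho> *\<^sub>R (s *\<^sub>R k)) - DD x)) = \<bar>s\<bar> * p (DD (y + \<rho> *\<^sub>R (s *\<^sub>R k)) - DD x)"
          by (rule seminorm_scale[OF p lcs_diff_mem[OF Y DDm[OF zU] DDm[OF x]]])
        moreover have "p (DD (y + \<rho> *\<^sub>R (s *\<^sub>R k)) - DD x) < e" using zC C(4) N(3) by blast
        ultimately show "p (s *\<^sub>R DD (y + \<rho> *\<^sub>R (s *\<^sub>R k)) - s *\<^sub>R DD x) \<le> s * e"
          using s by (simp add: scaleR_diff_right mult_left_mono)
      qed (intro lcs_scale_mem[OF Y] DDm x)
      have "p (s *\<^sub>R (D (y + s *\<^sub>R k) - D y - s *\<^sub>R DD x)) = \<bar>s\<bar> * p (D (y + s *\<^sub>R k) - D y - s *\<^sub>R DD x)"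
        by (rule seminorm_scale[OF p]) (intro lcs_diff_mem[OF Y] lcs_scale_mem[OF Y] Dm DDm x y)
      also have "\<dots> \<le> s * (s * e)" using inner s by (simp add: mult_left_mono)
      finally have "p (s *\<^sub>R (D (y + s *\<^sub>R k) - D y) - (s * s) *\<^sub>R DD x) \<le> s * s * e"
        by (simp add: scaleR_diff_right mult.assoc)
      then show "p (s *\<^sub>R (D (x + \<tau> *\<^sub>R (s *\<^sub>R h) + s *\<^sub>R k) - D (x + \<tau> *\<^sub>R (s *\<^sub>R h))) - (s * s) *\<^sub>R DD x) \<le> s * s * e"
        unfolding y_def .
    qed (intro lcs_scale_mem[OF Y] DDm x)
    then show ?thesis by (simp add: G_def)
  qed
  show ?thesis
  proof (intro exI[of _ "r / 2"] conjI allI impI)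
    show "r / 2 > 0" using r by simp
    fix s assume s: "0 < s \<and> s \<le> r / 2"
    show "x + s *\<^sub>R h \<in> U" "x + s *\<^sub>R k \<in> U" "x + s *\<^sub>R h + s *\<^sub>R k \<in> U"
      using square[of s 0] square[of 0 s] square[of s s] s r CU by auto
    show "p (f (x + s *\<^sub>R h + s *\<^sub>R k) - f (x + s *\<^sub>R h) - (f (x + s *\<^sub>R k) - f x)
        - (s * s) *\<^sub>R dir_deriv Y U (\<lambda>y. dir_deriv Y U f y h) x k) \<le> s * s * e"
      using est[of s] s by (simp add: DD_def D_def)
  qed
qed

text \<open>
  The second difference is symmetric in \<open>h\<close> and \<open>k\<close>, and it approximates \<open>s * s\<close> times either of the two
  iterated derivatives.
\<close>

lemma schwarz_positive:
  assumes X: "lcs X" and Y: "lcs Y" and U: "mb_dom X U" and f: "smooth_on_lcs X U Y f"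
    and x: "x \<in> U" and h: "h \<in> topspace X" and k: "k \<in> topspace X"
    and hp: "\<And>t. 0 \<le> t \<Longrightarrow> t \<le> d \<Longrightarrow> x + t *\<^sub>R h \<in> U" and kp: "\<And>t. 0 \<le> t \<Longrightarrow> t \<le> d \<Longrightarrow> x + t *\<^sub>R k \<in> U" and d: "d > 0"
  shows "dir_deriv Y U (\<lambda>y. dir_deriv Y U f y h) x k = dir_deriv Y U (\<lambda>y. dir_deriv Y U f y k) x h"
    (is "?a = ?b")
proof -
  have am: "?a \<in> topspace Y" and bm: "?b \<in> topspace Y"
    using C1map_deriv_mem[OF smooth_on_C1map[OF X Y U smooth_on_dir[OF X Y U f h]] x k]
      C1map_deriv_mem[OF smooth_on_C1map[OF X Y U smooth_on_dir[OF X Y U f k]] x h] .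
  have fm: "f y \<in> topspace Y" if "y \<in> U" for y using C1map_mem[OF smooth_on_C1map[OF X Y U f] U that] .
  have le: "p (?a - ?b) \<le> 0 + e" if p: "cont_seminorm Y p" and e: "e > 0" for p e
  proof -
    from e have e2: "e / 2 > 0" by simp
    obtain \<delta> where \<delta>: "\<delta> > 0" "\<And>s. 0 < s \<Longrightarrow> s \<le> \<delta> \<Longrightarrow> x + s *\<^sub>R h \<in> U \<and> x + s *\<^sub>R k \<in> U \<and> x + s *\<^sub>R h + s *\<^sub>R k \<in> U \<and>
       p (f (x + s *\<^sub>R h + s *\<^sub>R k) - f (x + s *\<^sub>R h) - (f (x + s *\<^sub>R k) - f x) - (s * s) *\<^sub>R ?a) \<le> s * s * (e / 2)"
      using second_difference_estimate[OF X Y U f x h k hp kp d p e2] by blast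
    obtain \<delta>' where \<delta>': "\<delta>' > 0" "\<And>s. 0 < s \<Longrightarrow> s \<le> \<delta>' \<Longrightarrow> x + s *\<^sub>R k \<in> U \<and> x + s *\<^sub>R h \<in> U \<and> x + s *\<^sub>R k + s *\<^sub>R h \<in> U \<and>
       p (f (x + s *\<^sub>R k + s *\<^sub>R h) - f (x + s *\<^sub>R k) - (f (x + s *\<^sub>R h) - f x) - (s * s) *\<^sub>R ?b) \<le> s * s * (e / 2)"
      using second_difference_estimate[OF X Y U f x k h kp hp d p e2] by blast
    define s where "s = min \<delta> \<delta>'"
    have s: "0 < s" "s \<le> \<delta>" "s \<le> \<delta>'" using \<delta>(1) \<delta>'(1) by (auto simp: s_def)
    define \<Delta> where "\<Delta> = f (x + s *\<^sub>R h + s *\<^sub>R k) - f (x + s *\<^sub>R h) - (f (x + s *\<^sub>R k) - f x)"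
    have comm: "x + s *\<^sub>R k + s *\<^sub>R h = x + s *\<^sub>R h + s *\<^sub>R k" by simp
    have \<Delta>': "f (x + s *\<^sub>R k + s *\<^sub>R h) - f (x + s *\<^sub>R k) - (f (x + s *\<^sub>R h) - f x) = \<Delta>"
      unfolding comm \<Delta>_def by (simp only: diff_diff_eq2 diff_diff_add add_diff_eq) (simp add: algebra_simps)
    have 1: "p (\<Delta> - (s * s) *\<^sub>R ?a) \<le> s * s * (e / 2)" using \<delta>(2)[OF s(1,2)] by (simp only: \<Delta>_def)
    have 2: "p (\<Delta> - (s * s) *\<^sub>R ?b) \<le> s * s * (e / 2)" using \<delta>'(2)[OF s(1,3)] by (simp only: \<Delta>')
    have \<Delta>m: "\<Delta> \<in> topspace Y" unfolding \<Delta>_def using \<delta>(2)[OF s(1,2)] x by (intro lcs_diff_mem[OF Y] fm) auto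
    have sa: "(s * s) *\<^sub>R ?a \<in> topspace Y" "(s * s) *\<^sub>R ?b \<in> topspace Y" using lcs_scale_mem[OF Y] am bm by auto
    have "s * s * p (?a - ?b) = p ((s * s) *\<^sub>R (?a - ?b))"
      using seminorm_scale[OF p lcs_diff_mem[OF Y am bm], of "s * s"] by simp
    also have "\<dots> \<le> p ((s * s) *\<^sub>R ?a - \<Delta>) + p (\<Delta> - (s * s) *\<^sub>R ?b)"
      using seminorm_diff_triangle[OF Y p sa(1) \<Delta>m sa(2)] by (simp add: scaleR_diff_right)
    also have "p ((s * s) *\<^sub>R ?a - \<Delta>) = p (\<Delta> - (s * s) *\<^sub>R ?a)" by (rule seminorm_commute[OF Y p sa(1) \<Delta>m])
    finally have "s * s * p (?a - ?b) \<le> s * s * e" using 1 2 by (simp add: field_simps)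
    then show ?thesis using s(1) by simp
  qed
  show ?thesis
  proof (rule seminorm_separates[OF Y am bm])
    fix p assume p: "cont_seminorm Y p"
    have "p (?a - ?b) \<le> 0" by (rule field_le_epsilon) (rule le[OF p])
    then show "p (?a - ?b) = 0" using seminorm_nonneg[OF Y p lcs_diff_mem[OF Y am bm]] by simp
  qed
qed

text \<open>
  At a boundary point \<open>h\<close> or \<open>k\<close> may point out of the domain. Then its negative points into the domain, and
  the signs cancel because both sides are homogeneous in \<open>h\<close> and in \<open>k\<close>.
\<close>

lemma schwarz:
  assumes X: "lcs X" and Y: "lcs Y" and U: "mb_dom X U" and f: "smooth_on_lcs X U Y f"
    and x: "x \<in> U" and h: "h \<in> topspace X" and k: "k \<in> topspace X"
  shows "dir_deriv Y U (\<lambda>y. dir_deriv Y U f y h) x k = dir_deriv Y U (\<lambda>y. dir_deriv Y U f y k) x h"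
proof -
  have scale: "dir_deriv Y U (\<lambda>y. dir_deriv Y U f y (a *\<^sub>R h)) x (b *\<^sub>R k) = (a * b) *\<^sub>R dir_deriv Y U (\<lambda>y. dir_deriv Y U f y h) x k"
    if h: "h \<in> topspace X" and k: "k \<in> topspace X" for a b h k
  proof -
    have C1: "C1map X U Y f (dir_deriv Y U f)" by (rule smooth_on_C1map[OF X Y U f])
    have D1: "C1map X U Y (\<lambda>y. dir_deriv Y U f y h) (dir_deriv Y U (\<lambda>y. dir_deriv Y U f y h))"
      by (rule smooth_on_C1map[OF X Y U smooth_on_dir[OF X Y U f h]])
    have eq: "dir_deriv Y U f y (a *\<^sub>R h) = a *\<^sub>R dir_deriv Y U f y h" if "y \<in> U" for y
      by (rule dir_deriv_eq[OF X lcs_Hausdorff[OF Y] U that lcs_scale_mem[OF X h]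
        has_dir_deriv_homogeneous[OF Y that C1map_has[OF C1 that h]]])
    have "dir_deriv Y U (\<lambda>y. dir_deriv Y U f y (a *\<^sub>R h)) x (b *\<^sub>R k) = dir_deriv Y U (\<lambda>y. a *\<^sub>R dir_deriv Y U f y h) x (b *\<^sub>R k)"
      by (rule dir_deriv_cong[OF x eq])
    also have "\<dots> = a *\<^sub>R b *\<^sub>R dir_deriv Y U (\<lambda>y. dir_deriv Y U f y h) x k"
      by (rule dir_deriv_eq[OF X lcs_Hausdorff[OF Y] U x lcs_scale_mem[OF X k]
        has_dir_deriv_scale[OF Y has_dir_deriv_homogeneous[OF Y x C1map_has[OF D1 x k]]]])
    finally show ?thesis by simp
  qed
  obtain \<sigma> \<delta> :: real where s: "\<sigma> = 1 \<or> \<sigma> = -1" "\<delta> > 0" "\<And>t. 0 \<le> t \<Longrightarrow> t \<le> \<delta> \<Longrightarrow> x + (\<sigma> * t) *\<^sub>R h \<in> U"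
    using mb_dom_direction[OF X U x h] by blast
  obtain \<tau> \<delta>' :: real where t: "\<tau> = 1 \<or> \<tau> = -1" "\<delta>' > 0" "\<And>t. 0 \<le> t \<Longrightarrow> t \<le> \<delta>' \<Longrightarrow> x + (\<tau> * t) *\<^sub>R k \<in> U"
    using mb_dom_direction[OF X U x k] by blast
  have "dir_deriv Y U (\<lambda>y. dir_deriv Y U f y (\<sigma> *\<^sub>R h)) x (\<tau> *\<^sub>R k) = dir_deriv Y U (\<lambda>y. dir_deriv Y U f y (\<tau> *\<^sub>R k)) x (\<sigma> *\<^sub>R h)"
    by (rule schwarz_positive[OF X Y U f x lcs_scale_mem[OF X h] lcs_scale_mem[OF X k], of "min \<delta> \<delta>'"])
      (use s(2,3) t(2,3) in \<open>auto simp: mult.commute\<close>)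
  then have "(\<sigma> * \<tau>) *\<^sub>R dir_deriv Y U (\<lambda>y. dir_deriv Y U f y h) x k = (\<sigma> * \<tau>) *\<^sub>R dir_deriv Y U (\<lambda>y. dir_deriv Y U f y k) x h"
    unfolding scale[OF h k] scale[OF k h] by (simp add: mult.commute)
  then show ?thesis using s(1) t(1) by auto
qed

section \<open>Manifolds with boundary and their tangent bundles\<close>

lemma continuous_map_Euclidean_proj: "continuous_map (Euclidean_space n) euclideanreal (\<lambda>x. x i)"
  unfolding Euclidean_space_def
  by (intro continuous_map_from_subtopology continuous_map_product_projection) simp

lemma continuous_map_into_Euclidean:
  "continuous_map T (Euclidean_space n) f \<longleftrightarrow>
    (\<forall>i. continuous_map T euclideanreal (\<lambda>x. f x i)) \<and> (\<forall>x\<in>topspace T. \<forall>i\<ge>n. f x i = 0)"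
  unfolding Euclidean_space_def continuous_map_in_subtopology continuous_map_componentwise_UNIV by auto

text \<open>
  Interleaving two vectors of length \<open>k\<close> gives one of length \<open>2 * k\<close>, so a tangent bundle is modelled on
  a Euclidean space again.
\<close>

lemma seq_square_Euclidean_space: "seq_square (Euclidean_space k) = Euclidean_space (2 * k)"
proof -
  have 1: "continuous_map (Euclidean_space (2 * k)) (seq_square (Euclidean_space k)) id"
    unfolding continuous_map_into_seq_square continuous_map_into_Euclidean seq_fst_def seq_snd_def id_def
    by (auto simp: topspace_Euclidean_space intro: continuous_map_Euclidean_proj)
  have zi: "z i = (if even i then seq_fst z (i div 2) else seq_snd z (i div 2))" for z :: "nat \<Rightarrow> real" and i
    by (simp add: seq_fst_def seq_snd_def)
  have 2: "continuous_map (seq_square (Euclidean_space k)) (Euclidean_space (2 * k)) id"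
    unfolding continuous_map_into_Euclidean
  proof (intro conjI allI ballI impI)
    fix i
    show "continuous_map (seq_square (Euclidean_space k)) euclideanreal (\<lambda>x. id x i)"
      unfolding id_def zi[of _ i]
      using continuous_map_compose'[OF continuous_map_seq_fst continuous_map_Euclidean_proj]
        continuous_map_compose'[OF continuous_map_seq_snd continuous_map_Euclidean_proj] by simp
    fix z assume "z \<in> topspace (seq_square (Euclidean_space k))" "2 * k \<le> i"
    then show "id z i = 0" unfolding id_def zi[of z i] by (auto simp: seq_times_def topspace_Euclidean_space)
  qed
  have "homeomorphic_maps (seq_square (Euclidean_space k)) (Euclidean_space (2 * k)) id id"
    using 1 2 by (simp add: homeomorphic_maps_def)
  then show ?thesis by (simp add: homeomorphic_maps_id)
qed

definition model_domains :: "nat \<Rightarrow> (nat \<Rightarrow> real) set set" where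
  "model_domains k = {topspace (Euclidean_space k), {x \<in> topspace (Euclidean_space k). 0 \<le> x 0}}"

text \<open>
  The local part of the definition of a manifold with boundary. It passes to the tangent bundle chart by
  chart, which makes it the right class for iterating the tangent functor.
\<close>

definition bman :: "nat \<Rightarrow> ('p, nat \<Rightarrow> real, 'i) manifold \<Rightarrow> bool" where
  "bman k N \<longleftrightarrow> mmodel N = Euclidean_space k \<and> lcs (mmodel N) \<and>
     topspace (mtop N) = (\<Union>i\<in>mindex N. mdom N i) \<and>
     (\<forall>i\<in>mindex N.
        openin (mtop N) (mdom N i) \<and>
        (\<exists>Q\<in>model_domains k. openin (subtopology (mmodel N) Q) (mchart N i ` mdom N i)) \<and>
        homeomorphic_map (subtopology (mtop N) (mdom N i))
          (subtopology (mmodel N) (mchart N i ` mdom N i)) (mchart N i)) \<and>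
     (\<forall>i\<in>mindex N. \<forall>j\<in>mindex N.
        smooth_on_lcs (mmodel N) (mchart N i ` (mdom N i \<inter> mdom N j)) (mmodel N)
          (mchart N j \<circ> chart_inv N i))"

lemma openin_subtopology_smaller:
  assumes "openin (subtopology X U) V" "V \<subseteq> W" "W \<subseteq> U"
  shows "openin (subtopology X W) V"
proof -
  obtain T where T: "openin X T" "V = T \<inter> U" using assms(1) unfolding openin_subtopology by blast
  have "V = T \<inter> W" using T(2) assms(2,3) by blast
  then show ?thesis using T(1) unfolding openin_subtopology by blast
qed

lemma finite_dim_manifold_bman: "finite_dim_manifold d M \<Longrightarrow> bman d M"
  unfolding finite_dim_manifold_def smooth_manifold_def bman_def model_domains_def by auto

text \<open>
  Chart image and overlap image.
\<close>

abbreviation (input) "cimg N i \<equiv> mchart N i ` mdom N i"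
abbreviation (input) "oimg N i j \<equiv> mchart N i ` (mdom N i \<inter> mdom N j)"

lemma half_dom_model_domains: "lcs (Euclidean_space k) \<Longrightarrow> Q \<in> model_domains k \<Longrightarrow> half_dom (Euclidean_space k) Q"
proof -
  assume L: "lcs (Euclidean_space k)" and "Q \<in> model_domains k"
  then consider "Q = topspace (Euclidean_space k)" | "Q = {x \<in> topspace (Euclidean_space k). 0 \<le> x 0}"
    by (auto simp: model_domains_def)
  then show ?thesis
  proof cases
    case 1
    then show ?thesis using half_dom_topspace[OF L] by simp
  next
    case 2
    have "convex (topspace (Euclidean_space k) \<inter> (\<lambda>x. x 0) -` {0..})"
      by (intro convex_Int lcs_convex[OF L] convex_linear_vimage linear_eval) simp
    moreover have "topspace (Euclidean_space k) \<inter> (\<lambda>x. x 0) -` {0..} = Q" using 2 by auto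
    ultimately have "convex Q" by simp
    then show ?thesis unfolding half_dom_def 2 using lcs_add_mem[OF L] lcs_diff_mem[OF L] by auto
  qed
qed

context
  fixes k :: nat and N :: "('p, nat \<Rightarrow> real, 'i) manifold"
  assumes N: "bman k N"
begin

lemma bman_lcs: "lcs (mmodel N)" and bman_model: "mmodel N = Euclidean_space k"
  and bman_topspace: "topspace (mtop N) = (\<Union>i\<in>mindex N. mdom N i)"
  using N by (auto simp: bman_def)

lemma bman_dom_open: "i \<in> mindex N \<Longrightarrow> openin (mtop N) (mdom N i)"
  using N by (auto simp: bman_def)

lemma bman_homeo: "i \<in> mindex N \<Longrightarrow> homeomorphic_map (subtopology (mtop N) (mdom N i)) (subtopology (mmodel N) (cimg N i)) (mchart N i)"
  using N by (auto simp: bman_def)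

lemma bman_trans_smooth: "i \<in> mindex N \<Longrightarrow> j \<in> mindex N \<Longrightarrow> smooth_on_lcs (mmodel N) (oimg N i j) (mmodel N) (\<lambda>x. mchart N j (chart_inv N i x))"
  using N by (auto simp: bman_def o_def)

lemma bman_dom_sub: "i \<in> mindex N \<Longrightarrow> mdom N i \<subseteq> topspace (mtop N)"
  using bman_dom_open openin_subset by metis

lemma bman_topsub: "i \<in> mindex N \<Longrightarrow> topspace (subtopology (mtop N) (mdom N i)) = mdom N i"
  using bman_dom_sub by auto

lemma bman_inj: "i \<in> mindex N \<Longrightarrow> inj_on (mchart N i) (mdom N i)"
  using homeomorphic_imp_injective_map[OF bman_homeo] bman_topsub by metis

lemma bman_inv: "i \<in> mindex N \<Longrightarrow> p \<in> mdom N i \<Longrightarrow> chart_inv N i (mchart N i p) = p"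
  unfolding chart_inv_def using bman_inj inv_into_f_f by metis

lemma chart_inv_mem: "x \<in> cimg N i \<Longrightarrow> chart_inv N i x \<in> mdom N i"
  unfolding chart_inv_def by (rule inv_into_into)

lemma chart_chart_inv: "x \<in> cimg N i \<Longrightarrow> mchart N i (chart_inv N i x) = x"
  unfolding chart_inv_def by (rule f_inv_into_f)

lemma chart_inv_in_topspace: "i \<in> mindex N \<Longrightarrow> x \<in> cimg N i \<Longrightarrow> chart_inv N i x \<in> topspace (mtop N)"
  using chart_inv_mem bman_dom_sub by blast

lemma bman_cimg_dom: assumes i: "i \<in> mindex N" shows "mb_dom (mmodel N) (cimg N i)"
proof -
  obtain Q where "Q \<in> model_domains k" "openin (subtopology (mmodel N) Q) (cimg N i)"
    using N i unfolding bman_def by blast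
  then show ?thesis using half_dom_model_domains[of k Q] bman_lcs bman_model unfolding mb_dom_def by metis
qed

lemma bman_cimg_sub: "i \<in> mindex N \<Longrightarrow> cimg N i \<subseteq> topspace (mmodel N)"
  using mb_dom_subset[OF bman_cimg_dom] .

lemma bman_image_open:
  assumes i: "i \<in> mindex N" and O: "openin (mtop N) O'"
  shows "openin (subtopology (mmodel N) (cimg N i)) (mchart N i ` (mdom N i \<inter> O'))"
proof -
  have "openin (subtopology (mtop N) (mdom N i)) (mdom N i \<inter> O')"
    using O by (simp add: openin_subtopology_Int2)
  then show ?thesis using homeomorphic_imp_open_map[OF bman_homeo[OF i]] by (simp add: open_map_def)
qed

lemma bman_chart_continuous: "i \<in> mindex N \<Longrightarrow> continuous_map (subtopology (mtop N) (mdom N i)) (subtopology (mmodel N) (cimg N i)) (mchart N i)"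
  by (rule homeomorphic_imp_continuous_map[OF bman_homeo])

lemma bman_chart_inv_continuous: assumes i: "i \<in> mindex N"
  shows "continuous_map (subtopology (mmodel N) (cimg N i)) (mtop N) (chart_inv N i)"
  unfolding continuous_map_def
proof safe
  fix x assume "x \<in> topspace (subtopology (mmodel N) (cimg N i))"
  then have "x \<in> cimg N i" by simp
  then show "chart_inv N i x \<in> topspace (mtop N)" by (rule chart_inv_in_topspace[OF i])
next
  fix O' assume O: "openin (mtop N) O'"
  have "{x \<in> topspace (subtopology (mmodel N) (cimg N i)). chart_inv N i x \<in> O'} = mchart N i ` (mdom N i \<inter> O')"
  proof (intro equalityI subsetI)
    fix x assume "x \<in> {x \<in> topspace (subtopology (mmodel N) (cimg N i)). chart_inv N i x \<in> O'}"
    then have x: "x \<in> cimg N i" "chart_inv N i x \<in> O'" by auto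
    then show "x \<in> mchart N i ` (mdom N i \<inter> O')"
      using chart_inv_mem[OF x(1)] chart_chart_inv[OF x(1)] by (intro image_eqI[of _ _ "chart_inv N i x"]) auto
  next
    fix x assume "x \<in> mchart N i ` (mdom N i \<inter> O')"
    then obtain p where p: "p \<in> mdom N i" "p \<in> O'" "x = mchart N i p" by blast
    then show "x \<in> {x \<in> topspace (subtopology (mmodel N) (cimg N i)). chart_inv N i x \<in> O'}"
      using bman_cimg_sub[OF i] bman_inv[OF i p(1)] by auto
  qed
  then show "openin (subtopology (mmodel N) (cimg N i)) {x \<in> topspace (subtopology (mmodel N) (cimg N i)). chart_inv N i x \<in> O'}"
    using bman_image_open[OF i O] by simp
qed

lemma bman_oimg_open: "i \<in> mindex N \<Longrightarrow> j \<in> mindex N \<Longrightarrow> openin (subtopology (mmodel N) (cimg N i)) (oimg N i j)"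
  by (rule bman_image_open[OF _ bman_dom_open])

lemma bman_oimg_dom: "i \<in> mindex N \<Longrightarrow> j \<in> mindex N \<Longrightarrow> mb_dom (mmodel N) (oimg N i j)"
  using mb_dom_open_subset[OF bman_cimg_dom bman_oimg_open] .

lemma oimg_iff: "i \<in> mindex N \<Longrightarrow> x \<in> oimg N i j \<longleftrightarrow> x \<in> cimg N i \<and> chart_inv N i x \<in> mdom N j"
proof -
  assume i: "i \<in> mindex N"
  show ?thesis
  proof
    assume "x \<in> oimg N i j"
    then obtain p where "p \<in> mdom N i" "p \<in> mdom N j" "x = mchart N i p" by blast
    then show "x \<in> cimg N i \<and> chart_inv N i x \<in> mdom N j" using bman_inv[OF i] by simp
  next
    assume x: "x \<in> cimg N i \<and> chart_inv N i x \<in> mdom N j"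
    then show "x \<in> oimg N i j"
      using chart_inv_mem[of x i] chart_chart_inv[of x i] by (intro image_eqI[of _ _ "chart_inv N i x"]) auto
  qed
qed

lemma bman_trans_inv: "j \<in> mindex N \<Longrightarrow> i \<in> mindex N \<Longrightarrow> x \<in> oimg N i j \<Longrightarrow> chart_inv N j (mchart N j (chart_inv N i x)) = chart_inv N i x"
  using oimg_iff bman_inv by metis

text \<open>
  The derivative of a chart change, by which the representatives of a tangent vector transform.
\<close>

definition dtrans :: "'i \<Rightarrow> 'i \<Rightarrow> (nat \<Rightarrow> real) \<Rightarrow> (nat \<Rightarrow> real) \<Rightarrow> nat \<Rightarrow> real" where
  "dtrans i j x v = dir_deriv (mmodel N) (oimg N i j) (\<lambda>x. mchart N j (chart_inv N i x)) x v"

lemma dtrans_C1: "i \<in> mindex N \<Longrightarrow> j \<in> mindex N \<Longrightarrow> C1map (mmodel N) (oimg N i j) (mmodel N) (\<lambda>x. mchart N j (chart_inv N i x)) (dtrans i j)"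
  using smooth_on_C1map[OF bman_lcs bman_lcs bman_oimg_dom bman_trans_smooth] unfolding dtrans_def[abs_def] by blast

lemma dtrans_mem: "i \<in> mindex N \<Longrightarrow> j \<in> mindex N \<Longrightarrow> x \<in> oimg N i j \<Longrightarrow> v \<in> topspace (mmodel N) \<Longrightarrow> dtrans i j x v \<in> topspace (mmodel N)"
  using C1map_deriv_mem[OF dtrans_C1] .

lemma dtrans_id: assumes i: "i \<in> mindex N" and x: "x \<in> cimg N i" and v: "v \<in> topspace (mmodel N)"
  shows "dtrans i i x v = v"
proof -
  have xi: "x \<in> oimg N i i" using x by simp
  have "has_dir_deriv (mmodel N) (oimg N i i) (\<lambda>x. x) x v v"
    using C1map_has[OF C1map_linear[OF mb_dom_subset[OF bman_oimg_dom[OF i i]] linear_ident] xi v] by simp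
  then have "has_dir_deriv (mmodel N) (oimg N i i) (\<lambda>x. mchart N i (chart_inv N i x)) x v v"
    by (rule has_dir_deriv_cong_imp[rotated 2]) (use xi chart_chart_inv in auto)
  then show ?thesis unfolding dtrans_def
    by (rule dir_deriv_eq[OF bman_lcs lcs_Hausdorff[OF bman_lcs] bman_oimg_dom[OF i i] xi v])
qed

text \<open>
  This is the chain rule on the part of \<open>O'\<close> that lies in both charts; directional derivatives do not change
  when the domain shrinks to a relatively open subset.
\<close>

lemma deriv_change_chart:
  fixes F :: "'b::real_vector topology"
  assumes i: "i \<in> mindex N" and j: "j \<in> mindex N" and F: "lcs F" and O: "openin (mtop N) O'"
    and f: "C1map (mmodel N) (mchart N j ` (mdom N j \<inter> O')) F (\<lambda>x. f (chart_inv N j x)) df"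
    and x: "x \<in> mchart N i ` (mdom N i \<inter> O')" "x \<in> oimg N i j" and v: "v \<in> topspace (mmodel N)"
  shows "has_dir_deriv F (mchart N i ` (mdom N i \<inter> O')) (\<lambda>x. f (chart_inv N i x)) x v
      (df (mchart N j (chart_inv N i x)) (dtrans i j x v))"
proof -
  let ?U = "mchart N i ` (mdom N i \<inter> (mdom N j \<inter> O'))" and ?V = "mchart N j ` (mdom N j \<inter> O')"
  let ?W = "mchart N i ` (mdom N i \<inter> O')"
  have xU: "x \<in> ?U"
  proof -
    obtain p q where "p \<in> mdom N i" "p \<in> O'" "x = mchart N i p" "q \<in> mdom N i" "q \<in> mdom N j" "x = mchart N i q" using x by blast
    moreover then have "p = q" using bman_inj[OF i] by (auto simp: inj_on_def)
    ultimately show ?thesis by blast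
  qed
  have Udom: "mb_dom (mmodel N) ?W"
    by (rule mb_dom_open_subset[OF bman_cimg_dom[OF i] bman_image_open[OF i O]])
  have Vdom: "mb_dom (mmodel N) ?V"
    by (rule mb_dom_open_subset[OF bman_cimg_dom[OF j] bman_image_open[OF j O]])
  have sub: "?U \<subseteq> oimg N i j" by blast
  have maps: "(\<lambda>x. mchart N j (chart_inv N i x)) ` ?U \<subseteq> ?V"
    using bman_inv[OF i] by auto
  have "has_dir_deriv (mmodel N) ?U (\<lambda>x. mchart N j (chart_inv N i x)) x v (dtrans i j x v)"
    by (rule has_dir_deriv_mono[OF C1map_has[OF dtrans_C1[OF i j] x(2) v] sub])
  from has_dir_deriv_compose[OF bman_lcs F Vdom f maps xU this]
  have "has_dir_deriv F ?U (\<lambda>x. f (chart_inv N j (mchart N j (chart_inv N i x)))) x v (df (mchart N j (chart_inv N i x)) (dtrans i j x v))" .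
  then have 1: "has_dir_deriv F ?U (\<lambda>x. f (chart_inv N i x)) x v (df (mchart N j (chart_inv N i x)) (dtrans i j x v))"
  proof (rule has_dir_deriv_cong_imp[rotated 2])
    fix y assume "y \<in> ?U"
    then have "y \<in> oimg N i j" by blast
    then show "f (chart_inv N j (mchart N j (chart_inv N i y))) = f (chart_inv N i y)"
      using bman_trans_inv[OF j i] by simp
  qed (rule xU)
  have "openin (mtop N) (mdom N j \<inter> O')" using O bman_dom_open[OF j] by blast
  then have "openin (subtopology (mmodel N) (cimg N i)) ?U" by (rule bman_image_open[OF i])
  then have UW: "openin (subtopology (mmodel N) ?W) ?U"
    by (rule openin_subtopology_smaller) blast+
  show ?thesis
    using 1 unfolding has_dir_deriv_subset(1)[OF bman_lcs mb_dom_subset[OF Udom] UW xU v] .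
qed

text \<open>
  The change of charts for derivatives, applied to a third chart as the function.
\<close>

lemma dtrans_cocycle:
  assumes i: "i \<in> mindex N" and j: "j \<in> mindex N" and l: "l \<in> mindex N"
    and x: "x \<in> oimg N i j" "x \<in> oimg N i l" and v: "v \<in> topspace (mmodel N)"
  shows "dtrans j l (mchart N j (chart_inv N i x)) (dtrans i j x v) = dtrans i l x v"
proof -
  have "has_dir_deriv (mmodel N) (oimg N i l) (\<lambda>x. mchart N l (chart_inv N i x)) x v
      (dtrans j l (mchart N j (chart_inv N i x)) (dtrans i j x v))"
    by (rule deriv_change_chart[OF i j bman_lcs bman_dom_open[OF l] dtrans_C1[OF j l] x(2,1) v])
  from dir_deriv_eq[OF bman_lcs lcs_Hausdorff[OF bman_lcs] bman_oimg_dom[OF i l] x(2) v this]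
  show ?thesis by (simp add: dtrans_def)
qed

text \<open>
  The tangent vector at \<open>p\<close> that the chart \<open>i\<close> represents by \<open>v\<close>. The value at an index without a chart
  around \<open>p\<close> is the normalisation in \<open>tangent_space\<close>.
\<close>

definition tvec :: "'i \<Rightarrow> 'p \<Rightarrow> (nat \<Rightarrow> real) \<Rightarrow> 'i \<Rightarrow> nat \<Rightarrow> real" where
  "tvec i p v = (\<lambda>j. if j \<in> mindex N \<and> p \<in> mdom N j then dtrans i j (mchart N i p) v else 0)"

lemma mchart_oimg: "p \<in> mdom N i \<Longrightarrow> p \<in> mdom N j \<Longrightarrow> mchart N i p \<in> oimg N i j"
  by blast

lemma tvec_self: "i \<in> mindex N \<Longrightarrow> p \<in> mdom N i \<Longrightarrow> v \<in> topspace (mmodel N) \<Longrightarrow> tvec i p v i = v"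
  by (simp add: tvec_def dtrans_id)

lemma tangent_space_alt:
  "v \<in> tangent_space N p \<longleftrightarrow> (\<forall>i. i \<in> mindex N \<and> p \<in> mdom N i \<longrightarrow> v i \<in> topspace (mmodel N)) \<and>
     (\<forall>i. \<not> (i \<in> mindex N \<and> p \<in> mdom N i) \<longrightarrow> v i = 0) \<and>
     (\<forall>i\<in>mindex N. \<forall>j\<in>mindex N. p \<in> mdom N i \<and> p \<in> mdom N j \<longrightarrow> v j = dtrans i j (mchart N i p) (v i))"
  unfolding tangent_space_def dtrans_def o_def by (rule mem_Collect_eq)

text \<open>
  The transformation rule between two further charts is the cocycle identity.
\<close>

lemma tvec_tangent:
  assumes i: "i \<in> mindex N" and p: "p \<in> mdom N i" and v: "v \<in> topspace (mmodel N)"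
  shows "tvec i p v \<in> tangent_space N p"
proof -
  have "tvec i p v l = dtrans j l (mchart N j p) (tvec i p v j)"
    if jl: "j \<in> mindex N" "l \<in> mindex N" "p \<in> mdom N j" "p \<in> mdom N l" for j l
    using dtrans_cocycle[OF i jl(1,2) mchart_oimg[OF p jl(3)] mchart_oimg[OF p jl(4)] v] jl
    by (simp add: tvec_def bman_inv[OF i p])
  moreover have "tvec i p v j \<in> topspace (mmodel N)" if "j \<in> mindex N" "p \<in> mdom N j" for j
    using dtrans_mem[OF i that(1) mchart_oimg[OF p that(2)] v] that by (simp add: tvec_def)
  ultimately show ?thesis
    unfolding tangent_space_alt by (metis (no_types, lifting) tvec_def)
qed

lemma tangent_space_eq_tvec:
  assumes i: "i \<in> mindex N" and p: "p \<in> mdom N i" and w: "w \<in> tangent_space N p"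
  shows "w i \<in> topspace (mmodel N)" "tvec i p (w i) = w"
proof -
  show "w i \<in> topspace (mmodel N)" using w i p unfolding tangent_space_alt by blast
  show "tvec i p (w i) = w"
  proof
    fix j
    show "tvec i p (w i) j = w j"
    proof (cases "j \<in> mindex N \<and> p \<in> mdom N j")
      case True
      then have "w j = dtrans i j (mchart N i p) (w i)"
        using w i p unfolding tangent_space_alt by blast
      then show ?thesis using True by (simp add: tvec_def)
    next
      case False
      then have "w j = 0" using w unfolding tangent_space_alt by blast
      moreover have "tvec i p (w i) j = 0" unfolding tvec_def using False by (rule if_not_P)
      ultimately show ?thesis by simp
    qed
  qed
qed

end

lemma linear_seq_fst_snd: "linear (\<lambda>z. (seq_fst z, seq_snd z))"
  by (auto intro!: linearI simp: seq_fst_add seq_snd_add seq_fst_scale seq_snd_scale)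

lemma continuous_map_seq_fst_snd: "continuous_map (seq_square X) (prod_topology X X) (\<lambda>z. (seq_fst z, seq_snd z))"
  by (intro continuous_map_pairedI continuous_map_seq_fst continuous_map_seq_snd)

lemma smooth_on_seq_deriv:
  assumes X: "lcs X" and Y: "lcs Y" and U: "mb_dom X U" and f: "smooth_on_lcs X U Y f"
  shows "smooth_on_lcs (seq_square X) (seq_times U (topspace X)) Y (\<lambda>z. dir_deriv Y U f (seq_fst z) (seq_snd z))"
proof -
  have "(\<lambda>z. (seq_fst z, seq_snd z)) ` seq_times U (topspace X) \<subseteq> U \<times> topspace X"
    by (auto simp: seq_times_def)
  from smooth_on_prelinear[OF lcs_seq_square[OF X] lcs_prod[OF X X] Y mb_dom_seq_square[OF X U] mb_dom_Times[OF X U openin_topspace]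
      linear_seq_fst_snd continuous_map_seq_fst_snd this smooth_on_deriv[OF X Y U f]]
  show ?thesis by simp
qed

lemma smooth_on_tangent:
  assumes X: "lcs X" and Y: "lcs Y" and U: "mb_dom X U" and f: "smooth_on_lcs X U Y f"
  shows "smooth_on_lcs (seq_square X) (seq_times U (topspace X)) (seq_square Y)
     (\<lambda>z. seq_pair (f (seq_fst z)) (dir_deriv Y U f (seq_fst z) (seq_snd z)))"
proof (rule smooth_on_seq_pair[OF lcs_seq_square[OF X] Y mb_dom_seq_square[OF X U] _ smooth_on_seq_deriv[OF X Y U f]])
  show "smooth_on_lcs (seq_square X) (seq_times U (topspace X)) Y (\<lambda>z. f (seq_fst z))"
    by (rule smooth_on_prelinear[OF lcs_seq_square[OF X] X Y mb_dom_seq_square[OF X U] U linear_seq_fst continuous_map_seq_fst _ f])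
      (auto simp: seq_times_def)
qed

lemma tangent_bundle_sel:
  "mmodel (tangent_bundle N) = seq_square (mmodel N)" "mindex (tangent_bundle N) = mindex N"
  "mdom (tangent_bundle N) = tangent_dom N" "mchart (tangent_bundle N) = tangent_chart N"
  by (simp_all add: tangent_bundle_def)

lemma tangent_dom_iff:
  "q \<in> tangent_dom N i \<longleftrightarrow> snd q \<noteq> [] \<and> (fst q, tl (snd q)) \<in> mdom N i \<and> hd (snd q) \<in> tangent_space N (fst q, tl (snd q))"
proof (cases q)
  case (Pair m ws)
  then show ?thesis by (cases ws) (auto simp: tangent_dom_def)
qed

text \<open>
  The inverse of \<open>tangent_chart N i\<close>.
\<close>

definition tangent_lift :: "(('m, 'i) tpoint, nat \<Rightarrow> real, 'i) manifold \<Rightarrow> 'i \<Rightarrow> (nat \<Rightarrow> real) \<Rightarrow> ('m, 'i) tpoint" where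
  "tangent_lift N i z = (fst (chart_inv N i (seq_fst z)), tvec N i (chart_inv N i (seq_fst z)) (seq_snd z) # snd (chart_inv N i (seq_fst z)))"

lemma tangent_lift_sel:
  "(fst (tangent_lift N i z), tl (snd (tangent_lift N i z))) = chart_inv N i (seq_fst z)"
  "hd (snd (tangent_lift N i z)) = tvec N i (chart_inv N i (seq_fst z)) (seq_snd z)"
  "snd (tangent_lift N i z) \<noteq> []"
  by (simp_all add: tangent_lift_def)

lemma tangent_chart_alt: "tangent_chart N i q = seq_pair (mchart N i (fst q, tl (snd q))) (hd (snd q) i)"
  by (simp add: tangent_chart_def case_prod_unfold)

context
  fixes k :: nat and N :: "(('m, 'i) tpoint, nat \<Rightarrow> real, 'i) manifold"
  assumes N: "bman k N"
begin

lemma tangent_lift_mem: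
  assumes i: "i \<in> mindex N" and z: "z \<in> seq_times (cimg N i) (topspace (mmodel N))"
  shows "tangent_lift N i z \<in> tangent_dom N i" "tangent_chart N i (tangent_lift N i z) = z"
proof -
  have x: "seq_fst z \<in> cimg N i" "seq_snd z \<in> topspace (mmodel N)" using z by (auto simp: seq_times_def)
  have p: "chart_inv N i (seq_fst z) \<in> mdom N i" by (rule chart_inv_mem[OF N x(1)])
  show "tangent_lift N i z \<in> tangent_dom N i"
    unfolding tangent_dom_iff tangent_lift_sel(1,2) using tangent_lift_sel(3)[of N i z] p tvec_tangent[OF N i p x(2)] by blast
  show "tangent_chart N i (tangent_lift N i z) = z"
    unfolding tangent_chart_alt tangent_lift_sel(1,2) tvec_self[OF N i p x(2)] chart_chart_inv[OF N x(1)] by simp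
qed

lemma tangent_chart_mem:
  assumes i: "i \<in> mindex N" and q: "q \<in> tangent_dom N i"
  shows "tangent_chart N i q \<in> seq_times (cimg N i) (topspace (mmodel N))" "tangent_lift N i (tangent_chart N i q) = q"
proof -
  define p where "p = (fst q, tl (snd q))"
  have q': "snd q \<noteq> []" "p \<in> mdom N i" "hd (snd q) \<in> tangent_space N p" using q unfolding tangent_dom_iff p_def by auto
  note t = tangent_space_eq_tvec[OF N i q'(2,3)]
  show "tangent_chart N i q \<in> seq_times (cimg N i) (topspace (mmodel N))"
    unfolding tangent_chart_alt p_def[symmetric] using q'(2) t(1) by (simp add: seq_times_def)
  have "tangent_lift N i (tangent_chart N i q) = (fst p, hd (snd q) # snd p)"
    unfolding tangent_chart_alt tangent_lift_def p_def[symmetric] by (simp add: bman_inv[OF N i q'(2)] t(2))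
  then show "tangent_lift N i (tangent_chart N i q) = q" using q'(1) by (simp add: p_def prod_eq_iff)
qed

lemma tangent_cimg: "i \<in> mindex N \<Longrightarrow> tangent_chart N i ` tangent_dom N i = seq_times (cimg N i) (topspace (mmodel N))"
proof (intro equalityI subsetI)
  fix z assume i: "i \<in> mindex N" and "z \<in> tangent_chart N i ` tangent_dom N i"
  then show "z \<in> seq_times (cimg N i) (topspace (mmodel N))" using tangent_chart_mem(1)[OF i] by blast
next
  fix z assume i: "i \<in> mindex N" and z: "z \<in> seq_times (cimg N i) (topspace (mmodel N))"
  show "z \<in> tangent_chart N i ` tangent_dom N i"
    using tangent_lift_mem[OF i z] by (intro image_eqI[of _ _ "tangent_lift N i z"]) simp_all
qed

lemma tangent_chart_inj: "i \<in> mindex N \<Longrightarrow> inj_on (tangent_chart N i) (tangent_dom N i)"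
  by (rule inj_on_inverseI[of _ "tangent_lift N i"]) (rule tangent_chart_mem(2))

lemma tangent_chart_inv:
  assumes i: "i \<in> mindex N" and z: "z \<in> seq_times (cimg N i) (topspace (mmodel N))"
  shows "chart_inv (tangent_bundle N) i z = tangent_lift N i z"
  unfolding chart_inv_def tangent_bundle_sel using inv_into_f_eq[OF tangent_chart_inj[OF i] tangent_lift_mem[OF i z]] .

lemma tangent_lift_dom_iff:
  assumes i: "i \<in> mindex N" and z: "z \<in> seq_times (cimg N i) (topspace (mmodel N))"
  shows "tangent_lift N i z \<in> tangent_dom N j \<longleftrightarrow> seq_fst z \<in> oimg N i j"
proof -
  have x: "seq_fst z \<in> cimg N i" "seq_snd z \<in> topspace (mmodel N)" using z by (auto simp: seq_times_def)
  have "tvec N i (chart_inv N i (seq_fst z)) (seq_snd z) \<in> tangent_space N (chart_inv N i (seq_fst z))"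
    by (rule tvec_tangent[OF N i chart_inv_mem[OF N x(1)] x(2)])
  then show ?thesis unfolding tangent_dom_iff tangent_lift_sel(1,2) oimg_iff[OF N i] using x(1) tangent_lift_sel(3)[of N i z] by blast
qed

lemma tangent_oimg:
  assumes i: "i \<in> mindex N"
  shows "tangent_chart N i ` (tangent_dom N i \<inter> tangent_dom N j) = seq_times (oimg N i j) (topspace (mmodel N))"
proof (intro equalityI subsetI)
  fix z assume "z \<in> tangent_chart N i ` (tangent_dom N i \<inter> tangent_dom N j)"
  then obtain q where q: "q \<in> tangent_dom N i" "q \<in> tangent_dom N j" "z = tangent_chart N i q" by blast
  note t = tangent_chart_mem[OF i q(1), folded q(3)]
  then have "seq_fst z \<in> oimg N i j" using tangent_lift_dom_iff[OF i t(1)] q(2) by simp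
  then show "z \<in> seq_times (oimg N i j) (topspace (mmodel N))" using t(1) by (simp add: seq_times_def)
next
  fix z assume z: "z \<in> seq_times (oimg N i j) (topspace (mmodel N))"
  then have z': "z \<in> seq_times (cimg N i) (topspace (mmodel N))" by (auto simp: seq_times_def)
  have "tangent_lift N i z \<in> tangent_dom N j" using tangent_lift_dom_iff[OF i z'] z by (simp add: seq_times_def)
  then show "z \<in> tangent_chart N i ` (tangent_dom N i \<inter> tangent_dom N j)"
    using tangent_lift_mem[OF i z'] by (intro image_eqI[of _ _ "tangent_lift N i z"]) auto
qed

lemma tangent_trans:
  assumes i: "i \<in> mindex N" and j: "j \<in> mindex N" and z: "z \<in> seq_times (oimg N i j) (topspace (mmodel N))"
  shows "tangent_chart N j (tangent_lift N i z) =
    seq_pair (mchart N j (chart_inv N i (seq_fst z))) (dtrans N i j (seq_fst z) (seq_snd z))"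
proof -
  have x: "seq_fst z \<in> cimg N i" "chart_inv N i (seq_fst z) \<in> mdom N j"
    using z oimg_iff[OF N i, of "seq_fst z" j] by (auto simp: seq_times_def)
  show ?thesis
    unfolding tangent_chart_alt tangent_lift_sel(1,2)
    using x j by (simp add: tvec_def[OF N] chart_chart_inv[OF N])
qed

lemma tangent_trans_smooth:
  assumes i: "i \<in> mindex N" and j: "j \<in> mindex N"
  shows "smooth_on_lcs (seq_square (mmodel N)) (seq_times (oimg N i j) (topspace (mmodel N))) (seq_square (mmodel N))
    (\<lambda>z. tangent_chart N j (tangent_lift N i z))"
  by (rule smooth_on_cong[OF smooth_on_tangent[OF bman_lcs[OF N] bman_lcs[OF N] bman_oimg_dom[OF N i j] bman_trans_smooth[OF N i j]]])
    (simp add: tangent_trans[OF i j] dtrans_def[OF N])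

lemma tangent_dom_generator:
  assumes i: "i \<in> mindex N"
  shows "tangent_dom N i \<in> {tangent_dom N i \<inter> tangent_chart N i -` V | i V. i \<in> mindex N \<and> openin (seq_square (mmodel N)) V}"
proof -
  have "tangent_dom N i \<inter> tangent_chart N i -` topspace (seq_square (mmodel N)) = tangent_dom N i"
    using tangent_chart_mem(1)[OF i] bman_cimg_sub[OF N i] unfolding topspace_seq_square seq_times_def by blast
  moreover have "openin (seq_square (mmodel N)) (topspace (seq_square (mmodel N)))" by (rule openin_topspace)
  ultimately show ?thesis using i unfolding mem_Collect_eq by metis
qed

lemma tangent_top: "mtop (tangent_bundle N) = topology_generated_by
   {tangent_dom N i \<inter> tangent_chart N i -` V | i V. i \<in> mindex N \<and> openin (seq_square (mmodel N)) V}"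
  by (simp add: tangent_bundle_def)

lemma tangent_dom_open: "i \<in> mindex N \<Longrightarrow> openin (mtop (tangent_bundle N)) (tangent_dom N i)"
  unfolding tangent_top by (rule topology_generated_by_Basis[OF tangent_dom_generator])

lemma tangent_topspace: "topspace (mtop (tangent_bundle N)) = (\<Union>i\<in>mindex N. tangent_dom N i)"
proof
  show "topspace (mtop (tangent_bundle N)) \<subseteq> (\<Union>i\<in>mindex N. tangent_dom N i)"
    unfolding tangent_top topology_generated_by_topspace by auto
  show "(\<Union>i\<in>mindex N. tangent_dom N i) \<subseteq> topspace (mtop (tangent_bundle N))"
    using openin_subset[OF tangent_dom_open] by (rule UN_least)
qed

text \<open>
  For continuity of the inverse chart the generators of the topology that come from other charts have to be
  considered as well; their preimages are open because the chart changes of the tangent bundle are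
  continuous.
\<close>

lemma tangent_homeo:
  assumes i: "i \<in> mindex N"
  shows "homeomorphic_map (subtopology (mtop (tangent_bundle N)) (tangent_dom N i))
     (subtopology (seq_square (mmodel N)) (tangent_chart N i ` tangent_dom N i)) (tangent_chart N i)"
proof -
  let ?S = "seq_square (mmodel N)" and ?T = "mtop (tangent_bundle N)"
  let ?C = "seq_times (cimg N i) (topspace (mmodel N))"
  have Csub: "?C \<subseteq> topspace ?S" using bman_cimg_sub[OF N i] by (auto simp: seq_times_def)
  have sub: "tangent_dom N i \<subseteq> topspace ?T" using openin_subset[OF tangent_dom_open[OF i]] .
  have 1: "continuous_map (subtopology ?T (tangent_dom N i)) (subtopology ?S ?C) (tangent_chart N i)"
    unfolding continuous_map_in_subtopology
  proof
    show "tangent_chart N i \<in> topspace (subtopology ?T (tangent_dom N i)) \<rightarrow> ?C" using tangent_chart_mem(1)[OF i] by auto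
    show "continuous_map (subtopology ?T (tangent_dom N i)) ?S (tangent_chart N i)"
      unfolding continuous_map_def
    proof safe
      fix q assume "q \<in> topspace (subtopology ?T (tangent_dom N i))"
      then have "q \<in> tangent_dom N i" by simp
      then show "tangent_chart N i q \<in> topspace ?S" using tangent_chart_mem(1)[OF i] Csub by blast
    next
      fix V assume V: "openin ?S V"
      have "openin ?T (tangent_dom N i \<inter> tangent_chart N i -` V)"
        unfolding tangent_top using i V by (intro topology_generated_by_Basis) blast
      moreover have "{q \<in> topspace (subtopology ?T (tangent_dom N i)). tangent_chart N i q \<in> V} = (tangent_dom N i \<inter> tangent_chart N i -` V) \<inter> tangent_dom N i"
        using sub by auto
      ultimately show "openin (subtopology ?T (tangent_dom N i)) {q \<in> topspace (subtopology ?T (tangent_dom N i)). tangent_chart N i q \<in> V}"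
        unfolding openin_subtopology by blast
    qed
  qed
  have 2: "continuous_map (subtopology ?S ?C) ?T (tangent_lift N i)"
    unfolding tangent_top
  proof (rule continuous_on_generated_topo)
    have top: "topspace (subtopology ?S ?C) = ?C" using Csub by auto
    fix U assume "U \<in> {tangent_dom N i \<inter> tangent_chart N i -` V | i V. i \<in> mindex N \<and> openin ?S V}"
    then obtain j V where j: "j \<in> mindex N" and V: "openin ?S V" and U: "U = tangent_dom N j \<inter> tangent_chart N j -` V" by blast
    let ?O = "seq_times (oimg N i j) (topspace (mmodel N))"
    have OC: "?O \<subseteq> ?C" by (auto simp: seq_times_def)
    have eq: "tangent_lift N i -` U \<inter> topspace (subtopology ?S ?C) = {z \<in> topspace (subtopology ?S ?O). tangent_chart N j (tangent_lift N i z) \<in> V}"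
    proof (intro equalityI subsetI)
      fix z assume "z \<in> tangent_lift N i -` U \<inter> topspace (subtopology ?S ?C)"
      then have z: "z \<in> ?C" "tangent_lift N i z \<in> tangent_dom N j" "tangent_chart N j (tangent_lift N i z) \<in> V" using top U by auto
      then have "seq_fst z \<in> oimg N i j" using tangent_lift_dom_iff[OF i z(1)] by blast
      then show "z \<in> {z \<in> topspace (subtopology ?S ?O). tangent_chart N j (tangent_lift N i z) \<in> V}"
        using z Csub by (auto simp: seq_times_def)
    next
      fix z assume z: "z \<in> {z \<in> topspace (subtopology ?S ?O). tangent_chart N j (tangent_lift N i z) \<in> V}"
      then have "z \<in> ?O" by simp
      then have "z \<in> ?C" "seq_fst z \<in> oimg N i j" using OC by (auto simp: seq_times_def)
      then have "tangent_lift N i z \<in> tangent_dom N j" using tangent_lift_dom_iff[OF i] by blast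
      then show "z \<in> tangent_lift N i -` U \<inter> topspace (subtopology ?S ?C)"
        using z \<open>z \<in> ?C\<close> top U by auto
    qed
    have o1: "openin (subtopology ?S ?O) {z \<in> topspace (subtopology ?S ?O). tangent_chart N j (tangent_lift N i z) \<in> V}"
      by (rule openin_preimage[OF smooth_on_continuous[OF tangent_trans_smooth[OF i j]] V])
    have o2: "openin (subtopology ?S ?C) ?O"
      by (rule openin_seq_times[OF bman_oimg_open[OF N i j]])
    show "openin (subtopology ?S ?C) (tangent_lift N i -` U \<inter> topspace (subtopology ?S ?C))"
      unfolding eq by (rule openin_subtopology_chain[OF o1 o2])
  next
    show "tangent_lift N i ` topspace (subtopology ?S ?C)
       \<subseteq> \<Union> {tangent_dom N i \<inter> tangent_chart N i -` V | i V. i \<in> mindex N \<and> openin ?S V}"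
    proof
      fix q assume "q \<in> tangent_lift N i ` topspace (subtopology ?S ?C)"
      then have "q \<in> tangent_lift N i ` ?C" by (simp only: topspace_subtopology_subset[OF Csub])
      then have "q \<in> tangent_dom N i" using tangent_lift_mem(1)[OF i] by blast
      then show "q \<in> \<Union> {tangent_dom N i \<inter> tangent_chart N i -` V | i V. i \<in> mindex N \<and> openin ?S V}"
        using tangent_dom_generator[OF i] by (rule UnionI[rotated])
    qed
  qed
  have "continuous_map (subtopology ?S ?C) (subtopology ?T (tangent_dom N i)) (tangent_lift N i)"
    unfolding continuous_map_in_subtopology topspace_subtopology_subset[OF Csub]
    using 2 tangent_lift_mem(1)[OF i] by blast
  with 1 have "homeomorphic_maps (subtopology ?T (tangent_dom N i)) (subtopology ?S ?C) (tangent_chart N i) (tangent_lift N i)"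
    unfolding homeomorphic_maps_def topspace_subtopology_subset[OF Csub] topspace_subtopology_subset[OF sub]
    using tangent_lift_mem(2)[OF i] tangent_chart_mem(2)[OF i] by blast
  then show ?thesis unfolding tangent_cimg[OF i] by (rule homeomorphic_maps_imp_map)
qed

text \<open>
  The coordinate \<open>0\<close> of an interleaved pair is the coordinate \<open>0\<close> of the base point: a boundary point of the
  tangent bundle is a tangent vector at a boundary point.
\<close>

lemma model_domains_seq_times:
  "Q \<in> model_domains k \<Longrightarrow> seq_times Q (topspace (Euclidean_space k)) \<in> model_domains (2 * k)"
proof -
  have top: "topspace (Euclidean_space (2 * k)) = seq_times (topspace (Euclidean_space k)) (topspace (Euclidean_space k))"
    by (simp flip: seq_square_Euclidean_space)
  have "seq_fst z 0 = z 0" for z :: "nat \<Rightarrow> real" by (simp add: seq_fst_def)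
  then show "Q \<in> model_domains k \<Longrightarrow> ?thesis" unfolding model_domains_def top by (auto simp: seq_times_def)
qed

text \<open>
  The chart changes of the tangent bundle are the tangent maps of the chart changes of \<open>N\<close>, hence smooth.
\<close>

lemma bman_tangent_bundle: "bman (2 * k) (tangent_bundle N)"
  unfolding bman_def
proof (intro conjI ballI)
  show "mmodel (tangent_bundle N) = Euclidean_space (2 * k)"
    by (simp add: tangent_bundle_sel bman_model[OF N] seq_square_Euclidean_space)
  show "lcs (mmodel (tangent_bundle N))" by (simp add: tangent_bundle_sel lcs_seq_square bman_lcs[OF N])
  show "topspace (mtop (tangent_bundle N)) = \<Union> (mdom (tangent_bundle N) ` mindex (tangent_bundle N))"
    unfolding tangent_bundle_sel by (rule tangent_topspace)
next
  fix i assume "i \<in> mindex (tangent_bundle N)"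
  then have i: "i \<in> mindex N" by (simp add: tangent_bundle_sel)
  show "openin (mtop (tangent_bundle N)) (mdom (tangent_bundle N) i)"
    unfolding tangent_bundle_sel by (rule tangent_dom_open[OF i])
  show "homeomorphic_map (subtopology (mtop (tangent_bundle N)) (mdom (tangent_bundle N) i))
     (subtopology (mmodel (tangent_bundle N)) (cimg (tangent_bundle N) i)) (mchart (tangent_bundle N) i)"
    unfolding tangent_bundle_sel by (rule tangent_homeo[OF i])
  obtain Q where Q: "Q \<in> model_domains k" "openin (subtopology (mmodel N) Q) (cimg N i)"
    using N i unfolding bman_def by blast
  show "\<exists>Q\<in>model_domains (2 * k). openin (subtopology (mmodel (tangent_bundle N)) Q) (cimg (tangent_bundle N) i)"
    unfolding tangent_bundle_sel tangent_cimg[OF i]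
    using openin_seq_times[OF Q(2)] model_domains_seq_times[OF Q(1)] bman_model[OF N] by metis
  fix j assume "j \<in> mindex (tangent_bundle N)"
  then have j: "j \<in> mindex N" by (simp add: tangent_bundle_sel)
  show "smooth_on_lcs (mmodel (tangent_bundle N)) (oimg (tangent_bundle N) i j) (mmodel (tangent_bundle N))
     (mchart (tangent_bundle N) j \<circ> chart_inv (tangent_bundle N) i)"
    unfolding tangent_bundle_sel tangent_oimg[OF i]
  proof (rule smooth_on_cong[OF tangent_trans_smooth[OF i j]])
    fix z assume "z \<in> seq_times (oimg N i j) (topspace (mmodel N))"
    then have "z \<in> seq_times (cimg N i) (topspace (mmodel N))" by (auto simp: seq_times_def)
    then show "tangent_chart N j (tangent_lift N i z) = (tangent_chart N j \<circ> chart_inv (tangent_bundle N) i) z"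
      by (simp add: tangent_chart_inv[OF i])
  qed
qed

end

lemma base_manifold_sel:
  "mtop (base_manifold M) = pullback_topology {p. snd p = []} fst (mtop M)"
  "mmodel (base_manifold M) = mmodel M" "mindex (base_manifold M) = mindex M"
  "mdom (base_manifold M) i = mdom M i \<times> {[]}" "mchart (base_manifold M) i = mchart M i \<circ> fst"
  by (simp_all add: base_manifold_def)

lemma base_topspace: "topspace (mtop (base_manifold M)) = topspace (mtop M) \<times> {[]}"
  by (auto simp: base_manifold_sel topspace_pullback_topology)

lemma base_cimg: "cimg (base_manifold M) i = cimg M i"
  by (auto simp: base_manifold_sel image_iff)

lemma base_oimg: "oimg (base_manifold M) i j = oimg M i j"
proof -
  have "mdom (base_manifold M) i \<inter> mdom (base_manifold M) j = (mdom M i \<inter> mdom M j) \<times> {[]}"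
    by (auto simp: base_manifold_sel)
  then show ?thesis by (auto simp: base_manifold_sel(5) image_iff)
qed

lemma base_chart_inv:
  assumes M: "bman k M" and i: "i \<in> mindex M" and x: "x \<in> cimg M i"
  shows "chart_inv (base_manifold M) i x = (chart_inv M i x, [])"
  unfolding chart_inv_def[of "base_manifold M"]
proof (rule inv_into_f_eq)
  show "inj_on (mchart (base_manifold M) i) (mdom (base_manifold M) i)"
    using bman_inj[OF M i] by (auto simp: base_manifold_sel inj_on_def)
  show "(chart_inv M i x, []) \<in> mdom (base_manifold M) i"
    using chart_inv_mem[OF M x] by (simp add: base_manifold_sel)
  show "mchart (base_manifold M) i (chart_inv M i x, []) = x"
    using chart_chart_inv[OF M x] by (simp add: base_manifold_sel)
qed

lemma bman_base_manifold:
  assumes M: "bman k M"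
  shows "bman k (base_manifold M)"
  unfolding bman_def
proof (intro conjI ballI)
  show "mmodel (base_manifold M) = Euclidean_space k" "lcs (mmodel (base_manifold M))"
    using bman_model[OF M] bman_lcs[OF M] by (simp_all add: base_manifold_sel)
  show "topspace (mtop (base_manifold M)) = \<Union> (mdom (base_manifold M) ` mindex (base_manifold M))"
    unfolding base_topspace bman_topspace[OF M] by (auto simp: base_manifold_sel)
next
  fix i assume "i \<in> mindex (base_manifold M)"
  then have i: "i \<in> mindex M" by (simp add: base_manifold_sel)
  have "mdom (base_manifold M) i = fst -` mdom M i \<inter> {p. snd p = []}" by (auto simp: base_manifold_sel)
  then show op: "openin (mtop (base_manifold M)) (mdom (base_manifold M) i)"
    using bman_dom_open[OF M i] by (auto simp: base_manifold_sel openin_pullback_topology)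
  show "\<exists>Q\<in>model_domains k. openin (subtopology (mmodel (base_manifold M)) Q) (cimg (base_manifold M) i)"
    unfolding base_cimg unfolding base_manifold_sel using M i unfolding bman_def by blast
  let ?A = "subtopology (mtop (base_manifold M)) (mdom (base_manifold M) i)" and ?B = "subtopology (mtop M) (mdom M i)"
  have "homeomorphic_maps ?A ?B fst (\<lambda>p. (p, []))"
    unfolding homeomorphic_maps_def
  proof (intro conjI)
    show "continuous_map ?A ?B fst"
      unfolding continuous_map_in_subtopology base_manifold_sel
      by (auto intro: continuous_map_from_subtopology continuous_map_from_pullback)
    show "continuous_map ?B ?A (\<lambda>p. (p, []))"
      unfolding continuous_map_in_subtopology base_manifold_sel continuous_map_pullback_iff
      by (auto simp: o_def intro: continuous_map_from_subtopology)
  qed (auto simp: base_manifold_sel)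
  then have "homeomorphic_map ?A ?B fst" by (rule homeomorphic_maps_imp_map)
  from homeomorphic_map_compose[OF this bman_homeo[OF M i]]
  show "homeomorphic_map ?A (subtopology (mmodel (base_manifold M)) (cimg (base_manifold M) i)) (mchart (base_manifold M) i)"
    unfolding base_cimg by (simp add: base_manifold_sel)
  fix j assume "j \<in> mindex (base_manifold M)"
  then have j: "j \<in> mindex M" by (simp add: base_manifold_sel)
  show "smooth_on_lcs (mmodel (base_manifold M)) (oimg (base_manifold M) i j) (mmodel (base_manifold M))
     (mchart (base_manifold M) j \<circ> chart_inv (base_manifold M) i)"
    unfolding base_oimg unfolding base_manifold_sel
  proof (rule smooth_on_cong[OF bman_trans_smooth[OF M i j]])
    fix x assume "x \<in> oimg M i j"
    then have "x \<in> cimg M i" by blast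
    then show "mchart M j (chart_inv M i x) = ((mchart M j \<circ> fst) \<circ> chart_inv (base_manifold M) i) x"
      by (simp add: base_chart_inv[OF M i])
  qed
qed

lemma bman_Tn_manifold:
  assumes "bman k M" shows "bman (2 ^ n * k) (Tn_manifold n M)"
proof (induction n)
  case 0
  then show ?case using bman_base_manifold[OF assms] by (simp add: Tn_manifold_def)
next
  case (Suc n)
  then show ?case using bman_tangent_bundle[OF Suc] by (simp add: Tn_manifold_def mult.assoc)
qed

section \<open>Partial derivatives on a product domain\<close>

context
  fixes Z :: "'z::real_vector topology" and E :: "'a::real_vector topology" and F :: "'b::real_vector topology"
    and W V g
  assumes Z: "lcs Z" and E: "lcs E" and F: "lcs F" and W: "openin Z W" and V: "mb_dom E V"
    and g: "smooth_on_lcs (prod_topology Z E) (W \<times> V) F g"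
begin

lemma partial_dom: "mb_dom (prod_topology Z E) (W \<times> V)"
  by (rule mb_dom_Times'[OF Z V W])

lemma partial_C1: "C1map (prod_topology Z E) (W \<times> V) F g (dir_deriv F (W \<times> V) g)"
  by (rule smooth_on_C1map[OF lcs_prod[OF Z E] F partial_dom g])

lemma partial_W_dom: "mb_dom Z W" by (rule mb_dom_open[OF Z W])

lemma partial2_C1:
  assumes w: "w \<in> W"
  shows "C1map E V F (\<lambda>x. g (w, x)) (\<lambda>x v. dir_deriv F (W \<times> V) g (w, x) (0, v))"
proof -
  have wZ: "w \<in> topspace Z" using openin_subset[OF W] w by blast
  have 1: "C1map E V (prod_topology Z E) (\<lambda>x. (w, x)) (\<lambda>x v. (0, v))"
    using C1map_pair[OF C1map_const[OF Z wZ] C1map_linear[OF mb_dom_subset[OF V] linear_ident]] by simp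
  have "(\<lambda>x. (w, x)) ` V \<subseteq> W \<times> V" using w by blast
  from C1map_compose[OF E lcs_prod[OF Z E] F V partial_dom 1 partial_C1 this] show ?thesis .
qed

lemma partial1_C1:
  assumes x: "x \<in> V"
  shows "C1map Z W F (\<lambda>w. g (w, x)) (\<lambda>w u. dir_deriv F (W \<times> V) g (w, x) (u, 0))"
proof -
  have xE: "x \<in> topspace E" using mb_dom_subset[OF V] x by blast
  have 1: "C1map Z W (prod_topology Z E) (\<lambda>w. (w, x)) (\<lambda>w u. (u, 0))"
    using C1map_pair[OF C1map_linear[OF openin_subset[OF W] linear_ident] C1map_const[OF E xE]] by simp
  have "(\<lambda>w. (w, x)) ` W \<subseteq> W \<times> V" using x by blast
  from C1map_compose[OF Z lcs_prod[OF Z E] F partial_W_dom partial_dom 1 partial_C1 this] show ?thesis .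
qed

lemma smooth_on_slice2:
  assumes w: "w \<in> W" shows "smooth_on_lcs E V F (\<lambda>x. g (w, x))"
proof -
  have wZ: "w \<in> topspace Z" using openin_subset[OF W] w by blast
  have 1: "smooth_on_lcs E V (prod_topology Z E) (\<lambda>x. (w, x))"
    by (rule smooth_on_pair[OF E Z E V smooth_on_const[OF E Z V wZ] smooth_on_linear[OF E E V linear_ident]]) simp
  have "(\<lambda>x. (w, x)) ` V \<subseteq> W \<times> V" using w by blast
  from smooth_on_compose[OF E lcs_prod[OF Z E] F V partial_dom 1 g this] show ?thesis .
qed

text \<open>
  Partial derivatives are derivatives of \<open>g\<close> in the directions \<open>(u, 0)\<close> and \<open>(0, v)\<close>, which commute by
  Schwarz's theorem.
\<close>

lemma partial_symmetric:
  assumes w: "w \<in> W" and x: "x \<in> V" and u: "u \<in> topspace Z" and v: "v \<in> topspace E"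
  shows "dir_deriv F V (\<lambda>x. dir_deriv F (W \<times> V) g (w, x) (u, 0)) x v =
     dir_deriv F W (\<lambda>w. dir_deriv F (W \<times> V) g (w, x) (0, v)) w u"
    "has_dir_deriv F V (\<lambda>x. dir_deriv F (W \<times> V) g (w, x) (u, 0)) x v (dir_deriv F W (\<lambda>w. dir_deriv F (W \<times> V) g (w, x) (0, v)) w u)"
    "has_dir_deriv F W (\<lambda>w. dir_deriv F (W \<times> V) g (w, x) (0, v)) w u (dir_deriv F W (\<lambda>w. dir_deriv F (W \<times> V) g (w, x) (0, v)) w u)"
proof -
  have u0: "(u, 0) \<in> topspace (prod_topology Z E)" and v0: "(0, v) \<in> topspace (prod_topology Z E)"
    using u v lcs_zero[OF Z] lcs_zero[OF E] by auto
  have s1: "smooth_on_lcs (prod_topology Z E) (W \<times> V) F (\<lambda>y. dir_deriv F (W \<times> V) g y (u, 0))"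
    by (rule smooth_on_dir[OF lcs_prod[OF Z E] F partial_dom g u0])
  have s2: "smooth_on_lcs (prod_topology Z E) (W \<times> V) F (\<lambda>y. dir_deriv F (W \<times> V) g y (0, v))"
    by (rule smooth_on_dir[OF lcs_prod[OF Z E] F partial_dom g v0])
  let ?D = "dir_deriv F (W \<times> V) (\<lambda>y. dir_deriv F (W \<times> V) g y (u, 0)) (w, x) (0, v)"
  have wx: "(w, x) \<in> W \<times> V" using w x by blast
  have sym: "dir_deriv F (W \<times> V) (\<lambda>y. dir_deriv F (W \<times> V) g y (0, v)) (w, x) (u, 0) = ?D"
    by (rule schwarz[OF lcs_prod[OF Z E] F partial_dom g wx v0 u0])
  have C2: "C1map (prod_topology Z E) (W \<times> V) F (\<lambda>y. dir_deriv F (W \<times> V) g y (u, 0)) (dir_deriv F (W \<times> V) (\<lambda>y. dir_deriv F (W \<times> V) g y (u, 0)))"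
    by (rule smooth_on_C1map[OF lcs_prod[OF Z E] F partial_dom s1])
  have wZ: "w \<in> topspace Z" using openin_subset[OF W] w by blast
  have xE: "x \<in> topspace E" using mb_dom_subset[OF V] x by blast
  have i2: "has_dir_deriv (prod_topology Z E) V (\<lambda>x. (w, x)) x v (0, v)"
    using C1map_has[OF C1map_pair[OF C1map_const[OF Z wZ] C1map_linear[OF mb_dom_subset[OF V] linear_ident]] x v] by simp
  have im2: "(\<lambda>x. (w, x)) ` V \<subseteq> W \<times> V" using w by blast
  have h1: "has_dir_deriv F V (\<lambda>x. dir_deriv F (W \<times> V) g (w, x) (u, 0)) x v ?D"
    by (rule has_dir_deriv_compose[OF lcs_prod[OF Z E] F partial_dom C2 im2 x i2])
  have C2': "C1map (prod_topology Z E) (W \<times> V) F (\<lambda>y. dir_deriv F (W \<times> V) g y (0, v)) (dir_deriv F (W \<times> V) (\<lambda>y. dir_deriv F (W \<times> V) g y (0, v)))"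
    by (rule smooth_on_C1map[OF lcs_prod[OF Z E] F partial_dom s2])
  have i1: "has_dir_deriv (prod_topology Z E) W (\<lambda>w. (w, x)) w u (u, 0)"
    using C1map_has[OF C1map_pair[OF C1map_linear[OF openin_subset[OF W] linear_ident] C1map_const[OF E xE]] w u] by simp
  have im1: "(\<lambda>w. (w, x)) ` W \<subseteq> W \<times> V" using x by blast
  have h2: "has_dir_deriv F W (\<lambda>w. dir_deriv F (W \<times> V) g (w, x) (0, v)) w u ?D"
    using has_dir_deriv_compose[OF lcs_prod[OF Z E] F partial_dom C2' im1 w i1] unfolding sym .
  have e2: "dir_deriv F W (\<lambda>w. dir_deriv F (W \<times> V) g (w, x) (0, v)) w u = ?D"
    by (rule dir_deriv_eq[OF Z lcs_Hausdorff[OF F] partial_W_dom w u h2])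
  show "has_dir_deriv F V (\<lambda>x. dir_deriv F (W \<times> V) g (w, x) (u, 0)) x v (dir_deriv F W (\<lambda>w. dir_deriv F (W \<times> V) g (w, x) (0, v)) w u)"
    using h1 unfolding e2 .
  show "has_dir_deriv F W (\<lambda>w. dir_deriv F (W \<times> V) g (w, x) (0, v)) w u (dir_deriv F W (\<lambda>w. dir_deriv F (W \<times> V) g (w, x) (0, v)) w u)"
    using h2 unfolding e2 .
  show "dir_deriv F V (\<lambda>x. dir_deriv F (W \<times> V) g (w, x) (u, 0)) x v =
     dir_deriv F W (\<lambda>w. dir_deriv F (W \<times> V) g (w, x) (0, v)) w u"
    unfolding e2 by (rule dir_deriv_eq[OF E lcs_Hausdorff[OF F] V x v h1])
qed

end

section \<open>Smooth families of functions on a manifold\<close>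

text \<open>
  Joint smoothness in the parameter and in the point of a manifold. The family is curried, as the exponential
  law will regard it as a map from the parameters to functions.
\<close>

definition smooth_family :: "'z::real_vector topology \<Rightarrow> 'z set \<Rightarrow> ('p, nat \<Rightarrow> real, 'i) manifold \<Rightarrow> 'b::real_vector topology \<Rightarrow> ('z \<Rightarrow> 'p \<Rightarrow> 'b) \<Rightarrow> bool" where
  "smooth_family Z W N F f \<longleftrightarrow>
     (\<forall>i\<in>mindex N. smooth_on_lcs (prod_topology Z (mmodel N)) (W \<times> cimg N i) F (\<lambda>(w, x). f w (chart_inv N i x)))"

lemma smooth_familyD: "smooth_family Z W N F f \<Longrightarrow> i \<in> mindex N \<Longrightarrow>
    smooth_on_lcs (prod_topology Z (mmodel N)) (W \<times> cimg N i) F (\<lambda>(w, x). f w (chart_inv N i x))"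
  by (simp add: smooth_family_def)

lemma tangent_map_alt:
  "tangent_map N F f q = (let p = (fst q, tl (snd q)); i = (SOME i. i \<in> mindex N \<and> p \<in> mdom N i)
     in seq_pair (f p) (dir_deriv F (cimg N i) (\<lambda>x. f (chart_inv N i x)) (mchart N i p) (hd (snd q) i)))"
  by (simp add: tangent_map_def case_prod_unfold o_def)

text \<open>
  The tangent map is defined by means of some chart around the point; since derivatives in two charts are
  related by \<open>dtrans\<close>, as are the representatives of the tangent vector, every chart gives the same value.
\<close>

lemma tangent_map_lift:
  assumes N: "bman k N" and F: "lcs F"
    and f: "\<And>i. i \<in> mindex N \<Longrightarrow> C1map (mmodel N) (cimg N i) F (\<lambda>x. f (chart_inv N i x)) (df i)"
    and i: "i \<in> mindex N" and z: "z \<in> seq_times (cimg N i) (topspace (mmodel N))"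
  shows "tangent_map N F f (tangent_lift N i z) = seq_pair (f (chart_inv N i (seq_fst z))) (df i (seq_fst z) (seq_snd z))"
proof -
  define p where "p = chart_inv N i (seq_fst z)"
  have x: "seq_fst z \<in> cimg N i" "seq_snd z \<in> topspace (mmodel N)" using z by (auto simp: seq_times_def)
  have p: "p \<in> mdom N i" unfolding p_def by (rule chart_inv_mem[OF N x(1)])
  define j where "j = (SOME i. i \<in> mindex N \<and> p \<in> mdom N i)"
  have j: "j \<in> mindex N" "p \<in> mdom N j"
    using someI[of "\<lambda>i. i \<in> mindex N \<and> p \<in> mdom N i" i] i p unfolding j_def by auto
  have xo: "seq_fst z \<in> oimg N i j" using oimg_iff[OF N i] x(1) j(2) by (simp add: p_def)
  have top: "mdom N i \<inter> topspace (mtop N) = mdom N i" "mdom N j \<inter> topspace (mtop N) = mdom N j"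
    using bman_dom_sub[OF N] i j by blast+
  have mj: "mchart N j p \<in> cimg N j" using j(2) by blast
  have pj: "mchart N i p = seq_fst z" unfolding p_def by (rule chart_chart_inv[OF N x(1)])
  have tv: "tvec N i p (seq_snd z) j = dtrans N i j (seq_fst z) (seq_snd z)"
    unfolding tvec_def[OF N] using j pj by simp
  have dm: "dtrans N i j (seq_fst z) (seq_snd z) \<in> topspace (mmodel N)"
    by (rule dtrans_mem[OF N i j(1) xo x(2)])
  have D1: "dir_deriv F (cimg N j) (\<lambda>x. f (chart_inv N j x)) (mchart N j p) (dtrans N i j (seq_fst z) (seq_snd z))
      = df j (mchart N j p) (dtrans N i j (seq_fst z) (seq_snd z))"
    by (rule C1map_deriv_eq[OF bman_lcs[OF N] F bman_cimg_dom[OF N j(1)] f[OF j(1)] mj dm])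
  have fj: "C1map (mmodel N) (mchart N j ` (mdom N j \<inter> topspace (mtop N))) F (\<lambda>x. f (chart_inv N j x)) (df j)"
    unfolding top by (rule f[OF j(1)])
  have xi: "seq_fst z \<in> mchart N i ` (mdom N i \<inter> topspace (mtop N))" unfolding top by (rule x(1))
  from deriv_change_chart[OF N i j(1) F openin_topspace fj xi xo x(2)] have "has_dir_deriv F (cimg N i) (\<lambda>x. f (chart_inv N i x)) (seq_fst z) (seq_snd z)
      (df j (mchart N j p) (dtrans N i j (seq_fst z) (seq_snd z)))" unfolding top p_def .
  moreover have "has_dir_deriv F (cimg N i) (\<lambda>x. f (chart_inv N i x)) (seq_fst z) (seq_snd z) (df i (seq_fst z) (seq_snd z))"
    by (rule C1map_has[OF f[OF i] x])
  ultimately have eq: "df j (mchart N j p) (dtrans N i j (seq_fst z) (seq_snd z)) = df i (seq_fst z) (seq_snd z)"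
    by (rule has_dir_deriv_unique[OF bman_lcs[OF N] lcs_Hausdorff[OF F] bman_cimg_dom[OF N i] x])
  show ?thesis
    unfolding tangent_map_alt tangent_lift_sel(1,2) Let_def p_def[symmetric] j_def[symmetric] tv D1 eq ..
qed

lemma tangent_map_cong:
  assumes N: "bman k N" and q: "q \<in> topspace (mtop (tangent_bundle N))" and eq: "\<And>p. p \<in> topspace (mtop N) \<Longrightarrow> f p = g p"
  shows "tangent_map N F f q = tangent_map N F g q"
proof -
  define p where "p = (fst q, tl (snd q))"
  obtain i where "i \<in> mindex N" "q \<in> tangent_dom N i"
    using q unfolding tangent_topspace[OF N] by blast
  then have i: "i \<in> mindex N" "p \<in> mdom N i" unfolding tangent_dom_iff p_def by simp_all
  define j where "j = (SOME i. i \<in> mindex N \<and> p \<in> mdom N i)"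
  have j: "j \<in> mindex N" "p \<in> mdom N j"
    using someI[of "\<lambda>i. i \<in> mindex N \<and> p \<in> mdom N i" i] i unfolding j_def by auto
  have fp: "f p = g p" using eq bman_dom_sub[OF N j(1)] j(2) by blast
  have "dir_deriv F (cimg N j) (\<lambda>x. f (chart_inv N j x)) (mchart N j p) h = dir_deriv F (cimg N j) (\<lambda>x. g (chart_inv N j x)) (mchart N j p) h" for h
  proof (rule dir_deriv_cong)
    show "mchart N j p \<in> cimg N j" using j(2) by blast
    show "f (chart_inv N j x) = g (chart_inv N j x)" if "x \<in> cimg N j" for x
      using eq chart_inv_in_topspace[OF N j(1) that] by blast
  qed
  then show ?thesis unfolding tangent_map_alt Let_def p_def[symmetric] j_def[symmetric] fp by simp
qed

context
  fixes Z :: "'z::real_vector topology" and F :: "'b::real_vector topology" and W :: "'z set" and k :: nat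
    and N :: "('p, nat \<Rightarrow> real, 'i) manifold" and f :: "'z \<Rightarrow> 'p \<Rightarrow> 'b"
  assumes Z: "lcs Z" and F: "lcs F" and W: "openin Z W" and N: "bman k N"
    and f: "smooth_family Z W N F f"
begin

text \<open>
  The derivative of the family in both variables, in the chart \<open>i\<close>. The derivatives in the parameter and in
  the point are its values in the directions \<open>(u, 0)\<close> and \<open>(0, v)\<close>.
\<close>

definition fam_deriv :: "'i \<Rightarrow> 'z \<times> (nat \<Rightarrow> real) \<Rightarrow> 'z \<times> (nat \<Rightarrow> real) \<Rightarrow> 'b" where
  "fam_deriv i = dir_deriv F (W \<times> cimg N i) (\<lambda>(w, x). f w (chart_inv N i x))"

lemmas fam_smooth = smooth_familyD[OF f]
lemmas fam_lcs = bman_lcs[OF N]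
lemmas fam_cimg = bman_cimg_dom[OF N]

lemma fam_C1_2: "i \<in> mindex N \<Longrightarrow> w \<in> W \<Longrightarrow> C1map (mmodel N) (cimg N i) F (\<lambda>x. f w (chart_inv N i x)) (\<lambda>x v. fam_deriv i (w, x) (0, v))"
  unfolding fam_deriv_def using partial2_C1[OF Z fam_lcs F W fam_cimg fam_smooth, of i w] by simp

lemma fam_C1_1:
  assumes i: "i \<in> mindex N" and p: "p \<in> mdom N i"
  shows "C1map Z W F (\<lambda>w. f w p) (\<lambda>w u. fam_deriv i (w, mchart N i p) (u, 0))"
  unfolding fam_deriv_def using partial1_C1[OF Z fam_lcs F W fam_cimg[OF i] fam_smooth[OF i], of "mchart N i p"] p
  by (simp add: bman_inv[OF N i p])

lemma fam_dir:
  assumes i: "i \<in> mindex N" and p: "p \<in> mdom N i" and w: "w \<in> W" and u: "u \<in> topspace Z"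
  shows "dir_deriv F W (\<lambda>w. f w p) w u = fam_deriv i (w, mchart N i p) (u, 0)"
  by (rule C1map_deriv_eq[OF Z F mb_dom_open[OF Z W] fam_C1_1[OF i p] w u])

lemma fam_C1:
  assumes p: "p \<in> topspace (mtop N)"
  shows "C1map Z W F (\<lambda>w. f w p) (dir_deriv F W (\<lambda>w. f w p))"
proof -
  obtain i where i: "i \<in> mindex N" "p \<in> mdom N i" using p unfolding bman_topspace[OF N] by blast
  show ?thesis by (rule C1map_cong[OF fam_C1_1[OF i]]) (simp_all add: fam_dir[OF i])
qed

lemma fam_continuous: "continuous_map (prod_topology (subtopology Z W) (mtop N)) F (\<lambda>(w, p). f w p)"
proof (rule continuous_map_local)
  fix wp assume wp: "wp \<in> topspace (prod_topology (subtopology Z W) (mtop N))"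
  obtain w p where [simp]: "wp = (w, p)" by (cases wp)
  have "p \<in> topspace (mtop N)" using wp by simp
  then obtain i where i: "i \<in> mindex N" "p \<in> mdom N i" unfolding bman_topspace[OF N] by blast
  let ?T = "subtopology (prod_topology (subtopology Z W) (mtop N)) (topspace (subtopology Z W) \<times> mdom N i)"
  have c1: "continuous_map ?T (subtopology Z W) fst" by (intro continuous_map_from_subtopology continuous_map_fst)
  have c2: "continuous_map ?T (subtopology (mmodel N) (cimg N i)) (\<lambda>z. mchart N i (snd z))"
    by (rule continuous_map_compose'[OF continuous_map_snd_sub bman_chart_continuous[OF N i(1)]])
  have "continuous_map ?T (subtopology (prod_topology Z (mmodel N)) (W \<times> cimg N i)) (\<lambda>z. (fst z, mchart N i (snd z)))"
    unfolding continuous_map_in_subtopology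
    using c1 c2 by (auto simp: continuous_map_in_subtopology intro!: continuous_map_pairedI)
  from continuous_map_compose'[OF this smooth_on_continuous[OF fam_smooth[OF i(1)]]]
  have "continuous_map ?T F (\<lambda>z. f (fst z) (chart_inv N i (mchart N i (snd z))))" by (simp add: case_prod_unfold)
  then have "continuous_map ?T F (\<lambda>(w, p). f w p)"
    by (rule continuous_map_eq) (auto simp: bman_inv[OF N i(1)])
  moreover have "openin (prod_topology (subtopology Z W) (mtop N)) (topspace (subtopology Z W) \<times> mdom N i)"
    unfolding openin_prod_Times_iff using bman_dom_open[OF N i(1)] by blast
  moreover have "wp \<in> topspace (subtopology Z W) \<times> mdom N i" using wp i by simp
  ultimately show "\<exists>T. openin (prod_topology (subtopology Z W) (mtop N)) T \<and> wp \<in> T \<and> continuous_map (subtopology (prod_topology (subtopology Z W) (mtop N)) T) F (\<lambda>(w, p). f w p)"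
    by blast
qed

end

lemma smooth_on_partial_deriv_compose:
  assumes X: "lcs X" and Y: "lcs Y" and F: "lcs F" and U: "mb_dom X U" and V: "mb_dom Y V" and g: "smooth_on_lcs Y V F g"
    and L: "linear L" "continuous_map X (prod_topology Y Y) L" "L ` U \<subseteq> V \<times> topspace Y"
  shows "smooth_on_lcs X U F (\<lambda>z. dir_deriv F V g (fst (L z)) (snd (L z)))"
  using smooth_on_prelinear[OF X lcs_prod[OF Y Y] F U mb_dom_Times[OF Y V openin_topspace] L smooth_on_deriv[OF Y F V g]]
  by (simp add: case_prod_unfold)

text \<open>
  In a chart the tangent map in the second variable consists of the function and of its total derivative in
  the directions \<open>(0, v)\<close>, both composed with linear maps.
\<close>

lemma smooth_family_tangent_map:
  fixes F :: "(nat \<Rightarrow> 'e::real_vector) topology"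
  assumes Z: "lcs Z" and F: "lcs F" and W: "openin Z W" and N: "bman k N" and f: "smooth_family Z W N F f"
  shows "smooth_family Z W (tangent_bundle N) (seq_square F) (\<lambda>w. tangent_map N F (f w))"
  unfolding smooth_family_def tangent_bundle_sel
proof
  fix i assume i: "i \<in> mindex N"
  let ?E = "mmodel N" and ?g = "\<lambda>(w, x). f w (chart_inv N i x)"
  let ?C = "seq_times (cimg N i) (topspace ?E)"
  have E: "lcs ?E" by (rule bman_lcs[OF N])
  note E2 = lcs_seq_square[OF E]
  have Vd: "mb_dom ?E (cimg N i)" by (rule bman_cimg_dom[OF N i])
  have dom: "mb_dom (prod_topology Z ?E) (W \<times> cimg N i)" by (rule mb_dom_Times'[OF Z Vd W])
  have dom2: "mb_dom (prod_topology Z (seq_square ?E)) (W \<times> ?C)"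
    by (rule mb_dom_Times'[OF Z mb_dom_seq_square[OF E Vd] W])
  let ?L1 = "\<lambda>y::'a \<times> (nat \<Rightarrow> real). (fst y, seq_fst (snd y))"
  let ?L2 = "\<lambda>y::'a \<times> (nat \<Rightarrow> real). ((fst y, seq_fst (snd y)), (0::'a, seq_snd (snd y)))"
  have L1: "linear ?L1" by (intro linearI) (auto simp: seq_fst_add seq_fst_scale)
  have L1c: "continuous_map (prod_topology Z (seq_square ?E)) (prod_topology Z ?E) ?L1"
    by (intro continuous_map_pairedI continuous_map_fst continuous_map_compose'[OF continuous_map_snd continuous_map_seq_fst])
  have L2: "linear ?L2" by (intro linearI) (auto simp: seq_fst_add seq_fst_scale seq_snd_add seq_snd_scale)
  have L2c: "continuous_map (prod_topology Z (seq_square ?E)) (prod_topology (prod_topology Z ?E) (prod_topology Z ?E)) ?L2"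
    by (intro continuous_map_pairedI continuous_map_fst continuous_map_compose'[OF continuous_map_snd continuous_map_seq_fst]
      continuous_map_compose'[OF continuous_map_snd continuous_map_seq_snd]) (simp add: lcs_zero[OF Z])
  have s1: "smooth_on_lcs (prod_topology Z (seq_square ?E)) (W \<times> ?C) F (\<lambda>y. ?g (?L1 y))"
    by (rule smooth_on_prelinear[OF lcs_prod[OF Z E2] lcs_prod[OF Z E] F dom2 dom L1 L1c _ smooth_familyD[OF f i]])
      (auto simp: seq_times_def)
  have s2: "smooth_on_lcs (prod_topology Z (seq_square ?E)) (W \<times> ?C) F
     (\<lambda>y. dir_deriv F (W \<times> cimg N i) ?g (fst (?L2 y)) (snd (?L2 y)))"
    by (rule smooth_on_partial_deriv_compose[OF lcs_prod[OF Z E2] lcs_prod[OF Z E] F dom2 dom smooth_familyD[OF f i] L2 L2c])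
      (use lcs_zero[OF Z] in \<open>auto simp: seq_times_def\<close>)
  show "smooth_on_lcs (prod_topology Z (seq_square ?E)) (W \<times> tangent_chart N i ` tangent_dom N i) (seq_square F)
     (\<lambda>(w, x). tangent_map N F (f w) (chart_inv (tangent_bundle N) i x))"
    unfolding tangent_cimg[OF N i]
  proof (rule smooth_on_cong[OF smooth_on_seq_pair[OF lcs_prod[OF Z E2] F dom2 s1 s2]])
    fix y assume y: "y \<in> W \<times> ?C"
    obtain w z where [simp]: "y = (w, z)" by (cases y)
    have w: "w \<in> W" and z: "z \<in> ?C" using y by auto
    have "tangent_map N F (f w) (tangent_lift N i z) = seq_pair (f w (chart_inv N i (seq_fst z))) (fam_deriv F W N f i (w, seq_fst z) (0, seq_snd z))"
      by (rule tangent_map_lift[OF N F fam_C1_2[OF Z F W N f _ w] i z])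
    then show "seq_pair (?g (?L1 y)) (dir_deriv F (W \<times> cimg N i) ?g (fst (?L2 y)) (snd (?L2 y))) =
       (\<lambda>(w, x). tangent_map N F (f w) (chart_inv (tangent_bundle N) i x)) y"
      by (simp add: tangent_chart_inv[OF N i z] fam_deriv_def[OF Z F W N f])
  qed
qed

lemma openin_seq_times_open: "openin Z W \<Longrightarrow> openin (seq_square Z) (seq_times W (topspace Z))"
  using openin_seq_times[of Z "topspace Z" W] by (simp flip: topspace_seq_square)

text \<open>
  In a chart the derivative in the parameter is the total derivative in the directions \<open>(u, 0)\<close>, composed with
  a linear map.
\<close>

lemma smooth_family_param_deriv:
  fixes Z :: "(nat \<Rightarrow> 'z::real_vector) topology"
  assumes Z: "lcs Z" and F: "lcs F" and W: "openin Z W" and N: "bman k N" and f: "smooth_family Z W N F f"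
  shows "smooth_family (seq_square Z) (seq_times W (topspace Z)) N F (\<lambda>\<zeta> p. dir_deriv F W (\<lambda>w. f w p) (seq_fst \<zeta>) (seq_snd \<zeta>))"
  unfolding smooth_family_def
proof
  fix i assume i: "i \<in> mindex N"
  let ?E = "mmodel N" and ?g = "\<lambda>(w, x). f w (chart_inv N i x)"
  have E: "lcs ?E" by (rule bman_lcs[OF N])
  note Z2 = lcs_seq_square[OF Z]
  have Vd: "mb_dom ?E (cimg N i)" by (rule bman_cimg_dom[OF N i])
  have dom: "mb_dom (prod_topology Z ?E) (W \<times> cimg N i)" by (rule mb_dom_Times'[OF Z Vd W])
  have dom2: "mb_dom (prod_topology (seq_square Z) ?E) (seq_times W (topspace Z) \<times> cimg N i)"
    by (rule mb_dom_Times'[OF Z2 Vd openin_seq_times_open[OF W]])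
  let ?L = "\<lambda>y::(nat \<Rightarrow> 'z) \<times> (nat \<Rightarrow> real). ((seq_fst (fst y), snd y), (seq_snd (fst y), 0::nat \<Rightarrow> real))"
  have L: "linear ?L" by (intro linearI) (auto simp: seq_fst_add seq_fst_scale seq_snd_add seq_snd_scale)
  have Lc: "continuous_map (prod_topology (seq_square Z) ?E) (prod_topology (prod_topology Z ?E) (prod_topology Z ?E)) ?L"
    by (intro continuous_map_pairedI continuous_map_snd continuous_map_compose'[OF continuous_map_fst continuous_map_seq_fst]
      continuous_map_compose'[OF continuous_map_fst continuous_map_seq_snd]) (simp add: lcs_zero[OF E])
  have s: "smooth_on_lcs (prod_topology (seq_square Z) ?E) (seq_times W (topspace Z) \<times> cimg N i) F
     (\<lambda>y. dir_deriv F (W \<times> cimg N i) ?g (fst (?L y)) (snd (?L y)))"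
    by (rule smooth_on_partial_deriv_compose[OF lcs_prod[OF Z2 E] lcs_prod[OF Z E] F dom2 dom smooth_familyD[OF f i] L Lc])
      (use lcs_zero[OF E] in \<open>auto simp: seq_times_def\<close>)
  show "smooth_on_lcs (prod_topology (seq_square Z) ?E) (seq_times W (topspace Z) \<times> cimg N i) F
     (\<lambda>(\<zeta>, x). dir_deriv F W (\<lambda>w. f w (chart_inv N i x)) (seq_fst \<zeta>) (seq_snd \<zeta>))"
  proof (rule smooth_on_cong[OF s])
    fix y assume y: "y \<in> seq_times W (topspace Z) \<times> cimg N i"
    obtain \<zeta> x where [simp]: "y = (\<zeta>, x)" by (cases y)
    have x: "x \<in> cimg N i" and z: "seq_fst \<zeta> \<in> W" "seq_snd \<zeta> \<in> topspace Z" using y by (auto simp: seq_times_def)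
    show "dir_deriv F (W \<times> cimg N i) ?g (fst (?L y)) (snd (?L y)) =
       (\<lambda>(\<zeta>, x). dir_deriv F W (\<lambda>w. f w (chart_inv N i x)) (seq_fst \<zeta>) (seq_snd \<zeta>)) y"
      using fam_dir[OF Z F W N f i chart_inv_mem[OF N x] z] chart_chart_inv[OF N x] by (simp add: fam_deriv_def[OF Z F W N f])
  qed
qed

text \<open>
  The tangent functor commutes with derivatives in the parameter: in a chart, the second components of both
  sides are the mixed derivative in the directions \<open>(u, 0)\<close> and \<open>(0, v)\<close>.
\<close>

lemma param_deriv_tangent_map:
  fixes F :: "(nat \<Rightarrow> 'e::real_vector) topology"
  assumes Z: "lcs Z" and F: "lcs F" and W: "openin Z W" and N: "bman k N" and f: "smooth_family Z W N F f"
    and w: "w \<in> W" and u: "u \<in> topspace Z" and q: "q \<in> topspace (mtop (tangent_bundle N))"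
  shows "tangent_map N F (\<lambda>p. dir_deriv F W (\<lambda>w. f w p) w u) q =
     dir_deriv (seq_square F) W (\<lambda>w. tangent_map N F (f w) q) w u"
proof -
  obtain i where i: "i \<in> mindex N" "q \<in> tangent_dom N i" using q unfolding tangent_topspace[OF N] by blast
  define z where "z = tangent_chart N i q"
  note t = tangent_chart_mem[OF N i, folded z_def]
  define x v where "x = seq_fst z" and "v = seq_snd z"
  have x: "x \<in> cimg N i" and v: "v \<in> topspace (mmodel N)" using t(1) by (auto simp: seq_times_def x_def v_def)
  let ?g = "\<lambda>i. \<lambda>(w, x). f w (chart_inv N i x)" and ?E = "mmodel N"
  let ?D = "\<lambda>i. fam_deriv F W N f i"
  have D: "?D i = dir_deriv F (W \<times> cimg N i) (?g i)" for i by (rule fam_deriv_def[OF Z F W N f])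
  have E: "lcs ?E" by (rule bman_lcs[OF N])
  have Wd: "mb_dom Z W" by (rule mb_dom_open[OF Z W])
  have "C1map ?E (cimg N j) F (\<lambda>x. dir_deriv F W (\<lambda>w. f w (chart_inv N j x)) w u)
      (dir_deriv F (cimg N j) (\<lambda>x. dir_deriv F W (\<lambda>w. f w (chart_inv N j x)) w u))" if j: "j \<in> mindex N" for j
  proof (rule smooth_on_C1map[OF E F bman_cimg_dom[OF N j]])
    have u0: "(u, 0) \<in> topspace (prod_topology Z ?E)" using u lcs_zero[OF E] by simp
    have dom: "mb_dom (prod_topology Z ?E) (W \<times> cimg N j)" by (rule mb_dom_Times'[OF Z bman_cimg_dom[OF N j] W])
    have "smooth_on_lcs ?E (cimg N j) F (\<lambda>x. ?D j (w, x) (u, 0))"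
      unfolding D
      by (rule smooth_on_slice2[OF Z E F W bman_cimg_dom[OF N j] smooth_on_dir[OF lcs_prod[OF Z E] F dom smooth_familyD[OF f j] u0] w])
    then show "smooth_on_lcs ?E (cimg N j) F (\<lambda>x. dir_deriv F W (\<lambda>w. f w (chart_inv N j x)) w u)"
    proof (rule smooth_on_cong)
      fix x assume x: "x \<in> cimg N j"
      show "?D j (w, x) (u, 0) = dir_deriv F W (\<lambda>w. f w (chart_inv N j x)) w u"
        using fam_dir[OF Z F W N f j chart_inv_mem[OF N x] w u] chart_chart_inv[OF N x] by simp
    qed
  qed
  from tangent_map_lift[OF N F this i(1) t(1)]
  have L: "tangent_map N F (\<lambda>p. dir_deriv F W (\<lambda>w. f w p) w u) q =
     seq_pair (dir_deriv F W (\<lambda>w. f w (chart_inv N i x)) w u)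
       (dir_deriv F (cimg N i) (\<lambda>x. dir_deriv F W (\<lambda>w. f w (chart_inv N i x)) w u) x v)"
    unfolding t(2) x_def v_def .
  have "dir_deriv F (cimg N i) (\<lambda>x. dir_deriv F W (\<lambda>w. f w (chart_inv N i x)) w u) x v
     = dir_deriv F (cimg N i) (\<lambda>x. ?D i (w, x) (u, 0)) x v"
    by (rule dir_deriv_cong[OF x])
      (use fam_dir[OF Z F W N f i(1) chart_inv_mem[OF N] w u] chart_chart_inv[OF N] in force)
  also have "\<dots> = dir_deriv F W (\<lambda>w. ?D i (w, x) (0, v)) w u"
    unfolding D by (rule partial_symmetric(1)[OF Z E F W bman_cimg_dom[OF N i(1)] smooth_familyD[OF f i(1)] w x u v])
  finally have L2: "dir_deriv F (cimg N i) (\<lambda>x. dir_deriv F W (\<lambda>w. f w (chart_inv N i x)) w u) x v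
     = dir_deriv F W (\<lambda>w. ?D i (w, x) (0, v)) w u" .
  have h1: "has_dir_deriv F W (\<lambda>w. f w (chart_inv N i x)) w u (dir_deriv F W (\<lambda>w. f w (chart_inv N i x)) w u)"
    by (rule C1map_has[OF fam_C1[OF Z F W N f chart_inv_in_topspace[OF N i(1) x]] w u])
  have h2: "has_dir_deriv F W (\<lambda>w. ?D i (w, x) (0, v)) w u (dir_deriv F W (\<lambda>w. ?D i (w, x) (0, v)) w u)"
    unfolding D by (rule partial_symmetric(3)[OF Z E F W bman_cimg_dom[OF N i(1)] smooth_familyD[OF f i(1)] w x u v])
  have "has_dir_deriv (seq_square F) W (\<lambda>w. seq_pair (f w (chart_inv N i x)) (?D i (w, x) (0, v))) w u
     (seq_pair (dir_deriv F W (\<lambda>w. f w (chart_inv N i x)) w u) (dir_deriv F W (\<lambda>w. ?D i (w, x) (0, v)) w u))"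
    using has_dir_deriv_postlinear[OF linear_seq_pair continuous_map_case_seq_pair has_dir_deriv_pair[OF h1 h2]] by simp
  then have "has_dir_deriv (seq_square F) W (\<lambda>w. tangent_map N F (f w) q) w u
     (seq_pair (dir_deriv F W (\<lambda>w. f w (chart_inv N i x)) w u) (dir_deriv F W (\<lambda>w. ?D i (w, x) (0, v)) w u))"
  proof (rule has_dir_deriv_cong_imp[rotated 2])
    fix w assume w: "w \<in> W"
    show "seq_pair (f w (chart_inv N i x)) (?D i (w, x) (0, v)) = tangent_map N F (f w) q"
      using tangent_map_lift[OF N F fam_C1_2[OF Z F W N f _ w] i(1) t(1)] unfolding t(2) x_def v_def by simp
  qed (rule w)
  from dir_deriv_eq[OF Z lcs_Hausdorff[OF lcs_seq_square[OF F]] Wd w u this]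
  show ?thesis unfolding L L2 by simp
qed

text \<open>
  At a point \<open>(0, p0)\<close> the mean value inequality bounds the distance between a difference quotient and the
  derivative by the oscillation of the derivative near \<open>(0, p0)\<close>, which is small because the derivative is
  jointly continuous. Joint continuity in \<open>t\<close> and \<open>p\<close> is what later gives convergence in the function space,
  and not just at each point.
\<close>

lemma smooth_family_quotient_continuous:
  fixes Z :: "(nat \<Rightarrow> 'z::real_vector) topology"
  assumes Z: "lcs Z" and F: "lcs F" and W: "openin Z W" and N: "bman k N" and f: "smooth_family Z W N F f"
    and w: "w \<in> W" and u: "u \<in> topspace Z"
  shows "continuous_map (prod_topology (top_of_set {t. w + t *\<^sub>R u \<in> W}) (mtop N)) F
     (\<lambda>(t, p). if t = 0 then dir_deriv F W (\<lambda>w. f w p) w u else (1 / t) *\<^sub>R (f (w + t *\<^sub>R u) p - f w p))"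
proof -
  define T where "T = {t. w + t *\<^sub>R u \<in> W}"
  let ?P = "prod_topology (top_of_set T) (mtop N)"
  define H where "H = (\<lambda>t p. dir_deriv F W (\<lambda>w. f w p) (w + t *\<^sub>R u) u)"
  define q where "q = (\<lambda>(t, p). if t = 0 then dir_deriv F W (\<lambda>w. f w p) w u else (1 / t) *\<^sub>R (f (w + t *\<^sub>R u) p - f w p))"
  have WZ: "W \<subseteq> topspace Z" using openin_subset[OF W] .
  have wZ: "w \<in> topspace Z" using w WZ by blast
  have To: "open T" unfolding T_def by (rule open_line_preimage[OF Z wZ u W])
  have T0: "0 \<in> T" using w by (simp add: T_def)
  have line: "continuous_map ?P Z (\<lambda>z. w + fst z *\<^sub>R u)"
  proof -
    have "continuous_map ?P euclideanreal fst"
      using continuous_map_fst[of "top_of_set T" "mtop N"] continuous_map_in_subtopology by blast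
    from continuous_map_compose'[OF this continuous_map_line[OF Z wZ u]] show ?thesis .
  qed
  have Hc: "continuous_map ?P F (\<lambda>z. H (fst z) (snd z))"
  proof -
    have "continuous_map ?P (prod_topology (subtopology (seq_square Z) (seq_times W (topspace Z))) (mtop N))
      (\<lambda>z. (seq_pair (w + fst z *\<^sub>R u) u, snd z))"
    proof (intro continuous_map_pairedI continuous_map_snd)
      have "continuous_map ?P (seq_square Z) (\<lambda>z. seq_pair (w + fst z *\<^sub>R u) u)"
        by (intro continuous_map_seq_pair line) (simp add: u)
      then show "continuous_map ?P (subtopology (seq_square Z) (seq_times W (topspace Z))) (\<lambda>z. seq_pair (w + fst z *\<^sub>R u) u)"
        unfolding continuous_map_in_subtopology using u by (auto simp: seq_times_def T_def)
    qed
    from continuous_map_compose'[OF this fam_continuous[OF lcs_seq_square[OF Z] F openin_seq_times_open[OF W] N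
        smooth_family_param_deriv[OF Z F W N f]]]
    show ?thesis by (simp add: H_def)
  qed
  have fc: "continuous_map ?P F (\<lambda>z. f (w + fst z *\<^sub>R u) (snd z))"
  proof -
    have "continuous_map ?P (prod_topology (subtopology Z W) (mtop N)) (\<lambda>z. (w + fst z *\<^sub>R u, snd z))"
      using line by (intro continuous_map_pairedI continuous_map_snd) (auto simp: continuous_map_in_subtopology T_def)
    from continuous_map_compose'[OF this fam_continuous[OF Z F W N f]] show ?thesis by simp
  qed
  have fc0: "continuous_map ?P F (\<lambda>z. f w (snd z))"
  proof -
    have "continuous_map ?P (prod_topology (subtopology Z W) (mtop N)) (\<lambda>z. (w, snd z))"
      using w wZ by (intro continuous_map_pairedI continuous_map_snd) auto
    from continuous_map_compose'[OF this fam_continuous[OF Z F W N f]] show ?thesis by simp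
  qed
  have C1: "C1map Z W F (\<lambda>w. f w p) (dir_deriv F W (\<lambda>w. f w p))" if "p \<in> topspace (mtop N)" for p
    by (rule fam_C1[OF Z F W N f that])
  have fm: "f w' p \<in> topspace F" if "p \<in> topspace (mtop N)" "w' \<in> W" for p w'
    by (rule C1map_mem[OF C1[OF that(1)] mb_dom_open[OF Z W] that(2)])
  have Hm: "H t p \<in> topspace F" if "p \<in> topspace (mtop N)" "t \<in> T" for p t
    using C1map_deriv_mem[OF C1[OF that(1)] _ u] that(2) by (simp add: H_def T_def)
  have H0: "dir_deriv F W (\<lambda>w. f w p) w u = H 0 p" for p by (simp add: H_def)
  have "continuous_map ?P F q"
    unfolding continuous_map_seminorm[OF F]
  proof (intro conjI ballI allI impI)
    fix z assume z: "z \<in> topspace ?P"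
    show "q z \<in> topspace F"
      using z fm Hm[OF _ T0] w by (auto simp: q_def H0 T_def intro!: lcs_scale_mem[OF F] lcs_diff_mem[OF F])
  next
    fix z p and e :: real assume z: "z \<in> topspace ?P" and p: "cont_seminorm F p" and e: "0 < e"
    obtain t0 p0 where zz: "z = (t0, p0)" by (cases z)
    have p0: "p0 \<in> topspace (mtop N)" and t0: "t0 \<in> T" using z zz by auto
    show "\<exists>A. openin ?P A \<and> z \<in> A \<and> (\<forall>y\<in>A. p (q y - q z) < e)"
    proof (cases "t0 = 0")
      case False
      let ?O = "(T - {0}) \<times> topspace (mtop N)"
      have Oo: "openin ?P ?O"
        unfolding openin_prod_Times_iff using To by (simp add: openin_open_eq open_Diff)
      have inv: "continuous_map (subtopology ?P ?O) euclideanreal (\<lambda>z. 1 / fst z)"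
      proof -
        have "continuous_map (subtopology ?P ?O) (top_of_set (T - {0})) fst"
          unfolding continuous_map_in_subtopology
          using continuous_map_fst[of "top_of_set T" "mtop N"]
          by (auto intro!: continuous_map_from_subtopology simp: continuous_map_in_subtopology)
        moreover have "continuous_map (top_of_set (T - {0})) euclideanreal (\<lambda>t. 1 / t)"
          by (auto intro!: continuous_intros)
        ultimately show ?thesis by (rule continuous_map_compose')
      qed
      have "continuous_map (subtopology ?P ?O) F (\<lambda>z. (1 / fst z) *\<^sub>R (f (w + fst z *\<^sub>R u) (snd z) - f w (snd z)))"
        by (intro continuous_map_lcs_scale[OF F] inv continuous_map_lcs_diff[OF F] continuous_map_from_subtopology fc fc0)
      then have "continuous_map (subtopology ?P ?O) F q"
      proof (rule continuous_map_eq)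
        fix z assume "z \<in> topspace (subtopology ?P ?O)"
        then have "fst z \<noteq> 0" by auto
        then show "(1 / fst z) *\<^sub>R (f (w + fst z *\<^sub>R u) (snd z) - f w (snd z)) = q z"
          by (simp add: q_def case_prod_unfold)
      qed
      moreover have "z \<in> topspace (subtopology ?P ?O)" using False z zz by auto
      ultimately obtain A where A: "openin (subtopology ?P ?O) A" "z \<in> A" "\<forall>y\<in>A. p (q y - q z) < e"
        unfolding continuous_map_seminorm[OF F] using p e by blast
      have "openin ?P A" by (rule openin_trans_full[OF A(1) Oo])
      then show ?thesis using A by blast
    next
      case True
      have e2: "0 < e / 2" using e by simp
      have z0: "(0, p0) \<in> topspace ?P" using T0 p0 by simp
      have "\<exists>A. openin ?P A \<and> (0, p0) \<in> A \<and> (\<forall>y\<in>A. p (H (fst y) (snd y) - H 0 p0) < e / 2)"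
        using Hc[unfolded continuous_map_seminorm[OF F], THEN conjunct2, rule_format, OF z0 p e2]
        by (simp only: fst_conv snd_conv)
      then obtain A where A': "openin ?P A \<and> (0, p0) \<in> A \<and> (\<forall>y\<in>A. p (H (fst y) (snd y) - H 0 p0) < e / 2)"
        by (rule exE)
      note A = A'[THEN conjunct1] A'[THEN conjunct2, THEN conjunct1] A'[THEN conjunct2, THEN conjunct2]
      have "\<exists>B C. openin (top_of_set T) B \<and> openin (mtop N) C \<and> 0 \<in> B \<and> p0 \<in> C \<and> B \<times> C \<subseteq> A"
        using A(1)[unfolded openin_prod_topology_alt, rule_format, OF A(2)] .
      then obtain B C where BC: "openin (top_of_set T) B" "openin (mtop N) C" "0 \<in> B" "p0 \<in> C" "B \<times> C \<subseteq> A" by metis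
      have Bo: "open B" "B \<subseteq> T" using BC(1) unfolding openin_open_eq[OF To] by blast+
      obtain \<delta> where \<delta>: "\<delta> > 0" "ball (0::real) \<delta> \<subseteq> B" using openE[OF Bo(1) BC(3)] by blast
      have CN: "C \<subseteq> topspace (mtop N)" using openin_subset[OF BC(2)] .
      show ?thesis
      proof (intro exI[of _ "ball (0::real) \<delta> \<times> C"] conjI ballI)
        have "openin (top_of_set T) (ball (0::real) \<delta>)" using To \<delta>(2) Bo(2) by (simp add: openin_open_eq)
        then show "openin ?P (ball (0::real) \<delta> \<times> C)" unfolding openin_prod_Times_iff using BC(2) by blast
        show "z \<in> ball (0::real) \<delta> \<times> C" using True zz \<delta>(1) BC(4) by simp
        fix y assume y: "y \<in> ball (0::real) \<delta> \<times> C"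
        obtain t m where yy: "y = (t, m)" by (cases y)
        have t: "\<bar>t\<bar> < \<delta>" and m: "m \<in> C" and mN: "m \<in> topspace (mtop N)" using y yy CN by auto
        have near: "p (H s m - H 0 p0) < e / 2" if "\<bar>s\<bar> < \<delta>" for s
        proof -
          have "s \<in> ball (0::real) \<delta>" using that by simp
          then have "(s, m) \<in> A" using \<delta>(2) BC(5) m by blast
          then show ?thesis using A(3) by fastforce
        qed
        have inT: "s \<in> T" if "\<bar>s\<bar> < \<delta>" for s
          using that \<delta>(2) Bo(2) by (auto simp: subset_iff)
        have qz: "q z = H 0 p0" using True zz by (simp add: q_def H0)
        show "p (q y - q z) < e"
        proof (cases "t = 0")
          case True
          then have "q y = H 0 m" using yy by (simp add: q_def H0)
          then show ?thesis using near[of 0] \<delta>(1) e qz by simp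
        next
          case False
          have H0m: "H 0 p0 \<in> topspace F" by (rule Hm[OF p0 T0])
          have est: "p (f (w + t *\<^sub>R u) m - f w m - t *\<^sub>R H 0 p0) \<le> \<bar>t\<bar> * (e / 2)"
          proof (rule mean_value_segment[OF F p, where U = W and g = "\<lambda>w. f w m" and d = "\<lambda>s. t *\<^sub>R H (s * t) m"])
            fix s :: real assume s: "0 \<le> s" "s \<le> 1"
            have "\<bar>s * t\<bar> \<le> \<bar>t\<bar>" using s by (simp add: abs_mult mult_left_le_one_le)
            then have st: "\<bar>s * t\<bar> < \<delta>" using t by linarith
            show sW: "w + s *\<^sub>R t *\<^sub>R u \<in> W" using inT[OF st] by (simp add: T_def)
            show "f (w + s *\<^sub>R t *\<^sub>R u) m \<in> topspace F" by (rule fm[OF mN sW])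
            show "has_dir_deriv F W (\<lambda>w. f w m) (w + s *\<^sub>R t *\<^sub>R u) (t *\<^sub>R u) (t *\<^sub>R H (s * t) m)"
              using has_dir_deriv_homogeneous[OF F sW C1map_has[OF C1[OF mN] sW u], of t] by (simp add: H_def)
            have "p (t *\<^sub>R (H (s * t) m - H 0 p0)) = \<bar>t\<bar> * p (H (s * t) m - H 0 p0)"
              by (rule seminorm_scale[OF p lcs_diff_mem[OF F Hm[OF mN inT[OF st]] H0m]])
            moreover have "\<bar>t\<bar> * p (H (s * t) m - H 0 p0) \<le> \<bar>t\<bar> * (e / 2)"
              using near[OF st] by (intro mult_left_mono) simp_all
            ultimately show "p (t *\<^sub>R H (s * t) m - t *\<^sub>R H 0 p0) \<le> \<bar>t\<bar> * (e / 2)"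
              by (simp only: scaleR_diff_right)
          qed (rule lcs_scale_mem[OF F H0m])
          have tT: "w + t *\<^sub>R u \<in> W" using inT[OF t] by (simp add: T_def)
          have mem: "f (w + t *\<^sub>R u) m - f w m - t *\<^sub>R H 0 p0 \<in> topspace F"
            by (intro lcs_diff_mem[OF F] lcs_scale_mem[OF F] H0m fm mN w tT)
          have "q y - q z = (1 / t) *\<^sub>R (f (w + t *\<^sub>R u) m - f w m - t *\<^sub>R H 0 p0)"
            using False yy qz by (simp add: q_def scaleR_diff_right)
          then have "p (q y - q z) = \<bar>1 / t\<bar> * p (f (w + t *\<^sub>R u) m - f w m - t *\<^sub>R H 0 p0)"
            using seminorm_scale[OF p mem] by (simp only:)
          also have "\<dots> \<le> \<bar>1 / t\<bar> * (\<bar>t\<bar> * (e / 2))" using est by (intro mult_left_mono) simp_all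
          also have "\<bar>1 / t\<bar> * (\<bar>t\<bar> * (e / 2)) = e / 2" using False by simp
          also have "e / 2 < e" using e by simp
          finally show ?thesis .
        qed
      qed
    qed
  qed
  then show ?thesis unfolding q_def T_def .
qed

lemma smooth_family_const:
  assumes Z: "lcs Z" and F: "lcs F" and W: "openin Z W" and N: "bman k N"
    and f: "\<And>i. i \<in> mindex N \<Longrightarrow> smooth_on_lcs (mmodel N) (cimg N i) F (\<lambda>x. f (chart_inv N i x))"
  shows "smooth_family Z W N F (\<lambda>w. f)"
  unfolding smooth_family_def
proof
  fix i assume i: "i \<in> mindex N"
  have im: "snd ` (W \<times> cimg N i) \<subseteq> cimg N i" by auto
  show "smooth_on_lcs (prod_topology Z (mmodel N)) (W \<times> cimg N i) F (\<lambda>(w, x). f (chart_inv N i x))"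
    using smooth_on_prelinear[OF lcs_prod[OF Z bman_lcs[OF N]] bman_lcs[OF N] F mb_dom_Times'[OF Z bman_cimg_dom[OF N i] W]
        bman_cimg_dom[OF N i] linear_snd continuous_map_snd im f[OF i]] by (simp add: case_prod_unfold)
qed

lemma smooth_family_slice:
  assumes Z: "lcs Z" and F: "lcs F" and W: "openin Z W" and N: "bman k N" and f: "smooth_family Z W N F f"
    and w: "w \<in> W" and i: "i \<in> mindex N"
  shows "smooth_on_lcs (mmodel N) (cimg N i) F (\<lambda>x. f w (chart_inv N i x))"
  using smooth_on_slice2[OF Z bman_lcs[OF N] F W bman_cimg_dom[OF N i] smooth_familyD[OF f i] w] by simp

text \<open>
  The function is regarded as a constant family, which is jointly continuous.
\<close>

lemma smooth_in_charts_continuous: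
  assumes F: "lcs F" and N: "bman k N"
    and f: "\<And>i. i \<in> mindex N \<Longrightarrow> smooth_on_lcs (mmodel N) (cimg N i) F (\<lambda>x. f (chart_inv N i x))"
  shows "continuous_map (mtop N) F f"
proof -
  have L: "lcs (mmodel N)" by (rule bman_lcs[OF N])
  have "smooth_family (mmodel N) (topspace (mmodel N)) N F (\<lambda>w. f)"
    by (rule smooth_family_const[OF L F openin_topspace N f])
  from fam_continuous[OF L F openin_topspace N this]
  have "continuous_map (prod_topology (mmodel N) (mtop N)) F (\<lambda>z. f (snd z))" by (simp add: case_prod_unfold)
  moreover have "continuous_map (mtop N) (prod_topology (mmodel N) (mtop N)) (\<lambda>p. (0, p))"
    by (intro continuous_map_pairedI) (simp_all add: lcs_zero[OF L])
  ultimately have "continuous_map (mtop N) F (\<lambda>p. f (snd (0 :: nat \<Rightarrow> real, p)))" by (rule continuous_map_compose'[rotated])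
  then show ?thesis by simp
qed

lemma model_domain_locally_compact:
  assumes "Q \<in> model_domains k"
  shows "neighbourhood_base_of (compactin (subtopology (Euclidean_space k) Q)) (subtopology (Euclidean_space k) Q)"
proof -
  have "closedin (Euclidean_space k) {x \<in> topspace (Euclidean_space k). x 0 \<in> {0..}}"
    by (rule closedin_continuous_map_preimage[OF continuous_map_Euclidean_proj]) simp
  then have "closedin (Euclidean_space k) Q" using assms by (auto simp: model_domains_def)
  then have "locally_compact_space (subtopology (Euclidean_space k) Q)"
    by (rule locally_compact_space_closed_subset[OF locally_compact_Euclidean_space])
  then show ?thesis
    using locally_compact_space_neighbourhood_base Hausdorff_space_subtopology[OF Hausdorff_Euclidean_space] by blast
qed

text \<open>
  A half-space is closed in the Euclidean space and hence locally compact, as is each of its relatively open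
  subsets.
\<close>

lemma bman_compact_nbhd:
  assumes N: "bman k N" and O: "openin (mtop N) O'" and p: "p \<in> O'"
  obtains U K where "openin (mtop N) U" "compactin (mtop N) K" "p \<in> U" "U \<subseteq> K" "K \<subseteq> O'"
proof -
  have "p \<in> topspace (mtop N)" using openin_subset[OF O] p by blast
  then obtain i where i: "i \<in> mindex N" "p \<in> mdom N i" unfolding bman_topspace[OF N] by blast
  obtain Q where Q: "Q \<in> model_domains k" "openin (subtopology (mmodel N) Q) (cimg N i)"
    using N i(1) unfolding bman_def by blast
  have Qs: "cimg N i \<subseteq> Q" using openin_imp_subset[OF Q(2)] .
  let ?Y = "subtopology (mmodel N) Q" and ?V = "mchart N i ` (mdom N i \<inter> O')"
  have V: "openin ?Y ?V" by (rule openin_subtopology_chain[OF bman_image_open[OF N i(1) O] Q(2)])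
  have x: "mchart N i p \<in> ?V" using i(2) p by blast
  have "\<exists>U K. openin ?Y U \<and> compactin ?Y K \<and> mchart N i p \<in> U \<and> U \<subseteq> K \<and> K \<subseteq> ?V"
    using model_domain_locally_compact[OF Q(1)] V x unfolding neighbourhood_base_of bman_model[OF N] by blast
  then obtain U K where UK: "openin ?Y U" "compactin ?Y K" "mchart N i p \<in> U" "U \<subseteq> K" "K \<subseteq> ?V" by metis
  have VC: "?V \<subseteq> cimg N i" by blast
  have Uo: "openin (subtopology (mmodel N) (cimg N i)) U"
    by (rule openin_subtopology_smaller[OF UK(1) _ Qs]) (use UK VC in blast)
  have Kc: "compactin (subtopology (mmodel N) (cimg N i)) K"
    using UK(2,5) VC unfolding compactin_subtopology by blast
  show thesis
  proof (rule that)
    have "openin (subtopology (mtop N) (mdom N i)) {q \<in> topspace (subtopology (mtop N) (mdom N i)). mchart N i q \<in> U}"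
      by (rule openin_preimage[OF bman_chart_continuous[OF N i(1)] Uo])
    then show "openin (mtop N) {q \<in> topspace (subtopology (mtop N) (mdom N i)). mchart N i q \<in> U}"
      by (rule openin_trans_full[OF _ bman_dom_open[OF N i(1)]])
    show "compactin (mtop N) (chart_inv N i ` K)"
      by (rule image_compactin[OF Kc bman_chart_inv_continuous[OF N i(1)]])
    show "p \<in> {q \<in> topspace (subtopology (mtop N) (mdom N i)). mchart N i q \<in> U}"
      unfolding bman_topsub[OF N i(1)] using i(2) UK(3) by simp
    show "{q \<in> topspace (subtopology (mtop N) (mdom N i)). mchart N i q \<in> U} \<subseteq> chart_inv N i ` K"
    proof
      fix q assume "q \<in> {q \<in> topspace (subtopology (mtop N) (mdom N i)). mchart N i q \<in> U}"
      then have q: "q \<in> mdom N i" "mchart N i q \<in> K" using UK(4) by auto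
      then show "q \<in> chart_inv N i ` K" using bman_inv[OF N i(1) q(1)] by (intro image_eqI[of _ _ "mchart N i q"]) simp_all
    qed
    show "chart_inv N i ` K \<subseteq> O'"
    proof
      fix q assume "q \<in> chart_inv N i ` K"
      then obtain r where r: "r \<in> mdom N i" "r \<in> O'" "q = chart_inv N i (mchart N i r)" using UK(5) by blast
      then show "q \<in> O'" using bman_inv[OF N i(1) r(1)] by simp
    qed
  qed
qed

section \<open>The space of smooth functions\<close>

text \<open>
  If \<open>h s\<close> maps the compact set \<open>K\<close> into \<open>V\<close>, then by the tube lemma so does \<open>h s'\<close> for all \<open>s'\<close> near \<open>s\<close>.
\<close>

lemma curry_compact_open:
  assumes h: "continuous_map (prod_topology S P) Y (\<lambda>(s, p). h s p)"
  shows "continuous_map S (compact_open_topology P Y) (\<lambda>s. restrict (h s) (topspace P))"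
proof -
  have cont: "continuous_map P Y (restrict (h s) (topspace P))" if "s \<in> topspace S" for s
  proof -
    have "continuous_map P (prod_topology S P) (\<lambda>p. (s, p))"
      using that by (intro continuous_map_pairedI) simp_all
    from continuous_map_compose'[OF this h] have "continuous_map P Y (h s)" by simp
    then show ?thesis by (rule continuous_map_eq) simp
  qed
  show ?thesis
    unfolding compact_open_topology_def
  proof (rule continuous_on_generated_topo)
    fix G assume "G \<in> {{f \<in> extensional (topspace P). continuous_map P Y f \<and> f ` K \<subseteq> V} | K V. compactin P K \<and> openin Y V}"
    then obtain K V where K: "compactin P K" and V: "openin Y V"
      and G: "G = {f \<in> extensional (topspace P). continuous_map P Y f \<and> f ` K \<subseteq> V}" by blast
    have KP: "K \<subseteq> topspace P" using compactin_subset_topspace[OF K] .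
    have eq: "(\<lambda>s. restrict (h s) (topspace P)) -` G \<inter> topspace S = {s \<in> topspace S. \<forall>p\<in>K. h s p \<in> V}"
    proof -
      have "restrict (h s) (topspace P) ` K \<subseteq> V \<longleftrightarrow> (\<forall>p\<in>K. h s p \<in> V)" for s using KP by (auto simp: image_subset_iff)
      then show ?thesis using cont unfolding G by auto
    qed
    show "openin S ((\<lambda>s. restrict (h s) (topspace P)) -` G \<inter> topspace S)"
      unfolding eq
    proof (subst openin_subopen, safe)
      fix s assume s: "s \<in> topspace S" "\<forall>p\<in>K. h s p \<in> V"
      let ?O = "{z \<in> topspace (prod_topology S P). (\<lambda>(s, p). h s p) z \<in> V}"
      have oO: "openin (prod_topology S P) ?O" by (rule openin_preimage[OF h V])
      have sub: "{s} \<times> K \<subseteq> ?O" using s KP by auto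
      obtain A B where AB: "openin S A" "openin P B" "s \<in> A" "K \<subseteq> B" "A \<times> B \<subseteq> ?O"
        using tube_lemma_right[OF oO K s(1) sub] by (elim exE conjE) (rule that)
      have "A \<subseteq> {s \<in> topspace S. \<forall>p\<in>K. h s p \<in> V}"
      proof
        fix s' assume s': "s' \<in> A"
        have "(s', p) \<in> ?O" if "p \<in> K" for p using AB s' that by blast
        then show "s' \<in> {s \<in> topspace S. \<forall>p\<in>K. h s p \<in> V}" using openin_subset[OF AB(1)] s' by auto
      qed
      then show "\<exists>A. openin S A \<and> s \<in> A \<and> A \<subseteq> {s \<in> topspace S. \<forall>p\<in>K. h s p \<in> V}" using AB by blast
    qed
  next
    show "(\<lambda>s. restrict (h s) (topspace P)) ` topspace S
      \<subseteq> \<Union> {{f \<in> extensional (topspace P). continuous_map P Y f \<and> f ` K \<subseteq> V} | K V. compactin P K \<and> openin Y V}"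
    proof safe
      fix s assume s: "s \<in> topspace S"
      have "restrict (h s) (topspace P) \<in> {f \<in> extensional (topspace P). continuous_map P Y f \<and> f ` {} \<subseteq> topspace Y}"
        using cont[OF s] by simp
      moreover have "compactin P {}" "openin Y (topspace Y)" by simp_all
      ultimately show "restrict (h s) (topspace P) \<in> \<Union> {{f \<in> extensional (topspace P). continuous_map P Y f \<and> f ` K \<subseteq> V} | K V. compactin P K \<and> openin Y V}"
        by blast
    qed
  qed
qed

lemma Tn_manifold_Suc: "Tn_manifold (Suc n) M = tangent_bundle (Tn_manifold n M)"
  by (simp add: Tn_manifold_def)

lemma Tn_manifold_0: "Tn_manifold 0 M = base_manifold M"
  by (simp add: Tn_manifold_def)

lemma Tn_lcs_Suc: "Tn_lcs (Suc n) E = seq_square (Tn_lcs n E)"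
  by (simp add: Tn_lcs_def)

lemma Tn_lcs_0: "Tn_lcs 0 E = seq_lcs E"
  by (simp add: Tn_lcs_def)

lemma mindex_Tn_manifold: "mindex (Tn_manifold n M) = mindex M"
  by (induction n) (simp_all add: Tn_manifold_Suc Tn_manifold_0 tangent_bundle_sel base_manifold_sel)

lemma linear_lincomb: "linear (\<lambda>z::'a::real_vector \<times> 'a. fst z + c *\<^sub>R snd z)"
  by (intro linearI) (auto simp: algebra_simps)

lemma continuous_map_lincomb: "lcs Y \<Longrightarrow> continuous_map (prod_topology Y Y) Y (\<lambda>z. fst z + c *\<^sub>R snd z)"
  by (intro continuous_map_lcs_add continuous_map_lcs_scale continuous_map_fst continuous_map_snd) auto

lemma smooth_on_lincomb:
  assumes "lcs X" "lcs Y" "mb_dom X U" "smooth_on_lcs X U Y f" "smooth_on_lcs X U Y g"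
  shows "smooth_on_lcs X U Y (\<lambda>x. f x + c *\<^sub>R g x)"
  using smooth_on_postlinear[OF assms(1) lcs_prod[OF assms(2,2)] assms(2,3) linear_lincomb continuous_map_lincomb[OF assms(2)]
      smooth_on_pair[OF assms(1,2,2,3,4,5)]] by simp

lemma C1map_lincomb:
  assumes "lcs Y" "C1map X U Y f df" "C1map X U Y g dg"
  shows "C1map X U Y (\<lambda>x. f x + c *\<^sub>R g x) (\<lambda>x h. df x h + c *\<^sub>R dg x h)"
  using C1map_postlinear[OF C1map_pair[OF assms(2,3)] linear_lincomb continuous_map_lincomb[OF assms(1)]] by simp

text \<open>
  Membership of a fixed point in a generated open set passes through finitely many intersections, so a
  property of neighbourhoods that is stable under intersection only has to be arranged for the generators.
  Both the compact-open and the product topology are treated in this way.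
\<close>

lemma generated_local_base:
  fixes \<Psi> :: "'a \<Rightarrow> 'b"
  assumes gi: "\<And>A B. good A \<Longrightarrow> good B \<Longrightarrow> good (A \<inter> B)"
    and base: "\<And>S. S \<in> \<S> \<Longrightarrow> a0 \<in> S \<Longrightarrow> \<exists>V. good V \<and> \<Psi> ` V \<subseteq> S"
    and G: "openin (topology_generated_by \<S>) G" "a0 \<in> G"
  shows "\<exists>V. good V \<and> \<Psi> ` V \<subseteq> G"
proof -
  have "generate_topology_on \<S> G" using G(1) by (rule openin_topology_generated_by)
  then show ?thesis using G(2)
  proof (induction rule: generate_topology_on.induct)
    case Empty
    then show ?case by simp
  next
    case (Int a b)
    have ab: "a0 \<in> a" "a0 \<in> b" using Int.prems by simp_all
    obtain A where A: "good A" "\<Psi> ` A \<subseteq> a" using Int.IH(1)[OF ab(1)] by (elim exE conjE)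
    obtain B where B: "good B" "\<Psi> ` B \<subseteq> b" using Int.IH(2)[OF ab(2)] by (elim exE conjE)
    have "\<Psi> ` (A \<inter> B) \<subseteq> a \<inter> b" using A(2) B(2) by auto
    with gi[OF A(1) B(1)] show ?case by (intro exI conjI)
  next
    case (UN K)
    from UN.prems obtain k where k: "k \<in> K" "a0 \<in> k" by (rule UnionE)
    obtain V where V: "good V" "\<Psi> ` V \<subseteq> k" using UN.IH[OF k] by (elim exE conjE)
    have "\<Psi> ` V \<subseteq> \<Union> K" using V(2) k(1) by auto
    with V(1) show ?case by (intro exI conjI)
  next
    case (Basis s)
    then show ?case by (rule base)
  qed
qed

context
  fixes d :: nat and M :: "('m, nat \<Rightarrow> real, 'i) manifold" and E :: "'e::real_vector topology"
  assumes M: "bman d M" and E: "lcs E"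
begin

lemma Tn_bman: "bman (2 ^ n * d) (Tn_manifold n M)"
  by (rule bman_Tn_manifold[OF M])

lemma Tn_model_lcs: "lcs (mmodel (Tn_manifold n M))"
  by (rule bman_lcs[OF Tn_bman])

lemma TnE: "lcs (Tn_lcs n E)"
  by (rule lcs_Tn_lcs[OF E])

text \<open>
  Smoothness in charts entails continuity.
\<close>

lemma smooth_functions_iff:
  "f \<in> smooth_functions M E \<longleftrightarrow>
    (\<forall>i\<in>mindex M. smooth_on_lcs (mmodel M) (cimg M i) E (\<lambda>x. f (chart_inv M i x))) \<and> (\<forall>m. m \<notin> topspace (mtop M) \<longrightarrow> f m = 0)"
proof -
  have dom: "mdom M i \<inter> f -` topspace E = mdom M i" if "continuous_map (mtop M) E f" "i \<in> mindex M" for i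
    using bman_dom_sub[OF M that(2)] continuous_map_image_subset_topspace[OF that(1)] by blast
  have "smooth_map M (lcs_manifold E) f \<longleftrightarrow> continuous_map (mtop M) E f \<and>
     (\<forall>i\<in>mindex M. smooth_on_lcs (mmodel M) (mchart M i ` (mdom M i \<inter> f -` topspace E)) E (\<lambda>x. f (chart_inv M i x)))"
    by (simp add: smooth_map_def lcs_manifold_def o_def)
  also have "\<dots> \<longleftrightarrow> continuous_map (mtop M) E f \<and>
     (\<forall>i\<in>mindex M. smooth_on_lcs (mmodel M) (cimg M i) E (\<lambda>x. f (chart_inv M i x)))"
    using dom by auto
  also have "\<dots> \<longleftrightarrow> (\<forall>i\<in>mindex M. smooth_on_lcs (mmodel M) (cimg M i) E (\<lambda>x. f (chart_inv M i x)))"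
    using smooth_in_charts_continuous[OF E M] by blast
  finally show ?thesis by (simp add: smooth_functions_def)
qed

lemma smooth_family_Tn_map:
  assumes Z: "lcs Z" and W: "openin Z W" and f: "smooth_family Z W M E f"
  shows "smooth_family Z W (Tn_manifold n M) (Tn_lcs n E) (\<lambda>w. Tn_map n M E (f w))"
proof (induction n)
  case 0
  show ?case
    unfolding smooth_family_def Tn_manifold_0 Tn_lcs_0 Tn_map.simps
  proof
    fix i assume "i \<in> mindex (base_manifold M)"
    then have i: "i \<in> mindex M" by (simp add: base_manifold_sel)
    have "smooth_on_lcs (prod_topology Z (mmodel M)) (W \<times> cimg M i) (seq_lcs E) (\<lambda>y. seq_embed ((\<lambda>(w, x). f w (chart_inv M i x)) y))"
      by (rule smooth_on_postlinear[OF lcs_prod[OF Z bman_lcs[OF M]] E lcs_seq_lcs[OF E] mb_dom_Times'[OF Z bman_cimg_dom[OF M i] W]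
          linear_seq_embed continuous_map_seq_embed smooth_familyD[OF f i]])
    then show "smooth_on_lcs (prod_topology Z (mmodel (base_manifold M))) (W \<times> cimg (base_manifold M) i) (seq_lcs E)
       (\<lambda>(w, x). (seq_embed \<circ> f w \<circ> fst) (chart_inv (base_manifold M) i x))"
      unfolding base_cimg base_manifold_sel(2)
      by (rule smooth_on_cong) (clarsimp simp: base_chart_inv[OF M i])
  qed
next
  case (Suc n)
  show ?case
    unfolding Tn_manifold_Suc Tn_lcs_Suc Tn_map.simps
    by (rule smooth_family_tangent_map[OF Z TnE W Tn_bman Suc])
qed

lemma const_family:
  assumes Z: "lcs Z" and W: "openin Z W" and f: "f \<in> smooth_functions M E"
  shows "smooth_family Z W M E (\<lambda>w. f)"
  using f unfolding smooth_functions_iff by (intro smooth_family_const[OF Z E W M]) blast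

lemma Tn_map_smooth:
  assumes f: "f \<in> smooth_functions M E" and i: "i \<in> mindex M"
  shows "smooth_on_lcs (mmodel (Tn_manifold n M)) (cimg (Tn_manifold n M) i) (Tn_lcs n E) (\<lambda>x. Tn_map n M E f (chart_inv (Tn_manifold n M) i x))"
proof -
  have L: "lcs (mmodel M)" by (rule bman_lcs[OF M])
  show ?thesis
    by (rule smooth_family_slice[OF L TnE openin_topspace Tn_bman smooth_family_Tn_map[OF L openin_topspace const_family[OF L openin_topspace f]] lcs_zero[OF L]])
      (simp add: mindex_Tn_manifold i)
qed

lemma Tn_map_C1:
  assumes f: "f \<in> smooth_functions M E" and i: "i \<in> mindex M"
  shows "C1map (mmodel (Tn_manifold n M)) (cimg (Tn_manifold n M) i) (Tn_lcs n E) (\<lambda>x. Tn_map n M E f (chart_inv (Tn_manifold n M) i x))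
     (dir_deriv (Tn_lcs n E) (cimg (Tn_manifold n M) i) (\<lambda>x. Tn_map n M E f (chart_inv (Tn_manifold n M) i x)))"
  by (rule smooth_on_C1map[OF Tn_model_lcs TnE bman_cimg_dom[OF Tn_bman] Tn_map_smooth[OF f i]]) (simp add: mindex_Tn_manifold i)

lemma Tn_map_continuous:
  assumes f: "f \<in> smooth_functions M E"
  shows "continuous_map (mtop (Tn_manifold n M)) (Tn_lcs n E) (Tn_map n M E f)"
  by (rule smooth_in_charts_continuous[OF TnE Tn_bman Tn_map_smooth[OF f]]) (simp add: mindex_Tn_manifold)

lemma Tn_map_mem: "f \<in> smooth_functions M E \<Longrightarrow> p \<in> topspace (mtop (Tn_manifold n M)) \<Longrightarrow> Tn_map n M E f p \<in> topspace (Tn_lcs n E)"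
  using continuous_map_image_subset_topspace[OF Tn_map_continuous] by blast

lemma Tn_map_Suc_lift:
  assumes f: "f \<in> smooth_functions M E" and i: "i \<in> mindex M" and z: "z \<in> seq_times (cimg (Tn_manifold n M) i) (topspace (mmodel (Tn_manifold n M)))"
  shows "Tn_map (Suc n) M E f (tangent_lift (Tn_manifold n M) i z) =
    seq_pair (Tn_map n M E f (chart_inv (Tn_manifold n M) i (seq_fst z)))
      (dir_deriv (Tn_lcs n E) (cimg (Tn_manifold n M) i) (\<lambda>x. Tn_map n M E f (chart_inv (Tn_manifold n M) i x)) (seq_fst z) (seq_snd z))"
  unfolding Tn_map.simps
  by (rule tangent_map_lift[OF Tn_bman TnE Tn_map_C1[OF f] _ z]) (simp_all add: mindex_Tn_manifold i)

lemma smooth_functions_lincomb: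
  assumes "f \<in> smooth_functions M E" "g \<in> smooth_functions M E"
  shows "f + c *\<^sub>R g \<in> smooth_functions M E"
  using assms unfolding smooth_functions_iff plus_fun_def scaleR_fun_def
  by (auto intro!: smooth_on_lincomb bman_lcs[OF M] E bman_cimg_dom[OF M])

lemma zero_smooth: "0 \<in> smooth_functions M E"
  unfolding smooth_functions_iff zero_fun_def
  using smooth_on_const[OF bman_lcs[OF M] E bman_cimg_dom[OF M] lcs_zero[OF E]] by blast

text \<open>
  In a chart the second component of a tangent map is a derivative, which is linear in the function; the case
  of a sum with a scaled summand gives sums and multiples at once.
\<close>

lemma Tn_map_lincomb:
  assumes f: "f \<in> smooth_functions M E" and g: "g \<in> smooth_functions M E"
    and q: "q \<in> topspace (mtop (Tn_manifold n M))"
  shows "Tn_map n M E (f + c *\<^sub>R g) q = Tn_map n M E f q + c *\<^sub>R Tn_map n M E g q"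
  using q
proof (induction n arbitrary: q)
  case 0
  show ?case by (simp add: scaleR_fun_def[of c g] linear_add[OF linear_seq_embed] linear_scale[OF linear_seq_embed])
next
  case (Suc n)
  let ?N = "Tn_manifold n M" and ?F = "Tn_lcs n E"
  have q: "q \<in> topspace (mtop (tangent_bundle ?N))" using Suc.prems by (simp add: Tn_manifold_Suc)
  then obtain i where i: "i \<in> mindex ?N" "q \<in> tangent_dom ?N i" unfolding tangent_topspace[OF Tn_bman] by blast
  define z where "z = tangent_chart ?N i q"
  note t = tangent_chart_mem[OF Tn_bman i, folded z_def]
  have iM: "j \<in> mindex M" if "j \<in> mindex ?N" for j using that by (simp add: mindex_Tn_manifold)
  let ?f = "Tn_map n M E f" and ?g = "Tn_map n M E g"
  have "Tn_map (Suc n) M E (f + c *\<^sub>R g) q = tangent_map ?N ?F (\<lambda>p. ?f p + c *\<^sub>R ?g p) q"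
    unfolding Tn_map.simps by (rule tangent_map_cong[OF Tn_bman q Suc.IH])
  also have "\<dots> = tangent_map ?N ?F (\<lambda>p. ?f p + c *\<^sub>R ?g p) (tangent_lift ?N i z)" unfolding t(2) ..
  also have "\<dots> = seq_pair (?f (chart_inv ?N i (seq_fst z)) + c *\<^sub>R ?g (chart_inv ?N i (seq_fst z)))
     (dir_deriv ?F (cimg ?N i) (\<lambda>x. ?f (chart_inv ?N i x)) (seq_fst z) (seq_snd z)
       + c *\<^sub>R dir_deriv ?F (cimg ?N i) (\<lambda>x. ?g (chart_inv ?N i x)) (seq_fst z) (seq_snd z))"
    by (rule tangent_map_lift[OF Tn_bman TnE C1map_lincomb[OF TnE Tn_map_C1[OF f iM] Tn_map_C1[OF g iM]] i(1) t(1)])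
  also have "\<dots> = Tn_map (Suc n) M E f (tangent_lift ?N i z) + c *\<^sub>R Tn_map (Suc n) M E g (tangent_lift ?N i z)"
    unfolding Tn_map_Suc_lift[OF f iM[OF i(1)] t(1)] Tn_map_Suc_lift[OF g iM[OF i(1)] t(1)] by (simp only: seq_pair_add seq_pair_scale)
  finally show ?case unfolding t(2) .
qed

lemma Tn_map_zero:
  assumes q: "q \<in> topspace (mtop (Tn_manifold n M))"
  shows "Tn_map n M E 0 q = 0"
  using Tn_map_lincomb[OF zero_smooth zero_smooth q, of 1] by simp

lemma Tn_map_scale:
  assumes f: "f \<in> smooth_functions M E" and q: "q \<in> topspace (mtop (Tn_manifold n M))"
  shows "Tn_map n M E (c *\<^sub>R f) q = c *\<^sub>R Tn_map n M E f q"
  using Tn_map_lincomb[OF zero_smooth f q, of c] by (simp add: Tn_map_zero[OF q])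

lemma Tn_map_add:
  assumes f: "f \<in> smooth_functions M E" and g: "g \<in> smooth_functions M E" and q: "q \<in> topspace (mtop (Tn_manifold n M))"
  shows "Tn_map n M E (f + g) q = Tn_map n M E f q + Tn_map n M E g q"
  using Tn_map_lincomb[OF f g q, of 1] by simp

abbreviation (input) "jet \<equiv> (\<lambda>f n. restrict (Tn_map n M E f) (topspace (mtop (Tn_manifold n M))))"
abbreviation (input) "CO n \<equiv> compact_open_topology (mtop (Tn_manifold n M)) (Tn_lcs n E)"

lemma topspace_CO: "topspace (CO n) = {f \<in> extensional (topspace (mtop (Tn_manifold n M))). continuous_map (mtop (Tn_manifold n M)) (Tn_lcs n E) f}"
proof -
  let ?G = "{{f \<in> extensional (topspace (mtop (Tn_manifold n M))). continuous_map (mtop (Tn_manifold n M)) (Tn_lcs n E) f \<and> f ` K \<subseteq> V} | K V.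
          compactin (mtop (Tn_manifold n M)) K \<and> openin (Tn_lcs n E) V}"
  have "{f \<in> extensional (topspace (mtop (Tn_manifold n M))). continuous_map (mtop (Tn_manifold n M)) (Tn_lcs n E) f \<and> f ` {} \<subseteq> {}} \<in> ?G"
  proof -
    have "compactin (mtop (Tn_manifold n M)) {}" "openin (Tn_lcs n E) {}" by simp_all
    then show ?thesis by blast
  qed
  then have "{f \<in> extensional (topspace (mtop (Tn_manifold n M))). continuous_map (mtop (Tn_manifold n M)) (Tn_lcs n E) f} \<in> ?G" by simp
  then show ?thesis unfolding compact_open_topology_def topology_generated_by_topspace by auto
qed

lemma jet_mem: "f \<in> smooth_functions M E \<Longrightarrow> jet f n \<in> topspace (CO n)"
  unfolding topspace_CO using continuous_map_eq[OF Tn_map_continuous, of f n "jet f n"] by simp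

lemma topspace_smooth_function_space: "topspace (smooth_function_space M E) = smooth_functions M E"
  unfolding smooth_function_space_def topspace_pullback_topology topspace_product_topology
  using jet_mem by auto

lemma continuous_map_into_function_space:
  assumes m: "\<And>s. s \<in> topspace S \<Longrightarrow> \<Phi> s \<in> smooth_functions M E"
    and c: "\<And>n. continuous_map (prod_topology S (mtop (Tn_manifold n M))) (Tn_lcs n E) (\<lambda>(s, p). Tn_map n M E (\<Phi> s) p)"
  shows "continuous_map S (smooth_function_space M E) \<Phi>"
  unfolding smooth_function_space_def continuous_map_pullback_iff
proof
  show "\<Phi> ` topspace S \<subseteq> smooth_functions M E" using m by blast
  have "continuous_map S (CO n) (\<lambda>s. jet (\<Phi> s) n)" for n
    by (rule curry_compact_open[OF c])
  then show "continuous_map S (product_topology (\<lambda>n. CO n) UNIV) (jet \<circ> \<Phi>)"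
    unfolding continuous_map_componentwise_UNIV o_def by blast
qed

lemma jet_continuous: "continuous_map (smooth_function_space M E) (CO n) (\<lambda>f. jet f n)"
proof -
  have "continuous_map (smooth_function_space M E) (product_topology (\<lambda>n. CO n) UNIV) jet"
    unfolding smooth_function_space_def by (rule continuous_map_from_pullback)
  then show ?thesis unfolding continuous_map_componentwise_UNIV by blast
qed

lemma compact_open_preimage_open:
  assumes K: "compactin (mtop (Tn_manifold n M)) K" and V: "openin (Tn_lcs n E) V"
  shows "openin (smooth_function_space M E) {f \<in> smooth_functions M E. \<forall>p\<in>K. Tn_map n M E f p \<in> V}"
proof -
  let ?G = "{f \<in> extensional (topspace (mtop (Tn_manifold n M))). continuous_map (mtop (Tn_manifold n M)) (Tn_lcs n E) f \<and> f ` K \<subseteq> V}"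
  have "openin (CO n) ?G"
    unfolding compact_open_topology_def using K V by (intro topology_generated_by_Basis) blast
  from openin_preimage[OF jet_continuous this]
  have "openin (smooth_function_space M E) {f \<in> smooth_functions M E. jet f n \<in> ?G}"
    unfolding topspace_smooth_function_space .
  moreover have "jet f n \<in> ?G \<longleftrightarrow> (\<forall>p\<in>K. Tn_map n M E f p \<in> V)" if "f \<in> smooth_functions M E" for f
    using jet_mem[OF that, of n] compactin_subset_topspace[OF K] unfolding topspace_CO by (auto simp: image_subset_iff)
  then have "{f \<in> smooth_functions M E. jet f n \<in> ?G} = {f \<in> smooth_functions M E. \<forall>p\<in>K. Tn_map n M E f p \<in> V}" by blast
  ultimately show ?thesis by simp
qed

text \<open>
  Local compactness of \<open>T\<^sup>nM\<close> enters here: a point has a compact neighbourhood \<open>K\<close> that \<open>T\<^sup>nf\<close> maps into \<open>V\<close>,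
  and the functions with this property for the same \<open>K\<close> form an open set.
\<close>

lemma Tn_eval_continuous:
  "continuous_map (prod_topology (smooth_function_space M E) (mtop (Tn_manifold n M))) (Tn_lcs n E) (\<lambda>z. Tn_map n M E (fst z) (snd z))"
  unfolding continuous_map_def
proof (intro conjI allI impI)
  let ?X = "smooth_function_space M E" and ?N = "mtop (Tn_manifold n M)"
  show "(\<lambda>z. Tn_map n M E (fst z) (snd z)) \<in> topspace (prod_topology ?X ?N) \<rightarrow> topspace (Tn_lcs n E)"
    using Tn_map_mem by (auto simp: topspace_smooth_function_space)
  fix V assume V: "openin (Tn_lcs n E) V"
  show "openin (prod_topology ?X ?N) {z \<in> topspace (prod_topology ?X ?N). Tn_map n M E (fst z) (snd z) \<in> V}"
  proof (subst openin_subopen, intro ballI)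
    fix z assume z: "z \<in> {z \<in> topspace (prod_topology ?X ?N). Tn_map n M E (fst z) (snd z) \<in> V}"
    then have f: "fst z \<in> smooth_functions M E" and p: "snd z \<in> topspace ?N" and fp: "Tn_map n M E (fst z) (snd z) \<in> V"
      by (auto simp: topspace_smooth_function_space)
    have O: "openin ?N {p \<in> topspace ?N. Tn_map n M E (fst z) p \<in> V}"
      by (rule openin_preimage[OF Tn_map_continuous[OF f] V])
    have pO: "snd z \<in> {p \<in> topspace ?N. Tn_map n M E (fst z) p \<in> V}" using p fp by simp
    obtain U K where UK: "openin ?N U" "compactin ?N K" "snd z \<in> U" "U \<subseteq> K" "K \<subseteq> {p \<in> topspace ?N. Tn_map n M E (fst z) p \<in> V}"
      by (rule bman_compact_nbhd[OF Tn_bman O pO])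
    let ?A = "{f \<in> smooth_functions M E. \<forall>p\<in>K. Tn_map n M E f p \<in> V}"
    have "openin (prod_topology ?X ?N) (?A \<times> U)"
      unfolding openin_prod_Times_iff using compact_open_preimage_open[OF UK(2) V] UK(1) by blast
    moreover have "z \<in> ?A \<times> U" using f UK(3,5) by (auto simp: mem_Times_iff)
    moreover have "?A \<times> U \<subseteq> {z \<in> topspace (prod_topology ?X ?N). Tn_map n M E (fst z) (snd z) \<in> V}"
      using UK(4) openin_subset[OF UK(1)] by (auto simp: topspace_smooth_function_space)
    ultimately show "\<exists>T. openin (prod_topology ?X ?N) T \<and> z \<in> T \<and> T \<subseteq> {z \<in> topspace (prod_topology ?X ?N). Tn_map n M E (fst z) (snd z) \<in> V}"
      by (intro exI[of _ "?A \<times> U"] conjI)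
  qed
qed

lemma Tn_eval_continuous':
  assumes "continuous_map T (smooth_function_space M E) a" "continuous_map T (mtop (Tn_manifold n M)) b"
  shows "continuous_map T (Tn_lcs n E) (\<lambda>z. Tn_map n M E (a z) (b z))"
  using continuous_map_compose'[OF continuous_map_pairedI[OF assms] Tn_eval_continuous] by simp

text \<open>
  For convex \<open>V\<close> the functions \<open>f\<close> such that \<open>T\<^sup>nf\<close> maps \<open>K\<close> into \<open>V\<close> form a convex set, because \<open>T\<^sup>n\<close> is linear
  in \<open>f\<close>.
\<close>

lemma function_space_convex_base:
  assumes U: "openin (smooth_function_space M E) U" and U0: "0 \<in> U"
  shows "\<exists>V. openin (smooth_function_space M E) V \<and> 0 \<in> V \<and> V \<subseteq> U \<and> convex V"
proof -
  let ?X = "smooth_function_space M E" and ?SF = "smooth_functions M E"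
  define good where "good = (\<lambda>V. openin ?X V \<and> 0 \<in> V \<and> convex V \<and> V \<subseteq> ?SF)"
  have gi: "good (A \<inter> B)" if "good A" "good B" for A B using that unfolding good_def by (auto intro: convex_Int)
  have convSF: "convex ?SF"
  proof (rule convexI)
    fix f g :: "'m \<Rightarrow> 'e" and u v :: real assume fg: "f \<in> ?SF" "g \<in> ?SF"
    have "0 + u *\<^sub>R f \<in> ?SF" by (rule smooth_functions_lincomb[OF zero_smooth fg(1)])
    then have "u *\<^sub>R f + v *\<^sub>R g \<in> ?SF" by (intro smooth_functions_lincomb fg(2)) simp
    then show "u *\<^sub>R f + v *\<^sub>R g \<in> ?SF" .
  qed
  have top: "good ?SF" unfolding good_def using zero_smooth convSF openin_topspace[of ?X] by (simp add: topspace_smooth_function_space)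
  have CO: "\<exists>V. good V \<and> (\<lambda>f. jet f n) ` V \<subseteq> G" if G: "openin (CO n) G" "jet 0 n \<in> G" for n G
  proof (rule generated_local_base[of good _ "jet 0 n" "\<lambda>f. jet f n" G])
    show "openin (topology_generated_by {{f \<in> extensional (topspace (mtop (Tn_manifold n M))). continuous_map (mtop (Tn_manifold n M)) (Tn_lcs n E) f \<and> f ` K \<subseteq> V} | K V.
          compactin (mtop (Tn_manifold n M)) K \<and> openin (Tn_lcs n E) V}) G"
      using G(1) unfolding compact_open_topology_def .
    show "jet 0 n \<in> G" by (rule G(2))
    show "good (A \<inter> B)" if "good A" "good B" for A B by (rule gi[OF that])
    fix S assume S: "S \<in> {{f \<in> extensional (topspace (mtop (Tn_manifold n M))). continuous_map (mtop (Tn_manifold n M)) (Tn_lcs n E) f \<and> f ` K \<subseteq> V} | K V.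
          compactin (mtop (Tn_manifold n M)) K \<and> openin (Tn_lcs n E) V}" "jet 0 n \<in> S"
    then obtain K V where K: "compactin (mtop (Tn_manifold n M)) K" and V: "openin (Tn_lcs n E) V"
      and S': "S = {f \<in> extensional (topspace (mtop (Tn_manifold n M))). continuous_map (mtop (Tn_manifold n M)) (Tn_lcs n E) f \<and> f ` K \<subseteq> V}" by blast
    have KP: "K \<subseteq> topspace (mtop (Tn_manifold n M))" using compactin_subset_topspace[OF K] .
    have jS: "jet f n \<in> S \<longleftrightarrow> (\<forall>p\<in>K. Tn_map n M E f p \<in> V)" if "f \<in> ?SF" for f
      using jet_mem[OF that, of n] KP unfolding topspace_CO S' by (auto simp: image_subset_iff)
    show "\<exists>V. good V \<and> (\<lambda>f. jet f n) ` V \<subseteq> S"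
    proof (cases "K = {}")
      \<comment> \<open>For empty \<open>K\<close> the set \<open>V\<close> may miss \<open>0\<close>, and \<open>S\<close> is the whole space.\<close>
      case True
      then have "(\<lambda>f. jet f n) ` ?SF \<subseteq> S" using jS by blast
      then show ?thesis using top by blast
    next
      case False
      then obtain p where p: "p \<in> K" by blast
      then have "Tn_map n M E 0 p \<in> V" using jS[OF zero_smooth] S(2) by blast
      moreover have K0: "Tn_map n M E 0 p = 0" if "p \<in> K" for p
        by (rule Tn_map_zero) (use that KP in blast)
      ultimately have V0: "0 \<in> V" using p by simp
      obtain V' where V': "openin (Tn_lcs n E) V'" "0 \<in> V'" "V' \<subseteq> V" "convex V'"
        by (rule lcs_convex_nbhd[OF TnE V V0])
      let ?A = "{f \<in> ?SF. \<forall>p\<in>K. Tn_map n M E f p \<in> V'}"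
      have "convex ?A"
      proof (rule convexI)
        fix f g :: "'m \<Rightarrow> 'e" and u v :: real assume fg: "f \<in> ?A" "g \<in> ?A" and uv: "0 \<le> u" "0 \<le> v" "u + v = 1"
        have f: "f \<in> ?SF" and g: "g \<in> ?SF" using fg by auto
        have "u *\<^sub>R f + v *\<^sub>R g \<in> ?SF" using convSF f g uv by (rule convexD)
        moreover have "Tn_map n M E (u *\<^sub>R f + v *\<^sub>R g) p \<in> V'" if p: "p \<in> K" for p
        proof -
          have pN: "p \<in> topspace (mtop (Tn_manifold n M))" using p KP by blast
          have uf: "u *\<^sub>R f \<in> ?SF" using smooth_functions_lincomb[OF zero_smooth f, of u] by simp
          have "Tn_map n M E (u *\<^sub>R f + v *\<^sub>R g) p = u *\<^sub>R Tn_map n M E f p + v *\<^sub>R Tn_map n M E g p"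
            unfolding Tn_map_lincomb[OF uf g pN] Tn_map_scale[OF f pN] ..
          also have "\<dots> \<in> V'" using V'(4) fg p uv by (intro convexD) auto
          finally show ?thesis .
        qed
        ultimately show "u *\<^sub>R f + v *\<^sub>R g \<in> ?A" by blast
      qed
      moreover have "0 \<in> ?A" using zero_smooth V'(2) K0 by simp
      ultimately have "good ?A" unfolding good_def using compact_open_preimage_open[OF K V'(1)] by blast
      moreover have "(\<lambda>f. jet f n) ` ?A \<subseteq> S" using jS V'(3) by blast
      ultimately show ?thesis by blast
    qed
  qed
  obtain G where G: "openin (product_topology (\<lambda>n. CO n) UNIV) G" "U = jet -` G \<inter> ?SF"
    using U unfolding smooth_function_space_def openin_pullback_topology by blast
  have "\<exists>V. good V \<and> jet ` V \<subseteq> G"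
  proof (rule generated_local_base[of good _ "jet 0" jet G])
    show "good (A \<inter> B)" if "good A" "good B" for A B by (rule gi[OF that])
    show "openin (topology_generated_by {(\<Pi>\<^sub>E i\<in>UNIV. Y i) |Y. (\<forall>i. openin (CO i) (Y i)) \<and> finite {i. Y i \<noteq> topspace (CO i)}}) G"
      using G(1) unfolding product_topology_def .
    show "jet 0 \<in> G" using U0 G(2) by blast
    fix S assume "S \<in> {(\<Pi>\<^sub>E i\<in>UNIV. Y i) |Y. (\<forall>i. openin (CO i) (Y i)) \<and> finite {i. Y i \<noteq> topspace (CO i)}}" "jet 0 \<in> S"
    then obtain Y where Y: "\<And>i. openin (CO i) (Y i)" "finite {i. Y i \<noteq> topspace (CO i)}" and S: "S = (\<Pi>\<^sub>E i\<in>UNIV. Y i)" and j0: "\<And>i. jet 0 i \<in> Y i"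
      by (auto simp: PiE_iff)
    have "\<exists>V. good V \<and> (\<forall>i\<in>J. (\<lambda>f. jet f i) ` V \<subseteq> Y i)" if "finite J" for J
      using that
    proof (induction J rule: finite_induct)
      case empty
      then show ?case using top by blast
    next
      case (insert j J)
      then obtain V where V: "good V" "\<forall>i\<in>J. (\<lambda>f. jet f i) ` V \<subseteq> Y i" by blast
      obtain V' where V': "good V'" "(\<lambda>f. jet f j) ` V' \<subseteq> Y j" using CO[OF Y(1) j0] by blast
      have "(\<lambda>f. jet f i) ` (V \<inter> V') \<subseteq> Y i" if "i \<in> insert j J" for i
        using that V(2) V'(2) by (cases "i = j") blast+
      then show ?case using gi[OF V(1) V'(1)] by blast
    qed
    from this[OF Y(2)] obtain V where V: "good V" "\<forall>i\<in>{i. Y i \<noteq> topspace (CO i)}. (\<lambda>f. jet f i) ` V \<subseteq> Y i" by blast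
    have "jet f i \<in> Y i" if f: "f \<in> V" for f i
    proof (cases "Y i = topspace (CO i)")
      case True
      have "f \<in> ?SF" using V(1) f unfolding good_def by blast
      then show ?thesis unfolding True by (rule jet_mem)
    next
      case False
      then have "i \<in> {i. Y i \<noteq> topspace (CO i)}" by (rule CollectI)
      from bspec[OF V(2) this] show ?thesis using f by (rule subsetD[OF _ imageI])
    qed
    then have jS: "jet ` V \<subseteq> S" unfolding S PiE_UNIV_domain by (intro image_subsetI Pi_I)
    show "\<exists>V. good V \<and> jet ` V \<subseteq> S" by (intro exI conjI) (rule V(1), rule jS)
  qed
  then obtain V where V: "good V" "jet ` V \<subseteq> G" by (elim exE conjE)
  have gV: "openin ?X V" "0 \<in> V" "convex V" "V \<subseteq> ?SF" using V(1) unfolding good_def by simp_all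
  have "V \<subseteq> U"
  proof
    fix f assume f: "f \<in> V"
    have "jet f \<in> G" by (rule subsetD[OF V(2) imageI[OF f]])
    then show "f \<in> U" unfolding G(2) using gV(4) f by (intro IntI vimageI2) auto
  qed
  with gV show ?thesis by (intro exI[of _ V] conjI)
qed

lemma base_point: "m \<in> topspace (mtop M) \<Longrightarrow> (m, []) \<in> topspace (mtop (Tn_manifold 0 M))"
  by (simp add: Tn_manifold_0 base_topspace)

lemma point_eval_continuous:
  assumes m: "m \<in> topspace (mtop M)"
  shows "continuous_map (smooth_function_space M E) E (\<lambda>f. f m)"
proof -
  have "continuous_map (smooth_function_space M E) (Tn_lcs 0 E) (\<lambda>f. Tn_map 0 M E f (m, []))"
    by (rule Tn_eval_continuous') (simp_all add: base_point[OF m])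
  from continuous_map_compose'[OF this[unfolded Tn_lcs_0] continuous_map_eval_seq_lcs] show ?thesis by simp
qed

text \<open>
  By \<open>curry_compact_open\<close> the vector operations are continuous as soon as \<open>T\<^sup>n\<close> of the result depends
  continuously on all the functions, scalars and points involved; this follows from continuity of evaluation.
  Two different functions are separated by evaluation at a point.
\<close>

lemma lcs_smooth_function_space: "lcs (smooth_function_space M E)"
  unfolding lcs_def
proof (intro conjI allI impI)
  let ?X = "smooth_function_space M E" and ?SF = "smooth_functions M E"
  have add: "f + g \<in> ?SF" if "f \<in> ?SF" "g \<in> ?SF" for f g using smooth_functions_lincomb[OF that, of 1] by simp
  have scale: "c *\<^sub>R f \<in> ?SF" if "f \<in> ?SF" for c f using smooth_functions_lincomb[OF zero_smooth that, of c] by simp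
  show "subspace (topspace ?X)"
    unfolding topspace_smooth_function_space by (rule subspaceI) (rule zero_smooth add scale; assumption?)+
  show "continuous_map (prod_topology ?X ?X) ?X (\<lambda>(x, y). x + y)"
  proof (rule continuous_map_into_function_space)
    fix s assume "s \<in> topspace (prod_topology ?X ?X)"
    then show "(case s of (x, y) \<Rightarrow> x + y) \<in> ?SF" by (auto simp: topspace_smooth_function_space add)
  next
    fix n
    let ?T = "prod_topology (prod_topology ?X ?X) (mtop (Tn_manifold n M))"
    have "continuous_map ?T (Tn_lcs n E) (\<lambda>z. Tn_map n M E (fst (fst z)) (snd z) + Tn_map n M E (snd (fst z)) (snd z))"
      by (intro continuous_map_lcs_add[OF TnE] Tn_eval_continuous' continuous_map_snd
         continuous_map_compose'[OF continuous_map_fst continuous_map_fst] continuous_map_compose'[OF continuous_map_fst continuous_map_snd])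
    then show "continuous_map ?T (Tn_lcs n E) (\<lambda>(s, p). Tn_map n M E (case s of (x, y) \<Rightarrow> x + y) p)"
      by (rule continuous_map_eq) (clarsimp simp: topspace_smooth_function_space Tn_map_add)
  qed
  show "continuous_map (prod_topology euclideanreal ?X) ?X (\<lambda>(c, x). c *\<^sub>R x)"
  proof (rule continuous_map_into_function_space)
    fix s assume "s \<in> topspace (prod_topology euclideanreal ?X)"
    then show "(case s of (c, x) \<Rightarrow> c *\<^sub>R x) \<in> ?SF" by (auto simp: topspace_smooth_function_space scale)
  next
    fix n
    let ?T = "prod_topology (prod_topology euclideanreal ?X) (mtop (Tn_manifold n M))"
    have "continuous_map ?T (Tn_lcs n E) (\<lambda>z. fst (fst z) *\<^sub>R Tn_map n M E (snd (fst z)) (snd z))"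
      by (intro continuous_map_lcs_scale[OF TnE] Tn_eval_continuous' continuous_map_snd
         continuous_map_compose'[OF continuous_map_fst continuous_map_fst] continuous_map_compose'[OF continuous_map_fst continuous_map_snd])
    then show "continuous_map ?T (Tn_lcs n E) (\<lambda>(s, p). Tn_map n M E (case s of (c, x) \<Rightarrow> c *\<^sub>R x) p)"
      by (rule continuous_map_eq) (clarsimp simp: topspace_smooth_function_space Tn_map_scale)
  qed
  show "Hausdorff_space ?X"
    unfolding Hausdorff_space_def topspace_smooth_function_space
  proof (intro allI impI)
    fix f g assume fg: "f \<in> ?SF \<and> g \<in> ?SF \<and> f \<noteq> g"
    then obtain m where m: "f m \<noteq> g m" by (auto simp: fun_eq_iff)
    have mM: "m \<in> topspace (mtop M)"
    proof (rule ccontr)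
      assume "m \<notin> topspace (mtop M)"
      then have "f m = 0" "g m = 0" using fg unfolding smooth_functions_iff by blast+
      then show False using m by simp
    qed
    note c = point_eval_continuous[OF mM]
    have "f m \<in> topspace E" "g m \<in> topspace E"
      using continuous_map_image_subset_topspace[OF c] fg unfolding topspace_smooth_function_space by blast+
    then obtain A B where AB: "openin E A" "openin E B" "f m \<in> A" "g m \<in> B" "disjnt A B"
      using lcs_Hausdorff[OF E] m unfolding Hausdorff_space_def by meson
    have "disjnt {x \<in> ?SF. x m \<in> A} {x \<in> ?SF. x m \<in> B}" using AB(5) unfolding disjnt_iff by blast
    then show "\<exists>U V. openin ?X U \<and> openin ?X V \<and> f \<in> U \<and> g \<in> V \<and> disjnt U V"
      using openin_preimage[OF c AB(1)] openin_preimage[OF c AB(2)] AB(3,4) fg unfolding topspace_smooth_function_space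
      by (intro exI[of _ "{x \<in> ?SF. x m \<in> A}"] exI[of _ "{x \<in> ?SF. x m \<in> B}"]) simp
  qed
  fix U assume "openin ?X U \<and> 0 \<in> U"
  then show "\<exists>V. openin ?X V \<and> 0 \<in> V \<and> V \<subseteq> U \<and> convex V" using function_space_convex_base by blast
qed

end

section \<open>Smoothness of evaluation\<close>

text \<open>
  For a point \<open>(f, x)\<close> and a direction \<open>(k, v)\<close>, encoded as a sequence of pairs, these are the maps to \<open>(k, x)\<close>
  and to \<open>(f, (x, v))\<close>, through which the derivative of evaluation factors.
\<close>

lemma linear_seq_lcs_pair_maps:
  "linear (\<lambda>z::nat \<Rightarrow> 'a::real_vector \<times> (nat \<Rightarrow> 'b::real_vector). seq_embed (fst (seq_snd z 0), snd (seq_fst z 0)) :: nat \<Rightarrow> 'a \<times> (nat \<Rightarrow> 'b))"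
  "linear (\<lambda>z::nat \<Rightarrow> 'a::real_vector \<times> (nat \<Rightarrow> 'b::real_vector). seq_embed (fst (seq_fst z 0), seq_pair (snd (seq_fst z 0)) (snd (seq_snd z 0))) :: nat \<Rightarrow> 'a \<times> (nat \<Rightarrow> 'b))"
proof -
  have e: "linear (\<lambda>z::nat \<Rightarrow> 'a \<times> (nat \<Rightarrow> 'b). seq_fst z 0)" "linear (\<lambda>z::nat \<Rightarrow> 'a \<times> (nat \<Rightarrow> 'b). seq_snd z 0)"
    using linear_compose[OF linear_seq_fst linear_eval[of 0]] linear_compose[OF linear_seq_snd linear_eval[of 0]] by (simp_all add: o_def)
  note c = linear_compose[OF e(1) linear_fst] linear_compose[OF e(1) linear_snd] linear_compose[OF e(2) linear_fst] linear_compose[OF e(2) linear_snd]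
  have 1: "linear (\<lambda>z::nat \<Rightarrow> 'a \<times> (nat \<Rightarrow> 'b). (fst (seq_snd z 0), snd (seq_fst z 0)))"
    using c by (intro linearI) (simp_all add: linear_add linear_scale o_def seq_fst_def seq_snd_def scaleR_fun_def)
  have 2: "linear (\<lambda>z::nat \<Rightarrow> 'a \<times> (nat \<Rightarrow> 'b). (fst (seq_fst z 0), seq_pair (snd (seq_fst z 0)) (snd (seq_snd z 0))))"
    by (intro linearI) (simp_all add: seq_fst_def seq_snd_def scaleR_fun_def[of _ "_ :: nat \<Rightarrow> 'a \<times> (nat \<Rightarrow> 'b)"] seq_pair_add seq_pair_scale)
  show "linear (\<lambda>z::nat \<Rightarrow> 'a::real_vector \<times> (nat \<Rightarrow> 'b::real_vector). seq_embed (fst (seq_snd z 0), snd (seq_fst z 0)) :: nat \<Rightarrow> 'a \<times> (nat \<Rightarrow> 'b))"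
    using linear_compose[OF 1 linear_seq_embed] by (simp add: o_def)
  show "linear (\<lambda>z::nat \<Rightarrow> 'a::real_vector \<times> (nat \<Rightarrow> 'b::real_vector). seq_embed (fst (seq_fst z 0), seq_pair (snd (seq_fst z 0)) (snd (seq_snd z 0))) :: nat \<Rightarrow> 'a \<times> (nat \<Rightarrow> 'b))"
    using linear_compose[OF 2 linear_seq_embed] by (simp add: o_def)
qed

lemma continuous_map_seq_lcs_eval:
  "continuous_map (seq_square (seq_lcs P)) P (\<lambda>z. seq_fst z 0)" "continuous_map (seq_square (seq_lcs P)) P (\<lambda>z. seq_snd z 0)"
  by (rule continuous_map_compose'[OF continuous_map_seq_fst continuous_map_eval_seq_lcs])
     (rule continuous_map_compose'[OF continuous_map_seq_snd continuous_map_eval_seq_lcs])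

context
  fixes d :: nat and M :: "('m, nat \<Rightarrow> real, 'i) manifold" and E :: "'e::real_vector topology"
  assumes M: "bman d M" and E: "lcs E"
begin

abbreviation (input) "Cinf \<equiv> smooth_function_space M E"
abbreviation (input) "SF \<equiv> smooth_functions M E"
abbreviation (input) "TM n \<equiv> Tn_manifold n M"

lemma TM_Suc_sel: "mmodel (TM (Suc n)) = seq_square (mmodel (TM n))"
  "i \<in> mindex M \<Longrightarrow> cimg (TM (Suc n)) i = seq_times (cimg (TM n) i) (topspace (mmodel (TM n)))"
  "i \<in> mindex M \<Longrightarrow> z \<in> seq_times (cimg (TM n) i) (topspace (mmodel (TM n))) \<Longrightarrow> chart_inv (TM (Suc n)) i z = tangent_lift (TM n) i z"
  unfolding Tn_manifold_Suc tangent_bundle_sel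
  using tangent_cimg[OF Tn_bman[OF M E]] tangent_chart_inv[OF Tn_bman[OF M E]] by (simp_all add: mindex_Tn_manifold)

lemma TM_index: "i \<in> mindex M \<Longrightarrow> i \<in> mindex (TM n)"
  by (simp add: mindex_Tn_manifold)

text \<open>
  Evaluation of \<open>T\<^sup>nf\<close> in the chart \<open>i\<close>.
\<close>

definition ev :: "nat \<Rightarrow> 'i \<Rightarrow> ('m \<Rightarrow> 'e) \<times> (nat \<Rightarrow> real) \<Rightarrow> nat \<Rightarrow> 'e" where
  "ev n i y = Tn_map n M E (fst y) (chart_inv (TM n) i (snd y))"

text \<open>
  The derivative of evaluation at \<open>(f, x)\<close> in the direction \<open>(k, v)\<close>. Evaluation is linear in \<open>f\<close>, which
  gives the summand \<open>T\<^sup>nk(x)\<close>; the derivative of \<open>T\<^sup>nf\<close> at \<open>x\<close> in direction \<open>v\<close> is the second component of \<open>T\<^sup>n\<^sup>+\<^sup>1f\<close>.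
\<close>

definition dev :: "nat \<Rightarrow> 'i \<Rightarrow> ('m \<Rightarrow> 'e) \<times> (nat \<Rightarrow> real) \<Rightarrow> ('m \<Rightarrow> 'e) \<times> (nat \<Rightarrow> real) \<Rightarrow> nat \<Rightarrow> 'e" where
  "dev n i y h = ev n i (fst h, snd y) + seq_snd (ev (Suc n) i (fst y, seq_pair (snd y) (snd h)))"

lemma lcs_Cinf: "lcs Cinf" by (rule lcs_smooth_function_space[OF M E])

lemma topspace_Cinf: "topspace Cinf = SF" by (rule topspace_smooth_function_space[OF M E])

lemma ev_dom: "i \<in> mindex M \<Longrightarrow> mb_dom (prod_topology Cinf (mmodel (TM n))) (SF \<times> cimg (TM n) i)"
  using mb_dom_Times'[OF lcs_Cinf bman_cimg_dom[OF Tn_bman[OF M E] TM_index] openin_topspace] unfolding topspace_Cinf .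

lemma ev_continuous:
  assumes i: "i \<in> mindex M" and a: "continuous_map T Cinf a" and b: "continuous_map T (subtopology (mmodel (TM n)) (cimg (TM n) i)) b"
  shows "continuous_map T (Tn_lcs n E) (\<lambda>z. ev n i (a z, b z))"
  unfolding ev_def fst_conv snd_conv
  by (rule Tn_eval_continuous'[OF M E a continuous_map_compose'[OF b bman_chart_inv_continuous[OF Tn_bman[OF M E] TM_index[OF i]]]])

lemma ev_lincomb:
  assumes i: "i \<in> mindex M" and f: "f \<in> SF" and g: "g \<in> SF" and x: "x \<in> cimg (TM n) i"
  shows "ev n i (f + c *\<^sub>R g, x) = ev n i (f, x) + c *\<^sub>R ev n i (g, x)"
  unfolding ev_def fst_conv snd_conv
  by (rule Tn_map_lincomb[OF M E f g chart_inv_in_topspace[OF Tn_bman[OF M E] TM_index[OF i] x]])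

lemma ev_Suc:
  assumes i: "i \<in> mindex M" and f: "f \<in> SF" and x: "x \<in> cimg (TM n) i" and v: "v \<in> topspace (mmodel (TM n))"
  shows "ev (Suc n) i (f, seq_pair x v) = seq_pair (ev n i (f, x)) (dir_deriv (Tn_lcs n E) (cimg (TM n) i) (\<lambda>x. ev n i (f, x)) x v)"
proof -
  have z: "seq_pair x v \<in> seq_times (cimg (TM n) i) (topspace (mmodel (TM n)))" using x v by (simp add: seq_times_def)
  show ?thesis
    unfolding ev_def fst_conv snd_conv TM_Suc_sel(3)[OF i z] Tn_map_Suc_lift[OF M E f i z] seq_pair_simps ..
qed

text \<open>
  The difference quotient of evaluation is the sum of the value of \<open>T\<^sup>nk\<close> at \<open>x + t *\<^sub>R v\<close> and of the difference
  quotient of \<open>T\<^sup>nf\<close>. Joint continuity of evaluation of \<open>T\<^sup>nf\<close> and \<open>T\<^sup>n\<^sup>+\<^sup>1f\<close>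
  gives the limit as well as the continuity of the derivative.
\<close>

lemma ev_C1:
  assumes i: "i \<in> mindex M"
  shows "C1map (prod_topology Cinf (mmodel (TM n))) (SF \<times> cimg (TM n) i) (Tn_lcs n E) (ev n i) (dev n i)"
  unfolding C1map_def
proof (intro conjI ballI)
  let ?E = "mmodel (TM n)" and ?V = "cimg (TM n) i" and ?F = "Tn_lcs n E"
  let ?P = "prod_topology Cinf ?E"
  have F: "lcs ?F" by (rule lcs_Tn_lcs[OF E])
  have Em: "lcs ?E" by (rule Tn_model_lcs[OF M E])
  have Vd: "mb_dom ?E ?V" by (rule bman_cimg_dom[OF Tn_bman[OF M E] TM_index[OF i]])
  have sub: "continuous_map (subtopology ?P (SF \<times> ?V)) Cinf fst" "continuous_map (subtopology ?P (SF \<times> ?V)) (subtopology ?E ?V) snd"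
    by (intro continuous_map_from_subtopology continuous_map_fst continuous_map_snd_sub)+
  from ev_continuous[OF i sub] show "continuous_map (subtopology ?P (SF \<times> ?V)) ?F (ev n i)" by simp
  fix y h assume y: "y \<in> SF \<times> ?V" and h: "h \<in> topspace ?P"
  obtain f x k v where [simp]: "y = (f, x)" "h = (k, v)" by (cases y, cases h)
  have f: "f \<in> SF" and x: "x \<in> ?V" and k: "k \<in> SF" and v: "v \<in> topspace ?E" using y h by (auto simp: topspace_Cinf)
  have xE: "x \<in> topspace ?E" using mb_dom_mem[OF Vd x] .
  let ?A = "{t. x + t *\<^sub>R v \<in> ?V}"
  have A: "{t. y + t *\<^sub>R h \<in> SF \<times> ?V} = ?A"
    using smooth_functions_lincomb[OF M E f k] by auto
  have c: "continuous_map (subtopology ?E ?V) ?F (\<lambda>x. ev n i (g, x))" if "g \<in> SF" for g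
    by (rule ev_continuous[OF i]) (simp_all add: topspace_Cinf that)
  have "C1map ?E ?V ?F (\<lambda>x. ev n i (f, x)) (dir_deriv ?F ?V (\<lambda>x. ev n i (f, x)))"
    using Tn_map_C1[OF M E f i, of n] by (simp add: ev_def)
  from C1map_has[OF this x v]
  have d1: "has_dir_deriv ?F ?V (\<lambda>x. ev n i (f, x)) x v (seq_snd (ev (Suc n) i (f, seq_pair x v)))"
    unfolding ev_Suc[OF i f x v] by simp
  have "limitin ?E (\<lambda>t. x + t *\<^sub>R v) x (at 0 within ?A)"
    using continuous_map_limit[OF continuous_map_line[OF Em xE v], of "\<lambda>t. t" 0 "at 0 within ?A"] by (simp add: o_def tendsto_ident_at)
  then have "limitin (subtopology ?E ?V) (\<lambda>t. x + t *\<^sub>R v) x (at 0 within ?A)"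
    unfolding limitin_subtopology using x eventually_in_within[of ?A 0] by simp
  from continuous_map_limit[OF c[OF k] this]
  have d2: "limitin ?F (\<lambda>t. ev n i (k, x + t *\<^sub>R v)) (ev n i (k, x)) (at 0 within ?A)" by (simp add: o_def)
  have "limitin (prod_topology ?F ?F) (\<lambda>t. (ev n i (k, x + t *\<^sub>R v), (1 / t) *\<^sub>R (ev n i (f, x + t *\<^sub>R v) - ev n i (f, x))))
     (ev n i (k, x), seq_snd (ev (Suc n) i (f, seq_pair x v))) (at 0 within ?A)"
    using d1 d2 unfolding limitin_pairwise has_dir_deriv_def by (simp add: o_def)
  from continuous_map_limit[OF continuous_map_lincomb[OF F, of 1] this]
  have lim: "limitin ?F (\<lambda>t. ev n i (k, x + t *\<^sub>R v) + (1 / t) *\<^sub>R (ev n i (f, x + t *\<^sub>R v) - ev n i (f, x)))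
     (ev n i (k, x) + seq_snd (ev (Suc n) i (f, seq_pair x v))) (at 0 within ?A)" by (simp add: o_def)
  have ev: "\<forall>\<^sub>F t in at 0 within ?A. ev n i (k, x + t *\<^sub>R v) + (1 / t) *\<^sub>R (ev n i (f, x + t *\<^sub>R v) - ev n i (f, x))
     = (1 / t) *\<^sub>R (ev n i (y + t *\<^sub>R h) - ev n i y)"
    using eventually_in_within[of ?A 0] eventually_not_at[of 0 ?A]
  proof eventually_elim
    case (elim t)
    then have "x + t *\<^sub>R v \<in> ?V" by simp
    then have "ev n i (y + t *\<^sub>R h) = ev n i (f, x + t *\<^sub>R v) + t *\<^sub>R ev n i (k, x + t *\<^sub>R v)"
      using ev_lincomb[OF i f k] by simp
    then show ?case using elim(2) by (simp add: algebra_simps)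
  qed
  show "has_dir_deriv ?F (SF \<times> ?V) (ev n i) y h (dev n i y h)"
    unfolding has_dir_deriv_def A using limitin_transform_eventually[OF ev lim] by (simp add: dev_def)
next
  let ?E = "mmodel (TM n)" and ?V = "cimg (TM n) i" and ?F = "Tn_lcs n E"
  let ?P = "prod_topology Cinf ?E"
  let ?T = "subtopology (prod_topology ?P ?P) ((SF \<times> ?V) \<times> topspace ?P)"
  have F: "lcs ?F" by (rule lcs_Tn_lcs[OF E])
  have y: "continuous_map ?T (subtopology ?P (SF \<times> ?V)) fst" by (rule continuous_map_fst_sub)
  have h: "continuous_map ?T ?P snd" by (intro continuous_map_from_subtopology continuous_map_snd)
  have yf: "continuous_map ?T Cinf (\<lambda>z. fst (fst z))"
    by (rule continuous_map_compose'[OF y]) (intro continuous_map_from_subtopology continuous_map_fst)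
  have yx: "continuous_map ?T (subtopology ?E ?V) (\<lambda>z. snd (fst z))"
    by (rule continuous_map_compose'[OF y continuous_map_snd_sub])
  have hk: "continuous_map ?T Cinf (\<lambda>z. fst (snd z))" by (rule continuous_map_compose'[OF h continuous_map_fst])
  have hv: "continuous_map ?T ?E (\<lambda>z. snd (snd z))" by (rule continuous_map_compose'[OF h continuous_map_snd])
  have yx': "continuous_map ?T ?E (\<lambda>z. snd (fst z))" using yx by (simp add: continuous_map_in_subtopology)
  have p: "continuous_map ?T (subtopology (mmodel (TM (Suc n))) (cimg (TM (Suc n)) i)) (\<lambda>z. seq_pair (snd (fst z)) (snd (snd z)))"
    unfolding TM_Suc_sel(1) TM_Suc_sel(2)[OF i] continuous_map_in_subtopology
    using continuous_map_seq_pair[OF yx' hv] by (auto simp: seq_times_def)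
  have "continuous_map ?T ?F (\<lambda>z. seq_snd (ev (Suc n) i (fst (fst z), seq_pair (snd (fst z)) (snd (snd z)))))"
    using continuous_map_compose'[OF ev_continuous[OF i yf p, unfolded Tn_lcs_Suc] continuous_map_seq_snd] .
  from continuous_map_lcs_add[OF F ev_continuous[OF i hk yx] this]
  show "continuous_map ?T ?F (\<lambda>(y, h). dev n i y h)"
    by (simp add: dev_def case_prod_unfold)
qed

text \<open>
  The derivative of the \<open>n\<close>-th evaluation map is made of the \<open>n\<close>-th and the \<open>(n+1)\<close>-st evaluation map, each
  preceded by a linear map. Hence the induction on the order of differentiability is for all \<open>n\<close> at once.
\<close>

lemma ev_Cn:
  assumes i: "i \<in> mindex M"
  shows "Cn_on m (seq_lcs (prod_topology Cinf (mmodel (TM n)))) (seq_embed ` (SF \<times> cimg (TM n) i)) (Tn_lcs n E) (\<lambda>z. ev n i (z 0))"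
proof (induction m arbitrary: n)
  case 0
  have "continuous_map (subtopology (seq_lcs (prod_topology Cinf (mmodel (TM n)))) (seq_embed ` (SF \<times> cimg (TM n) i)))
     (subtopology (prod_topology Cinf (mmodel (TM n))) (SF \<times> cimg (TM n) i)) (\<lambda>z. z 0)"
    unfolding continuous_map_in_subtopology
    using continuous_map_from_subtopology[OF continuous_map_eval_seq_lcs] by auto
  from continuous_map_compose'[OF this] ev_C1[OF i, of n] show ?case unfolding C1map_def Cn_on.simps by blast
next
  case (Suc m)
  let ?E = "mmodel (TM n)" and ?V = "cimg (TM n) i" and ?F = "Tn_lcs n E"
  let ?P = "prod_topology Cinf ?E" and ?P' = "prod_topology Cinf (mmodel (TM (Suc n)))"
  let ?S = "seq_lcs ?P" and ?U = "seq_embed ` (SF \<times> ?V)" and ?U' = "seq_embed ` (SF \<times> cimg (TM (Suc n)) i)"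
  have F: "lcs ?F" and F': "lcs (Tn_lcs (Suc n) E)" by (rule lcs_Tn_lcs[OF E])+
  have P: "lcs ?P" and P': "lcs ?P'" by (intro lcs_prod lcs_Cinf Tn_model_lcs[OF M E])+
  have S: "lcs ?S" by (rule lcs_seq_lcs[OF P])
  have Ud: "mb_dom ?S ?U" by (rule mb_dom_seq_embed[OF ev_dom[OF i]])
  have Ud': "mb_dom (seq_lcs ?P') ?U'" by (rule mb_dom_seq_embed[OF ev_dom[OF i]])
  note S2 = lcs_seq_square[OF S] and U2 = mb_dom_seq_square[OF S Ud]
  have im: "(\<lambda>z. z 0) ` ?U \<subseteq> SF \<times> ?V" by auto
  have C1: "C1map ?S ?U ?F (\<lambda>z. ev n i (z 0)) (\<lambda>z h. dev n i (z 0) (h 0))"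
    by (rule C1map_compose[OF S P F Ud ev_dom[OF i] C1map_linear[OF mb_dom_subset[OF Ud] linear_eval continuous_map_eval_seq_lcs] ev_C1[OF i] im])
  let ?L1 = "\<lambda>z::nat \<Rightarrow> ('m \<Rightarrow> 'e) \<times> (nat \<Rightarrow> real). seq_embed (fst (seq_snd z 0), snd (seq_fst z 0)) :: nat \<Rightarrow> ('m \<Rightarrow> 'e) \<times> (nat \<Rightarrow> real)"
  let ?L2 = "\<lambda>z::nat \<Rightarrow> ('m \<Rightarrow> 'e) \<times> (nat \<Rightarrow> real). seq_embed (fst (seq_fst z 0), seq_pair (snd (seq_fst z 0)) (snd (seq_snd z 0))) :: nat \<Rightarrow> ('m \<Rightarrow> 'e) \<times> (nat \<Rightarrow> real)"
  note c = continuous_map_compose'[OF continuous_map_seq_lcs_eval(1)[of ?P] continuous_map_fst] continuous_map_compose'[OF continuous_map_seq_lcs_eval(1)[of ?P] continuous_map_snd]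
    continuous_map_compose'[OF continuous_map_seq_lcs_eval(2)[of ?P] continuous_map_fst] continuous_map_compose'[OF continuous_map_seq_lcs_eval(2)[of ?P] continuous_map_snd]
  have L1c: "continuous_map (seq_square ?S) ?S ?L1"
    by (rule continuous_map_compose'[OF continuous_map_pairedI[OF c(3,2)] continuous_map_seq_embed])
  have L2c: "continuous_map (seq_square ?S) (seq_lcs ?P') ?L2"
    unfolding TM_Suc_sel(1)
    by (rule continuous_map_compose'[OF continuous_map_pairedI[OF c(1) continuous_map_seq_pair[OF c(2,4)]] continuous_map_seq_embed])
  have mem: "seq_fst z 0 \<in> SF \<times> ?V \<and> seq_snd z 0 \<in> SF \<times> topspace ?E" if "z \<in> seq_times ?U (topspace ?S)" for z
    using that by (auto simp: seq_times_def topspace_seq_lcs topspace_Cinf)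
  have L1U: "?L1 ` seq_times ?U (topspace ?S) \<subseteq> ?U"
    using mem by (intro image_subsetI imageI) (auto simp: mem_Times_iff)
  have L2U: "?L2 ` seq_times ?U (topspace ?S) \<subseteq> ?U'"
    unfolding TM_Suc_sel(2)[OF i] using mem by (intro image_subsetI imageI) (auto simp: mem_Times_iff seq_times_def)
  have A1: "Cn_on m (seq_square ?S) (seq_times ?U (topspace ?S)) ?F (\<lambda>z. ev n i (?L1 z 0))"
    by (rule Cn_on_prelinear[OF S2 S F U2 Ud linear_seq_lcs_pair_maps(1) L1c L1U Suc.IH])
  have "Cn_on m (seq_square ?S) (seq_times ?U (topspace ?S)) (Tn_lcs (Suc n) E) (\<lambda>z. ev (Suc n) i (?L2 z 0))"
    by (rule Cn_on_prelinear[OF S2 lcs_seq_lcs[OF P'] F' U2 Ud' linear_seq_lcs_pair_maps(2) L2c L2U Suc.IH])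
  then have A2: "Cn_on m (seq_square ?S) (seq_times ?U (topspace ?S)) ?F (\<lambda>z. seq_snd (ev (Suc n) i (?L2 z 0)))"
    unfolding Tn_lcs_Suc by (rule Cn_on_postlinear[OF S2 lcs_seq_square[OF F] F U2 linear_seq_snd continuous_map_seq_snd])
  have "Cn_on m (seq_square ?S) (seq_times ?U (topspace ?S)) ?F (\<lambda>z. dev n i (seq_fst z 0) (seq_snd z 0))"
    using Cn_on_postlinear[OF S2 lcs_prod[OF F F] F U2 linear_lincomb continuous_map_lincomb[OF F, of 1] Cn_on_pair[OF S2 F F U2 A1 A2]]
    by (simp add: dev_def)
  then show ?case by (rule Cn_on_SucI[OF S F Ud C1])
qed

lemma evaluation_smooth:
  assumes i: "i \<in> mindex M"
  shows "smooth_on_lcs (prod_topology Cinf (mmodel M)) (SF \<times> cimg M i) E (\<lambda>(f, x). f (chart_inv M i x))"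
proof -
  have m0: "mmodel (TM 0) = mmodel M" and c0: "cimg (TM 0) i = cimg M i"
    unfolding Tn_manifold_0 by (rule base_manifold_sel(2), rule base_cimg)
  have "smooth_on_lcs (prod_topology Cinf (mmodel M)) (SF \<times> cimg M i) (seq_lcs E) (ev 0 i)"
    using smooth_onI[OF ev_Cn[OF i, of _ 0]] unfolding m0 c0 Tn_lcs_0 .
  from smooth_on_postlinear[OF lcs_prod[OF lcs_Cinf bman_lcs[OF M]] lcs_seq_lcs[OF E] E ev_dom[OF i, of 0, unfolded m0 c0]
      linear_eval continuous_map_eval_seq_lcs this]
  show ?thesis
    by (rule smooth_on_cong) (clarsimp simp: ev_def Tn_manifold_0 base_chart_inv[OF M i])
qed

section \<open>The exponential law\<close>

lemma family_mem:
  assumes Z: "lcs Z" and W: "openin Z W" and f: "smooth_family Z W M E f" and w: "w \<in> W"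
    and f0: "\<And>m. m \<notin> topspace (mtop M) \<Longrightarrow> f w m = 0"
  shows "f w \<in> SF"
  unfolding smooth_functions_iff[OF M E] using smooth_family_slice[OF Z E W M f w] f0 by blast

lemma family_continuous:
  assumes Z: "lcs Z" and W: "openin Z W" and f: "smooth_family Z W M E f"
    and f0: "\<And>w m. w \<in> W \<Longrightarrow> m \<notin> topspace (mtop M) \<Longrightarrow> f w m = 0"
  shows "continuous_map (subtopology Z W) Cinf f"
proof (rule continuous_map_into_function_space[OF M E])
  show "f s \<in> SF" if "s \<in> topspace (subtopology Z W)" for s
    using family_mem[OF Z W f _ f0] that by simp
  show "continuous_map (prod_topology (subtopology Z W) (mtop (TM n))) (Tn_lcs n E) (\<lambda>(s, p). Tn_map n M E (f s) p)" for n
    by (rule fam_continuous[OF Z lcs_Tn_lcs[OF E] W Tn_bman[OF M E] smooth_family_Tn_map[OF M E Z W f]])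
qed

lemma param_deriv_zero:
  assumes Z: "lcs Z" and W: "openin Z W" and f0: "\<And>w. w \<in> W \<Longrightarrow> f w m = 0" and w: "w \<in> W" and u: "u \<in> topspace Z"
  shows "dir_deriv E W (\<lambda>w. f w m) w u = 0"
proof -
  have "dir_deriv E W (\<lambda>w. f w m) w u = dir_deriv E W (\<lambda>w. 0) w u" by (rule dir_deriv_cong[OF w f0])
  then show ?thesis using C1map_deriv_eq[OF Z E mb_dom_open[OF Z W] C1map_const[OF E lcs_zero[OF E]] w u] by simp
qed

text \<open>
  The tangent functor commutes with derivatives in the parameter at each stage, since \<open>T\<^sup>nf\<close> is a smooth family.
\<close>

lemma Tn_map_param_deriv:
  fixes Z :: "(nat \<Rightarrow> 'z::real_vector) topology"
  assumes Z: "lcs Z" and W: "openin Z W" and f: "smooth_family Z W M E f" and w: "w \<in> W" and u: "u \<in> topspace Z"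
    and q: "q \<in> topspace (mtop (TM n))"
  shows "Tn_map n M E (\<lambda>m. dir_deriv E W (\<lambda>w. f w m) w u) q = dir_deriv (Tn_lcs n E) W (\<lambda>w. Tn_map n M E (f w) q) w u"
  using q
proof (induction n arbitrary: q)
  case 0
  then have m: "fst q \<in> topspace (mtop M)" by (auto simp: Tn_manifold_0 base_topspace)
  have "has_dir_deriv (seq_lcs E) W (\<lambda>w. seq_embed (f w (fst q))) w u (seq_embed (dir_deriv E W (\<lambda>w. f w (fst q)) w u))"
    by (rule has_dir_deriv_postlinear[OF linear_seq_embed continuous_map_seq_embed C1map_has[OF fam_C1[OF Z E W M f m] w u]])
  from dir_deriv_eq[OF Z lcs_Hausdorff[OF lcs_seq_lcs[OF E]] mb_dom_open[OF Z W] w u this]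
  show ?case by (simp add: Tn_lcs_0 o_def)
next
  case (Suc n)
  have q: "q \<in> topspace (mtop (tangent_bundle (TM n)))" using Suc.prems by (simp add: Tn_manifold_Suc)
  have "Tn_map (Suc n) M E (\<lambda>m. dir_deriv E W (\<lambda>w. f w m) w u) q
     = tangent_map (TM n) (Tn_lcs n E) (\<lambda>p. dir_deriv (Tn_lcs n E) W (\<lambda>w. Tn_map n M E (f w) p) w u) q"
    unfolding Tn_map.simps by (rule tangent_map_cong[OF Tn_bman[OF M E] q Suc.IH])
  also have "\<dots> = dir_deriv (Tn_lcs (Suc n) E) W (\<lambda>w. Tn_map (Suc n) M E (f w) q) w u"
    unfolding Tn_map.simps Tn_lcs_Suc
    by (rule param_deriv_tangent_map[OF Z lcs_Tn_lcs[OF E] W Tn_bman[OF M E] smooth_family_Tn_map[OF M E Z W f] w u q])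
  finally show ?case .
qed

text \<open>
  Since \<open>T\<^sup>n\<close> is linear in the function and commutes with derivatives in the parameter, \<open>T\<^sup>n\<close> of the difference
  quotients, extended to \<open>t = 0\<close> by the derivative, is the corresponding expression for the family \<open>T\<^sup>nf\<close>. It is
  jointly continuous in \<open>t\<close> and the point, so the quotients converge in the function space.
\<close>

lemma family_has_dir_deriv:
  fixes Z :: "(nat \<Rightarrow> 'z::real_vector) topology"
  assumes Z: "lcs Z" and W: "openin Z W" and f: "smooth_family Z W M E f" and w: "w \<in> W" and u: "u \<in> topspace Z"
    and f0: "\<And>w m. w \<in> W \<Longrightarrow> m \<notin> topspace (mtop M) \<Longrightarrow> f w m = 0"
  shows "has_dir_deriv Cinf W f w u (\<lambda>m. dir_deriv E W (\<lambda>w. f w m) w u)"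
proof -
  define D where "D = (\<lambda>m. dir_deriv E W (\<lambda>w. f w m) w u)"
  define T where "T = {t. w + t *\<^sub>R u \<in> W}"
  \<comment> \<open>The claim is continuity at \<open>0\<close> of this curve in the function space.\<close>
  define Q where "Q = (\<lambda>t. if t = 0 then D else (1 / t) *\<^sub>R (f (w + t *\<^sub>R u) - f w))"
  have fm: "f w' \<in> SF" if "w' \<in> W" for w' by (rule family_mem[OF Z W f that]) (rule f0[OF that])
  have Dfam: "smooth_family (seq_square Z) (seq_times W (topspace Z)) M E (\<lambda>\<zeta> p. dir_deriv E W (\<lambda>w. f w p) (seq_fst \<zeta>) (seq_snd \<zeta>))"
    by (rule smooth_family_param_deriv[OF Z E W M f])
  have wu: "seq_pair w u \<in> seq_times W (topspace Z)" using w u by (simp add: seq_times_def)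
  have D0: "dir_deriv E W (\<lambda>w. f w m) w u = 0" if "m \<notin> topspace (mtop M)" for m
    by (rule param_deriv_zero[OF Z W _ w u]) (rule f0[OF _ that])
  have "(\<lambda>p. dir_deriv E W (\<lambda>w. f w p) (seq_fst (seq_pair w u)) (seq_snd (seq_pair w u))) \<in> SF"
    by (rule family_mem[OF lcs_seq_square[OF Z] openin_seq_times_open[OF W] Dfam wu])
      (use D0 in simp)
  then have Dm: "D \<in> SF" by (simp add: D_def)
  have diff: "f w' - f w \<in> SF" if "w' \<in> W" for w'
    using smooth_functions_lincomb[OF M E fm[OF that] fm[OF w], of "-1"] by simp
  have Qm: "Q t \<in> SF" if "t \<in> T" for t
    using smooth_functions_lincomb[OF M E zero_smooth[OF M E] diff, of "w + t *\<^sub>R u" "1 / t"] that Dm by (simp add: Q_def T_def)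
  have "continuous_map (top_of_set T) Cinf Q"
  proof (rule continuous_map_into_function_space[OF M E])
    show "Q t \<in> SF" if "t \<in> topspace (top_of_set T)" for t using Qm that by simp
    fix n
    show "continuous_map (prod_topology (top_of_set T) (mtop (TM n))) (Tn_lcs n E) (\<lambda>(t, p). Tn_map n M E (Q t) p)"
    proof (rule continuous_map_eq)
      show "continuous_map (prod_topology (top_of_set T) (mtop (TM n))) (Tn_lcs n E)
        (\<lambda>(t, p). if t = 0 then dir_deriv (Tn_lcs n E) W (\<lambda>w. Tn_map n M E (f w) p) w u
           else (1 / t) *\<^sub>R (Tn_map n M E (f (w + t *\<^sub>R u)) p - Tn_map n M E (f w) p))"
        unfolding T_def
        by (rule smooth_family_quotient_continuous[OF Z lcs_Tn_lcs[OF E] W Tn_bman[OF M E] smooth_family_Tn_map[OF M E Z W f] w u])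
      fix z assume z: "z \<in> topspace (prod_topology (top_of_set T) (mtop (TM n)))"
      obtain t p where [simp]: "z = (t, p)" by (cases z)
      have t: "w + t *\<^sub>R u \<in> W" and p: "p \<in> topspace (mtop (TM n))" using z by (auto simp: T_def)
      show "(\<lambda>(t, p). if t = 0 then dir_deriv (Tn_lcs n E) W (\<lambda>w. Tn_map n M E (f w) p) w u
           else (1 / t) *\<^sub>R (Tn_map n M E (f (w + t *\<^sub>R u)) p - Tn_map n M E (f w) p)) z = (\<lambda>(t, p). Tn_map n M E (Q t) p) z"
      proof (cases "t = 0")
        case True
        then show ?thesis using Tn_map_param_deriv[OF Z W f w u p] by (simp add: Q_def D_def)
      next
        case False
        have "Tn_map n M E (f (w + t *\<^sub>R u) - f w) p = Tn_map n M E (f (w + t *\<^sub>R u)) p - Tn_map n M E (f w) p"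
          using Tn_map_lincomb[OF M E fm[OF t] fm[OF w] p, of "-1"] by simp
        then show ?thesis using False Tn_map_scale[OF M E diff[OF t] p, of "1 / t"] by (simp add: Q_def)
      qed
    qed
  qed
  moreover have "limitin (top_of_set T) (\<lambda>t. t) 0 (at 0 within T)"
    unfolding limitin_subtopology using w eventually_in_within[of T 0] by (simp add: T_def tendsto_ident_at)
  ultimately have "limitin Cinf (Q \<circ> (\<lambda>t. t)) (Q 0) (at 0 within T)" by (rule continuous_map_limit)
  then have lim: "limitin Cinf Q D (at 0 within T)" by (simp add: o_def Q_def)
  have ev: "\<forall>\<^sub>F t in at 0 within T. Q t = (1 / t) *\<^sub>R (f (w + t *\<^sub>R u) - f w)"
    using eventually_not_at[of 0 T] by eventually_elim (simp add: Q_def)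
  show ?thesis
    unfolding has_dir_deriv_def using limitin_transform_eventually[OF ev lim] unfolding T_def D_def .
qed

text \<open>
  The derivative of the curried map is the curried derivative in the parameter. That is a smooth family again,
  with parameters in \<open>W \<times> Z\<close>, so the induction hypothesis applies to it.
\<close>

lemma exponential_law:
  fixes Z :: "(nat \<Rightarrow> 'z::real_vector) topology"
  assumes Z: "lcs Z" and W: "openin Z W" and f: "smooth_family Z W M E f"
    and f0: "\<And>w m. w \<in> W \<Longrightarrow> m \<notin> topspace (mtop M) \<Longrightarrow> f w m = 0"
  shows "Cn_on n Z W Cinf f"
  using assms
proof (induction n arbitrary: Z W f)
  case 0
  have "continuous_map (subtopology Z W) Cinf f" by (rule family_continuous[OF 0(1-3)]) (rule 0(4))
  then show ?case by simp
next
  case (Suc n)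
  note Z = Suc.prems(1) and W = Suc.prems(2) and f = Suc.prems(3) and f0 = Suc.prems(4)
  let ?D = "\<lambda>w u m. dir_deriv E W (\<lambda>w. f w m) w u"
  have Dfam: "smooth_family (seq_square Z) (seq_times W (topspace Z)) M E (\<lambda>\<zeta>. ?D (seq_fst \<zeta>) (seq_snd \<zeta>))"
    by (rule smooth_family_param_deriv[OF Z E W M f])
  have D0: "?D (seq_fst \<zeta>) (seq_snd \<zeta>) m = 0" if "\<zeta> \<in> seq_times W (topspace Z)" "m \<notin> topspace (mtop M)" for \<zeta> m
  proof (rule param_deriv_zero[OF Z W])
    show "seq_fst \<zeta> \<in> W" "seq_snd \<zeta> \<in> topspace Z" using that(1) by (simp_all add: seq_times_def)
  qed (rule f0[OF _ that(2)])
  note Z2 = lcs_seq_square[OF Z] and W2 = openin_seq_times_open[OF W]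
  have "C1map Z W Cinf f ?D"
    unfolding C1map_def
  proof (intro conjI ballI)
    show "continuous_map (subtopology Z W) Cinf f" by (rule family_continuous[OF Z W f]) (rule f0)
    show "has_dir_deriv Cinf W f w u (?D w u)" if "w \<in> W" "u \<in> topspace Z" for w u
      by (rule family_has_dir_deriv[OF Z W f that]) (rule f0)
    show "continuous_map (subtopology (prod_topology Z Z) (W \<times> topspace Z)) Cinf (\<lambda>(w, u). ?D w u)"
      unfolding continuous_deriv_seq_iff by (rule family_continuous[OF Z2 W2 Dfam]) (rule D0)
  qed
  moreover have "Cn_on n (seq_square Z) (seq_times W (topspace Z)) Cinf (\<lambda>\<zeta>. ?D (seq_fst \<zeta>) (seq_snd \<zeta>))"
    by (rule Suc.IH[OF Z2 W2 Dfam]) (rule D0)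
  ultimately show ?case by (rule Cn_on_SucI[OF Z lcs_Cinf mb_dom_open[OF Z W]])
qed

end

section \<open>The induced action\<close>

text \<open>
  As the model domain is the whole model space, chart images are open in the model space.
\<close>

lemma manifold_chart_facts:
  assumes A: "smooth_manifold {topspace (mmodel A)} A" and j: "j \<in> mindex A"
  shows "openin (mtop A) (mdom A j)" "openin (mmodel A) (cimg A j)"
    "\<And>g. g \<in> mdom A j \<Longrightarrow> chart_inv A j (mchart A j g) = g"
    "\<And>a. a \<in> cimg A j \<Longrightarrow> chart_inv A j a \<in> mdom A j"
    "\<And>a. a \<in> cimg A j \<Longrightarrow> mchart A j (chart_inv A j a) = a"
    "continuous_map (subtopology (mtop A) (mdom A j)) (subtopology (mmodel A) (cimg A j)) (mchart A j)"
    "continuous_map (subtopology (mmodel A) (cimg A j)) (mtop A) (chart_inv A j)"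
proof -
  show op: "openin (mtop A) (mdom A j)" and img: "openin (mmodel A) (cimg A j)"
    using A j unfolding smooth_manifold_def by (auto simp: subtopology_topspace)
  have h: "homeomorphic_map (subtopology (mtop A) (mdom A j)) (subtopology (mmodel A) (cimg A j)) (mchart A j)"
    using A j unfolding smooth_manifold_def by blast
  have top: "topspace (subtopology (mtop A) (mdom A j)) = mdom A j" "topspace (subtopology (mmodel A) (cimg A j)) = cimg A j"
    using openin_subset[OF op] openin_subset[OF img] by auto
  have inj: "inj_on (mchart A j) (mdom A j)" using homeomorphic_imp_injective_map[OF h] unfolding top .
  show inv: "chart_inv A j (mchart A j g) = g" if "g \<in> mdom A j" for g
    unfolding chart_inv_def by (rule inv_into_f_f[OF inj that])
  show mem: "chart_inv A j a \<in> mdom A j" if "a \<in> cimg A j" for a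
    unfolding chart_inv_def using that by (rule inv_into_into)
  show ci: "mchart A j (chart_inv A j a) = a" if "a \<in> cimg A j" for a
    unfolding chart_inv_def using that by (rule f_inv_into_f)
  show "continuous_map (subtopology (mtop A) (mdom A j)) (subtopology (mmodel A) (cimg A j)) (mchart A j)"
    by (rule homeomorphic_imp_continuous_map[OF h])
  obtain g where g: "homeomorphic_maps (subtopology (mtop A) (mdom A j)) (subtopology (mmodel A) (cimg A j)) (mchart A j) g"
    using h unfolding homeomorphic_map_maps by blast
  have gc: "continuous_map (subtopology (mmodel A) (cimg A j)) (subtopology (mtop A) (mdom A j)) g"
    using g by (simp add: homeomorphic_maps_def)
  have "g a = chart_inv A j a" if a: "a \<in> cimg A j" for a
  proof -
    have "mchart A j (g a) = a" using g a unfolding homeomorphic_maps_def top by blast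
    moreover have "g a \<in> mdom A j" using continuous_map_image_subset_topspace[OF gc] a unfolding top by blast
    ultimately show ?thesis using inv[of "g a"] by simp
  qed
  note eq = this
  have gA: "continuous_map (subtopology (mmodel A) (cimg A j)) (mtop A) g"
    using gc unfolding continuous_map_in_subtopology by (rule conjunct1)
  show "continuous_map (subtopology (mmodel A) (cimg A j)) (mtop A) (chart_inv A j)"
    by (rule continuous_map_eq[OF gA], unfold top(2)) (rule eq)
qed

lemma inv_into_map_prod:
  assumes "inj_on f A" "inj_on g B" "a \<in> f ` A" "b \<in> g ` B"
  shows "inv_into (A \<times> B) (map_prod f g) (a, b) = (inv_into A f a, inv_into B g b)"
proof (rule inv_into_f_eq)
  show "inj_on (map_prod f g) (A \<times> B)" using assms(1,2) by (rule map_prod_inj_on)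
  show "(inv_into A f a, inv_into B g b) \<in> A \<times> B" using assms(3,4) by (simp add: inv_into_into)
  show "map_prod f g (inv_into A f a, inv_into B g b) = (a, b)" using assms(3,4) by (simp add: f_inv_into_f)
qed

context
  fixes d :: nat and M :: "('m, nat \<Rightarrow> real, 'i) manifold" and A :: "('g, 'x::real_vector, 'j) manifold"
    and \<sigma> :: "'m \<times> 'g \<Rightarrow> 'm" and E :: "'e::real_vector topology"
  assumes M: "bman d M" and A: "smooth_manifold {topspace (mmodel A)} A" and E: "lcs E"
    and \<sigma>: "smooth_map (prod_manifold M A) M \<sigma>"
begin

lemma group_model_lcs: "lcs (mmodel A)" using A by (simp add: smooth_manifold_def)

lemma \<sigma>_continuous: "continuous_map (prod_topology (mtop M) (mtop A)) (mtop M) \<sigma>"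
  using \<sigma> by (simp add: smooth_map_def prod_manifold_def)

lemma prod_chart_inv:
  assumes i: "i \<in> mindex M" and j: "j \<in> mindex A" and x: "x \<in> cimg M i" and a: "a \<in> cimg A j"
  shows "chart_inv (prod_manifold M A) (i, j) (x, a) = (chart_inv M i x, chart_inv A j a)"
proof -
  have "inj_on (mchart A j) (mdom A j)"
    by (rule inj_on_inverseI[of _ "chart_inv A j"]) (rule manifold_chart_facts(3)[OF A j])
  from inv_into_map_prod[OF bman_inj[OF M i] this x a] show ?thesis by (simp add: chart_inv_def prod_manifold_def)
qed

text \<open>
  The domain of \<open>\<sigma>\<close> written in the charts \<open>i\<close> of \<open>M\<close> and \<open>j\<close> of the group at the source and \<open>l\<close> of \<open>M\<close> at the
  target.
\<close>

definition sdom :: "'i \<Rightarrow> 'j \<Rightarrow> 'i \<Rightarrow> ((nat \<Rightarrow> real) \<times> 'x) set" where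
  "sdom i j l = {(x, a) \<in> cimg M i \<times> cimg A j. \<sigma> (chart_inv M i x, chart_inv A j a) \<in> mdom M l}"

lemma sdom_eq:
  assumes i: "i \<in> mindex M" and j: "j \<in> mindex A"
  shows "mchart (prod_manifold M A) (i, j) ` (mdom (prod_manifold M A) (i, j) \<inter> \<sigma> -` mdom M l) = sdom i j l"
proof -
  have "map_prod (mchart M i) (mchart A j) ` (mdom M i \<times> mdom A j \<inter> \<sigma> -` mdom M l) = sdom i j l"
  proof (intro equalityI subsetI)
    fix y assume "y \<in> map_prod (mchart M i) (mchart A j) ` (mdom M i \<times> mdom A j \<inter> \<sigma> -` mdom M l)"
    then obtain p g where "p \<in> mdom M i" "g \<in> mdom A j" "\<sigma> (p, g) \<in> mdom M l" "y = (mchart M i p, mchart A j g)" by auto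
    then show "y \<in> sdom i j l" using bman_inv[OF M i] manifold_chart_facts(3)[OF A j] by (simp add: sdom_def)
  next
    fix y assume y: "y \<in> sdom i j l"
    obtain x a where [simp]: "y = (x, a)" by (cases y)
    have x: "x \<in> cimg M i" and a: "a \<in> cimg A j" and s: "\<sigma> (chart_inv M i x, chart_inv A j a) \<in> mdom M l"
      using y by (simp_all add: sdom_def)
    show "y \<in> map_prod (mchart M i) (mchart A j) ` (mdom M i \<times> mdom A j \<inter> \<sigma> -` mdom M l)"
      using chart_inv_mem[OF M x] manifold_chart_facts(4,5)[OF A j a] chart_chart_inv[OF M x] s
      by (intro image_eqI[of _ _ "(chart_inv M i x, chart_inv A j a)"]) simp_all
  qed
  then show ?thesis by (simp add: prod_manifold_def)
qed

lemma \<sigma>_chart_smooth: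
  assumes i: "i \<in> mindex M" and j: "j \<in> mindex A" and l: "l \<in> mindex M"
  shows "smooth_on_lcs (prod_topology (mmodel M) (mmodel A)) (sdom i j l) (mmodel M)
     (\<lambda>y. mchart M l (\<sigma> (chart_inv M i (fst y), chart_inv A j (snd y))))"
proof -
  have "(i, j) \<in> mindex (prod_manifold M A)" using i j by (simp add: prod_manifold_def)
  then have "smooth_on_lcs (mmodel (prod_manifold M A)) (mchart (prod_manifold M A) (i, j) ` (mdom (prod_manifold M A) (i, j) \<inter> \<sigma> -` mdom M l))
     (mmodel M) (mchart M l \<circ> \<sigma> \<circ> chart_inv (prod_manifold M A) (i, j))"
    using \<sigma> l unfolding smooth_map_def by blast
  then have "smooth_on_lcs (prod_topology (mmodel M) (mmodel A)) (sdom i j l)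
     (mmodel M) (mchart M l \<circ> \<sigma> \<circ> chart_inv (prod_manifold M A) (i, j))"
    unfolding sdom_eq[OF i j] by (simp add: prod_manifold_def)
  then show ?thesis
    by (rule smooth_on_cong) (auto simp: sdom_def prod_chart_inv[OF i j])
qed

lemma \<sigma>_local_continuous:
  assumes i: "i \<in> mindex M" and j: "j \<in> mindex A"
  shows "continuous_map (subtopology (prod_topology (mmodel M) (mmodel A)) (cimg M i \<times> cimg A j)) (mtop M)
    (\<lambda>y. \<sigma> (chart_inv M i (fst y), chart_inv A j (snd y)))"
  by (rule continuous_map_compose'[OF continuous_map_pairedI \<sigma>_continuous])
    (rule continuous_map_compose'[OF continuous_map_fst_sub bman_chart_inv_continuous[OF M i]]
      continuous_map_compose'[OF continuous_map_snd_sub manifold_chart_facts(7)[OF A j]])+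

lemma sdom_open:
  assumes i: "i \<in> mindex M" and j: "j \<in> mindex A" and l: "l \<in> mindex M"
  shows "openin (subtopology (prod_topology (mmodel M) (mmodel A)) (cimg M i \<times> cimg A j)) (sdom i j l)"
proof -
  have "sdom i j l = {y \<in> topspace (subtopology (prod_topology (mmodel M) (mmodel A)) (cimg M i \<times> cimg A j)).
     \<sigma> (chart_inv M i (fst y), chart_inv A j (snd y)) \<in> mdom M l}"
    using bman_cimg_sub[OF M i] openin_subset[OF manifold_chart_facts(2)[OF A j]] by (auto simp: sdom_def)
  then show ?thesis using openin_preimage[OF \<sigma>_local_continuous[OF i j] bman_dom_open[OF M l]] by simp
qed

definition local_action :: "'j \<Rightarrow> 'x \<times> ('m \<Rightarrow> 'e) \<Rightarrow> 'm \<Rightarrow> 'e" where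
  "local_action j y = induced_action M \<sigma> (chart_inv A j (fst y), snd y)"

text \<open>
  Near each point, \<open>f (\<sigma> (p, g))\<close> is the evaluation map at the pair of \<open>f\<close> and \<open>\<sigma> (p, g)\<close>, the latter written in
  a chart \<open>l\<close>; both depend smoothly on all the variables.
\<close>

lemma joint_action_smooth:
  assumes i: "i \<in> mindex M" and j: "j \<in> mindex A"
  shows "smooth_on_lcs (prod_topology (prod_topology (mmodel A) (smooth_function_space M E)) (mmodel M))
     ((cimg A j \<times> smooth_functions M E) \<times> cimg M i) E
     (\<lambda>y. snd (fst y) (\<sigma> (chart_inv M i (snd y), chart_inv A j (fst (fst y)))))"
proof -
  let ?X = "smooth_function_space M E" and ?SF = "smooth_functions M E" and ?B = "mmodel A" and ?R = "mmodel M"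
  let ?P = "prod_topology (prod_topology ?B ?X) ?R" and ?U = "(cimg A j \<times> ?SF) \<times> cimg M i"
  have X: "lcs ?X" by (rule lcs_smooth_function_space[OF M E])
  have Xt: "topspace ?X = ?SF" by (rule topspace_smooth_function_space[OF M E])
  have B: "lcs ?B" by (rule group_model_lcs)
  have R: "lcs ?R" by (rule bman_lcs[OF M])
  have P: "lcs ?P" by (intro lcs_prod B X R)
  have Wo: "openin (prod_topology ?B ?X) (cimg A j \<times> ?SF)"
    unfolding openin_prod_Times_iff using manifold_chart_facts(2)[OF A j] openin_topspace[of ?X] unfolding Xt by blast
  have Ud: "mb_dom ?P ?U" by (rule mb_dom_Times'[OF lcs_prod[OF B X] bman_cimg_dom[OF M i] Wo])
  let ?sw = "\<lambda>y::('x \<times> ('m \<Rightarrow> 'e)) \<times> (nat \<Rightarrow> real). (snd y, fst (fst y))"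
  have swl: "linear ?sw" by (intro linearI) auto
  have swc: "continuous_map ?P (prod_topology ?R ?B) ?sw"
    by (intro continuous_map_pairedI continuous_map_snd continuous_map_compose'[OF continuous_map_fst continuous_map_fst])
  let ?pr = "\<lambda>y::('x \<times> ('m \<Rightarrow> 'e)) \<times> (nat \<Rightarrow> real). snd (fst y)"
  have prl: "linear ?pr" by (intro linearI) auto
  have prc: "continuous_map ?P ?X ?pr" by (rule continuous_map_compose'[OF continuous_map_fst continuous_map_snd])
  have swU: "continuous_map (subtopology ?P ?U) (subtopology (prod_topology ?R ?B) (cimg M i \<times> cimg A j)) ?sw"
    unfolding continuous_map_in_subtopology using continuous_map_from_subtopology[OF swc] by auto
  have Utop: "topspace (subtopology ?P ?U) = ?U" using mb_dom_subset[OF Ud] by auto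
  have dS: "mb_dom (prod_topology ?R ?B) (cimg M i \<times> cimg A j)"
    by (rule mb_dom_Times[OF B bman_cimg_dom[OF M i] manifold_chart_facts(2)[OF A j]])
  show ?thesis
  proof (rule smooth_on_local[OF P Ud])
    fix y assume y: "y \<in> ?U"
    have "?sw y \<in> topspace (subtopology (prod_topology ?R ?B) (cimg M i \<times> cimg A j))"
      using continuous_map_image_subset_topspace[OF swU] y unfolding Utop by blast
    then have "\<sigma> (chart_inv M i (snd y), chart_inv A j (fst (fst y))) \<in> topspace (mtop M)"
      using continuous_map_image_subset_topspace[OF \<sigma>_local_continuous[OF i j]] by fastforce
    then obtain l where l: "l \<in> mindex M" "\<sigma> (chart_inv M i (snd y), chart_inv A j (fst (fst y))) \<in> mdom M l"
      unfolding bman_topspace[OF M] by blast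
    \<comment> \<open>On \<open>V\<close> the action lands in the single chart \<open>l\<close>, in which evaluation can be written down.\<close>
    define V where "V = {y \<in> topspace (subtopology ?P ?U). ?sw y \<in> sdom i j l}"
    have Vo: "openin (subtopology ?P ?U) V" unfolding V_def by (rule openin_preimage[OF swU sdom_open[OF i j l(1)]])
    have yV: "y \<in> V" unfolding V_def Utop using y l(2) by (auto simp: sdom_def)
    have Vd: "mb_dom ?P V" by (rule mb_dom_open_subset[OF Ud Vo])
    have sd: "mb_dom (prod_topology ?R ?B) (sdom i j l)" by (rule mb_dom_open_subset[OF dS sdom_open[OF i j l(1)]])
    let ?\<tau> = "\<lambda>y. mchart M l (\<sigma> (chart_inv M i (fst y), chart_inv A j (snd y)))"
    have swV: "?sw ` V \<subseteq> sdom i j l" unfolding V_def by blast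
    have s1: "smooth_on_lcs ?P V ?R (\<lambda>y. ?\<tau> (?sw y))"
      by (rule smooth_on_prelinear[OF P lcs_prod[OF R B] R Vd sd swl swc swV \<sigma>_chart_smooth[OF i j l(1)]])
    have s2: "smooth_on_lcs ?P V ?X ?pr" by (rule smooth_on_linear[OF P X Vd prl prc])
    have s3: "smooth_on_lcs ?P V (prod_topology ?X ?R) (\<lambda>y. (?pr y, ?\<tau> (?sw y)))"
      by (rule smooth_on_pair[OF P X R Vd s2 s1])
    have evd: "mb_dom (prod_topology ?X ?R) (?SF \<times> cimg M l)"
      using mb_dom_Times'[OF X bman_cimg_dom[OF M l(1)] openin_topspace] unfolding Xt .
    have im: "(\<lambda>y. (?pr y, ?\<tau> (?sw y))) ` V \<subseteq> ?SF \<times> cimg M l"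
      unfolding V_def Utop by (auto simp: sdom_def)
    have "smooth_on_lcs ?P V E (\<lambda>y. (\<lambda>(f, x). f (chart_inv M l x)) (?pr y, ?\<tau> (?sw y)))"
      by (rule smooth_on_compose[OF P lcs_prod[OF X R] E Vd evd s3 evaluation_smooth[OF M E l(1)] im])
    then have "smooth_on_lcs ?P V E (\<lambda>y. snd (fst y) (\<sigma> (chart_inv M i (snd y), chart_inv A j (fst (fst y)))))"
    proof (rule smooth_on_cong)
      fix y assume "y \<in> V"
      then have "\<sigma> (chart_inv M i (snd y), chart_inv A j (fst (fst y))) \<in> mdom M l" unfolding V_def by (auto simp: sdom_def)
      then show "(\<lambda>(f, x). f (chart_inv M l x)) (?pr y, ?\<tau> (?sw y)) = snd (fst y) (\<sigma> (chart_inv M i (snd y), chart_inv A j (fst (fst y))))"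
        using bman_inv[OF M l(1)] by simp
    qed
    then show "\<exists>V. openin (subtopology ?P ?U) V \<and> y \<in> V \<and> smooth_on_lcs ?P V E (\<lambda>y. snd (fst y) (\<sigma> (chart_inv M i (snd y), chart_inv A j (fst (fst y)))))"
      using Vo yV by blast
  qed
qed

text \<open>
  The exponential law, with the pairs of a group element and a function as parameters.
\<close>

lemma local_action_smooth:
  assumes j: "j \<in> mindex A"
  shows "smooth_on_lcs (prod_topology (mmodel A) (smooth_function_space M E)) (cimg A j \<times> smooth_functions M E)
     (smooth_function_space M E) (local_action j)"
proof (rule smooth_onI)
  fix n
  let ?X = "smooth_function_space M E" and ?SF = "smooth_functions M E" and ?B = "mmodel A" and ?R = "mmodel M"
  let ?Q = "prod_topology ?B ?X" and ?W = "cimg A j \<times> ?SF"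
  have X: "lcs ?X" by (rule lcs_smooth_function_space[OF M E])
  have Xt: "topspace ?X = ?SF" by (rule topspace_smooth_function_space[OF M E])
  have Q: "lcs ?Q" by (rule lcs_prod[OF group_model_lcs X])
  have R: "lcs ?R" by (rule bman_lcs[OF M])
  have Wo: "openin ?Q ?W"
    unfolding openin_prod_Times_iff using manifold_chart_facts(2)[OF A j] openin_topspace[of ?X] unfolding Xt by blast
  have Zo: "openin (seq_lcs ?Q) (seq_embed ` ?W)"
    using openin_seq_embed[of ?Q "topspace ?Q" ?W, unfolded subtopology_topspace, OF Wo]
    unfolding topspace_seq_lcs[symmetric] subtopology_topspace .
  show "Cn_on n (seq_lcs ?Q) (seq_embed ` ?W) ?X (\<lambda>z. local_action j (z 0))"
  proof (rule exponential_law[OF M E lcs_seq_lcs[OF Q] Zo])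
    show "local_action j (w 0) m = 0" if "m \<notin> topspace (mtop M)" for w :: "nat \<Rightarrow> 'x \<times> ('m \<Rightarrow> 'e)" and m
      using that by (simp add: local_action_def induced_action_def)
    show "smooth_family (seq_lcs ?Q) (seq_embed ` ?W) M E (\<lambda>z. local_action j (z 0))"
      unfolding smooth_family_def
    proof
      fix i assume i: "i \<in> mindex M"
      let ?L = "\<lambda>y::(nat \<Rightarrow> 'x \<times> ('m \<Rightarrow> 'e)) \<times> (nat \<Rightarrow> real). (fst y 0, snd y)"
      have L: "linear ?L" by (intro linearI) (auto simp: scaleR_fun_def[of _ "_ :: nat \<Rightarrow> 'x \<times> ('m \<Rightarrow> 'e)"])
      have Lc: "continuous_map (prod_topology (seq_lcs ?Q) ?R) (prod_topology ?Q ?R) ?L"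
        by (intro continuous_map_pairedI continuous_map_snd continuous_map_compose'[OF continuous_map_fst continuous_map_eval_seq_lcs])
      have LU: "?L ` (seq_embed ` ?W \<times> cimg M i) \<subseteq> ?W \<times> cimg M i" by auto
      have d1: "mb_dom (prod_topology (seq_lcs ?Q) ?R) (seq_embed ` ?W \<times> cimg M i)"
        by (rule mb_dom_Times'[OF lcs_seq_lcs[OF Q] bman_cimg_dom[OF M i] Zo])
      have d2: "mb_dom (prod_topology ?Q ?R) (?W \<times> cimg M i)"
        by (rule mb_dom_Times'[OF Q bman_cimg_dom[OF M i] Wo])
      from smooth_on_prelinear[OF lcs_prod[OF lcs_seq_lcs[OF Q] R] lcs_prod[OF Q R] E d1 d2 L Lc LU joint_action_smooth[OF i j]]
      show "smooth_on_lcs (prod_topology (seq_lcs ?Q) ?R) (seq_embed ` ?W \<times> cimg M i) E (\<lambda>(z, x). local_action j (z 0) (chart_inv M i x))"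
      proof (rule smooth_on_cong)
        fix y assume "y \<in> seq_embed ` ?W \<times> cimg M i"
        then have "chart_inv M i (snd y) \<in> topspace (mtop M)" using chart_inv_in_topspace[OF M i] by auto
        then show "snd (fst (?L y)) (\<sigma> (chart_inv M i (snd (?L y)), chart_inv A j (fst (fst (?L y))))) = (\<lambda>(z, x). local_action j (z 0) (chart_inv M i x)) y"
          by (simp add: local_action_def induced_action_def case_prod_unfold)
      qed
    qed
  qed
qed

text \<open>
  In charts of the group this is the smoothness of \<open>local_action\<close>, from which continuity follows by covering
  the group with charts.
\<close>

lemma induced_action_smooth:
  "smooth_map (prod_manifold A (lcs_manifold (smooth_function_space M E))) (lcs_manifold (smooth_function_space M E)) (induced_action M \<sigma> :: _ \<Rightarrow> _ \<Rightarrow> 'e)"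
proof -
  let ?X = "smooth_function_space M E" and ?SF = "smooth_functions M E"
  let ?\<alpha> = "induced_action M \<sigma> :: 'g \<times> ('m \<Rightarrow> 'e) \<Rightarrow> 'm \<Rightarrow> 'e"
  have Xt: "topspace ?X = ?SF" by (rule topspace_smooth_function_space[OF M E])
  have Atop: "topspace (mtop A) = (\<Union>j\<in>mindex A. mdom A j)" using A by (simp add: smooth_manifold_def)
  note F = manifold_chart_facts[OF A]
  have \<alpha>_local: "?\<alpha> y = local_action j (mchart A j (fst y), snd y)" if "j \<in> mindex A" "fst y \<in> mdom A j" for y j
    using F(3)[OF that] by (simp add: local_action_def)
  have cont: "continuous_map (prod_topology (mtop A) ?X) ?X ?\<alpha>"
  proof (rule continuous_map_local)
    fix y assume "y \<in> topspace (prod_topology (mtop A) ?X)"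
    then have y: "fst y \<in> topspace (mtop A)" "snd y \<in> ?SF" by (auto simp: Xt)
    then obtain j where j: "j \<in> mindex A" "fst y \<in> mdom A j" unfolding Atop by blast
    let ?T = "subtopology (prod_topology (mtop A) ?X) (mdom A j \<times> ?SF)"
    have c1: "continuous_map ?T (subtopology (mmodel A) (cimg A j)) (\<lambda>y. mchart A j (fst y))"
      by (rule continuous_map_compose'[OF continuous_map_fst_sub F(6)[OF j(1)]])
    have c2: "continuous_map ?T ?X snd" by (intro continuous_map_from_subtopology continuous_map_snd)
    have "continuous_map ?T (subtopology (prod_topology (mmodel A) ?X) (cimg A j \<times> ?SF)) (\<lambda>y. (mchart A j (fst y), snd y))"
      unfolding continuous_map_in_subtopology
    proof
      show "continuous_map ?T (prod_topology (mmodel A) ?X) (\<lambda>y. (mchart A j (fst y), snd y))"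
        using c1 c2 by (intro continuous_map_pairedI) (simp_all add: continuous_map_in_subtopology)
    qed auto
    from continuous_map_compose'[OF this smooth_on_continuous[OF local_action_smooth[OF j(1)]]]
    have "continuous_map ?T ?X (\<lambda>y. local_action j (mchart A j (fst y), snd y))" .
    then have "continuous_map ?T ?X ?\<alpha>" by (rule continuous_map_eq) (auto simp: \<alpha>_local[OF j(1)])
    moreover have "openin (prod_topology (mtop A) ?X) (mdom A j \<times> ?SF)"
      unfolding openin_prod_Times_iff using F(1)[OF j(1)] openin_topspace[of ?X] unfolding Xt by blast
    moreover have "y \<in> mdom A j \<times> ?SF" using j y by (simp add: mem_Times_iff)
    ultimately show "\<exists>N. openin (prod_topology (mtop A) ?X) N \<and> y \<in> N \<and> continuous_map (subtopology (prod_topology (mtop A) ?X) N) ?X ?\<alpha>" by blast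
  qed
  show ?thesis
    unfolding smooth_map_def
  proof (intro conjI ballI)
    show "continuous_map (mtop (prod_manifold A (lcs_manifold ?X))) (mtop (lcs_manifold ?X)) ?\<alpha>"
      using cont by (simp add: prod_manifold_def lcs_manifold_def)
    fix jk k' assume "jk \<in> mindex (prod_manifold A (lcs_manifold ?X))" "k' \<in> mindex (lcs_manifold ?X)"
    then obtain j where j: "j \<in> mindex A" and jk: "jk = (j, ())" by (cases jk) (auto simp: prod_manifold_def)
    have dom: "mdom (prod_manifold A (lcs_manifold ?X)) jk = mdom A j \<times> ?SF"
      by (simp add: prod_manifold_def lcs_manifold_def jk Xt)
    have ch: "mchart (prod_manifold A (lcs_manifold ?X)) jk = map_prod (mchart A j) (\<lambda>x. x)"
      by (simp add: prod_manifold_def lcs_manifold_def jk)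
    have "?\<alpha> y \<in> ?SF" if y: "y \<in> mdom A j \<times> ?SF" for y
    proof -
      have "y \<in> topspace (prod_topology (mtop A) ?X)" using y j by (auto simp: Xt Atop)
      then show ?thesis using continuous_map_image_subset_topspace[OF cont] unfolding Xt by blast
    qed
    then have "mdom A j \<times> ?SF \<inter> ?\<alpha> -` ?SF = mdom A j \<times> ?SF" by blast
    then have img: "mchart (prod_manifold A (lcs_manifold ?X)) jk `
       (mdom (prod_manifold A (lcs_manifold ?X)) jk \<inter> ?\<alpha> -` mdom (lcs_manifold ?X) k') = cimg A j \<times> ?SF"
      unfolding dom ch by (simp add: lcs_manifold_def Xt map_prod_surj_on)
    have inj: "inj_on (mchart A j) (mdom A j)" by (rule inj_on_inverseI[of _ "chart_inv A j"]) (rule F(3)[OF j])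
    have ci: "chart_inv (prod_manifold A (lcs_manifold ?X)) jk (a, f) = (chart_inv A j a, f)" if "a \<in> cimg A j" "f \<in> ?SF" for a f
      unfolding chart_inv_def dom ch
      by (rule inv_into_f_eq) (use that inj in \<open>auto simp: inj_on_def inv_into_into f_inv_into_f\<close>)
    show "smooth_on_lcs (mmodel (prod_manifold A (lcs_manifold ?X)))
       (mchart (prod_manifold A (lcs_manifold ?X)) jk ` (mdom (prod_manifold A (lcs_manifold ?X)) jk \<inter> ?\<alpha> -` mdom (lcs_manifold ?X) k'))
       (mmodel (lcs_manifold ?X)) (mchart (lcs_manifold ?X) k' \<circ> ?\<alpha> \<circ> chart_inv (prod_manifold A (lcs_manifold ?X)) jk)"
    proof -
      have model: "mmodel (prod_manifold A (lcs_manifold ?X)) = prod_topology (mmodel A) ?X" "mmodel (lcs_manifold ?X) = ?X"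
        by (simp_all add: prod_manifold_def lcs_manifold_def)
      show ?thesis
        unfolding img model
      proof (rule smooth_on_cong[OF local_action_smooth[OF j]])
        fix y assume "y \<in> cimg A j \<times> ?SF"
        then obtain a f where "y = (a, f)" "a \<in> cimg A j" "f \<in> ?SF" by blast
        then show "local_action j y = (mchart (lcs_manifold ?X) k' \<circ> ?\<alpha> \<circ> chart_inv (prod_manifold A (lcs_manifold ?X)) jk) y"
          using ci by (simp add: local_action_def lcs_manifold_def)
      qed
    qed
  qed
qed

end

theorem proposition1p4p1:
  fixes d :: nat
    and M :: "('m, nat \<Rightarrow> real, 'i) manifold"
    and G :: "('g, 'z) monoid_scheme"
    and A :: "('g, 'x::real_vector, 'j) manifold"
    and \<sigma> :: "'m \<times> 'g \<Rightarrow> 'm"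
    and E :: "'e::real_vector topology"
  assumes "finite_dim_manifold d M"
    and "lie_group G A"
    and "smooth_right_action M G A \<sigma>"
    and "lcs E"
  shows "smooth_map (prod_manifold A (lcs_manifold (smooth_function_space M E)))
           (lcs_manifold (smooth_function_space M E)) (induced_action M \<sigma>)"
proof (rule induced_action_smooth)
  show "bman d M" using assms(1) by (rule finite_dim_manifold_bman)
  show "smooth_manifold {topspace (mmodel A)} A" using assms(2) by (simp add: lie_group_def)
  show "smooth_map (prod_manifold M A) M \<sigma>" using assms(3) by (simp add: smooth_right_action_def)
qed (rule assms(4))

end
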